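(* Let $n\ge 8$ be a multiple of $4$, let $\mathbb{H}$ be a separable Hilbert space, and let $X_1,\dots,X_n$ be independent random compact self-adjoint operators on $\mathbb{H}$ such that, for constants $c,B>0$ and all $i$, $\|X_i\|\le c$ and $\operatorname{tr}(X_i^2)\le B$ almost surely, and such that for all $i$ (with operators $\mu,\Sigma,\Sigma'$ not depending on $i$) $\mathbb{E}X_i=\mu$, $\mathbb{V}X_i=\Sigma$, $\mathbb{V}[(X_i-\mu)^2-\Sigma]=\Sigma'$. Let $S_i=\sum_{j\le i}X_j$. For $\delta_1,\delta_2,\delta_3\in(0,1)$, with $\tau_u(\delta_2)$ and $\sigma_u^2(\delta_3)$ the empirical quantities defined in the context, put $$\Pi_{2c,\delta_2,\delta_3}(r):=2\left(\frac{\tau_u(\delta_2)}{\sigma_u^2(\delta_3)}\vee 1\right)\exp\left(-\frac{n\sigma_u^2(\delta_3)}{(2c)^2}\,h\!\left(\frac{2c\,r}{n\sigma_u^2(\delta_3)}\right)\right),\qquad r\ge 0,$$ where $h(u)=(1+u)\log(1+u)-u$, and let $\Pi^{-1}_{2c,\delta_2,\delta_3}$ denote the inverse function of the strictly decreasing function $r\mapsto\Pi_{2c,\delta_2,\delta_3}(r)$ on $[0,\infty)$. Then $$\mathbb{P}\left(\sup_{i\le n}\|S_i-i\mu\|\ge \Pi^{-1}_{2c,\delta_2,\delta_3}(\delta_1)\right)\le\delta_1+\delta_2+\delta_3 .$$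
   Context: $\|\cdot\|$ is the operator norm, $\operatorname{tr}$ the trace, $a\vee b=\max(a,b)$, and $\mathbb{V}X:=\mathbb{E}(X-\mathbb{E}X)^2$ for a random self-adjoint operator $X$. Auxiliary operators: for $i=1,\dots,n/2$, $X_i':=\tfrac12(X_{2i-1}-X_{2i})^2$; for $i=1,\dots,n/4$, $X_i'':=\tfrac12(X_{2i-1}'-X_{2i}')^2$. Put $\Sigma_n:=\frac2n\sum_{i=1}^{n/2}X_i'$ and $\Sigma_n':=\frac4n\sum_{i=1}^{n/4}X_i''$. Scalar sample variance: for real $\mathbf{Z}=(Z_1,\dots,Z_m)$, $\varsigma_m^2(\mathbf{Z}):=\frac{1}{m(m-1)}\sum_{1\le i<j\le m}(Z_i-Z_j)^2$. With $Z_i=\operatorname{tr}(X_i')$ ($i\le n/2$) and $Z_i'=\operatorname{tr}(X_i'')$ ($i\le n/4$), $$\tau_u(\delta):=\operatorname{tr}(\Sigma_n)+\varsigma_{n/2}(\mathbf{Z})\sqrt{\frac{2\log(2/\delta)}{n/2}}+\frac{7(2B)\log(2/\delta)}{3(n/2-1)},$$ $$\tau_u'(\delta):=\operatorname{tr}(\Sigma_n')+\varsigma_{n/4}(\mathbf{Z}')\sqrt{\frac{2\log(2/\delta)}{n/4}}+\frac{7(4Bc^2)\log(2/\delta)}{3(n/4-1)}.$$ Further, for $\tau\ge0$, $$\Gamma_{c,\delta}(\tau):=\sqrt{\frac{2\tau}{n/2}\log(2/\delta)}+\frac{2c^2}{3(n/2)}\log(2/\delta),\qquad \sigma_u^2(\tau;\delta):=\|\Sigma_n\|+\Gamma_{c,\delta}(\tau),$$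 and $$\sigma_u^2(\delta_3):=\sigma_u^2\!\left(\tau_u'(\delta_3/2);\,\delta_3/2\right).$$ The function $\Pi_{2c,\delta_2,\delta_3}$ is random (data dependent), and its inverse is taken for each realization. *)

theory Defs
  imports "HOL-Probability.Probability"
begin

text \<open>
  A separable Hilbert space over the scalar field \<open>K\<close>, either the reals or the complex numbers.
  Completeness and separability come from the sort of the carrier type.  The inner product \<open>ip\<close> is
  \<open>K\<close>-valued and linear in its first argument; \<open>ip_Re\<close> together with \<open>ip_cnj\<close> makes the norm of
  the type (and hence the operator norm of \<open>'a \<Rightarrow>\<^sub>L 'a\<close>) the Hilbert space norm.  If \<open>K\<close> is the
  set of reals, \<open>scale\<close> is only constrained on real scalars, and \<open>ip\<close> is the inner product of the
  type, embedded in the complex numbers.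
\<close>

locale hilbert_space =
  fixes K :: "complex set"
    and scale :: "complex \<Rightarrow> 'a \<Rightarrow> 'a::{real_inner, banach, second_countable_topology}"
    and ip :: "'a \<Rightarrow> 'a \<Rightarrow> complex"
  assumes scalars: "K = \<real> \<or> K = UNIV"
    and scale_of_real: "scale (of_real r) x = r *\<^sub>R x"
    and scale_add_right: "a \<in> K \<Longrightarrow> scale a (x + y) = scale a x + scale a y"
    and scale_add_left: "\<lbrakk>a \<in> K; b \<in> K\<rbrakk> \<Longrightarrow> scale (a + b) x = scale a x + scale b x"
    and scale_scale: "\<lbrakk>a \<in> K; b \<in> K\<rbrakk> \<Longrightarrow> scale a (scale b x) = scale (a * b) x"
    and ip_in_K: "ip x y \<in> K"
    and ip_add_left: "ip (x + y) z = ip x z + ip y z"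
    and ip_scale_left: "a \<in> K \<Longrightarrow> ip (scale a x) y = a * ip x y"
    and ip_cnj: "ip y x = cnj (ip x y)"
    and ip_Re: "Re (ip x y) = x \<bullet> y"
begin

lemma ip_self: "ip x x = complex_of_real ((norm x)\<^sup>2)"
proof -
  have "Im (ip x x) = 0"
    using arg_cong[OF ip_cnj[of x x], of Im] by simp
  then show ?thesis
    by (simp add: complex_eq_iff ip_Re power2_norm_eq_inner)
qed

end

lemma hilbert_space_real:
  "hilbert_space \<real> (\<lambda>a x::'a::{real_inner, banach, second_countable_topology}. Re a *\<^sub>R x)
     (\<lambda>x y. complex_of_real (x \<bullet> y))"
  by unfold_locales
    (auto simp: algebra_simps inner_commute inner_add_left elim!: Reals_cases)

lemma hilbert_space_complex: "hilbert_space UNIV (*) (\<lambda>x y. x * cnj y)"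
  by unfold_locales
    (auto simp: algebra_simps scaleR_conv_of_real inner_complex_def)

text \<open>
  Operators are elements of \<open>'a \<Rightarrow>\<^sub>L 'a\<close>, i.e. bounded and real-linear.  Self-adjointness with respect to
  the \<open>K\<close>-valued inner product forces \<open>K\<close>-linearity (see \<open>self_adjoint_K_linear\<close>).
\<close>

definition self_adjoint ::
  "('a \<Rightarrow> 'a \<Rightarrow> complex) \<Rightarrow> ('a::real_normed_vector \<Rightarrow>\<^sub>L 'a) \<Rightarrow> bool" where
  "self_adjoint ip A \<longleftrightarrow> (\<forall>x y. ip (blinfun_apply A x) y = ip x (blinfun_apply A y))"

lemma (in hilbert_space) self_adjoint_K_linear:
  assumes "self_adjoint ip A" "a \<in> K"
  shows "blinfun_apply A (scale a x) = scale a (blinfun_apply A x)"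
proof -
  have "ip (blinfun_apply A (scale a x)) z = ip (scale a (blinfun_apply A x)) z" for z
    using assms by (simp add: self_adjoint_def ip_scale_left)
  then have "blinfun_apply A (scale a x) \<bullet> z = scale a (blinfun_apply A x) \<bullet> z" for z
    by (metis ip_Re)
  then show ?thesis
    by (metis vector_eq_rdot)
qed

definition compact_operator :: "('a::real_normed_vector \<Rightarrow>\<^sub>L 'a) \<Rightarrow> bool" where
  "compact_operator A \<longleftrightarrow> compact (closure (blinfun_apply A ` cball 0 1))"

definition op_sq :: "('a::real_normed_vector \<Rightarrow>\<^sub>L 'a) \<Rightarrow> ('a \<Rightarrow>\<^sub>L 'a)" where
  "op_sq A = A o\<^sub>L A"

definition onb :: "('a \<Rightarrow> 'a \<Rightarrow> complex) \<Rightarrow> 'a::zero set \<Rightarrow> bool" where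
  "onb ip E \<longleftrightarrow>
     (\<forall>e\<in>E. \<forall>f\<in>E. ip e f = (if e = f then 1 else 0)) \<and>
     (\<forall>x. (\<forall>e\<in>E. ip x e = 0) \<longrightarrow> x = 0)"

text \<open>
  Only traces of positive self-adjoint operators are needed.  For these the diagonal sum is
  absolutely convergent, with the same value, for all orthonormal bases, or for none of them; it
  is infinite in the latter case.  Finiteness is recorded separately by \<open>trace_class\<close>, since
  \<open>op_trace\<close> has no meaningful value without it.
\<close>

definition has_trace ::
  "('a \<Rightarrow> 'a \<Rightarrow> complex) \<Rightarrow> ('a::real_normed_vector \<Rightarrow>\<^sub>L 'a) \<Rightarrow> real \<Rightarrow> bool" where
  "has_trace ip A t \<longleftrightarrow>
     (\<forall>E. onb ip E \<longrightarrow> ((\<lambda>e. ip (blinfun_apply A e) e) has_sum complex_of_real t) E)"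

definition trace_class ::
  "('a \<Rightarrow> 'a \<Rightarrow> complex) \<Rightarrow> ('a::real_normed_vector \<Rightarrow>\<^sub>L 'a) \<Rightarrow> bool" where
  "trace_class ip A \<longleftrightarrow> (\<exists>t. has_trace ip A t)"

definition op_trace ::
  "('a \<Rightarrow> 'a \<Rightarrow> complex) \<Rightarrow> ('a::real_normed_vector \<Rightarrow>\<^sub>L 'a) \<Rightarrow> real" where
  "op_trace ip A = (THE t. has_trace ip A t)"

text \<open>
  The expectation of a random operator \<open>Y\<close> is the operator mapping \<open>x\<close> to the Bochner expectation of
  the random vector \<open>Y x\<close>.  The library's Bochner integral is not available on \<open>'a \<Rightarrow>\<^sub>L 'a\<close> itself,
  which is not separable in infinite dimension; for a Bochner integrable \<open>Y\<close> (such as a measurable,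
  almost surely bounded random compact operator) the two expectations agree.
\<close>

definition op_expectation ::
  "'w measure \<Rightarrow> ('w \<Rightarrow> ('a::{real_normed_vector, banach, second_countable_topology} \<Rightarrow>\<^sub>L 'a))
     \<Rightarrow> ('a \<Rightarrow>\<^sub>L 'a)" where
  "op_expectation M Y = Blinfun (\<lambda>x. \<integral>\<omega>. blinfun_apply (Y \<omega>) x \<partial>M)"

definition op_variance ::
  "'w measure \<Rightarrow> ('w \<Rightarrow> ('a::{real_normed_vector, banach, second_countable_topology} \<Rightarrow>\<^sub>L 'a))
     \<Rightarrow> ('a \<Rightarrow>\<^sub>L 'a)" where
  "op_variance M Y = op_expectation M (\<lambda>\<omega>. op_sq (Y \<omega> - op_expectation M Y))"

text \<open>
  In the following definitions \<open>X\<close> is one realization \<open>X 1, \<dots>, X n\<close> of the operators.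
  The operators \<open>X'\<close> are \<open>paired X\<close>, and \<open>X''\<close> are \<open>paired (paired X)\<close>.
\<close>

definition paired ::
  "(nat \<Rightarrow> ('a::real_normed_vector \<Rightarrow>\<^sub>L 'a)) \<Rightarrow> nat \<Rightarrow> ('a \<Rightarrow>\<^sub>L 'a)" where
  "paired X i = (1/2) *\<^sub>R op_sq (X (2*i - 1) - X (2*i))"

definition Sigma_n ::
  "nat \<Rightarrow> (nat \<Rightarrow> ('a::real_normed_vector \<Rightarrow>\<^sub>L 'a)) \<Rightarrow> ('a \<Rightarrow>\<^sub>L 'a)" where
  "Sigma_n n X = (2 / real n) *\<^sub>R (\<Sum>i=1..n div 2. paired X i)"

definition Sigma_n' ::
  "nat \<Rightarrow> (nat \<Rightarrow> ('a::real_normed_vector \<Rightarrow>\<^sub>L 'a)) \<Rightarrow> ('a \<Rightarrow>\<^sub>L 'a)" where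
  "Sigma_n' n X = (4 / real n) *\<^sub>R (\<Sum>i=1..n div 4. paired (paired X) i)"

definition sample_variance :: "nat \<Rightarrow> (nat \<Rightarrow> real) \<Rightarrow> real" where
  "sample_variance m Z =
     1 / (real m * (real m - 1)) * (\<Sum>j=1..m. \<Sum>i\<in>{1..<j}. (Z i - Z j)\<^sup>2)"

definition tau_u ::
  "('a \<Rightarrow> 'a \<Rightarrow> complex) \<Rightarrow> real \<Rightarrow> nat \<Rightarrow> (nat \<Rightarrow> ('a::real_normed_vector \<Rightarrow>\<^sub>L 'a))
     \<Rightarrow> real \<Rightarrow> real" where
  "tau_u ip B n X \<delta> =
     op_trace ip (Sigma_n n X)
     + sqrt (sample_variance (n div 2) (\<lambda>i. op_trace ip (paired X i)))
       * sqrt (2 * ln (2 / \<delta>) / (real n / 2))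
     + 7 * (2 * B) * ln (2 / \<delta>) / (3 * (real n / 2 - 1))"

definition tau_u' ::
  "('a \<Rightarrow> 'a \<Rightarrow> complex) \<Rightarrow> real \<Rightarrow> real \<Rightarrow> nat \<Rightarrow> (nat \<Rightarrow> ('a::real_normed_vector \<Rightarrow>\<^sub>L 'a))
     \<Rightarrow> real \<Rightarrow> real" where
  "tau_u' ip c B n X \<delta> =
     op_trace ip (Sigma_n' n X)
     + sqrt (sample_variance (n div 4) (\<lambda>i. op_trace ip (paired (paired X) i)))
       * sqrt (2 * ln (2 / \<delta>) / (real n / 4))
     + 7 * (4 * B * c\<^sup>2) * ln (2 / \<delta>) / (3 * (real n / 4 - 1))"

definition Gamma_dev :: "real \<Rightarrow> nat \<Rightarrow> real \<Rightarrow> real \<Rightarrow> real" where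
  "Gamma_dev c n \<delta> \<tau> =
     sqrt (2 * \<tau> / (real n / 2) * ln (2 / \<delta>)) + 2 * c\<^sup>2 / (3 * (real n / 2)) * ln (2 / \<delta>)"

definition sigma2_u_of ::
  "real \<Rightarrow> nat \<Rightarrow> (nat \<Rightarrow> ('a::real_normed_vector \<Rightarrow>\<^sub>L 'a)) \<Rightarrow> real \<Rightarrow> real \<Rightarrow> real" where
  "sigma2_u_of c n X \<tau> \<delta> = norm (Sigma_n n X) + Gamma_dev c n \<delta> \<tau>"

definition sigma2_u ::
  "('a \<Rightarrow> 'a \<Rightarrow> complex) \<Rightarrow> real \<Rightarrow> real \<Rightarrow> nat \<Rightarrow> (nat \<Rightarrow> ('a::real_normed_vector \<Rightarrow>\<^sub>L 'a))
     \<Rightarrow> real \<Rightarrow> real" where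
  "sigma2_u ip c B n X \<delta> = sigma2_u_of c n X (tau_u' ip c B n X (\<delta> / 2)) (\<delta> / 2)"

definition bennett_h :: "real \<Rightarrow> real" where
  "bennett_h u = (1 + u) * ln (1 + u) - u"

definition Pi_bound ::
  "('a \<Rightarrow> 'a \<Rightarrow> complex) \<Rightarrow> real \<Rightarrow> real \<Rightarrow> nat \<Rightarrow> (nat \<Rightarrow> ('a::real_normed_vector \<Rightarrow>\<^sub>L 'a))
     \<Rightarrow> real \<Rightarrow> real \<Rightarrow> real \<Rightarrow> real" where
  "Pi_bound ip c B n X \<delta>\<^sub>2 \<delta>\<^sub>3 r =
     (let \<sigma>2 = sigma2_u ip c B n X \<delta>\<^sub>3 in
       2 * max (tau_u ip B n X \<delta>\<^sub>2 / \<sigma>2) 1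
         * exp (- (real n * \<sigma>2 / (2 * c)\<^sup>2 * bennett_h (2 * c * r / (real n * \<sigma>2)))))"

definition Pi_bound_inv ::
  "('a \<Rightarrow> 'a \<Rightarrow> complex) \<Rightarrow> real \<Rightarrow> real \<Rightarrow> nat \<Rightarrow> (nat \<Rightarrow> ('a::real_normed_vector \<Rightarrow>\<^sub>L 'a))
     \<Rightarrow> real \<Rightarrow> real \<Rightarrow> real \<Rightarrow> real" where
  "Pi_bound_inv ip c B n X \<delta>\<^sub>2 \<delta>\<^sub>3 = the_inv_into {0..} (Pi_bound ip c B n X \<delta>\<^sub>2 \<delta>\<^sub>3)"

end

theory Submission
  imports Defs "HOL-Combinatorics.Permutations"
begin

text \<open>
  Compress all operators to finite-dimensional subspaces and put \<open>p x = (1 + x / m) ^ m\<close> with \<open>m\<close> a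
  power of two.  Since \<open>tr ((x y) ^ m) \<le> tr (x ^ m y ^ m)\<close> for self-adjoint \<open>x\<close> and \<open>y\<close>, which follows
  from the Cauchy--Schwarz inequality alone, the expectation of \<open>tr (p S + p (- S) - 2)\<close>, a polynomial
  substitute for the trace of \<open>2 (cosh S - 1)\<close>, obeys a linear recursion in the number of summands.
  Its inhomogeneous term is the trace of the variance, which brings in the intrinsic dimension.
  Stopping the sum at its first passage turns the resulting Bennett inequality into a maximal one.

  With the trace of the variance in the role of the variance bound, the same inequality estimates the norm of
  \<open>\<Sigma>\<close> by that of \<open>\<Sigma>\<^sub>n\<close>.  Both traces are estimated by a scalar empirical Bernstein inequality; there
  the sample variance is an average over permutations of sums of independent block variances, as in
  Hoeffding's treatment of U-statistics.

  The bound is not monotone in the variance parameter, so the random \<open>\<sigma>\<^sub>u\<^sup>2\<close> cannot simply be inserted.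
  But every deterministic value above the norm of \<open>\<Sigma>\<close> yields an admissible level, and hence so does the
  infimum of these levels.
\<close>

section \<open>The algebra of bounded operators\<close>

text \<open>Two limits are taken, and their order matters. Splitting
  \<open>exp_approx m (A + X)\<close> into a product costs an error of order
  \<open>card F / m\<close>, whose constant contains the crude bound \<open>n C\<close> on the sums.
  On a fixed subspace this error vanishes as \<open>m\<close> grows, and what survives sees the
  dimension only through a ratio of trace and norm; only then may the subspace grow. Subtracting
  \<open>2\<close> makes this possible: at the zero operator the trace then vanishes, where it would
  otherwise be twice the dimension.

  Evenness of \<open>m\<close> has a second use: it makes \<open>exp_approx m A\<close> a square, so
  that operator inequalities may be inserted under the trace.

  The bounds on the operators hold only almost surely, and traces carry no evident measurability.
  Truncated operators and capped Hilbert-Schmidt sums, bounded and measurable everywhere, therefore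
  stand in for them and agree with them almost surely.

  One half of \<open>\<delta>\<^sub>3\<close> pays for the trace estimate inside
  \<open>sigma2_u\<close>, the other half for the Bernstein bound on the deviation of
  \<open>Sigma_n\<close>.\<close>

text \<open>A copy of the operator space that can carry a ring structure.  It is not an instance of the
  class \<open>real_normed_algebra_1\<close>, because the space may be trivial, in which case \<open>0 = 1\<close>.\<close>

typedef (overloaded) 'a bop = "UNIV :: ('a::real_normed_vector \<Rightarrow>\<^sub>L 'a) set"
  morphisms of_bop to_bop by simp

lemmas bop_inverse [simp] = to_bop_inverse[OF UNIV_I] of_bop_inverse

abbreviation ap :: "'a::real_normed_vector bop \<Rightarrow> 'a \<Rightarrow> 'a"
  where "ap x \<equiv> blinfun_apply (of_bop x)"

lemma bop_eqI: "(\<And>v. ap x v = ap y v) \<Longrightarrow> x = y"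
  by (simp add: blinfun_eqI of_bop_inject[symmetric])

instantiation bop :: (real_normed_vector) "{real_normed_algebra, monoid_mult}"
begin

definition "0 = to_bop 0"
definition "1 = to_bop id_blinfun"
definition "x + y = to_bop (of_bop x + of_bop y)"
definition "x - y = to_bop (of_bop x - of_bop y)"
definition "- x = to_bop (- of_bop x)"
definition "x * y = to_bop (of_bop x o\<^sub>L of_bop y)"
definition "r *\<^sub>R x = to_bop (r *\<^sub>R of_bop x)"
definition "norm x = norm (of_bop x)"
definition "sgn x = to_bop (sgn (of_bop x))"
definition "dist x y = dist (of_bop x) (of_bop y)"
definition "uniformity = (INF e\<in>{0<..}. principal {(x, y :: 'a bop). dist x y < e})"
definition "open U = (\<forall>x\<in>U. eventually (\<lambda>(x', y :: 'a bop). x' = x \<longrightarrow> y \<in> U) uniformity)"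

lemmas bop_defs = zero_bop_def one_bop_def plus_bop_def minus_bop_def uminus_bop_def times_bop_def
  scaleR_bop_def norm_bop_def sgn_bop_def dist_bop_def

instance
proof
  fix x :: "'a bop"
  show "norm x = 0 \<longleftrightarrow> x = 0"
    by (metis bop_defs(1) bop_defs(8) bop_inverse norm_eq_zero)
qed (auto intro!: bop_eqI simp: bop_defs uniformity_bop_def open_bop_def dist_norm algebra_simps
      sgn_div_norm norm_blinfun_compose norm_triangle_ineq blinfun.bilinear_simps)

end

lemma ap_simps [simp]:
  "ap 0 v = 0" "ap 1 v = v" "ap (x + y) v = ap x v + ap y v" "ap (x - y) v = ap x v - ap y v"
  "ap (- x) v = - ap x v" "ap (x * y) v = ap x (ap y v)" "ap (r *\<^sub>R x) v = r *\<^sub>R ap x v"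
  by (simp_all add: bop_defs blinfun.bilinear_simps)

lemma ap_sum: "ap (\<Sum>i\<in>I. f i) v = (\<Sum>i\<in>I. ap (f i) v)"
  by (induction I rule: infinite_finite_induct) auto

lemma ap_linear [simp]:
  "ap x 0 = 0" "ap x (v + w) = ap x v + ap x w" "ap x (v - w) = ap x v - ap x w"
  "ap x (- v) = - ap x v" "ap x (r *\<^sub>R v) = r *\<^sub>R ap x v"
  by (simp_all add: blinfun.bilinear_simps)

lemma ap_sum_right: "ap x (\<Sum>i\<in>I. f i) = (\<Sum>i\<in>I. ap x (f i))"
  by (simp add: blinfun.sum_right)

lemma norm_ap_le: "norm (ap x v) \<le> norm x * norm v"
  by (simp add: norm_bop_def norm_blinfun)

lemma norm_bop_bound: "0 \<le> b \<Longrightarrow> (\<And>v. norm (ap x v) \<le> b * norm v) \<Longrightarrow> norm x \<le> b"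
  by (simp add: norm_bop_def norm_blinfun_bound)

lemma norm_one_bop_le: "norm (1 :: 'a::real_normed_vector bop) \<le> 1"
  by (rule norm_bop_bound) auto

lemma norm_power_bop_le: "norm (x ^ k) \<le> norm x ^ k" for x :: "'a::real_normed_vector bop"
proof (induction k)
  case (Suc k)
  have "norm (x ^ Suc k) \<le> norm x * norm (x ^ k)"
    by (simp add: norm_mult_ineq)
  also have "\<dots> \<le> norm x ^ Suc k"
    using Suc by (simp add: mult_left_mono)
  finally show ?case .
qed (simp add: norm_one_bop_le)

text \<open>A relation and not a function: adjoints are carried along with the construction of an
  operator, every operator in use being assembled from self-adjoint ones. The real inner product is
  the real part of \<open>ip\<close>.\<close>

definition adj :: "'a::real_inner bop \<Rightarrow> 'a bop \<Rightarrow> bool"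
  where "adj x y \<longleftrightarrow> (\<forall>v w. ap x v \<bullet> w = v \<bullet> ap y w)"

lemma adj_sym: "adj x y \<Longrightarrow> adj y x"
  unfolding adj_def by (metis inner_commute)

lemma adj_intros:
  "adj 0 0" "adj 1 1" "adj x x' \<Longrightarrow> adj y y' \<Longrightarrow> adj (x + y) (x' + y')"
  "adj x x' \<Longrightarrow> adj y y' \<Longrightarrow> adj (x - y) (x' - y')"
  "adj x x' \<Longrightarrow> adj (- x) (- x')" "adj x x' \<Longrightarrow> adj (r *\<^sub>R x) (r *\<^sub>R x')"
  "adj x x' \<Longrightarrow> adj y y' \<Longrightarrow> adj (x * y) (y' * x')"
  by (simp_all add: adj_def inner_add_left inner_add_right inner_diff_left inner_diff_right)

lemma adj_power: "adj x x' \<Longrightarrow> adj (x ^ k) (x' ^ k)"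
proof (induction k)
  case (Suc k)
  then have "adj (x * x ^ k) (x' ^ k * x')"
    by (intro adj_intros)
  then show ?case
    by (simp add: power_commutes)
qed (simp add: adj_intros)

lemma adj_self_power2: "adj x x \<Longrightarrow> ap (x ^ (2 * k)) v \<bullet> v = (norm (ap (x ^ k) v))\<^sup>2"
  using adj_power[of x x k] by (simp add: mult_2 power_add adj_def power2_norm_eq_inner)

text \<open>Associativity peels off one factor at each end; \<open>tr_power_cyclic\<close> then
  moves an end factor around the trace.\<close>

lemma power_mult_cyclic: "(u * v) ^ Suc n = u * (v * u) ^ n * v" for u :: "'m::monoid_mult"
  by (induction n) (simp_all add: mult.assoc power_commutes)

section \<open>Sesquilinear calculus over the scalar field\<close>

context hilbert_space
begin

lemma K_closed [simp]: "of_real r \<in> K" "a \<in> K \<Longrightarrow> cnj a \<in> K"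
  using scalars by (auto elim!: Reals_cases)

declare ip_in_K [simp]

lemma ip_scaleR_left: "ip (r *\<^sub>R x) y = of_real r * ip x y"
  using ip_scale_left[of "of_real r" x y] by (simp add: scale_of_real)

lemma ip_add_right: "ip x (y + z) = ip x y + ip x z"
  by (metis complex_cnj_add ip_add_left ip_cnj)

lemma ip_scale_right: "a \<in> K \<Longrightarrow> ip x (scale a y) = cnj a * ip x y"
  by (metis complex_cnj_mult ip_cnj ip_scale_left)

lemma ip_scaleR_right: "ip x (r *\<^sub>R y) = of_real r * ip x y"
  using ip_scale_right[of "of_real r" x y] by (simp add: scale_of_real)

lemma ip_zero [simp]: "ip 0 y = 0" "ip x 0 = 0"
  using ip_scaleR_left[of 0 0 y] ip_scaleR_right[of x 0 0] by auto

lemma ip_minus: "ip (- x) y = - ip x y" "ip x (- y) = - ip x y"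
  using ip_scaleR_left[of "-1" x y] ip_scaleR_right[of x "-1" y] by auto

lemma ip_diff_left: "ip (x - y) z = ip x z - ip y z"
  using ip_add_left[of x "- y" z] by (simp add: ip_minus)

lemma ip_diff_right: "ip x (y - z) = ip x y - ip x z"
  using ip_add_right[of x y "- z"] by (simp add: ip_minus)

lemma ip_sum_left: "ip (\<Sum>i\<in>I. f i) y = (\<Sum>i\<in>I. ip (f i) y)"
  by (induction I rule: infinite_finite_induct) (auto simp: ip_add_left)

lemma ip_sum_right: "ip x (\<Sum>i\<in>I. f i) = (\<Sum>i\<in>I. ip x (f i))"
  by (induction I rule: infinite_finite_induct) (auto simp: ip_add_right)

lemma scale_diff_right: "a \<in> K \<Longrightarrow> scale a (x - y) = scale a x - scale a y"
  by (metis add_diff_cancel diff_add_cancel scale_add_right)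

lemma scale_zero [simp]: "scale 0 x = 0" "a \<in> K \<Longrightarrow> scale a 0 = 0"
  using scale_of_real[of 0 x] scale_add_right[of a 0 0] by auto

lemma scale_sum_right: "a \<in> K \<Longrightarrow> scale a (\<Sum>i\<in>I. f i) = (\<Sum>i\<in>I. scale a (f i))"
  by (induction I rule: infinite_finite_induct) (auto simp: scale_add_right)

lemma norm_scale: "a \<in> K \<Longrightarrow> norm (scale a x) = cmod a * norm x"
proof -
  assume a: "a \<in> K"
  have "complex_of_real ((norm (scale a x))\<^sup>2) = a * cnj a * complex_of_real ((norm x)\<^sup>2)"
    using a by (simp only: ip_self[symmetric]) (simp add: ip_scale_left ip_scale_right)
  also have "\<dots> = complex_of_real ((cmod a * norm x)\<^sup>2)"
    by (simp only: complex_norm_square[symmetric]) (simp add: power_mult_distrib)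
  finally have "(norm (scale a x))\<^sup>2 = (cmod a * norm x)\<^sup>2"
    by (simp only: of_real_eq_iff)
  then show ?thesis
    by (simp add: power2_eq_iff_nonneg)
qed

lemma scale_scaleR: "a \<in> K \<Longrightarrow> scale a (r *\<^sub>R x) = r *\<^sub>R scale a x"
  by (metis K_closed(1) mult.commute scale_of_real scale_scale)

text \<open>Rotating \<open>x\<close> by a phase makes the inner product a nonnegative real, which
  reduces the claim to the real Cauchy-Schwarz inequality. Over the reals the phase is a sign, hence
  again a scalar in \<open>K\<close>.\<close>

lemma cmod_ip_le: "cmod (ip x y) \<le> norm x * norm y"
proof (cases "ip x y = 0")
  case False
  define a where "a = cnj (ip x y) * of_real (inverse (cmod (ip x y)))"
  have aK: "a \<in> K"
    using scalars
  proof
    assume "K = \<real>"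
    then obtain r where "ip x y = of_real r"
      using ip_in_K[of x y] by (auto elim: Reals_cases)
    then have "a = of_real (r * inverse (cmod (ip x y)))"
      by (simp add: a_def)
    then show ?thesis
      by (simp only: K_closed)
  qed simp
  have a1: "cmod a = 1"
    using False by (simp add: a_def norm_mult norm_inverse)
  have "ip (scale a x) y = of_real (cmod (ip x y))"
    using aK False complex_norm_square[of "ip x y"] 
    by (simp add: ip_scale_left a_def field_simps power2_eq_square)
  then have "cmod (ip x y) = scale a x \<bullet> y"
    by (metis Re_complex_of_real ip_Re)
  also have "\<dots> \<le> norm (scale a x) * norm y"
    by (rule norm_cauchy_schwarz)
  finally show ?thesis
    by (simp add: norm_scale aK a1)
qed (simp)

lemma self_adjoint_inner: "self_adjoint ip A \<Longrightarrow> blinfun_apply A v \<bullet> w = v \<bullet> blinfun_apply A w"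
  unfolding self_adjoint_def by (metis ip_Re)

end

section \<open>Projections onto finite-dimensional subspaces and the trace there\<close>

locale finite_onset = hilbert_space K scale ip
  for K scale and ip :: "'a \<Rightarrow> 'a::{real_inner, banach, second_countable_topology} \<Rightarrow> complex" +
  fixes F :: "'a set"
  assumes finF [simp]: "finite F"
    and orthoF: "e \<in> F \<Longrightarrow> f \<in> F \<Longrightarrow> ip e f = (if e = f then 1 else 0)"
begin

definition prj :: "'a \<Rightarrow> 'a" where "prj x = (\<Sum>e\<in>F. scale (ip x e) e)"

lemma ip_prj_left: "ip (prj x) y = (\<Sum>e\<in>F. ip x e * ip e y)"
  by (simp add: prj_def ip_sum_left ip_scale_left)

lemma ip_prj_sym: "ip (prj x) y = ip x (prj y)"
proof -
  have "ip x (prj y) = (\<Sum>e\<in>F. cnj (ip y e) * ip x e)"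
    by (simp add: prj_def ip_sum_right ip_scale_right)
  also have "\<dots> = (\<Sum>e\<in>F. ip x e * ip e y)"
    by (rule sum.cong) (auto simp: ip_cnj[symmetric])
  finally show ?thesis by (simp add: ip_prj_left)
qed

lemma ip_prj_basis: "e \<in> F \<Longrightarrow> ip (prj x) e = ip x e"
  by (simp add: ip_prj_left orthoF if_distrib sum.If_cases cong: if_cong)

lemma prj_prj [simp]: "prj (prj x) = prj x"
  unfolding prj_def[of "prj x"] by (simp add: ip_prj_basis) (simp add: prj_def)

lemma prj_basis: "e \<in> F \<Longrightarrow> prj e = e"
proof -
  assume e: "e \<in> F"
  have "prj e = (\<Sum>f\<in>F. if f = e then e else 0)"
    unfolding prj_def by (rule sum.cong) (use e scale_of_real[of 1 e] in \<open>auto simp: orthoF\<close>)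
  then show ?thesis using e by simp
qed

lemma prj_add: "prj (x + y) = prj x + prj y"
  by (simp add: prj_def ip_add_left scale_add_left sum.distrib)

lemma prj_scale: "a \<in> K \<Longrightarrow> prj (scale a x) = scale a (prj x)"
  by (simp add: prj_def ip_scale_left scale_sum_right scale_scale)

lemma prj_scaleR: "prj (r *\<^sub>R x) = r *\<^sub>R prj x"
  using prj_scale[of "of_real r" x] by (simp add: scale_of_real)

lemma prj_zero [simp]: "prj 0 = 0" by (simp add: prj_def)

lemma prj_sum: "prj (\<Sum>i\<in>I. f i) = (\<Sum>i\<in>I. prj (f i))"
  by (induction I rule: infinite_finite_induct) (auto simp: prj_add)

lemma prj_diff: "prj (x - y) = prj x - prj y"
  using prj_add[of x "- y"] prj_scaleR[of "-1" y] by simp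

lemma inner_prj: "prj x \<bullet> y = x \<bullet> prj y"
  by (metis ip_Re ip_prj_sym)

lemma norm_prj_sq: "(norm (prj x))\<^sup>2 = (\<Sum>e\<in>F. (cmod (ip x e))\<^sup>2)"
proof -
  have "complex_of_real ((norm (prj x))\<^sup>2) = ip (prj x) x"
    by (metis ip_prj_sym ip_self prj_prj)
  also have "\<dots> = (\<Sum>e\<in>F. ip x e * cnj (ip x e))"
    by (simp add: ip_prj_left ip_cnj[symmetric])
  also have "\<dots> = complex_of_real (\<Sum>e\<in>F. (cmod (ip x e))\<^sup>2)"
    unfolding of_real_sum complex_norm_square ..
  finally show ?thesis by (simp only: of_real_eq_iff)
qed

lemma norm_minus_prj_sq: "(norm (x - prj x))\<^sup>2 = (norm x)\<^sup>2 - (norm (prj x))\<^sup>2"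
proof -
  have "prj x \<bullet> prj x = x \<bullet> prj x"
    by (simp add: inner_prj)
  then show ?thesis
    unfolding power2_norm_eq_inner inner_diff_left inner_diff_right inner_commute[of "prj x" x]
    by linarith
qed

lemma norm_prj_le: "norm (prj x) \<le> norm x"
proof (rule power2_le_imp_le)
  show "(norm (prj x))\<^sup>2 \<le> (norm x)\<^sup>2"
    using norm_minus_prj_sq[of x] zero_le_power2[of "norm (x - prj x)"] by linarith
qed simp

definition prjop :: "'a bop" where "prjop = to_bop (Blinfun prj)"

lemma ap_prjop [simp]: "ap prjop x = prj x"
proof -
  have "bounded_linear prj"
    by (rule bounded_linear_intro[where K=1]) (auto simp: prj_add prj_scaleR norm_prj_le)
  then show ?thesis
    by (simp add: prjop_def bounded_linear_Blinfun_apply)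
qed

text \<open>The algebra of \<open>K\<close>-linear operators that leave the span of \<open>F\<close>
  invariant. It contains the identity, which the polynomials require, and an element may act
  arbitrarily off the span; \<open>tr\<close> only sees its restriction.\<close>

definition G :: "'a bop set" where
  "G = {x. (\<forall>a\<in>K. \<forall>v. ap x (scale a v) = scale a (ap x v)) \<and> (\<forall>e\<in>F. prj (ap x e) = ap x e)}"

lemma G_scale: "x \<in> G \<Longrightarrow> a \<in> K \<Longrightarrow> ap x (scale a v) = scale a (ap x v)"
  and G_range: "x \<in> G \<Longrightarrow> e \<in> F \<Longrightarrow> prj (ap x e) = ap x e"
  by (auto simp: G_def)

lemma G_ap_prj: "x \<in> G \<Longrightarrow> ap x (prj v) = (\<Sum>e\<in>F. scale (ip v e) (ap x e))"
  by (simp add: prj_def ap_sum_right G_scale)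

lemma G_prj: assumes "x \<in> G" shows "prj (ap x (prj v)) = ap x (prj v)"
proof -
  have "ap x (prj v) = (\<Sum>e\<in>F. scale (ip v e) (prj (ap x e)))"
    using assms by (simp add: G_ap_prj G_range)
  also have "\<dots> = prj (\<Sum>e\<in>F. scale (ip v e) (ap x e))"
    by (simp add: prj_sum prj_scale)
  also have "(\<Sum>e\<in>F. scale (ip v e) (ap x e)) = ap x (prj v)"
    using assms by (simp add: G_ap_prj)
  finally show ?thesis by (rule sym)
qed

lemma G_intros:
  "0 \<in> G" "1 \<in> G" "x \<in> G \<Longrightarrow> y \<in> G \<Longrightarrow> x + y \<in> G" "x \<in> G \<Longrightarrow> y \<in> G \<Longrightarrow> x - y \<in> G"
  "x \<in> G \<Longrightarrow> r *\<^sub>R x \<in> G"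
  by (auto simp: G_def prj_add prj_diff prj_scaleR scale_add_right scale_diff_right scale_scaleR prj_basis)

lemma G_mult: "x \<in> G \<Longrightarrow> y \<in> G \<Longrightarrow> x * y \<in> G"
proof -
  assume x: "x \<in> G" and y: "y \<in> G"
  have "prj (ap x (ap y e)) = ap x (ap y e)" if "e \<in> F" for e
    using G_prj[OF x, of "ap y e"] G_range[OF y that] by simp
  then show ?thesis
    using G_scale[OF x] G_scale[OF y] by (simp add: G_def)
qed

lemma G_power: "x \<in> G \<Longrightarrow> x ^ k \<in> G"
  by (induction k) (auto intro: G_intros G_mult)

lemma G_uminus: "x \<in> G \<Longrightarrow> - x \<in> G"
  using G_intros(5)[of x "-1"] by simp

lemma G_compress:
  "(\<And>a v. a \<in> K \<Longrightarrow> ap x (scale a v) = scale a (ap x v)) \<Longrightarrow> prjop * x * prjop \<in> G"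
  by (simp add: G_def prj_scale)

text \<open>On \<open>G\<close> this is the real part of the trace of the restriction to the span of
  \<open>F\<close>. All inequalities below concern real parts only.\<close>

definition tr :: "'a bop \<Rightarrow> real" where "tr x = (\<Sum>e\<in>F. ap x e \<bullet> e)"

lemma tr_simps:
  "tr 0 = 0" "tr (x + y) = tr x + tr y" "tr (x - y) = tr x - tr y" "tr (r *\<^sub>R x) = r * tr x"
  "tr (- x) = - tr x"
  by (simp_all add: tr_def inner_add_left inner_diff_left sum.distrib sum_subtractf sum_distrib_left
      sum_negf)

lemma tr_sum: "tr (\<Sum>i\<in>I. f i) = (\<Sum>i\<in>I. tr (f i))"
  by (induction I rule: infinite_finite_induct) (auto simp: tr_simps)

text \<open>Expanding the inner operator in the basis writes both sides as the same double sum with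
  the indices exchanged. \<open>K\<close>-linearity enters because the coefficients are
  \<open>K\<close>-valued.\<close>

lemma tr_comm: assumes "x \<in> G" "y \<in> G" shows "tr (x * y) = tr (y * x)"
proof -
  have *: "tr (x * y) = Re (\<Sum>e\<in>F. \<Sum>f\<in>F. ip (ap y e) f * ip (ap x f) e)" if "x \<in> G" "y \<in> G" for x y
  proof -
    have "ap (x * y) e \<bullet> e = Re (\<Sum>f\<in>F. ip (ap y e) f * ip (ap x f) e)" if e: "e \<in> F" for e
    proof -
      have "ap (x * y) e = ap x (prj (ap y e))"
        using \<open>y \<in> G\<close> e by (simp add: G_range)
      also have "\<dots> = (\<Sum>f\<in>F. scale (ip (ap y e) f) (ap x f))"
        using \<open>x \<in> G\<close> by (rule G_ap_prj)
      finally have "ip (ap (x * y) e) e = (\<Sum>f\<in>F. ip (ap y e) f * ip (ap x f) e)"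
        by (simp add: ip_sum_left ip_scale_left)
      then show ?thesis
        by (metis ip_Re)
    qed
    then show ?thesis
      by (simp add: tr_def)
  qed
  show ?thesis
    unfolding *[OF assms] *[OF assms(2,1)] by (subst sum.swap) (simp add: mult.commute)
qed

lemma norm_basis: "e \<in> F \<Longrightarrow> norm e = 1"
proof -
  assume "e \<in> F"
  then have "complex_of_real ((norm e)\<^sup>2) = of_real 1"
    using ip_self[of e] orthoF[of e e] by simp
  then have "(norm e)\<^sup>2 = 1"
    by (simp only: of_real_eq_iff)
  then show ?thesis
    using norm_ge_zero[of e] by (auto simp: power2_eq_1_iff simp del: norm_ge_zero)
qed

lemma abs_tr_le: "\<bar>tr x\<bar> \<le> real (card F) * norm x"
proof -
  have "\<bar>tr x\<bar> \<le> (\<Sum>e\<in>F. \<bar>ap x e \<bullet> e\<bar>)"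
    unfolding tr_def by (rule sum_abs)
  also have "\<dots> \<le> (\<Sum>e\<in>F. norm x)"
  proof (rule sum_mono)
    fix e assume "e \<in> F"
    then show "\<bar>ap x e \<bullet> e\<bar> \<le> norm x"
      using Cauchy_Schwarz_ineq2[of "ap x e" e] norm_ap_le[of x e] by (simp add: norm_basis)
  qed
  finally show ?thesis by simp
qed

text \<open>Cauchy-Schwarz for the Hilbert-Schmidt inner product, in the additive form that comes
  from a single square. The cyclic property replaces \<open>x * x'\<close> by
  \<open>x' * x\<close>.\<close>

lemma tr_mult_le:
  assumes "adj x x'" "adj y y'" "x \<in> G" "x' \<in> G"
  shows "tr (x * y) \<le> (tr (x' * x) + tr (y' * y)) / 2"
proof -
  have "tr (x * y) = (\<Sum>e\<in>F. ap y e \<bullet> ap x' e)"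
    using assms by (simp add: tr_def adj_def)
  also have "\<dots> \<le> (\<Sum>e\<in>F. ((norm (ap x' e))\<^sup>2 + (norm (ap y e))\<^sup>2) / 2)"
  proof (rule sum_mono)
    fix e
    have "0 \<le> (norm (ap x' e - ap y e))\<^sup>2" by simp
    then show "ap y e \<bullet> ap x' e \<le> ((norm (ap x' e))\<^sup>2 + (norm (ap y e))\<^sup>2) / 2"
      unfolding power2_norm_eq_inner by (simp add: inner_diff_left inner_diff_right inner_commute)
  qed
  also have "\<dots> = (tr (x * x') + tr (y' * y)) / 2"
    using adj_sym[OF assms(2)] assms(1)
    by (simp add: tr_def adj_def power2_norm_eq_inner sum.distrib sum_divide_distrib[symmetric])
  finally show ?thesis
    using tr_comm[OF assms(3,4)] by simp
qed

lemma tr_power_cyclic: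
  assumes "u \<in> G" "v \<in> G" shows "tr ((u * v) ^ k) = tr ((v * u) ^ k)"
proof (cases k)
  case (Suc n)
  have "tr ((u * v) ^ k) = tr (u * ((v * u) ^ n * v))"
    unfolding Suc power_mult_cyclic by (simp add: mult.assoc)
  also have "\<dots> = tr ((v * u) ^ n * v * u)"
    using assms by (intro tr_comm G_mult G_power)
  also have "\<dots> = tr ((v * u) ^ k)"
    by (simp add: Suc mult.assoc flip: power_Suc2)
  finally show ?thesis .
qed simp

text \<open>A substitute for the Golden--Thompson inequality.  The two statements are proved together: each
  one at exponent \<open>2 ^ (j + 1)\<close> reduces to both at exponent \<open>2 ^ j\<close>.\<close>

lemma trace_power_aux:
  "(\<forall>c\<in>G. \<forall>c'\<in>G. adj c c' \<longrightarrow> tr (c ^ (2 ^ Suc j)) \<le> tr ((c' * c) ^ (2 ^ j))) \<and>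
   (\<forall>x\<in>G. \<forall>y\<in>G. adj x x \<longrightarrow> adj y y \<longrightarrow> tr ((x * y) ^ (2 ^ j)) \<le> tr (x ^ (2 ^ j) * y ^ (2 ^ j)))"
proof (induction j)
  case 0
  have "tr (c * c) \<le> tr (c' * c)" if "c \<in> G" "c' \<in> G" "adj c c'" for c c'
    using tr_mult_le[OF that(3) that(3) that(1,2)] by simp
  then show ?case by (simp add: power2_eq_square)
next
  case (Suc j)
  then have P: "\<And>c c'. c \<in> G \<Longrightarrow> c' \<in> G \<Longrightarrow> adj c c' \<Longrightarrow> tr (c ^ (2 ^ Suc j)) \<le> tr ((c' * c) ^ (2 ^ j))"
    and Q: "\<And>x y. x \<in> G \<Longrightarrow> y \<in> G \<Longrightarrow> adj x x \<Longrightarrow> adj y y \<Longrightarrow>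
       tr ((x * y) ^ (2 ^ j)) \<le> tr (x ^ (2 ^ j) * y ^ (2 ^ j))"
    by blast+
  have dbl: "z ^ (2 ^ Suc i) = (z * z) ^ (2 ^ i)" for z :: "'a bop" and i
    by (simp add: power_mult power2_eq_square)
  have "tr (c ^ (2 ^ Suc (Suc j))) \<le> tr ((c' * c) ^ (2 ^ Suc j))"
    if c: "c \<in> G" "c' \<in> G" "adj c c'" for c c'
  proof -
    note c' = c adj_sym[OF c(3)]
    have "tr (c ^ (2 ^ Suc (Suc j))) = tr ((c * c) ^ (2 ^ Suc j))"
      by (simp only: dbl)
    \<comment> \<open>The first hypothesis for \<open>c * c\<close>, whose adjoint is
      \<open>c' * c'\<close>. Rotating one \<open>c'\<close> to the end then exposes
      \<open>c' * c\<close> times \<open>c * c'\<close>, two self-adjoint factors, to which the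
      second hypothesis applies.\<close>
    also have "\<dots> \<le> tr ((c' * c' * (c * c)) ^ (2 ^ j))"
      using c by (intro P G_mult adj_intros)
    also have "\<dots> = tr ((c' * (c' * c * c)) ^ (2 ^ j))"
      by (simp add: mult.assoc)
    also have "\<dots> = tr ((c' * c * c * c') ^ (2 ^ j))"
      using c by (intro tr_power_cyclic G_mult)
    also have "\<dots> = tr ((c' * c * (c * c')) ^ (2 ^ j))"
      by (simp add: mult.assoc)
    also have "\<dots> \<le> tr ((c' * c) ^ (2 ^ j) * (c * c') ^ (2 ^ j))"
      using c' by (intro Q G_mult adj_intros)
    also have "\<dots> \<le> (tr ((c' * c) ^ (2 ^ j) * (c' * c) ^ (2 ^ j)) + tr ((c * c') ^ (2 ^ j) * (c * c') ^ (2 ^ j))) / 2"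
      using c' by (intro tr_mult_le G_mult G_power adj_power adj_intros)
    also have "\<dots> = (tr ((c' * c) ^ (2 ^ Suc j)) + tr ((c * c') ^ (2 ^ Suc j))) / 2"
      by (simp add: mult_2 power_add)
    also have "tr ((c * c') ^ (2 ^ Suc j)) = tr ((c' * c) ^ (2 ^ Suc j))"
      using c by (intro tr_power_cyclic)
    finally show ?thesis by simp
  qed note P' = this
  have "tr ((x * y) ^ (2 ^ Suc j)) \<le> tr (x ^ (2 ^ Suc j) * y ^ (2 ^ Suc j))"
    if x: "x \<in> G" "y \<in> G" "adj x x" "adj y y" for x y
  proof -
    have "tr ((x * y) ^ (2 ^ Suc j)) \<le> tr ((y * x * (x * y)) ^ (2 ^ j))"
      using x by (intro P G_mult adj_intros)
    also have "\<dots> = tr ((y * (x * x * y)) ^ (2 ^ j))"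
      by (simp add: mult.assoc)
    also have "\<dots> = tr ((x * x * y * y) ^ (2 ^ j))"
      using x by (intro tr_power_cyclic G_mult)
    also have "\<dots> = tr ((x * x * (y * y)) ^ (2 ^ j))"
      by (simp add: mult.assoc)
    also have "\<dots> \<le> tr ((x * x) ^ (2 ^ j) * (y * y) ^ (2 ^ j))"
      using x by (intro Q G_mult adj_intros)
    also have "\<dots> = tr (x ^ (2 ^ Suc j) * y ^ (2 ^ Suc j))"
      by (simp only: dbl)
    finally show ?thesis .
  qed
  with P' show ?case by blast
qed

lemma trace_power_mult_le:
  assumes "x \<in> G" "y \<in> G" "adj x x" "adj y y"
  shows "tr ((x * y) ^ (2 ^ j)) \<le> tr (x ^ (2 ^ j) * y ^ (2 ^ j))"
  using trace_power_aux[of j] assms by blast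

end

section \<open>Polynomial approximations of the exponential\<close>

definition exp_coeff :: "nat \<Rightarrow> nat \<Rightarrow> real" where "exp_coeff m k = real (m choose k) / real m ^ k"

definition exp_approx :: "nat \<Rightarrow> 'b \<Rightarrow> 'b::{real_algebra, monoid_mult}"
  where "exp_approx m x = (1 + (1 / real m) *\<^sub>R x) ^ m"

definition cosh_approx :: "nat \<Rightarrow> 'b \<Rightarrow> 'b::{real_algebra, monoid_mult}"
  where "cosh_approx m x = exp_approx m x + exp_approx m (- x) - 2 *\<^sub>R 1"

text \<open>The constant in \<open>exp x \<le> 1 + x + g x^2\<close> for
  \<open>\<bar>x\<bar> \<le> C\<close>; equivalently the power series with coefficients
  \<open>1 / (k + 2)!\<close>.\<close>

definition bennett_g :: "real \<Rightarrow> real" where "bennett_g C = (exp C - 1 - C) / C\<^sup>2"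

lemma exp_coeff_nonneg: "0 \<le> exp_coeff m k"
  by (simp add: exp_coeff_def)

lemma exp_coeff_0 [simp]: "exp_coeff m 0 = 1" and exp_coeff_1: "0 < m \<Longrightarrow> exp_coeff m (Suc 0) = 1"
  by (simp_all add: exp_coeff_def)

lemma exp_coeff_le: "exp_coeff m k \<le> 1 / fact k"
proof (cases "m = 0")
  case True
  then show ?thesis by (cases k) (auto simp: exp_coeff_def)
next
  case False
  have "real (m choose k) * fact k \<le> real m ^ k"
    using binomial_fact_pow[of m k] by (metis of_nat_fact of_nat_le_iff of_nat_mult of_nat_power)
  then show ?thesis
    using False by (simp add: exp_coeff_def field_simps)
qed

lemma one_plus_power_expand:
  "(1 + x) ^ m = (\<Sum>k\<le>m. real (m choose k) *\<^sub>R x ^ k)" for x :: "'b::{real_algebra, monoid_mult}"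
proof (induction m)
  case (Suc m)
  have 1: "(\<Sum>k\<le>m. real (m choose k) *\<^sub>R x ^ k) = 1 + (\<Sum>k\<le>m. real (m choose Suc k) *\<^sub>R x ^ Suc k)"
  proof -
    have "(\<Sum>k\<le>m. real (m choose k) *\<^sub>R x ^ k) = (\<Sum>k\<le>Suc m. real (m choose k) *\<^sub>R x ^ k)"
      by simp
    also have "\<dots> = 1 + (\<Sum>k\<le>m. real (m choose Suc k) *\<^sub>R x ^ Suc k)"
      by (subst sum.atMost_Suc_shift) simp
    finally show ?thesis .
  qed
  have "(1 + x) ^ Suc m = (\<Sum>k\<le>m. real (m choose k) *\<^sub>R x ^ k) + x * (\<Sum>k\<le>m. real (m choose k) *\<^sub>R x ^ k)"
    by (simp add: Suc distrib_right)
  also have "\<dots> = 1 + ((\<Sum>k\<le>m. real (m choose Suc k) *\<^sub>R x ^ Suc k) + (\<Sum>k\<le>m. real (m choose k) *\<^sub>R x ^ Suc k))"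
    by (subst (1) 1) (simp add: add.assoc sum_distrib_left)
  also have "\<dots> = 1 + (\<Sum>k\<le>m. real (Suc m choose Suc k) *\<^sub>R x ^ Suc k)"
    by (simp only: sum.distrib[symmetric] binomial_Suc_Suc of_nat_add scaleR_left_distrib) (simp add: add.commute)
  also have "\<dots> = (\<Sum>k\<le>Suc m. real (Suc m choose k) *\<^sub>R x ^ k)"
    by (subst sum.atMost_Suc_shift) simp
  finally show ?case .
qed simp

lemma scaleR_power': "(a *\<^sub>R x) ^ k = a ^ k *\<^sub>R x ^ k" for x :: "'b::{real_algebra, monoid_mult}"
  by (induction k) auto

lemma exp_approx_expand: "exp_approx m x = (\<Sum>k\<le>m. exp_coeff m k *\<^sub>R x ^ k)"
  unfolding exp_approx_def one_plus_power_expand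
  by (rule sum.cong) (auto simp: scaleR_power' exp_coeff_def power_one_over divide_simps)

lemma uminus_power_even: "(- x) ^ (2 * i) = x ^ (2 * i)" for x :: "'b::{real_algebra, monoid_mult}"
  by (induction i) auto

lemma sum_even_odd:
  "(\<Sum>k\<le>2 * h. u k) = (\<Sum>i\<le>h. u (2 * i)) + (\<Sum>i<h. u (Suc (2 * i)))" for u :: "nat \<Rightarrow> 'b::ab_group_add"
  by (induction h) (auto simp: algebra_simps)

text \<open>Adding the polynomial at \<open>- x\<close> leaves only even powers, with nonnegative
  coefficients. Positivity of the trace and monotonicity in the norm both rest on this.\<close>

lemma cosh_approx_expand:
  fixes x :: "'b::{real_algebra, monoid_mult}"
  shows "cosh_approx (2 * h) x = (\<Sum>i=1..h. (2 * exp_coeff (2 * h) (2 * i)) *\<^sub>R x ^ (2 * i))"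
proof -
  have "exp_approx (2 * h) x + exp_approx (2 * h) (- x) =
      (\<Sum>k\<le>2 * h. exp_coeff (2 * h) k *\<^sub>R x ^ k + exp_coeff (2 * h) k *\<^sub>R (- x) ^ k)"
    by (simp add: exp_approx_expand sum.distrib)
  also have "\<dots> = (\<Sum>i\<le>h. (2 * exp_coeff (2 * h) (2 * i)) *\<^sub>R x ^ (2 * i))"
    by (subst sum_even_odd) (simp add: uminus_power_even scaleR_left_distrib[symmetric])
  also have "\<dots> = 2 *\<^sub>R 1 + (\<Sum>i=1..h. (2 * exp_coeff (2 * h) (2 * i)) *\<^sub>R x ^ (2 * i))"
    by (subst sum.atMost_shift) (simp add: sum.atLeast1_atMost_eq lessThan_Suc_atMost)
  finally show ?thesis
    by (simp add: cosh_approx_def)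
qed

lemma cosh_approx_real_mono: "0 \<le> r \<Longrightarrow> r \<le> s \<Longrightarrow> cosh_approx (2 * h) r \<le> cosh_approx (2 * h) (s :: real)"
  unfolding cosh_approx_expand by (intro sum_mono) (auto intro!: mult_left_mono power_mono exp_coeff_nonneg)

lemma cosh_approx_zero [simp]: "cosh_approx m (0 :: 'b::{real_algebra, monoid_mult}) = 0"
proof -
  have "1 ^ k = (1 :: 'b)" for k
    by (induction k) auto
  then show ?thesis
    by (simp add: cosh_approx_def exp_approx_def scaleR_2)
qed

lemma cosh_approx_real_tendsto: "(\<lambda>j. cosh_approx (2 ^ Suc j) (r :: real)) \<longlonglongrightarrow> exp r + exp (- r) - 2"
proof -
  have *: "(\<lambda>j. exp_approx (2 ^ Suc j) (s :: real)) \<longlonglongrightarrow> exp s" for s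
  proof -
    have "strict_mono (\<lambda>j::nat. 2 ^ Suc j :: nat)"
      by (rule strict_monoI) simp
    from LIMSEQ_subseq_LIMSEQ[OF tendsto_exp_limit_sequentially[of s] this]
    show ?thesis
      by (simp add: exp_approx_def comp_def)
  qed
  have "(\<lambda>j. cosh_approx (2 ^ Suc j) (r :: real)) \<longlonglongrightarrow> exp r + exp (- r) - 2 *\<^sub>R 1"
    unfolding cosh_approx_def by (intro tendsto_intros *)
  then show ?thesis by simp
qed

lemma bennett_g_partial: assumes "0 < C" shows "(\<Sum>k=2..m. C ^ (k - 2) / fact k) \<le> bennett_g C"
proof -
  have s: "summable (\<lambda>k. C ^ k / fact k)"
    using summable_exp[of C] by (simp add: field_simps)
  have e: "exp C = (\<Sum>k. C ^ k / fact k)"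
    unfolding exp_def by (simp add: scaleR_conv_of_real field_simps)
  have "C\<^sup>2 * (\<Sum>k=2..m. C ^ (k - 2) / fact k) = (\<Sum>k=2..m. C ^ k / fact k)"
    unfolding sum_distrib_left
  proof (rule sum.cong)
    fix k assume "k \<in> {2..m}"
    then have "C ^ k = C\<^sup>2 * C ^ (k - 2)"
      by (metis atLeastAtMost_iff le_add_diff_inverse power_add)
    then show "C\<^sup>2 * (C ^ (k - 2) / fact k) = C ^ k / fact k"
      by (simp only: times_divide_eq_right)
  qed simp
  also have "1 + C + (\<Sum>k=2..m. C ^ k / fact k) = (\<Sum>k\<in>{0, 1} \<union> {2..m}. C ^ k / fact k)"
    by (subst sum.union_disjoint) auto
  then have "(\<Sum>k=2..m. C ^ k / fact k) = (\<Sum>k\<in>{0, 1} \<union> {2..m}. C ^ k / fact k) - 1 - C"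
    by simp
  also have "\<dots> \<le> exp C - 1 - C"
    unfolding e using assms by (intro diff_mono order_refl sum_le_suminf s) auto
  finally show ?thesis
    using assms by (simp add: bennett_g_def field_simps)
qed

lemma bennett_g_nonneg: "0 < C \<Longrightarrow> 0 \<le> bennett_g C"
  using bennett_g_partial[of C 0] by simp

lemma norm_power_diff_le:
  fixes u w :: "'a::real_normed_vector bop"
  assumes "norm u \<le> q" "norm w \<le> q"
  shows "norm (u ^ m - w ^ m) \<le> real m * q ^ (m - 1) * norm (u - w)"
proof (induction m)
  case (Suc m)
  have q: "0 \<le> q"
    using assms(1) norm_ge_zero[of u] by linarith
  have "u ^ Suc m - w ^ Suc m = u * (u ^ m - w ^ m) + (u - w) * w ^ m"
    by (simp add: algebra_simps)
  then have "norm (u ^ Suc m - w ^ Suc m) \<le> norm u * norm (u ^ m - w ^ m) + norm (u - w) * norm (w ^ m)"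
    by (metis norm_triangle_le add_mono norm_mult_ineq)
  also have "\<dots> \<le> q * (real m * q ^ (m - 1) * norm (u - w)) + norm (u - w) * q ^ m"
    using assms q order_trans[OF norm_power_bop_le power_mono[OF assms(2), of m]]
    by (intro add_mono mult_mono Suc.IH) auto
  also have "\<dots> = real (Suc m) * q ^ (Suc m - 1) * norm (u - w)"
    by (cases m) (auto simp: algebra_simps)
  finally show ?case .
qed simp

text \<open>The bases of the two powers differ by \<open>A * X / m^2\<close> only, and raising to
  the power \<open>m\<close> magnifies a difference by at most \<open>m q ^ (m - 1)\<close>. The
  choice of \<open>q\<close> keeps \<open>q ^ m\<close> equal to \<open>exp (R + C)\<close>, so the
  error is of order \<open>1 / m\<close>.\<close>

lemma exp_approx_add_approx:
  fixes A X :: "'a::real_normed_vector bop"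
  assumes "norm A \<le> R" "norm X \<le> C" "0 < m"
  shows "norm (exp_approx m (A + X) - ((1 + (1 / real m) *\<^sub>R A) * (1 + (1 / real m) *\<^sub>R X)) ^ m)
           \<le> R * C * exp (R + C) / real m"
proof -
  have R: "0 \<le> R" and C: "0 \<le> C"
    using assms norm_ge_zero[of A] norm_ge_zero[of X] by linarith+
  define u where "u = 1 + (1 / real m) *\<^sub>R (A + X)"
  define w where "w = (1 + (1 / real m) *\<^sub>R A) * (1 + (1 / real m) *\<^sub>R X)"
  define q where "q = exp ((R + C) / real m)"
  have n1: "norm (1 + (1 / real m) *\<^sub>R Y) \<le> 1 + r / real m" if "norm Y \<le> r" for Y :: "'a bop" and r
  proof -
    have "norm (1 + (1 / real m) *\<^sub>R Y) \<le> norm (1 :: 'a bop) + norm ((1 / real m) *\<^sub>R Y)"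
      by (rule norm_triangle_ineq)
    also have "\<dots> \<le> 1 + r / real m"
      using that assms(3) by (intro add_mono norm_one_bop_le) (auto simp: divide_right_mono)
    finally show ?thesis .
  qed
  have u: "norm u \<le> q"
    using n1[of "A + X" "R + C"] norm_triangle_le[of A X "R + C"] assms(1,2) exp_ge_add_one_self[of "(R + C) / real m"]
    unfolding u_def q_def by linarith
  have "norm w \<le> norm (1 + (1 / real m) *\<^sub>R A) * norm (1 + (1 / real m) *\<^sub>R X)"
    unfolding w_def by (rule norm_mult_ineq)
  also have "\<dots> \<le> exp (R / real m) * exp (C / real m)"
    using n1[OF assms(1)] n1[OF assms(2)] exp_ge_add_one_self[of "R / real m"] exp_ge_add_one_self[of "C / real m"]
    by (intro mult_mono) (linarith | simp)+
  also have "\<dots> = q"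
    by (simp add: q_def exp_add[symmetric] add_divide_distrib)
  finally have w: "norm w \<le> q" .
  have q1: "1 \<le> q"
    using R C by (simp add: q_def)
  have "u - w = - ((1 / (real m)\<^sup>2) *\<^sub>R (A * X))"
    by (simp add: u_def w_def algebra_simps power2_eq_square)
  then have uw: "norm (u - w) \<le> R * C / (real m)\<^sup>2"
    using norm_mult_ineq[of A X] mult_mono[OF assms(1,2) R norm_ge_zero]
    by (simp add: divide_right_mono)
  have "norm (u ^ m - w ^ m) \<le> real m * q ^ (m - 1) * norm (u - w)"
    by (rule norm_power_diff_le[OF u w])
  also have "\<dots> \<le> real m * q ^ m * (R * C / (real m)\<^sup>2)"
    using q1 uw by (intro mult_mono) (auto intro: power_increasing)
  also have "q ^ m = exp (R + C)"
    using assms(3) by (simp add: q_def exp_of_nat_mult[symmetric])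
  also have "real m * exp (R + C) * (R * C / (real m)\<^sup>2) = R * C * exp (R + C) / real m"
    using assms(3) by (simp add: power2_eq_square)
  finally show ?thesis
    by (simp add: exp_approx_def u_def w_def)
qed

lemma adj_exp_approx: "adj A A \<Longrightarrow> adj (exp_approx m A) (exp_approx m A)"
  unfolding exp_approx_def by (intro adj_power adj_intros)

lemma adj_cosh_approx: "adj A A \<Longrightarrow> adj (cosh_approx m A) (cosh_approx m A)"
  unfolding cosh_approx_def by (intro adj_intros adj_exp_approx) auto

text \<open>The polynomial version of \<open>exp X \<le> 1 + X + g X^2\<close>, as an inequality of
  quadratic forms. From degree two on, one factor \<open>X\<close> is moved to each side of the
  inner product, the remaining \<open>k - 2\<close> factors cost \<open>C ^ (k - 2)\<close>, and the
  coefficients are at most those of the exponential.\<close>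

lemma exp_approx_quadratic_le:
  assumes sa: "adj X X" and X: "norm X \<le> C" and C: "0 < C" and m: "2 \<le> m"
  shows "ap (exp_approx m X) v \<bullet> v \<le> (norm v)\<^sup>2 + ap X v \<bullet> v + bennett_g C * (norm (ap X v))\<^sup>2"
proof -
  have sp: "{..m} = {0, 1} \<union> {2..m}"
    using m by auto
  have "ap (exp_approx m X) v \<bullet> v = (\<Sum>k\<le>m. exp_coeff m k * (ap (X ^ k) v \<bullet> v))"
    by (simp add: exp_approx_expand ap_sum inner_sum_left)
  also have "\<dots> = (norm v)\<^sup>2 + ap X v \<bullet> v + (\<Sum>k=2..m. exp_coeff m k * (ap (X ^ k) v \<bullet> v))"
    unfolding sp using m by (subst sum.union_disjoint) (auto simp: exp_coeff_1 power2_norm_eq_inner)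
  also have "(\<Sum>k=2..m. exp_coeff m k * (ap (X ^ k) v \<bullet> v)) \<le> (\<Sum>k=2..m. C ^ (k - 2) / fact k * (norm (ap X v))\<^sup>2)"
  proof (rule sum_mono)
    fix k assume k: "k \<in> {2..m}"
    then obtain i where i: "k = Suc (i + 1)" 
      by (metis add.commute add_2_eq_Suc' atLeastAtMost_iff le_Suc_ex Suc_eq_plus1 add_Suc_right)
    have "X ^ k = X * (X ^ i * X)"
      by (simp add: i power_commutes)
    then have "ap (X ^ k) v \<bullet> v = ap (X ^ i) (ap X v) \<bullet> ap X v"
      using sa by (simp add: adj_def)
    also have "\<dots> \<le> norm (ap (X ^ i) (ap X v)) * norm (ap X v)"
      by (rule norm_cauchy_schwarz)
    also have "\<dots> \<le> (C ^ i * norm (ap X v)) * norm (ap X v)"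
    proof (intro mult_right_mono)
      have "norm (X ^ i) \<le> C ^ i"
        using norm_power_bop_le[of X i] power_mono[OF X norm_ge_zero, of i] by linarith
      then have "norm (X ^ i) * norm (ap X v) \<le> C ^ i * norm (ap X v)"
        by (intro mult_right_mono) auto
      then show "norm (ap (X ^ i) (ap X v)) \<le> C ^ i * norm (ap X v)"
        using norm_ap_le[of "X ^ i" "ap X v"] by linarith
    qed simp
    finally have 1: "ap (X ^ k) v \<bullet> v \<le> C ^ (k - 2) * (norm (ap X v))\<^sup>2"
      by (simp add: i power2_eq_square mult.assoc)
    have "exp_coeff m k * (ap (X ^ k) v \<bullet> v) \<le> exp_coeff m k * (C ^ (k - 2) * (norm (ap X v))\<^sup>2)"
      by (intro mult_left_mono 1 exp_coeff_nonneg)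
    also have "\<dots> \<le> 1 / fact k * (C ^ (k - 2) * (norm (ap X v))\<^sup>2)"
      using C by (intro mult_right_mono exp_coeff_le) auto
    finally show "exp_coeff m k * (ap (X ^ k) v \<bullet> v) \<le> C ^ (k - 2) / fact k * (norm (ap X v))\<^sup>2"
      by simp
  qed
  also have "\<dots> \<le> bennett_g C * (norm (ap X v))\<^sup>2"
    unfolding sum_distrib_right[symmetric] by (intro mult_right_mono bennett_g_partial C) auto
  finally show ?thesis by simp
qed

text \<open>The sequence \<open>norm (A ^ k w)\<close> is log-convex by self-adjointness and
  Cauchy-Schwarz, so its successive ratios increase and are at least the first one. For
  \<open>k = 0\<close> the inequality would demand \<open>norm w = 1\<close>, hence the
  exception.\<close>

lemma norm_ap_power_ge:
  assumes sa: "adj A A" and w: "norm w \<le> 1"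
  shows "norm (ap A w) ^ k \<le> norm (ap (A ^ k) w) \<or> k = 0"
proof (cases "ap A w = 0")
  case True
  then show ?thesis by (cases k) auto
next
  case False
  define u where "u k = norm (ap (A ^ k) w)" for k
  have u2: "(u (Suc k))\<^sup>2 \<le> u k * u (Suc (Suc k))" for k
  proof -
    have "(u (Suc k))\<^sup>2 = ap A (ap (A ^ k) w) \<bullet> ap A (ap (A ^ k) w)"
      by (simp add: u_def power2_norm_eq_inner)
    also have "\<dots> = ap (A ^ k) w \<bullet> ap (A ^ Suc (Suc k)) w"
      using sa by (simp add: adj_def)
    also have "\<dots> \<le> u k * u (Suc (Suc k))"
      unfolding u_def by (rule norm_cauchy_schwarz)
    finally show ?thesis .
  qed
  have u1: "0 < u 1" using False by (simp add: u_def)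
  have step: "0 < u (Suc k) \<and> u 1 * u k \<le> u (Suc k)" for k
  proof (induction k)
    case 0
    show ?case using u1 w by (simp add: u_def mult_left_le)
  next
    case (Suc k)
    have "0 < (u (Suc k))\<^sup>2" using Suc by simp
    then have "0 < u k * u (Suc (Suc k))" using u2[of k] by linarith
    then have uk: "0 < u k" and pos: "0 < u (Suc (Suc k))"
      by (auto simp: zero_less_mult_iff u_def)
    have "u 1 * u (Suc k) * u k = (u 1 * u k) * u (Suc k)" by simp
    also have "\<dots> \<le> u (Suc k) * u (Suc k)"
      using Suc by (intro mult_right_mono) auto
    also have "\<dots> \<le> u (Suc (Suc k)) * u k"
      using u2[of k] by (simp add: power2_eq_square mult.commute)
    finally have "u 1 * u (Suc k) \<le> u (Suc (Suc k))"
      using uk by simp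
    then show ?case using pos by simp
  qed
  have "u 1 ^ Suc k \<le> u (Suc k)" for k
  proof (induction k)
    case (Suc k)
    have "u 1 ^ Suc (Suc k) \<le> u 1 * u (Suc k)"
      using Suc u1 by simp
    also have "\<dots> \<le> u (Suc (Suc k))"
      using step[of "Suc k"] by simp
    finally show ?case .
  qed simp
  then show ?thesis
    by (cases k) (auto simp: u_def)
qed

section \<open>Trace estimates for the polynomial hyperbolic cosine\<close>

context finite_onset
begin

lemma G_exp_approx: "A \<in> G \<Longrightarrow> exp_approx m A \<in> G"
  unfolding exp_approx_def by (intro G_power G_intros)

lemma tr_adj: "adj A A \<Longrightarrow> tr (A * X) = (\<Sum>e\<in>F. ap X e \<bullet> ap A e)"
  by (simp add: tr_def adj_def)

lemma norm_ap_HS: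
  assumes "B \<in> G" shows "(norm (ap B (prj v)))\<^sup>2 \<le> (\<Sum>e\<in>F. (norm (ap B e))\<^sup>2) * (norm v)\<^sup>2"
proof -
  have "norm (ap B (prj v)) \<le> (\<Sum>e\<in>F. norm (scale (ip v e) (ap B e)))"
    unfolding G_ap_prj[OF assms] by (rule norm_sum)
  also have "\<dots> = (\<Sum>e\<in>F. cmod (ip v e) * norm (ap B e))"
    by (simp add: norm_scale)
  finally have "(norm (ap B (prj v)))\<^sup>2 \<le> (\<Sum>e\<in>F. cmod (ip v e) * norm (ap B e))\<^sup>2"
    by (intro power_mono) auto
  also have "\<dots> \<le> (\<Sum>e\<in>F. (cmod (ip v e))\<^sup>2) * (\<Sum>e\<in>F. (norm (ap B e))\<^sup>2)"
    by (rule Cauchy_Schwarz_ineq_sum)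
  also have "(\<Sum>e\<in>F. (cmod (ip v e))\<^sup>2) \<le> (norm v)\<^sup>2"
    unfolding norm_prj_sq[symmetric] by (intro power_mono norm_prj_le) auto
  finally show ?thesis
    by (simp add: mult.commute mult_right_mono sum_nonneg)
qed

lemma tr_even_power: "adj A A \<Longrightarrow> tr (A ^ (2 * i)) = (\<Sum>e\<in>F. (norm (ap (A ^ i) e))\<^sup>2)"
  by (simp add: tr_def adj_self_power2)

text \<open>Stands in for the comparison of the top eigenvalue with the sum of all eigenvalues: for
  a unit vector, \<open>norm (A w) ^ (2 i)\<close> is at most the squared norm of
  \<open>A ^ i w\<close>, hence at most the squared Hilbert-Schmidt norm of \<open>A ^ i\<close>,
  which is the trace. The assumption on \<open>prj\<close> ensures that the norm of \<open>A\<close>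
  is already seen on the span.\<close>

lemma tr_power_ge:
  assumes "A \<in> G" "adj A A" and A: "\<And>v. ap A (prj v) = ap A v" and "0 < i"
  shows "norm A ^ (2 * i) \<le> tr (A ^ (2 * i))"
proof -
  define t where "t = tr (A ^ (2 * i))"
  have t0: "0 \<le> t"
    unfolding t_def tr_even_power[OF assms(2)] by (simp add: sum_nonneg)
  have *: "norm (ap A w) ^ (2 * i) \<le> t" if "norm w \<le> 1" for w
  proof -
    have "norm (ap A w) ^ (2 * i) = (norm (ap A (prj w)) ^ i)\<^sup>2"
      by (simp add: A power_mult mult.commute[of 2])
    also have "\<dots> \<le> (norm (ap (A ^ i) (prj w)))\<^sup>2"
      using norm_ap_power_ge[OF assms(2), of "prj w" i] order_trans[OF norm_prj_le that] assms(4)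
      by (intro power_mono) auto
    also have "\<dots> \<le> t * (norm w)\<^sup>2"
      unfolding t_def tr_even_power[OF assms(2)] by (intro norm_ap_HS G_power assms)
    also have "\<dots> \<le> t"
      using that t0 by (simp add: mult_left_le power_le_one)
    finally show ?thesis .
  qed
  have "norm A \<le> root (2 * i) t"
  proof (rule norm_bop_bound)
    show "0 \<le> root (2 * i) t" using t0 by (rule real_root_ge_zero)
    fix v :: 'a
    show "norm (ap A v) \<le> root (2 * i) t * norm v"
    proof (cases "v = 0")
      case False
      define w where "w = (1 / norm v) *\<^sub>R v"
      have "norm (ap A w) \<le> root (2 * i) t"
      proof -
        have "root (2 * i) (norm (ap A w) ^ (2 * i)) \<le> root (2 * i) t"
          using *[of w] False assms(4) by (intro real_root_le_mono) (auto simp: w_def)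
        then show ?thesis
          using assms(4) by (simp add: real_root_power_cancel)
      qed
      then show ?thesis
        using False by (simp add: w_def field_simps)
    qed simp
  qed
  then have "norm A ^ (2 * i) \<le> root (2 * i) t ^ (2 * i)"
    by (intro power_mono) auto
  then show ?thesis
    using t0 assms(4) by (simp add: t_def)
qed

lemma tr_cosh_approx: "tr (cosh_approx (2 * h) A) = (\<Sum>i=1..h. 2 * exp_coeff (2 * h) (2 * i) * tr (A ^ (2 * i)))"
  by (simp add: cosh_approx_expand tr_sum tr_simps)

lemma tr_cosh_approx_nonneg: "adj A A \<Longrightarrow> 0 \<le> tr (cosh_approx (2 * h) A)"
  unfolding tr_cosh_approx by (intro sum_nonneg) (auto simp: tr_even_power exp_coeff_nonneg sum_nonneg)

lemma tr_cosh_approx_ge: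
  assumes "A \<in> G" "adj A A" "\<And>v. ap A (prj v) = ap A v"
  shows "cosh_approx (2 * h) (norm A) \<le> tr (cosh_approx (2 * h) A)"
  unfolding tr_cosh_approx by (subst cosh_approx_expand) (auto intro!: sum_mono mult_left_mono tr_power_ge assms exp_coeff_nonneg)

lemma tr_cosh_approx_sq:
  assumes "A \<in> G" "adj A A" "X \<in> G" "adj X X"
  shows "tr (cosh_approx (2 * h) A * X\<^sup>2) =
           (\<Sum>i=1..h. 2 * exp_coeff (2 * h) (2 * i) * (\<Sum>e\<in>F. (norm (ap X (ap (A ^ i) e)))\<^sup>2))"
proof -
  have "tr (A ^ (2 * i) * X\<^sup>2) = (\<Sum>e\<in>F. (norm (ap X (ap (A ^ i) e)))\<^sup>2)" for i
  proof -
    have "tr (A ^ (2 * i) * X\<^sup>2) = tr (A ^ i * (A ^ i * X\<^sup>2))"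
      by (simp add: mult_2 power_add mult.assoc)
    also have "\<dots> = tr (A ^ i * X\<^sup>2 * A ^ i)"
      using assms by (intro tr_comm G_mult G_power)
    also have "\<dots> = (\<Sum>e\<in>F. (norm (ap X (ap (A ^ i) e)))\<^sup>2)"
      unfolding tr_def power2_norm_eq_inner
    proof (rule sum.cong[OF refl])
      fix e
      have "ap (A ^ i * X\<^sup>2 * A ^ i) e \<bullet> e = ap X (ap X (ap (A ^ i) e)) \<bullet> ap (A ^ i) e"
        using adj_power[OF assms(2), of i] by (simp add: adj_def power2_eq_square)
      then show "ap (A ^ i * X\<^sup>2 * A ^ i) e \<bullet> e = ap X (ap (A ^ i) e) \<bullet> ap X (ap (A ^ i) e)"
        using assms(4) by (simp add: adj_def)
    qed
    finally show ?thesis .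
  qed
  then show ?thesis
    by (simp add: cosh_approx_expand sum_distrib_right tr_sum tr_simps)
qed

text \<open>The degree is even, so the polynomial of \<open>A\<close> equals \<open>D * D\<close>
  with \<open>D\<close> self-adjoint. By cyclicity the trace against \<open>Z\<close> is a sum of
  quadratic forms of \<open>Z\<close> at the vectors \<open>D e\<close>, hence monotone in
  \<open>Z\<close>.\<close>

lemma tr_exp_approx_mult_le:
  assumes A: "A \<in> G" "adj A A" and X: "X \<in> G" "adj X X" "norm X \<le> C" and C: "0 < C"
  shows "tr (exp_approx (2 ^ Suc j) A * exp_approx (2 ^ Suc j) X) \<le>
     tr (exp_approx (2 ^ Suc j) A * (1 + X + bennett_g C *\<^sub>R X\<^sup>2))"
proof -
  define m where "m = (2::nat) ^ Suc j"
  define D where "D = (1 + (1 / real m) *\<^sub>R A) ^ (2 ^ j)"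
  have D: "D \<in> G" "adj D D"
    using A unfolding D_def by (auto intro!: G_power G_intros adj_power adj_intros)
  have "m = 2 ^ j + 2 ^ j"
    by (simp add: m_def)
  then have pD: "exp_approx m A = D * D"
    unfolding exp_approx_def D_def by (simp only: power_add)
  have sq: "tr (exp_approx m A * Z) = (\<Sum>e\<in>F. ap Z (ap D e) \<bullet> ap D e)" if "Z \<in> G" for Z
  proof -
    have "tr (exp_approx m A * Z) = tr (D * (D * Z))"
      by (simp add: pD mult.assoc)
    also have "\<dots> = tr (D * Z * D)"
      using D that by (intro tr_comm G_mult)
    also have "\<dots> = (\<Sum>e\<in>F. ap Z (ap D e) \<bullet> ap D e)"
      using D(2) by (simp add: tr_def adj_def)
    finally show ?thesis .
  qed
  have "tr (exp_approx m A * exp_approx m X) \<le> tr (exp_approx m A * (1 + X + bennett_g C *\<^sub>R X\<^sup>2))"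
    unfolding sq[OF G_exp_approx[OF X(1)]] sq[OF G_intros(3)[OF G_intros(3)[OF G_intros(2) X(1)] G_intros(5)[OF G_power[OF X(1)]]]]
  proof (intro sum_mono)
    fix e assume "e \<in> F"
    have "ap (exp_approx m X) (ap D e) \<bullet> ap D e \<le>
       (norm (ap D e))\<^sup>2 + ap X (ap D e) \<bullet> ap D e + bennett_g C * (norm (ap X (ap D e)))\<^sup>2"
      using X C self_le_power[of "2::nat" "Suc j"] unfolding m_def
      by (intro exp_approx_quadratic_le) auto
    also have "\<dots> = ap (1 + X + bennett_g C *\<^sub>R X\<^sup>2) (ap D e) \<bullet> ap D e"
    proof -
      have "ap (X\<^sup>2) (ap D e) \<bullet> ap D e = (norm (ap X (ap D e)))\<^sup>2"
        using adj_self_power2[OF X(2), of 1] by simp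
      then show ?thesis
        by (simp add: inner_add_left power2_norm_eq_inner)
    qed
    finally show "ap (exp_approx m X) (ap D e) \<bullet> ap D e \<le> ap (1 + X + bennett_g C *\<^sub>R X\<^sup>2) (ap D e) \<bullet> ap D e" .
  qed
  then show ?thesis by (simp add: m_def)
qed

text \<open>The error of \<open>exp_approx_add_approx\<close> is paid once, multiplied by
  \<open>card F\<close>; the bound \<open>R\<close> on \<open>A\<close> enters only there.\<close>

lemma tr_exp_approx_add_le:
  assumes A: "A \<in> G" "adj A A" "norm A \<le> R" and X: "X \<in> G" "adj X X" "norm X \<le> C" and C: "0 < C"
  shows "tr (exp_approx (2 ^ Suc j) (A + X)) \<le> tr (exp_approx (2 ^ Suc j) A * (1 + X + bennett_g C *\<^sub>R X\<^sup>2))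
           + real (card F) * (R * C * exp (R + C)) / 2 ^ Suc j"
proof -
  define m where "m = (2::nat) ^ Suc j"
  define a where "a = 1 + (1 / real m) *\<^sub>R A"
  define b where "b = 1 + (1 / real m) *\<^sub>R X"
  have ab: "a \<in> G" "b \<in> G" "adj a a" "adj b b"
    using A X by (auto simp: a_def b_def intro!: G_intros adj_intros)
  have "tr (exp_approx m (A + X)) - tr ((a * b) ^ m) \<le> \<bar>tr (exp_approx m (A + X) - (a * b) ^ m)\<bar>"
    by (simp add: tr_simps)
  also have "\<dots> \<le> real (card F) * norm (exp_approx m (A + X) - (a * b) ^ m)"
    by (rule abs_tr_le)
  also have "\<dots> \<le> real (card F) * (R * C * exp (R + C) / real m)"
    unfolding a_def b_def by (intro mult_left_mono exp_approx_add_approx A X) (auto simp: m_def)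
  finally have 1: "tr (exp_approx m (A + X)) \<le> tr ((a * b) ^ m) + real (card F) * (R * C * exp (R + C) / real m)"
    by simp
  have "tr ((a * b) ^ m) \<le> tr (a ^ m * b ^ m)"
    unfolding m_def by (intro trace_power_mult_le ab)
  also have "\<dots> = tr (exp_approx m A * exp_approx m X)"
    by (simp add: exp_approx_def a_def b_def)
  also have "\<dots> \<le> tr (exp_approx m A * (1 + X + bennett_g C *\<^sub>R X\<^sup>2))"
    unfolding m_def by (intro tr_exp_approx_mult_le A X C)
  finally show ?thesis
    using 1 by (simp add: m_def)
qed

text \<open>Add the estimates for \<open>A, X\<close> and for \<open>- A, - X\<close>. The linear
  terms combine to one that is centred in \<open>X\<close>; the quadratic ones are multiplied by
  \<open>cosh_approx m A + 2\<close>, whose constant \<open>2\<close> produces the term that does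
  not involve \<open>A\<close>.\<close>

lemma tr_cosh_approx_add_le:
  fixes j :: nat
  defines "m \<equiv> 2 ^ Suc j"
  assumes A: "A \<in> G" "adj A A" "norm A \<le> R" and X: "X \<in> G" "adj X X" "norm X \<le> C" and C: "0 < C"
  shows "tr (cosh_approx m (A + X)) \<le> tr (cosh_approx m A) + (\<Sum>e\<in>F. ap X e \<bullet> ap (exp_approx m A - exp_approx m (- A)) e)
           + bennett_g C * (\<Sum>e\<in>F. ap (X\<^sup>2) e \<bullet> ap (cosh_approx m A) e) + 2 * bennett_g C * (\<Sum>e\<in>F. (norm (ap X e))\<^sup>2)
           + 2 * (real (card F) * (R * C * exp (R + C)) / 2 ^ Suc j)"
proof -
  define err where "err = real (card F) * (R * C * exp (R + C)) / 2 ^ Suc j"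
  have A': "- A \<in> G" "adj (- A) (- A)" "norm (- A) \<le> R" and X': "- X \<in> G" "adj (- X) (- X)" "norm (- X) \<le> C"
    using A X by (auto intro: G_uminus adj_intros)
  have 1: "tr (exp_approx m (A + X)) \<le> tr (exp_approx m A * (1 + X + bennett_g C *\<^sub>R X\<^sup>2)) + err"
    unfolding m_def err_def by (rule tr_exp_approx_add_le[OF A X C])
  have 2: "tr (exp_approx m (- (A + X))) \<le> tr (exp_approx m (- A) * (1 - X + bennett_g C *\<^sub>R X\<^sup>2)) + err"
  proof -
    have "(- X)\<^sup>2 = X\<^sup>2"
      by (simp add: power2_eq_square)
    then show ?thesis
      using tr_exp_approx_add_le[OF A' X' C, of j] by (simp add: m_def err_def)
  qed
  have "tr (cosh_approx m (A + X)) = tr (exp_approx m (A + X)) + tr (exp_approx m (- (A + X))) - 2 * tr 1"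
    unfolding cosh_approx_def by (simp add: tr_simps)
  also have "\<dots> \<le> tr (exp_approx m A * (1 + X + bennett_g C *\<^sub>R X\<^sup>2)) + tr (exp_approx m (- A) * (1 - X + bennett_g C *\<^sub>R X\<^sup>2)) - 2 * tr 1 + 2 * err"
    using 1 2 by linarith
  also have "\<dots> = tr (cosh_approx m A + (exp_approx m A - exp_approx m (- A)) * X + bennett_g C *\<^sub>R (cosh_approx m A * X\<^sup>2) + (2 * bennett_g C) *\<^sub>R X\<^sup>2) + 2 * err"
  proof -
    have "cosh_approx m A + (exp_approx m A - exp_approx m (- A)) * X + bennett_g C *\<^sub>R (cosh_approx m A * X\<^sup>2) + (2 * bennett_g C) *\<^sub>R X\<^sup>2 =
       exp_approx m A * (1 + X + bennett_g C *\<^sub>R X\<^sup>2) + exp_approx m (- A) * (1 - X + bennett_g C *\<^sub>R X\<^sup>2) - 2 *\<^sub>R 1"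
      by (simp add: cosh_approx_def algebra_simps)
    then show ?thesis by (simp add: tr_simps)
  qed
  also have "\<dots> = tr (cosh_approx m A) + (\<Sum>e\<in>F. ap X e \<bullet> ap (exp_approx m A - exp_approx m (- A)) e)
           + bennett_g C * (\<Sum>e\<in>F. ap (X\<^sup>2) e \<bullet> ap (cosh_approx m A) e) + 2 * bennett_g C * (\<Sum>e\<in>F. (norm (ap X e))\<^sup>2) + 2 * err"
  proof -
    have "tr ((exp_approx m A - exp_approx m (- A)) * X) = (\<Sum>e\<in>F. ap X e \<bullet> ap (exp_approx m A - exp_approx m (- A)) e)"
      using A A' by (intro tr_adj adj_intros adj_exp_approx)
    moreover have "tr (cosh_approx m A * X\<^sup>2) = (\<Sum>e\<in>F. ap (X\<^sup>2) e \<bullet> ap (cosh_approx m A) e)"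
      using A by (intro tr_adj adj_cosh_approx)
    moreover have "tr (X\<^sup>2) = (\<Sum>e\<in>F. (norm (ap X e))\<^sup>2)"
      using tr_even_power[OF X(2), of 1] by simp
    ultimately show ?thesis by (simp add: tr_simps)
  qed
  finally show ?thesis by (simp only: err_def)
qed

end

section \<open>Random operators\<close>

definition strong_meas :: "'w measure \<Rightarrow> ('w \<Rightarrow> 'a::real_normed_vector bop) \<Rightarrow> bool"
  where "strong_meas N A \<longleftrightarrow> (\<forall>v. (\<lambda>\<omega>. ap (A \<omega>) v) \<in> borel_measurable N)"

lemma strong_measD: "strong_meas N A \<Longrightarrow> (\<lambda>\<omega>. ap (A \<omega>) v) \<in> borel_measurable N"
  by (simp add: strong_meas_def)

text \<open>Operator norm measurability is unavailable for sums, since the operator space is not separable;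
  measurability of each \<open>\<omega> \<mapsto> A \<omega> v\<close> is stable under all operations needed.\<close>

lemma strong_meas_apply:
  fixes A :: "'w \<Rightarrow> 'a::{real_normed_vector, second_countable_topology} bop"
  assumes A: "strong_meas N A" and V: "V \<in> borel_measurable N"
  shows "(\<lambda>\<omega>. ap (A \<omega>) (V \<omega>)) \<in> borel_measurable N"
proof -
  obtain s where s: "\<And>i. simple_function N (s i)" and lim: "\<And>\<omega>. \<omega> \<in> space N \<Longrightarrow> (\<lambda>i. s i \<omega>) \<longlonglongrightarrow> V \<omega>"
    using borel_measurable_implies_sequence_metric[OF V, of 0] by metis
  have "(\<lambda>\<omega>. ap (A \<omega>) (s i \<omega>)) \<in> borel_measurable N" for i
  proof -
    have "(\<lambda>\<omega>. \<Sum>w\<in>s i ` space N. indicator (s i -` {w} \<inter> space N) \<omega> *\<^sub>R ap (A \<omega>) w) \<in> borel_measurable N"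
      using A s[of i] by (intro borel_measurable_sum borel_measurable_scaleR borel_measurable_indicator)
        (auto simp: strong_meas_def simple_function_def)
    also have "?this \<longleftrightarrow> (\<lambda>\<omega>. ap (A \<omega>) (s i \<omega>)) \<in> borel_measurable N"
    proof (rule measurable_cong)
      fix \<omega> assume \<omega>: "\<omega> \<in> space N"
      have "(\<Sum>w\<in>s i ` space N. indicator (s i -` {w} \<inter> space N) \<omega> *\<^sub>R ap (A \<omega>) w) =
          (\<Sum>w\<in>s i ` space N. if w = s i \<omega> then ap (A \<omega>) (s i \<omega>) else 0)"
        using \<omega> by (intro sum.cong) (auto simp: indicator_def)
      also have "\<dots> = ap (A \<omega>) (s i \<omega>)"
        using \<omega> s[of i] by (simp add: simple_function_def)
      finally show "(\<Sum>w\<in>s i ` space N. indicator (s i -` {w} \<inter> space N) \<omega> *\<^sub>R ap (A \<omega>) w) = ap (A \<omega>) (s i \<omega>)" .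
    qed
    finally show ?thesis .
  qed
  moreover have "(\<lambda>i. ap (A \<omega>) (s i \<omega>)) \<longlonglongrightarrow> ap (A \<omega>) (V \<omega>)" if "\<omega> \<in> space N" for \<omega>
    using lim[OF that] by (intro tendsto_intros) auto
  ultimately show ?thesis
    by (rule borel_measurable_LIMSEQ_metric)
qed

context
  fixes N :: "'w measure" and A B :: "'w \<Rightarrow> 'a::{real_normed_vector, second_countable_topology} bop"
begin

lemma strong_meas_const: "strong_meas N (\<lambda>\<omega>. x)"
  by (simp add: strong_meas_def)

lemma strong_meas_add: "strong_meas N A \<Longrightarrow> strong_meas N B \<Longrightarrow> strong_meas N (\<lambda>\<omega>. A \<omega> + B \<omega>)"
  and strong_meas_diff: "strong_meas N A \<Longrightarrow> strong_meas N B \<Longrightarrow> strong_meas N (\<lambda>\<omega>. A \<omega> - B \<omega>)"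
  and strong_meas_uminus: "strong_meas N A \<Longrightarrow> strong_meas N (\<lambda>\<omega>. - A \<omega>)"
  and strong_meas_scaleR: "strong_meas N A \<Longrightarrow> strong_meas N (\<lambda>\<omega>. r *\<^sub>R A \<omega>)"
  by (auto simp: strong_meas_def intro!: borel_measurable_add borel_measurable_diff borel_measurable_const_scaleR)

lemma strong_meas_if: "Measurable.pred N P \<Longrightarrow> strong_meas N A \<Longrightarrow> strong_meas N B \<Longrightarrow> strong_meas N (\<lambda>\<omega>. if P \<omega> then A \<omega> else B \<omega>)"
  by (auto simp: strong_meas_def if_distrib[of "\<lambda>x. ap x _"] pred_def intro!: measurable_If)

lemma strong_meas_mult: "strong_meas N A \<Longrightarrow> strong_meas N B \<Longrightarrow> strong_meas N (\<lambda>\<omega>. A \<omega> * B \<omega>)"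
  unfolding strong_meas_def[of N "\<lambda>\<omega>. A \<omega> * B \<omega>"] by (auto intro!: strong_meas_apply simp: strong_measD)

end

lemma strong_meas_power:
  fixes A :: "'w \<Rightarrow> 'a::{real_normed_vector, second_countable_topology} bop"
  shows "strong_meas N A \<Longrightarrow> strong_meas N (\<lambda>\<omega>. A \<omega> ^ k)"
  by (induction k) (auto intro: strong_meas_mult strong_meas_const)

lemma strong_meas_sum:
  fixes A :: "'i \<Rightarrow> 'w \<Rightarrow> 'a::{real_normed_vector, second_countable_topology} bop"
  shows "(\<And>i. i \<in> I \<Longrightarrow> strong_meas N (A i)) \<Longrightarrow> strong_meas N (\<lambda>\<omega>. \<Sum>i\<in>I. A i \<omega>)"
  by (induction I rule: infinite_finite_induct) (auto intro: strong_meas_add strong_meas_const)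

lemma strong_meas_exp_approx:
  fixes A :: "'w \<Rightarrow> 'a::{real_normed_vector, second_countable_topology} bop"
  shows "strong_meas N A \<Longrightarrow> strong_meas N (\<lambda>\<omega>. exp_approx m (A \<omega>))"
  unfolding exp_approx_def by (intro strong_meas_power strong_meas_add strong_meas_const strong_meas_scaleR)

lemma strong_meas_cosh_approx:
  fixes A :: "'w \<Rightarrow> 'a::{real_normed_vector, second_countable_topology} bop"
  shows "strong_meas N A \<Longrightarrow> strong_meas N (\<lambda>\<omega>. cosh_approx m (A \<omega>))"
  unfolding cosh_approx_def by (intro strong_meas_diff strong_meas_add strong_meas_exp_approx strong_meas_const strong_meas_uminus)

lemma strong_meas_compose: "strong_meas N A \<Longrightarrow> g \<in> measurable M N \<Longrightarrow> strong_meas M (\<lambda>\<omega>. A (g \<omega>))"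
  unfolding strong_meas_def by (auto intro: measurable_compose)

text \<open>Separability of the underlying space: a bound on the operator norm need only be tested
  on a countable dense set of vectors, and each test is a measurable condition.\<close>

lemma strong_meas_norm:
  fixes A :: "'w \<Rightarrow> 'a::{real_normed_vector, second_countable_topology} bop"
  assumes "strong_meas N A" shows "(\<lambda>\<omega>. norm (A \<omega>)) \<in> borel_measurable N"
proof -
  obtain D :: "'a set" where D: "countable D" "\<And>X. open X \<Longrightarrow> X \<noteq> {} \<Longrightarrow> \<exists>d\<in>D. d \<in> X"
    by (rule countable_dense_setE) blast
  have *: "norm x \<le> r \<longleftrightarrow> 0 \<le> r \<and> (\<forall>d\<in>D. norm (ap x d) \<le> r * norm d)" for x :: "'a bop" and r
  proof
    assume r: "norm x \<le> r"
    then show "0 \<le> r \<and> (\<forall>d\<in>D. norm (ap x d) \<le> r * norm d)"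
      using order_trans[OF norm_ge_zero r] order_trans[OF norm_ap_le mult_right_mono[OF r norm_ge_zero]] by blast
  next
    assume r: "0 \<le> r \<and> (\<forall>d\<in>D. norm (ap x d) \<le> r * norm d)"
    have "closed {v. norm (ap x v) \<le> r * norm v}"
      by (intro closed_Collect_le continuous_intros)
    then have "open (- {v. norm (ap x v) \<le> r * norm v})"
      by (simp add: open_Compl)
    then have "- {v. norm (ap x v) \<le> r * norm v} = {}"
      using D(2)[of "- {v. norm (ap x v) \<le> r * norm v}"] r by auto
    then show "norm x \<le> r"
      using r by (intro norm_bop_bound) auto
  qed
  show ?thesis
    unfolding borel_measurable_iff_le
  proof
    fix r
    have "{\<omega> \<in> space N. norm (A \<omega>) \<le> r} =
        {\<omega> \<in> space N. 0 \<le> r \<and> (\<forall>d\<in>D. norm (ap (A \<omega>) d) \<le> r * norm d)}"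
      by (auto simp: *)
    also have "\<dots> \<in> sets N"
    proof (intro sets.sets_Collect_conj sets.sets_Collect_const sets.sets_Collect_countable_All' D(1))
      fix d assume "d \<in> D"
      have "(\<lambda>\<omega>. norm (ap (A \<omega>) d)) \<in> borel_measurable N"
        using strong_measD[OF assms, of d] by measurable
      then show "{\<omega> \<in> space N. norm (ap (A \<omega>) d) \<le> r * norm d} \<in> sets N"
        by (intro borel_measurable_le) auto
    qed
    finally show "{\<omega> \<in> space N. norm (A \<omega>) \<le> r} \<in> sets N" .
  qed
qed

lemma norm_exp_approx_le: "norm A \<le> R \<Longrightarrow> norm (exp_approx m A) \<le> (1 + R / real m) ^ m"
  for A :: "'a::real_normed_vector bop"
proof -
  assume A: "norm A \<le> R"
  have "norm (1 + (1 / real m) *\<^sub>R A) \<le> norm (1 :: 'a bop) + norm ((1 / real m) *\<^sub>R A)"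
    by (rule norm_triangle_ineq)
  also have "\<dots> \<le> 1 + R / real m"
    using A by (intro add_mono norm_one_bop_le) (auto simp: divide_right_mono)
  finally have "norm (1 + (1 / real m) *\<^sub>R A) ^ m \<le> (1 + R / real m) ^ m"
    by (intro power_mono) auto
  then show ?thesis
    unfolding exp_approx_def using norm_power_bop_le order_trans by blast
qed

lemma norm_cosh_approx_le: "norm A \<le> R \<Longrightarrow> norm (cosh_approx m A) \<le> 2 * (1 + R / real m) ^ m + 2"
  for A :: "'a::real_normed_vector bop"
proof -
  assume A: "norm A \<le> R"
  have "norm (cosh_approx m A) \<le> norm (exp_approx m A) + norm (exp_approx m (- A)) + norm (2 *\<^sub>R (1 :: 'a bop))"
    unfolding cosh_approx_def by (rule order_trans[OF norm_triangle_ineq4 add_right_mono[OF norm_triangle_ineq]])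
  also have "\<dots> \<le> (1 + R / real m) ^ m + (1 + R / real m) ^ m + 2"
    using A norm_one_bop_le[where ?'a='a] by (intro add_mono norm_exp_approx_le) auto
  finally show ?thesis by simp
qed

section \<open>Expectations of bounded random vectors\<close>

context prob_space
begin

lemma integrable_bdd:
  fixes f :: "'a \<Rightarrow> 'b::{banach, second_countable_topology}"
  assumes "f \<in> borel_measurable M" "\<And>\<omega>. \<omega> \<in> space M \<Longrightarrow> norm (f \<omega>) \<le> b"
  shows "integrable M f"
  using assms by (intro integrable_const_bound[of _ b]) auto

text \<open>Fubini on the product of the two distributions; the bounds supply the
  integrability.\<close>

lemma indep_var_inner:
  fixes U V :: "'a \<Rightarrow> 'b::{real_inner, banach, second_countable_topology}"
  assumes ind: "indep_var borel U borel V"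
    and U: "\<And>\<omega>. \<omega> \<in> space M \<Longrightarrow> norm (U \<omega>) \<le> a" and V: "\<And>\<omega>. \<omega> \<in> space M \<Longrightarrow> norm (V \<omega>) \<le> b"
  shows "expectation (\<lambda>\<omega>. U \<omega> \<bullet> V \<omega>) = expectation U \<bullet> expectation V"
proof -
  have mU [measurable]: "U \<in> borel_measurable M" and mV [measurable]: "V \<in> borel_measurable M"
    using indep_var_rv1[OF ind] indep_var_rv2[OF ind] by auto
  interpret U: prob_space "distr M borel U" by (rule prob_space_distr) simp
  interpret V: prob_space "distr M borel V" by (rule prob_space_distr) simp
  interpret UV: pair_prob_space "distr M borel U" "distr M borel V" ..
  have J: "distr M borel U \<Otimes>\<^sub>M distr M borel V = distr M (borel \<Otimes>\<^sub>M borel) (\<lambda>\<omega>. (U \<omega>, V \<omega>))"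
    using ind by (simp add: indep_var_distribution_eq)
  have iV: "integrable M V" and iU: "integrable M U"
    by (rule integrable_bdd[OF mV V], assumption) (rule integrable_bdd[OF mU U], assumption)
  have iUV: "integrable M (\<lambda>\<omega>. U \<omega> \<bullet> V \<omega>)"
  proof (rule integrable_bdd)
    fix \<omega> assume \<omega>: "\<omega> \<in> space M"
    have "\<bar>U \<omega> \<bullet> V \<omega>\<bar> \<le> norm (U \<omega>) * norm (V \<omega>)"
      by (rule Cauchy_Schwarz_ineq2)
    also have "\<dots> \<le> a * b"
      using U[OF \<omega>] V[OF \<omega>] order_trans[OF norm_ge_zero U[OF \<omega>]] by (intro mult_mono) auto
    finally show "norm (U \<omega> \<bullet> V \<omega>) \<le> a * b" by simp
  qed simp
  have "integrable (distr M borel U \<Otimes>\<^sub>M distr M borel V) (\<lambda>p. fst p \<bullet> snd p)"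
    unfolding J using iUV by (subst integrable_distr_eq) auto
  then have int: "integrable (distr M borel U \<Otimes>\<^sub>M distr M borel V) (\<lambda>(u, v). u \<bullet> v)"
    by (simp add: case_prod_unfold)
  have "expectation (\<lambda>\<omega>. U \<omega> \<bullet> V \<omega>) = (\<integral>p. fst p \<bullet> snd p \<partial>(distr M borel U \<Otimes>\<^sub>M distr M borel V))"
    unfolding J by (subst integral_distr) auto
  also have "\<dots> = (\<integral>u. (\<integral>v. u \<bullet> v \<partial>distr M borel V) \<partial>distr M borel U)"
    using UV.integral_fst'[OF int] by (simp add: case_prod_unfold)
  also have "\<dots> = (\<integral>u. u \<bullet> expectation V \<partial>distr M borel U)"
    using iV by (simp add: integral_distr)
  also have "\<dots> = expectation U \<bullet> expectation V"
    using iU by (simp add: integral_distr)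
  finally show ?thesis .
qed

lemma expectation_mono_bdd:
  fixes f g :: "'a \<Rightarrow> real"
  assumes "integrable M f" "integrable M g" "\<And>\<omega>. \<omega> \<in> space M \<Longrightarrow> f \<omega> \<le> g \<omega>"
  shows "expectation f \<le> expectation g"
  using assms by (intro integral_mono) auto

end

section \<open>A Bennett inequality for stopped sums of random operators\<close>

text \<open>The sum frozen at its first passage of the level \<open>r\<close>. Whether
  \<open>z (Suc i)\<close> is added is decided by the first \<open>i\<close> summands alone, which
  keeps the new summand independent of the decision.\<close>

fun stopped :: "real \<Rightarrow> (nat \<Rightarrow> 'b::real_normed_vector) \<Rightarrow> nat \<Rightarrow> 'b" where
  "stopped r z 0 = 0"
| "stopped r z (Suc i) = stopped r z i + (if \<forall>j\<le>i. norm (\<Sum>l=1..j. z l) < r then z (Suc i) else 0)"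

lemma stopped_before:
  "\<forall>j<i. norm (\<Sum>l=1..j. z l) < r \<Longrightarrow> stopped r z i = (\<Sum>l=1..i. z l)"
  by (induction i) (auto simp: less_Suc_eq_le)

lemma stopped_after:
  assumes "r \<le> norm (\<Sum>l=1..i. z l)" "stopped r z i = w" "i \<le> n"
  shows "stopped r z n = w"
  using assms(3)
proof (induction n)
  case (Suc n)
  then show ?case
    using assms by (cases "i = Suc n") (auto simp: not_less le_Suc_eq)
qed (use assms in auto)

lemma stopped_norm_ge:
  assumes "i \<le> n" "r \<le> norm (\<Sum>l=1..i. z l)"
  shows "r \<le> norm (stopped r z n)"
proof -
  define k where "k = (LEAST i. r \<le> norm (\<Sum>l=1..i. z l))"
  have k: "r \<le> norm (\<Sum>l=1..k. z l)"
    unfolding k_def by (rule LeastI[of _ i]) fact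
  have "k \<le> i"
    unfolding k_def by (rule Least_le) fact
  moreover have "\<forall>j<k. norm (\<Sum>l=1..j. z l) < r"
    using not_less_Least k_def by (metis not_le)
  ultimately show ?thesis
    using stopped_after[OF k stopped_before, of n] k assms(1) by simp
qed

lemma stopped_cong: "(\<And>j. 1 \<le> j \<Longrightarrow> j \<le> i \<Longrightarrow> z j = z' j) \<Longrightarrow> stopped r z i = stopped r z' i"
proof (induction i)
  case (Suc i)
  have "(\<Sum>l=1..j. z l) = (\<Sum>l=1..j. z' l)" if "j \<le> i" for j
    using Suc.prems that by (intro sum.cong) auto
  then have "(\<forall>j\<le>i. norm (\<Sum>l=1..j. z l) < r) \<longleftrightarrow> (\<forall>j\<le>i. norm (\<Sum>l=1..j. z' l) < r)"
    by (metis (no_types, lifting))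
  then show ?case
    using Suc by (simp only: stopped.simps)
qed simp

lemma pred_partial_sums_less:
  fixes z :: "'w \<Rightarrow> nat \<Rightarrow> 'a::{real_normed_vector, second_countable_topology} bop"
  assumes "\<And>j. 1 \<le> j \<Longrightarrow> j \<le> i \<Longrightarrow> strong_meas N (\<lambda>\<omega>. z \<omega> j)"
  shows "Measurable.pred N (\<lambda>\<omega>. \<forall>j\<le>i. norm (\<Sum>l=1..j. z \<omega> l) < r)"
proof -
  have "Measurable.pred N (\<lambda>\<omega>. \<forall>j\<in>{..i}. norm (\<Sum>l=1..j. z \<omega> l) < r)"
    unfolding pred_def
  proof (rule sets.sets_Collect_countable_All')
    fix j assume "j \<in> {..i}"
    then have "(\<lambda>\<omega>. norm (\<Sum>l=1..j. z \<omega> l)) \<in> borel_measurable N"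
      by (intro strong_meas_norm strong_meas_sum assms; simp)
    then show "{\<omega> \<in> space N. norm (\<Sum>l=1..j. z \<omega> l) < r} \<in> sets N"
      by (rule borel_measurable_less) (rule borel_measurable_const)
  qed simp
  then show ?thesis
    unfolding Ball_def atMost_iff .
qed

lemma strong_meas_stopped:
  fixes z :: "'w \<Rightarrow> nat \<Rightarrow> 'a::{real_normed_vector, second_countable_topology} bop"
  assumes "\<And>j. 1 \<le> j \<Longrightarrow> j \<le> i \<Longrightarrow> strong_meas N (\<lambda>\<omega>. z \<omega> j)"
  shows "strong_meas N (\<lambda>\<omega>. stopped r (z \<omega>) i)"
  using assms
proof (induction i)
  case (Suc i)
  have "strong_meas N (\<lambda>\<omega>. if \<forall>j\<le>i. norm (\<Sum>l=1..j. z \<omega> l) < r then z \<omega> (Suc i) else 0)"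
    by (intro strong_meas_if strong_meas_const pred_partial_sums_less Suc.prems) auto
  moreover have "strong_meas N (\<lambda>\<omega>. stopped r (z \<omega>) i)"
    by (rule Suc.IH) (simp add: Suc.prems)
  ultimately show ?case
    unfolding stopped.simps by (intro strong_meas_add)
qed (simp add: strong_meas_const)

text \<open>The simplification procedure does not terminate on operator-valued sums.\<close>

declare [[simproc del: measurable]]

text \<open>The summands are functions of independent data \<open>\<Xi> i\<close> in arbitrary
  spaces, so that one summand may be built from a whole block of operators. The number
  \<open>s i\<close> bounds the variance as a quadratic form and \<open>\<kappa> * s i\<close>
  bounds its trace; \<open>\<kappa>\<close> is the intrinsic dimension.\<close>

locale operator_bennett = finite_onset K scale ip F + prob_space M
  for K scale and ip :: "'a \<Rightarrow> 'a::{real_inner, banach, second_countable_topology} \<Rightarrow> complex"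
    and F :: "'a set" and M :: "'w measure" +
  fixes N :: "nat \<Rightarrow> 'b measure" and \<Xi> :: "nat \<Rightarrow> 'w \<Rightarrow> 'b" and y :: "nat \<Rightarrow> 'b \<Rightarrow> 'a bop"
    and n :: nat and C \<kappa> :: real and s :: "nat \<Rightarrow> real"
  assumes indep: "indep_vars N \<Xi> {1..n}"
    and strong_meas_y: "i \<in> {1..n} \<Longrightarrow> strong_meas (N i) (y i)"
    and yG: "i \<in> {1..n} \<Longrightarrow> \<omega> \<in> space M \<Longrightarrow> y i (\<Xi> i \<omega>) \<in> G"
    and y_adj: "i \<in> {1..n} \<Longrightarrow> \<omega> \<in> space M \<Longrightarrow> adj (y i (\<Xi> i \<omega>)) (y i (\<Xi> i \<omega>))"
    and y_prj: "i \<in> {1..n} \<Longrightarrow> \<omega> \<in> space M \<Longrightarrow> ap (y i (\<Xi> i \<omega>)) (prj v) = ap (y i (\<Xi> i \<omega>)) v"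
    and norm_y: "i \<in> {1..n} \<Longrightarrow> \<omega> \<in> space M \<Longrightarrow> norm (y i (\<Xi> i \<omega>)) \<le> C"
    and mean_y: "i \<in> {1..n} \<Longrightarrow> expectation (\<lambda>\<omega>. ap (y i (\<Xi> i \<omega>)) v) = 0"
    and var_y: "i \<in> {1..n} \<Longrightarrow> expectation (\<lambda>\<omega>. (norm (ap (y i (\<Xi> i \<omega>)) v))\<^sup>2) \<le> s i * (norm v)\<^sup>2"
    and HS_y: "i \<in> {1..n} \<Longrightarrow> expectation (\<lambda>\<omega>. \<Sum>e\<in>F. (norm (ap (y i (\<Xi> i \<omega>)) e))\<^sup>2) \<le> \<kappa> * s i"
    and C_pos: "0 < C" and s_nonneg: "i \<in> {1..n} \<Longrightarrow> 0 \<le> s i" and \<kappa>_nonneg: "0 \<le> \<kappa>"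
begin

abbreviation Y where "Y i \<omega> \<equiv> y i (\<Xi> i \<omega>)"

abbreviation T where "T r i \<omega> \<equiv> stopped r (\<lambda>j. Y j \<omega>) i"

lemma \<Xi>_measurable: "i \<in> {1..n} \<Longrightarrow> \<Xi> i \<in> measurable M (N i)"
  using indep by (simp add: indep_vars_def)

lemma strong_meas_Y: "i \<in> {1..n} \<Longrightarrow> strong_meas M (Y i)"
  by (rule strong_meas_compose[OF strong_meas_y \<Xi>_measurable])

lemma strong_meas_T: "i \<le> n \<Longrightarrow> strong_meas M (T r i)"
  by (rule strong_meas_stopped) (auto intro: strong_meas_Y)

lemma T_props:
  assumes "i \<le> n" "\<omega> \<in> space M"
  shows "T r i \<omega> \<in> G \<and> adj (T r i \<omega>) (T r i \<omega>) \<and> (\<forall>v. ap (T r i \<omega>) (prj v) = ap (T r i \<omega>) v)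
           \<and> norm (T r i \<omega>) \<le> real i * C"
  using assms(1)
proof (induction i)
  case (Suc i)
  let ?Z = "if \<forall>j\<le>i. norm (\<Sum>l=1..j. Y l \<omega>) < r then Y (Suc i) \<omega> else 0"
  have i: "Suc i \<in> {1..n}" using Suc.prems by auto
  have Z: "?Z \<in> G" "adj ?Z ?Z" "ap ?Z (prj v) = ap ?Z v" "norm ?Z \<le> C" for v
    using yG[OF i assms(2)] y_adj[OF i assms(2)] y_prj[OF i assms(2)] norm_y[OF i assms(2)] C_pos
    by (auto intro: G_intros adj_intros)
  have "norm (T r (Suc i) \<omega>) \<le> norm (T r i \<omega>) + norm ?Z"
    by (simp only: stopped.simps norm_triangle_ineq)
  moreover have "real (Suc i) * C = real i * C + C"
    by (simp add: distrib_right)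
  ultimately show ?case
    using Suc Z unfolding stopped.simps by (auto intro!: G_intros(3) adj_intros(3))
qed (auto intro: G_intros adj_intros)

lemma norm_T: "i \<le> n \<Longrightarrow> \<omega> \<in> space M \<Longrightarrow> norm (T r i \<omega>) \<le> real n * C"
proof -
  assume i: "i \<le> n" and \<omega>: "\<omega> \<in> space M"
  have "real i * C \<le> real n * C"
    using i C_pos by (intro mult_right_mono) auto
  then show ?thesis
    using T_props[OF i \<omega>, of r] by linarith
qed

definition flag where "flag r i \<omega> \<longleftrightarrow> (\<forall>j\<le>i. norm (\<Sum>l=1..j. Y l \<omega>) < r)"

lemma past_indep:
  fixes h :: "'a bop \<Rightarrow> 'a bop"
  assumes i: "Suc i \<le> n"
    and h: "\<And>(P :: (nat \<Rightarrow> 'b) measure) A. strong_meas P A \<Longrightarrow> strong_meas P (\<lambda>x. h (A x))"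
  shows "indep_var borel (\<lambda>\<omega>. ap (Y (Suc i) \<omega> ^ k) e)
           borel (\<lambda>\<omega>. if flag r i \<omega> then ap (h (T r i \<omega>)) e else 0)"
proof -
  let ?U = "\<lambda>x. ap (y (Suc i) (x (Suc i)) ^ k) e"
  let ?z = "\<lambda>x j. y j (x j)"
  let ?V = "\<lambda>x. if \<forall>j\<le>i. norm (\<Sum>l=1..j. ?z x l) < r then ap (h (stopped r (?z x) i)) e else 0"
  let ?X = "\<lambda>A \<omega>. \<lambda>j\<in>A. \<Xi> j \<omega>"
  have z: "strong_meas (PiM A N) (\<lambda>x. ?z x j)" if "j \<in> A" "A \<subseteq> {1..n}" for j A
    using that by (intro strong_meas_compose[OF strong_meas_y] measurable_component_singleton) auto
  have U: "?U \<in> borel_measurable (PiM {Suc i} N)"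
    using i by (intro strong_measD strong_meas_power z) auto
  have V: "?V \<in> borel_measurable (PiM {1..i} N)"
    using i by (intro measurable_If strong_measD h strong_meas_stopped z pred_partial_sums_less[unfolded pred_def] borel_measurable_const) auto
  have "indep_var borel (?U \<circ> ?X {Suc i}) borel (?V \<circ> ?X {1..i})"
    using i by (intro indep_var_compose[OF _ U V] indep_var_restrict[OF indep]) auto
  moreover have "?U \<circ> ?X {Suc i} = (\<lambda>\<omega>. ap (Y (Suc i) \<omega> ^ k) e)"
    by (simp add: comp_def)
  moreover have "?V \<circ> ?X {1..i} = (\<lambda>\<omega>. if flag r i \<omega> then ap (h (T r i \<omega>)) e else 0)"
  proof
    fix \<omega>
    have 1: "stopped r (?z (?X {1..i} \<omega>)) i = T r i \<omega>"
      by (rule stopped_cong) auto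
    have 2: "(\<Sum>l=1..j. ?z (?X {1..i} \<omega>) l) = (\<Sum>l=1..j. Y l \<omega>)" if "j \<le> i" for j
      using that by (intro sum.cong) auto
    then have "(\<forall>j\<le>i. norm (\<Sum>l=1..j. ?z (?X {1..i} \<omega>) l) < r) \<longleftrightarrow> flag r i \<omega>"
      unfolding flag_def by (metis (no_types, lifting))
    then show "(?V \<circ> ?X {1..i}) \<omega> = (if flag r i \<omega> then ap (h (T r i \<omega>)) e else 0)"
      unfolding comp_def 1 by simp
  qed
  ultimately show ?thesis by simp
qed

definition err where "err j = 2 * (real (card F) * (real n * C * C * exp (real n * C + C)) / 2 ^ Suc j)"

lemma tr_cosh_approx_step:
  fixes j :: nat
  defines "m \<equiv> 2 ^ Suc j"
  assumes i: "Suc i \<le> n" and \<omega>: "\<omega> \<in> space M"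
  shows "tr (cosh_approx m (T r (Suc i) \<omega>)) \<le> tr (cosh_approx m (T r i \<omega>))
      + (\<Sum>e\<in>F. ap (Y (Suc i) \<omega> ^ 1) e \<bullet> (if flag r i \<omega> then ap (exp_approx m (T r i \<omega>) - exp_approx m (- T r i \<omega>)) e else 0))
      + bennett_g C * (\<Sum>e\<in>F. ap (Y (Suc i) \<omega> ^ 2) e \<bullet> (if flag r i \<omega> then ap (cosh_approx m (T r i \<omega>)) e else 0))
      + 2 * bennett_g C * (\<Sum>e\<in>F. (norm (ap (Y (Suc i) \<omega>) e))\<^sup>2) + err j"
proof (cases "flag r i \<omega>")
  case True
  have "Suc i \<in> {1..n}" using i by auto
  then show ?thesis
    using tr_cosh_approx_add_le[of "T r i \<omega>" "real n * C" "Y (Suc i) \<omega>" C j] T_props[of i \<omega> r] norm_T[of i \<omega> r] i \<omega> True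
      yG[of "Suc i" \<omega>] y_adj[of "Suc i" \<omega>] norm_y[of "Suc i" \<omega>] C_pos
    by (simp add: m_def err_def flag_def)
next
  case False
  have "0 \<le> err j"
    using C_pos by (simp add: err_def)
  moreover have "0 \<le> 2 * bennett_g C * (\<Sum>e\<in>F. (norm (ap (Y (Suc i) \<omega>) e))\<^sup>2)"
    using bennett_g_nonneg[OF C_pos] by (simp add: sum_nonneg)
  moreover have "T r (Suc i) \<omega> = T r i \<omega>"
    by (simp only: stopped.simps flag_def[symmetric] False if_False add_0_right)
  ultimately show ?thesis
    using False by simp
qed

lemma integrable_norm_Y_sq:
  assumes i: "i \<in> {1..n}"
  shows "integrable M (\<lambda>\<omega>. (norm (ap (Y i \<omega>) v))\<^sup>2)"
proof (rule integrable_bdd)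
  show "(\<lambda>\<omega>. (norm (ap (Y i \<omega>) v))\<^sup>2) \<in> borel_measurable M"
    using strong_measD[OF strong_meas_Y[OF i], of v] by measurable
  fix \<omega> assume "\<omega> \<in> space M"
  then show "norm ((norm (ap (Y i \<omega>) v))\<^sup>2) \<le> (C * norm v)\<^sup>2"
    using norm_ap_le[of "Y i \<omega>" v] mult_right_mono[OF norm_y[OF i], of \<omega> "norm v"]
    by (auto intro!: power_mono)
qed

text \<open>\<open>cosh_approx\<close> is a nonnegative combination of squares
  \<open>A ^ k * A ^ k\<close>, so its trace against the second moment of \<open>Y i\<close> is a
  combination of quadratic forms at the vectors \<open>A ^ k e\<close>, where \<open>var_y\<close>
  applies.\<close>

lemma expectation_quadratic_le:
  assumes i: "i \<in> {1..n}" and A: "A \<in> G" "adj A A"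
  shows "(\<Sum>e\<in>F. expectation (\<lambda>\<omega>. ap (Y i \<omega> ^ 2) e) \<bullet> ap (cosh_approx (2 * h) A) e) \<le> s i * tr (cosh_approx (2 * h) A)"
proof -
  have int: "integrable M (\<lambda>\<omega>. ap (Y i \<omega> ^ 2) e)" for e
  proof (rule integrable_bdd)
    show "(\<lambda>\<omega>. ap (Y i \<omega> ^ 2) e) \<in> borel_measurable M"
      by (intro strong_measD strong_meas_power strong_meas_Y i)
    fix \<omega> assume "\<omega> \<in> space M"
    then have "norm (Y i \<omega> ^ 2) \<le> C ^ 2"
      using norm_power_bop_le[of "Y i \<omega>" 2] power_mono[OF norm_y[OF i] norm_ge_zero, of \<omega> 2] by linarith
    then show "norm (ap (Y i \<omega> ^ 2) e) \<le> C ^ 2 * norm e"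
      using norm_ap_le[of "Y i \<omega> ^ 2" e] mult_right_mono[of _ _ "norm e"] order_trans by (metis norm_ge_zero)
  qed
  have "(\<Sum>e\<in>F. expectation (\<lambda>\<omega>. ap (Y i \<omega> ^ 2) e) \<bullet> ap (cosh_approx (2 * h) A) e) =
      expectation (\<lambda>\<omega>. \<Sum>e\<in>F. ap (Y i \<omega> ^ 2) e \<bullet> ap (cosh_approx (2 * h) A) e)"
    using int by simp
  also have "\<dots> = expectation (\<lambda>\<omega>. \<Sum>k=1..h. 2 * exp_coeff (2 * h) (2 * k) * (\<Sum>e\<in>F. (norm (ap (Y i \<omega>) (ap (A ^ k) e)))\<^sup>2))"
  proof (rule Bochner_Integration.integral_cong)
    fix \<omega> assume \<omega>: "\<omega> \<in> space M"
    show "(\<Sum>e\<in>F. ap (Y i \<omega> ^ 2) e \<bullet> ap (cosh_approx (2 * h) A) e) =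
        (\<Sum>k=1..h. 2 * exp_coeff (2 * h) (2 * k) * (\<Sum>e\<in>F. (norm (ap (Y i \<omega>) (ap (A ^ k) e)))\<^sup>2))"
      using tr_cosh_approx_sq[OF A yG[OF i \<omega>] y_adj[OF i \<omega>], of h] tr_adj[OF adj_cosh_approx[OF A(2)], of "2 * h" "Y i \<omega> ^ 2"]
      by simp
  qed simp
  also have "\<dots> = (\<Sum>k=1..h. 2 * exp_coeff (2 * h) (2 * k) * (\<Sum>e\<in>F. expectation (\<lambda>\<omega>. (norm (ap (Y i \<omega>) (ap (A ^ k) e)))\<^sup>2)))"
    using integrable_norm_Y_sq[OF i] by simp
  also have "\<dots> \<le> (\<Sum>k=1..h. 2 * exp_coeff (2 * h) (2 * k) * (\<Sum>e\<in>F. s i * (norm (ap (A ^ k) e))\<^sup>2))"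
    by (intro sum_mono mult_left_mono var_y i) (simp add: exp_coeff_nonneg)
  also have "\<dots> = s i * tr (cosh_approx (2 * h) A)"
    unfolding tr_cosh_approx tr_even_power[OF A(2)] by (simp add: sum_distrib_left mult_ac)
  finally show ?thesis .
qed

lemma integrable_tr_cosh_approx: "i \<le> n \<Longrightarrow> integrable M (\<lambda>\<omega>. tr (cosh_approx m (T r i \<omega>)))"
proof (rule integrable_bdd)
  assume i: "i \<le> n"
  show "(\<lambda>\<omega>. tr (cosh_approx m (T r i \<omega>))) \<in> borel_measurable M"
    unfolding tr_def
    by (intro borel_measurable_sum borel_measurable_inner borel_measurable_const strong_measD strong_meas_cosh_approx strong_meas_T i)
  fix \<omega> assume "\<omega> \<in> space M"
  then show "norm (tr (cosh_approx m (T r i \<omega>))) \<le> real (card F) * (2 * (1 + real n * C / real m) ^ m + 2)"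
    unfolding real_norm_def
    by (intro order_trans[OF abs_tr_le] mult_left_mono norm_cosh_approx_le norm_T i) auto
qed

lemma expectation_step:
  fixes j :: nat and r :: real
  defines "a \<equiv> \<lambda>i. expectation (\<lambda>\<omega>. tr (cosh_approx (2 ^ Suc j) (T r i \<omega>)))"
  assumes i: "Suc i \<le> n"
  shows "a (Suc i) \<le> (1 + bennett_g C * s (Suc i)) * a i + 2 * bennett_g C * (\<kappa> * s (Suc i)) + err j"
proof -
  define m where "m = (2::nat) ^ Suc j"
  have i': "Suc i \<in> {1..n}" "i \<le> n" using i by auto
  define U where "U k e \<omega> = ap (Y (Suc i) \<omega> ^ k) e" for k e \<omega>
  \<comment> \<open>The factors that depend on the past, set to zero once the sum is frozen; this is
    how stopping enters the one-step bound.\<close>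
  define V1 where "V1 e \<omega> = (if flag r i \<omega> then ap (exp_approx m (T r i \<omega>) - exp_approx m (- T r i \<omega>)) e else 0)" for e \<omega>
  define V2 where "V2 e \<omega> = (if flag r i \<omega> then ap (cosh_approx m (T r i \<omega>)) e else 0)" for e \<omega>
  define b where "b = (1 + real n * C / real m) ^ m"
  have b0: "0 \<le> b" using C_pos by (simp add: b_def)
  have bU: "norm (U k e \<omega>) \<le> C ^ k * norm e" if "\<omega> \<in> space M" for k e \<omega>
  proof -
    have "norm (Y (Suc i) \<omega> ^ k) \<le> C ^ k"
      using norm_power_bop_le[of "Y (Suc i) \<omega>" k] power_mono[OF norm_y[OF i'(1) that] norm_ge_zero, of k] by linarith
    then show ?thesis
      unfolding U_def using norm_ap_le order_trans mult_right_mono norm_ge_zero by metis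
  qed
  have bV: "norm (V1 e \<omega>) \<le> (b + b) * norm e" "norm (V2 e \<omega>) \<le> (2 * b + 2) * norm e"
    if "\<omega> \<in> space M" for e \<omega>
  proof -
    note nT = norm_T[OF i'(2) that, of r]
    have "norm (exp_approx m (T r i \<omega>) - exp_approx m (- T r i \<omega>)) \<le> b + b"
      unfolding b_def using nT by (intro order_trans[OF norm_triangle_ineq4] add_mono norm_exp_approx_le) auto
    then show "norm (V1 e \<omega>) \<le> (b + b) * norm e"
      unfolding V1_def using b0 norm_ap_le[of "exp_approx m (T r i \<omega>) - exp_approx m (- T r i \<omega>)" e]
        mult_right_mono[of "norm (exp_approx m (T r i \<omega>) - exp_approx m (- T r i \<omega>))" "b + b" "norm e"]
      by (auto simp del: ap_simps)
    show "norm (V2 e \<omega>) \<le> (2 * b + 2) * norm e"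
      unfolding V2_def using b0 norm_ap_le[of "cosh_approx m (T r i \<omega>)" e]
        mult_right_mono[OF norm_cosh_approx_le[OF nT, of m], of "norm e"]
      by (auto simp: b_def)
  qed
  have ind: "indep_var borel (U k e) borel (V1 e)" "indep_var borel (U k e) borel (V2 e)" for k e
    unfolding U_def V1_def V2_def
    by (intro past_indep[OF i] strong_meas_diff strong_meas_exp_approx strong_meas_uminus strong_meas_cosh_approx; assumption)+
  have mU: "U k e \<in> borel_measurable M" and mV1: "V1 e \<in> borel_measurable M" and mV2: "V2 e \<in> borel_measurable M" for k e
    using indep_var_rv1[OF ind(1)] indep_var_rv2[OF ind(1)] indep_var_rv2[OF ind(2)] by auto
  have iU: "integrable M (U k e)" and iV1: "integrable M (V1 e)" and iV2: "integrable M (V2 e)" for k e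
    by (rule integrable_bdd[OF mU bU]; assumption)
       (rule integrable_bdd[OF mV1 bV(1)] integrable_bdd[OF mV2 bV(2)]; assumption)+
  have iUV: "integrable M (\<lambda>\<omega>. U k e \<omega> \<bullet> V \<omega>)" if V: "V \<in> borel_measurable M" "\<And>\<omega>. \<omega> \<in> space M \<Longrightarrow> norm (V \<omega>) \<le> d" for V k e d
  proof (rule integrable_bdd)
    show "(\<lambda>\<omega>. U k e \<omega> \<bullet> V \<omega>) \<in> borel_measurable M"
      using mU V(1) by measurable
    fix \<omega> assume \<omega>: "\<omega> \<in> space M"
    have "\<bar>U k e \<omega> \<bullet> V \<omega>\<bar> \<le> norm (U k e \<omega>) * norm (V \<omega>)"
      by (rule Cauchy_Schwarz_ineq2)
    also have "\<dots> \<le> (C ^ k * norm e) * d"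
      using C_pos by (intro mult_mono bU V \<omega>) auto
    finally show "norm (U k e \<omega> \<bullet> V \<omega>) \<le> (C ^ k * norm e) * d" by simp
  qed
  note int [simp] = iUV[OF mV1 bV(1)] iUV[OF mV2 bV(2)] integrable_tr_cosh_approx[OF i'(2)] integrable_tr_cosh_approx[OF i]
    integrable_norm_Y_sq[OF i'(1)]
  have "a (Suc i) \<le> expectation (\<lambda>\<omega>. tr (cosh_approx m (T r i \<omega>)) + (\<Sum>e\<in>F. U 1 e \<omega> \<bullet> V1 e \<omega>)
      + bennett_g C * (\<Sum>e\<in>F. U 2 e \<omega> \<bullet> V2 e \<omega>)
      + 2 * bennett_g C * (\<Sum>e\<in>F. (norm (ap (Y (Suc i) \<omega>) e))\<^sup>2) + err j)"
    unfolding a_def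
  proof (rule expectation_mono_bdd)
    fix \<omega> assume "\<omega> \<in> space M"
    from tr_cosh_approx_step[OF i this, of j r]
    show "tr (cosh_approx (2 ^ Suc j) (T r (Suc i) \<omega>)) \<le> tr (cosh_approx m (T r i \<omega>)) + (\<Sum>e\<in>F. U 1 e \<omega> \<bullet> V1 e \<omega>)
      + bennett_g C * (\<Sum>e\<in>F. U 2 e \<omega> \<bullet> V2 e \<omega>)
      + 2 * bennett_g C * (\<Sum>e\<in>F. (norm (ap (Y (Suc i) \<omega>) e))\<^sup>2) + err j"
      unfolding U_def V1_def V2_def m_def .
  qed (rule int, simp)
  also have "\<dots> = a i + (\<Sum>e\<in>F. expectation (\<lambda>\<omega>. U 1 e \<omega> \<bullet> V1 e \<omega>))
      + bennett_g C * (\<Sum>e\<in>F. expectation (\<lambda>\<omega>. U 2 e \<omega> \<bullet> V2 e \<omega>))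
      + 2 * bennett_g C * expectation (\<lambda>\<omega>. \<Sum>e\<in>F. (norm (ap (Y (Suc i) \<omega>) e))\<^sup>2) + err j"
    by (simp add: a_def m_def prob_space)
  finally have deviation_bound: "a (Suc i) \<le> a i + (\<Sum>e\<in>F. expectation (\<lambda>\<omega>. U 1 e \<omega> \<bullet> V1 e \<omega>))
      + bennett_g C * (\<Sum>e\<in>F. expectation (\<lambda>\<omega>. U 2 e \<omega> \<bullet> V2 e \<omega>))
      + 2 * bennett_g C * expectation (\<lambda>\<omega>. \<Sum>e\<in>F. (norm (ap (Y (Suc i) \<omega>) e))\<^sup>2) + err j" .
  have 1: "(\<Sum>e\<in>F. expectation (\<lambda>\<omega>. U 1 e \<omega> \<bullet> V1 e \<omega>)) = 0"
  proof (rule sum.neutral, rule ballI)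
    fix e
    have "expectation (\<lambda>\<omega>. U 1 e \<omega> \<bullet> V1 e \<omega>) = expectation (U 1 e) \<bullet> expectation (V1 e)"
      by (rule indep_var_inner[OF ind(1) bU bV(1)])
    moreover have "expectation (U 1 e) = 0"
      using mean_y[OF i'(1), of e] by (simp add: U_def[abs_def])
    ultimately show "expectation (\<lambda>\<omega>. U 1 e \<omega> \<bullet> V1 e \<omega>) = 0"
      by simp
  qed
  have 2: "(\<Sum>e\<in>F. expectation (\<lambda>\<omega>. U 2 e \<omega> \<bullet> V2 e \<omega>)) \<le> s (Suc i) * a i"
  proof -
    have "(\<Sum>e\<in>F. expectation (\<lambda>\<omega>. U 2 e \<omega> \<bullet> V2 e \<omega>)) = (\<Sum>e\<in>F. expectation (U 2 e) \<bullet> expectation (V2 e))"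
      by (intro sum.cong refl indep_var_inner[OF ind(2) bU bV(2)])
    also have "\<dots> = expectation (\<lambda>\<omega>. \<Sum>e\<in>F. expectation (U 2 e) \<bullet> V2 e \<omega>)"
      using iV2 by simp
    also have "\<dots> \<le> expectation (\<lambda>\<omega>. s (Suc i) * tr (cosh_approx m (T r i \<omega>)))"
    proof (rule expectation_mono_bdd)
      fix \<omega> assume \<omega>: "\<omega> \<in> space M"
      have m: "m = 2 * 2 ^ j" by (simp add: m_def)
      have T: "T r i \<omega> \<in> G" "adj (T r i \<omega>) (T r i \<omega>)"
        using T_props[OF i'(2) \<omega>] by auto
      show "(\<Sum>e\<in>F. expectation (U 2 e) \<bullet> V2 e \<omega>) \<le> s (Suc i) * tr (cosh_approx m (T r i \<omega>))"
      proof (cases "flag r i \<omega>")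
        case True
        then show ?thesis
          using expectation_quadratic_le[OF i'(1) T, of "2 ^ j"] by (simp add: U_def[abs_def] V2_def m)
      next
        \<comment> \<open>After the first passage the left side is zero, while the trace on the
          right stays nonnegative.\<close>
        case False
        then show ?thesis
          using s_nonneg[OF i'(1)] tr_cosh_approx_nonneg[OF T(2), of "2 ^ j"] by (simp add: V2_def m)
      qed
    qed (use iV2 in simp_all)
    also have "\<dots> = s (Suc i) * a i"
      by (simp add: a_def m_def)
    finally show ?thesis .
  qed
  have g: "0 \<le> bennett_g C"
    by (rule bennett_g_nonneg[OF C_pos])
  have "2 * bennett_g C * expectation (\<lambda>\<omega>. \<Sum>e\<in>F. (norm (ap (Y (Suc i) \<omega>) e))\<^sup>2) \<le> 2 * bennett_g C * (\<kappa> * s (Suc i))"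
    using g by (intro mult_left_mono HS_y[OF i'(1)]) auto
  moreover have "bennett_g C * (\<Sum>e\<in>F. expectation (\<lambda>\<omega>. U 2 e \<omega> \<bullet> V2 e \<omega>)) \<le> bennett_g C * (s (Suc i) * a i)"
    by (intro mult_left_mono 2 g)
  ultimately show ?thesis
    using deviation_bound 1 by (simp add: distrib_right)
qed

text \<open>Adding \<open>2 * \<kappa>\<close> absorbs the inhomogeneous term of the recursion,
  which then grows by the factor \<open>1 + g s \<le> exp (g s)\<close> at each step. The starting
  value is \<open>2 * \<kappa>\<close> because \<open>cosh_approx\<close> vanishes at zero.\<close>

lemma expectation_tr_cosh_approx_le:
  assumes "i \<le> n"
  shows "expectation (\<lambda>\<omega>. tr (cosh_approx (2 ^ Suc j) (T r i \<omega>))) + 2 * \<kappa>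
           \<le> (2 * \<kappa> + real i * err j) * exp (bennett_g C * (\<Sum>k=1..i. s k))"
  using assms
proof (induction i)
  case 0
  then show ?case by (simp add: tr_simps)
next
  case (Suc i)
  let ?a = "\<lambda>i. expectation (\<lambda>\<omega>. tr (cosh_approx (2 ^ Suc j) (T r i \<omega>)))"
  have g: "0 \<le> bennett_g C * s (Suc i)"
    using bennett_g_nonneg[OF C_pos] s_nonneg[of "Suc i"] Suc.prems by simp
  have e0: "0 \<le> err j" using C_pos by (simp add: err_def)
  have gs: "0 \<le> bennett_g C * (\<Sum>k=1..i. s k)"
    using bennett_g_nonneg[OF C_pos] s_nonneg Suc.prems by (intro mult_nonneg_nonneg sum_nonneg) auto
  have "?a (Suc i) + 2 * \<kappa> \<le> (1 + bennett_g C * s (Suc i)) * (?a i + 2 * \<kappa>) + err j"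
    using expectation_step[OF Suc.prems, of j r] by (simp add: algebra_simps)
  also have "\<dots> \<le> (1 + bennett_g C * s (Suc i)) * ((2 * \<kappa> + real i * err j) * exp (bennett_g C * (\<Sum>k=1..i. s k))) + err j"
    using Suc g by (intro add_right_mono mult_left_mono) auto
  also have "\<dots> \<le> exp (bennett_g C * s (Suc i)) * ((2 * \<kappa> + real i * err j) * exp (bennett_g C * (\<Sum>k=1..i. s k)))
      + err j * (exp (bennett_g C * s (Suc i)) * exp (bennett_g C * (\<Sum>k=1..i. s k)))"
  proof (intro add_mono mult_right_mono)
    show "err j \<le> err j * (exp (bennett_g C * s (Suc i)) * exp (bennett_g C * (\<Sum>k=1..i. s k)))"
      using e0 g gs by (simp add: mult_le_cancel_left1 flip: exp_add)
  qed (use e0 \<kappa>_nonneg exp_ge_add_one_self in auto)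
  also have "\<dots> = (2 * \<kappa> + real (Suc i) * err j) * exp (bennett_g C * (\<Sum>k=1..Suc i. s k))"
    by (simp add: exp_add algebra_simps)
  finally show ?case .
qed

theorem tail_bound:
  assumes r: "0 < r"
  shows "prob {\<omega> \<in> space M. \<exists>i\<in>{1..n}. r \<le> norm (\<Sum>l=1..i. Y l \<omega>)} * (exp r + exp (- r) - 2)
           \<le> 2 * \<kappa> * (exp (bennett_g C * (\<Sum>k=1..n. s k)) - 1)"
proof -
  define B where "B = {\<omega> \<in> space M. \<exists>i\<in>{1..n}. r \<le> norm (\<Sum>l=1..i. Y l \<omega>)}"
  define q where "q = exp (bennett_g C * (\<Sum>k=1..n. s k))"
  have B: "B \<in> sets M"
    unfolding B_def
  proof (rule sets.sets_Collect_finite_Ex)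
    fix i assume i: "i \<in> {1..n}"
    have "(\<lambda>\<omega>. norm (\<Sum>l=1..i. Y l \<omega>)) \<in> borel_measurable M"
      using i by (intro strong_meas_norm strong_meas_sum strong_meas_Y) auto
    then show "{\<omega> \<in> space M. r \<le> norm (\<Sum>l=1..i. Y l \<omega>)} \<in> sets M"
      by (rule borel_measurable_le[rotated]) (rule borel_measurable_const)
  qed simp
  have *: "prob B * cosh_approx (2 ^ Suc j) r \<le> (2 * \<kappa> + real n * err j) * q - 2 * \<kappa>" for j
  proof -
    have "prob B * cosh_approx (2 ^ Suc j) r = expectation (\<lambda>\<omega>. indicator B \<omega> * cosh_approx (2 ^ Suc j) r)"
      using B by simp
    also have "\<dots> \<le> expectation (\<lambda>\<omega>. tr (cosh_approx (2 ^ Suc j) (T r n \<omega>)))"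
    proof (rule expectation_mono_bdd)
      fix \<omega> assume \<omega>: "\<omega> \<in> space M"
      note T = T_props[OF order_refl \<omega>, of r]
      show "indicator B \<omega> * cosh_approx (2 ^ Suc j) r \<le> tr (cosh_approx (2 ^ Suc j) (T r n \<omega>))"
      proof (cases "\<omega> \<in> B")
        case True
        then obtain i where "i \<in> {1..n}" "r \<le> norm (\<Sum>l=1..i. Y l \<omega>)"
          by (auto simp: B_def)
        then have "r \<le> norm (T r n \<omega>)"
          by (intro stopped_norm_ge) auto
        then have "cosh_approx (2 * 2 ^ j) r \<le> cosh_approx (2 * 2 ^ j) (norm (T r n \<omega>))"
          using r by (intro cosh_approx_real_mono) auto
        also have "\<dots> \<le> tr (cosh_approx (2 * 2 ^ j) (T r n \<omega>))"
          using T by (intro tr_cosh_approx_ge) auto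
        finally show ?thesis
          using True by simp
      next
        case False
        then show ?thesis
          using tr_cosh_approx_nonneg[of "T r n \<omega>" "2 ^ j"] T by simp
      qed
    qed (use B in \<open>auto intro!: integrable_tr_cosh_approx integrable_real_mult_indicator simp: less_top[symmetric]\<close>)
    also have "\<dots> \<le> (2 * \<kappa> + real n * err j) * q - 2 * \<kappa>"
      using expectation_tr_cosh_approx_le[OF order_refl, of j r] by (simp add: q_def)
    finally show ?thesis .
  qed
  have "(\<lambda>j. err j) \<longlonglongrightarrow> 0"
  proof -
    have "(\<lambda>j. 2 * (real (card F) * (real n * C * C * exp (real n * C + C)) * (1 / 2) ^ Suc j)) \<longlonglongrightarrow> 2 * (real (card F) * (real n * C * C * exp (real n * C + C)) * 0)"
      by (intro tendsto_intros LIMSEQ_Suc LIMSEQ_power_zero) simp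
    then show ?thesis
      by (simp add: err_def power_divide)
  qed
  then have 1: "(\<lambda>j. (2 * \<kappa> + real n * err j) * q - 2 * \<kappa>) \<longlonglongrightarrow> (2 * \<kappa> + real n * 0) * q - 2 * \<kappa>"
    by (intro tendsto_intros)
  have 2: "(\<lambda>j. prob B * cosh_approx (2 ^ Suc j) r) \<longlonglongrightarrow> prob B * (exp r + exp (- r) - 2)"
    by (intro tendsto_intros cosh_approx_real_tendsto)
  have "prob B * (exp r + exp (- r) - 2) \<le> (2 * \<kappa> + real n * 0) * q - 2 * \<kappa>"
    by (rule LIMSEQ_le[OF 2 1]) (use * in auto)
  then show ?thesis
    by (simp add: B_def q_def algebra_simps)
qed

end

section \<open>Scalar concentration\<close>

text \<open>The inequality \<open>(n + 2)! \<ge> 2 * 3 ^ n\<close> dominates the power series by a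
  geometric one; this is the origin of the thirds in all Bernstein terms.\<close>

lemma bennett_g_le: assumes "0 < x" "x < 3" shows "bennett_g x \<le> 1 / (2 * (1 - x / 3))"
proof -
  have e: "exp x = 1 + x + (\<Sum>n. inverse (fact (n + 2)) *\<^sub>R (x ^ (n + 2)))"
    by (rule exp_first_two_terms)
  have f: "2 * (3::real) ^ n \<le> fact (n + 2)" for n
  proof (induction n)
    case (Suc n)
    have "2 * (3::real) ^ Suc n = 3 * (2 * 3 ^ n)" by simp
    also have "\<dots> \<le> 3 * fact (n + 2)" by (intro mult_left_mono Suc) simp
    also have "\<dots> \<le> real (Suc (n + 2)) * fact (n + 2)" by (intro mult_right_mono) auto
    also have "\<dots> = fact (Suc n + 2)" by (simp only: add_Suc fact_Suc)
    finally show ?case .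
  qed (simp add: numeral_2_eq_2)
  have geo: "(\<lambda>n. x\<^sup>2 / 2 * (x / 3) ^ n) sums (x\<^sup>2 / 2 * (1 / (1 - x / 3)))"
    using assms by (intro sums_mult geometric_sums) auto
  have "(\<Sum>n. inverse (fact (n + 2)) *\<^sub>R (x ^ (n + 2))) \<le> (\<Sum>n. x\<^sup>2 / 2 * (x / 3) ^ n)"
  proof (rule suminf_le)
    show "summable (\<lambda>n. inverse (fact (n + 2)) *\<^sub>R (x ^ (n + 2)))"
      using summable_exp_generic[of x] by (subst summable_iff_shift[where k = 2]) 
    show "summable (\<lambda>n. x\<^sup>2 / 2 * (x / 3) ^ n)"
      using geo by (rule sums_summable)
    fix n
    have "inverse (fact (n + 2)) \<le> inverse (2 * (3::real) ^ n)"
      by (rule le_imp_inverse_le[OF f]) simp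
    then have "inverse (fact (n + 2)) * x ^ (n + 2) \<le> inverse (2 * 3 ^ n) * x ^ (n + 2)"
      using assms by (intro mult_right_mono) auto
    also have "\<dots> = x\<^sup>2 / 2 * (x / 3) ^ n"
      by (simp add: power_add power2_eq_square field_simps)
    finally show "inverse (fact (n + 2)) *\<^sub>R (x ^ (n + 2)) \<le> x\<^sup>2 / 2 * (x / 3) ^ n"
      by simp
  qed
  also have "\<dots> = x\<^sup>2 / 2 * (1 / (1 - x / 3))"
    using geo by (rule sums_unique[symmetric])
  finally have "exp x - 1 - x \<le> x\<^sup>2 * (1 / (2 * (1 - x / 3)))"
    using e by simp
  then show ?thesis
    using assms by (simp add: bennett_g_def divide_le_eq mult.commute)
qed

text \<open>The scalar counterpart of \<open>exp_approx_quadratic_le\<close>: a term by term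
  comparison of the Taylor series from degree two on.\<close>

lemma exp_le_quadratic:
  assumes "\<bar>x\<bar> \<le> C" "0 < C" shows "exp x \<le> 1 + x + bennett_g C * x\<^sup>2"
proof -
  have sm: "summable (\<lambda>n. inverse (fact (n + 2)) *\<^sub>R (y ^ (n + 2)))" for y :: real
    using summable_exp_generic[of y] by (subst summable_iff_shift[where k = 2])
  have gC: "bennett_g C = (\<Sum>n. inverse (fact (n + 2)) * C ^ n)"
  proof -
    have "exp C - 1 - C = (\<Sum>n. C\<^sup>2 * (inverse (fact (n + 2)) * C ^ n))"
      using exp_first_two_terms[of C] by (simp add: power_add power2_eq_square mult_ac)
    also have "\<dots> = C\<^sup>2 * (\<Sum>n. inverse (fact (n + 2)) * C ^ n)"
    proof (rule suminf_mult)
      have "summable (\<lambda>n. inverse (C\<^sup>2) * (inverse (fact (n + 2)) *\<^sub>R (C ^ (n + 2))))"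
        by (intro summable_mult sm)
      then show "summable (\<lambda>n. inverse (fact (n + 2)) * C ^ n)"
        using assms by (simp add: power_add power2_eq_square field_simps)
    qed
    finally show ?thesis
      using assms by (simp add: bennett_g_def)
  qed
  have sC: "summable (\<lambda>n. inverse (fact (n + 2)) * C ^ n)"
  proof -
    have "summable (\<lambda>n. inverse (C\<^sup>2) * (inverse (fact (n + 2)) *\<^sub>R (C ^ (n + 2))))"
      by (intro summable_mult sm)
    then show ?thesis
      using assms by (simp add: power_add power2_eq_square field_simps)
  qed
  have "exp x - 1 - x = (\<Sum>n. inverse (fact (n + 2)) *\<^sub>R (x ^ (n + 2)))"
    using exp_first_two_terms[of x] by simp
  also have "\<dots> \<le> (\<Sum>n. x\<^sup>2 * (inverse (fact (n + 2)) * C ^ n))"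
  proof (intro suminf_le sm summable_mult sC)
    fix n
    have "x ^ n \<le> \<bar>x\<bar> ^ n"
      by (simp add: power_abs[symmetric])
    also have "\<dots> \<le> C ^ n"
      using assms by (intro power_mono) auto
    finally have "x\<^sup>2 * inverse (fact (n + 2)) * x ^ n \<le> x\<^sup>2 * inverse (fact (n + 2)) * C ^ n"
      by (intro mult_left_mono) auto
    then show "inverse (fact (n + 2)) *\<^sub>R (x ^ (n + 2)) \<le> x\<^sup>2 * (inverse (fact (n + 2)) * C ^ n)"
      by (simp only: real_scaleR_def power_add mult_ac)
  qed
  also have "\<dots> = x\<^sup>2 * bennett_g C"
    unfolding gC by (intro suminf_mult sC)
  finally show ?thesis by (simp add: mult.commute)
qed

text \<open>Inversion of a sub-gamma bound in closed form. At
  \<open>\<theta> = q / (1 + q c)\<close> with \<open>q = sqrt (2 L / S)\<close> the exponent is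
  exactly \<open>- L\<close>.\<close>

lemma subgamma_tail:
  assumes S: "0 \<le> S" and c: "0 < c" and L: "0 < L" and k: "0 \<le> k"
    and p: "\<And>\<theta>. 0 < \<theta> \<Longrightarrow> \<theta> * c < 1 \<Longrightarrow> p \<le> k * exp (S * \<theta>\<^sup>2 / (2 * (1 - \<theta> * c)) - \<theta> * (sqrt (2 * S * L) + c * L))"
  shows "p \<le> k * exp (- L)"
proof (cases "S = 0")
  case True
  \<comment> \<open>Without variance the best exponent is approached only as \<open>\<theta>\<close>
    tends to the excluded endpoint \<open>1 / c\<close>.\<close>
  have "((\<lambda>\<theta>. k * exp (- (\<theta> * (c * L)))) \<longlongrightarrow> k * exp (- (1 / c * (c * L)))) (at_left (1 / c))"
    by (intro tendsto_intros)
  moreover have "eventually (\<lambda>\<theta>. p \<le> k * exp (- (\<theta> * (c * L)))) (at_left (1 / c))"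
    using eventually_at_left_real[of 0 "1 / c"] c
    by (auto elim!: eventually_mono dest!: p simp: True field_simps)
  ultimately have "p \<le> k * exp (- (1 / c * (c * L)))"
    by (intro tendsto_lowerbound[where F = "at_left (1 / c)"]) auto
  then show ?thesis using c by simp
next
  case False
  then have S0: "0 < S" using S by simp
  define q where "q = sqrt (2 * L / S)"
  have q: "0 < q" "q\<^sup>2 = 2 * L / S" using S0 L by (auto simp: q_def)
  have q': "S * q\<^sup>2 = 2 * L" using S0 q by simp
  have sq: "sqrt (2 * S * L) = S * q"
  proof (rule real_sqrt_unique)
    have "(S * q)\<^sup>2 = S * (S * q\<^sup>2)" by (simp add: power2_eq_square)
    then show "(S * q)\<^sup>2 = 2 * S * L" unfolding q' by simp
  qed (use S0 q in simp)
  define D where "D = 1 + q * c"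
  define \<theta> where "\<theta> = q / D"
  have d: "0 < D" using q c by (simp add: D_def add_pos_pos)
  have qc: "q * c = D - 1" by (simp add: D_def)
  have th: "0 < \<theta>" "\<theta> * c < 1" "1 - \<theta> * c = 1 / D"
    using q d qc by (auto simp: \<theta>_def field_simps)
  have "S * \<theta>\<^sup>2 / (2 * (1 - \<theta> * c)) = S * q\<^sup>2 / (2 * D)"
    unfolding th(3) using d by (simp add: \<theta>_def power_divide power2_eq_square field_simps)
  also have "\<dots> = L / D" unfolding q' by simp
  finally have 1: "S * \<theta>\<^sup>2 / (2 * (1 - \<theta> * c)) = L / D" .
  have "\<theta> * (sqrt (2 * S * L) + c * L) = (S * q\<^sup>2 + q * c * L) / D"
    unfolding sq using d by (simp add: \<theta>_def power2_eq_square field_simps)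
  also have "\<dots> = (L + L * D) / D"
    unfolding q' qc by (simp add: algebra_simps)
  also have "\<dots> = L / D + L"
    using d by (simp add: add_divide_distrib)
  finally have 2: "\<theta> * (sqrt (2 * S * L) + c * L) = L / D + L" .
  show ?thesis
    using p[OF th(1,2)] unfolding 1 2 by simp
qed

section \<open>Averages over permutations and partitions into small blocks\<close>

lemma sum_pairs_ordered:
  fixes f :: "nat \<Rightarrow> nat \<Rightarrow> real"
  assumes "\<And>i. f i i = 0" "\<And>i j. f i j = f j i"
  shows "(\<Sum>i=1..m. \<Sum>j=1..m. f i j) = 2 * (\<Sum>j=1..m. \<Sum>i\<in>{1..<j}. f i j)"
proof (induction m)
  case (Suc m)
  have "(\<Sum>i=1..m. f i (Suc m)) = (\<Sum>i=1..m. f (Suc m) i)"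
    by (rule sum.cong[OF refl]) (rule assms(2))
  moreover have "{1..<Suc m} = {1..m}" by auto
  ultimately show ?case
    using Suc assms(1)[of "Suc m"] by (simp add: sum.distrib)
qed simp

text \<open>The symmetric group is doubly transitive, so the sum over permutations is the same for
  every pair of distinct positions. Summing over all positions instead gives the full double sum for
  each single permutation.\<close>

lemma sum_over_permutations_pairs:
  fixes f :: "nat \<Rightarrow> nat \<Rightarrow> real"
  assumes f0: "\<And>i. f i i = 0" and A: "finite A" and ij: "i \<in> A" "j \<in> A" "i \<noteq> j"
  shows "(real (card A) * (real (card A) - 1)) * (\<Sum>\<pi> | \<pi> permutes A. f (\<pi> i) (\<pi> j))
           = real (card {\<pi>. \<pi> permutes A}) * (\<Sum>a\<in>A. \<Sum>b\<in>A. f a b)"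
proof -
  define t where "t i j = (\<Sum>\<pi> | \<pi> permutes A. f (\<pi> i) (\<pi> j))" for i j
  have t_perm: "t (\<sigma> i) (\<sigma> j) = t i j" if "\<sigma> permutes A" for \<sigma> i j
    unfolding t_def by (subst (2) sum_permutations_compose_right[OF that]) simp
  have t_const: "t k l = t i j" if "k \<in> A" "l \<in> A" "k \<noteq> l" for k l
  proof -
    \<comment> \<open>The first transposition carries \<open>i\<close> to \<open>k\<close>; the
      second carries the image of \<open>j\<close> to \<open>l\<close> and fixes
      \<open>k\<close>.\<close>
    define \<sigma>1 where "\<sigma>1 = Transposition.transpose i k"
    define \<sigma>2 where "\<sigma>2 = Transposition.transpose (\<sigma>1 j) l"
    have s1: "\<sigma>1 permutes A" unfolding \<sigma>1_def using ij that by (intro permutes_swap_id)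
    have jA: "\<sigma>1 j \<in> A" using s1 ij by (simp add: permutes_in_image)
    have s2: "\<sigma>2 permutes A" unfolding \<sigma>2_def using jA that by (intro permutes_swap_id)
    have "\<sigma>1 i = k" by (simp add: \<sigma>1_def)
    moreover have "\<sigma>1 j \<noteq> k" using ij by (metis \<open>\<sigma>1 i = k\<close> s1 permutes_inj injD)
    then have "\<sigma>2 k = k" using that by (simp add: \<sigma>2_def Transposition.transpose_def)
    moreover have "\<sigma>2 (\<sigma>1 j) = l" by (simp add: \<sigma>2_def)
    ultimately have "t k l = t (\<sigma>2 (\<sigma>1 i)) (\<sigma>2 (\<sigma>1 j))" by simp
    then show ?thesis by (simp only: t_perm[OF s2] t_perm[OF s1])
  qed
  have "(\<Sum>k\<in>A. \<Sum>l\<in>A. t k l) = (\<Sum>k\<in>A. \<Sum>l\<in>A. if l = k then 0 else t i j)"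
    by (intro sum.cong) (auto simp: t_def f0 intro: t_const[unfolded t_def])
  also have "\<dots> = (\<Sum>k\<in>A. (real (card A) - 1) * t i j)"
  proof (rule sum.cong[OF refl])
    fix k assume k: "k \<in> A"
    have "(\<Sum>l\<in>A. if l = k then 0 else t i j) = (\<Sum>l\<in>A - {k}. t i j)"
      using A by (intro sum.mono_neutral_cong_right) auto
    also have "\<dots> = (real (card A) - 1) * t i j"
    proof -
      have "1 \<le> card A" using A k by (metis card_gt_0_iff empty_iff Suc_leI One_nat_def)
      then show ?thesis using A k by (simp add: of_nat_diff)
    qed
    finally show "(\<Sum>l\<in>A. if l = k then 0 else t i j) = (real (card A) - 1) * t i j" .
  qed
  finally have 1: "(\<Sum>k\<in>A. \<Sum>l\<in>A. t k l) = real (card A) * ((real (card A) - 1) * t i j)"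
    by simp
  have "(\<Sum>k\<in>A. \<Sum>l\<in>A. t k l) = (\<Sum>\<pi> | \<pi> permutes A. \<Sum>k\<in>A. \<Sum>l\<in>A. f (\<pi> k) (\<pi> l))"
    unfolding t_def by (subst sum.swap, subst sum.swap) (simp add: sum.swap[of _ A "{\<pi>. \<pi> permutes A}"])
  also have "\<dots> = (\<Sum>\<pi> | \<pi> permutes A. \<Sum>a\<in>A. \<Sum>b\<in>A. f a b)"
  proof (rule sum.cong[OF refl])
    fix \<pi> assume "\<pi> \<in> {\<pi>. \<pi> permutes A}"
    then have \<pi>: "\<pi> permutes A" by simp
    have "(\<Sum>k\<in>A. \<Sum>l\<in>A. f (\<pi> k) (\<pi> l)) = (\<Sum>k\<in>A. \<Sum>b\<in>A. f (\<pi> k) b)"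
      using sum.permute[OF \<pi>, of "f (\<pi> _)"] by (simp add: comp_def)
    also have "\<dots> = (\<Sum>a\<in>A. \<Sum>b\<in>A. f a b)"
      using sum.permute[OF \<pi>, of "\<lambda>a. \<Sum>b\<in>A. f a b"] by (simp add: comp_def)
    finally show "(\<Sum>k\<in>A. \<Sum>l\<in>A. f (\<pi> k) (\<pi> l)) = (\<Sum>a\<in>A. \<Sum>b\<in>A. f a b)" .
  qed
  finally show ?thesis
    using 1 by (simp add: t_def)
qed

text \<open>Pairs alone do not exhaust an odd index set; one block of three takes up the rest, and
  the bounds for block variances are the same for both sizes.\<close>

lemma partition_2_3:
  assumes "2 \<le> m"
  shows "\<exists>P. finite P \<and> \<Union>P = {1..m::nat} \<and> disjoint P \<and> (\<forall>J\<in>P. finite J \<and> (card J = 2 \<or> card J = 3))"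
  using assms
proof (induction m rule: less_induct)
  case (less m)
  consider "m = 2" | "m = 3" | "4 \<le> m" using less.prems by linarith
  then show ?case
  proof cases
    case 1
    then show ?thesis by (intro exI[of _ "{{1..2}}"]) (auto simp: disjoint_def)
  next
    case 2
    then show ?thesis by (intro exI[of _ "{{1..3}}"]) (auto simp: disjoint_def)
  next
    case 3
    then have "m - 2 < m" "2 \<le> m - 2" by linarith+
    from less.IH[OF this]
    obtain P where P: "finite P" "\<Union>P = {1..m - 2}" "disjoint P" "\<forall>J\<in>P. finite J \<and> (card J = 2 \<or> card J = 3)"
      by blast
    have "\<Union>(insert {m - 1, m} P) = {1..m}"
      using P(2) 3 by auto
    moreover have "disjoint (insert {m - 1, m} P)"
    proof -
      have "J \<inter> {m - 1, m} = {}" if "J \<in> P" for J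
      proof -
        have "J \<subseteq> {1..m - 2}" using that P(2) by blast
        then show ?thesis using 3 by fastforce
      qed
      then show ?thesis
        using P(3) by (auto simp: disjoint_def pairwise_insert disjnt_def Int_commute)
    qed
    ultimately show ?thesis
      using P 3 by (intro exI[of _ "insert {m - 1, m} P"]) auto
  qed
qed

text \<open>\<open>card J / 2\<close> times the unbiased sample variance of the block. In this
  normalization the expectation is at least half the sum of the variances, and values in
  \<open>[0, b]\<close> give at most \<open>b^2 / 2\<close>, for blocks of two and of three
  alike.\<close>

definition block_var :: "nat set \<Rightarrow> (nat \<Rightarrow> real) \<Rightarrow> real" where
  "block_var J z = (\<Sum>i\<in>J. \<Sum>j\<in>J. (z i - z j)\<^sup>2) / (4 * (real (card J) - 1))"

lemma block_var_nonneg: "card J = 2 \<or> card J = 3 \<Longrightarrow> 0 \<le> block_var J z"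
  by (auto simp: block_var_def intro!: divide_nonneg_nonneg sum_nonneg)

text \<open>For ordered points the squares of the two shorter distances add up to at most the square
  of the longest one.\<close>

lemma three_points_sq:
  fixes x y z b :: real
  assumes "0 \<le> x" "x \<le> b" "0 \<le> y" "y \<le> b" "0 \<le> z" "z \<le> b"
  shows "(x - y)\<^sup>2 + (y - z)\<^sup>2 + (x - z)\<^sup>2 \<le> 2 * b\<^sup>2"
proof -
  have *: "(x - y)\<^sup>2 + (y - z)\<^sup>2 + (x - z)\<^sup>2 \<le> 2 * b\<^sup>2"
    if "0 \<le> x" "x \<le> y" "y \<le> z" "z \<le> b" for x y z :: real
  proof -
    have "(x - z)\<^sup>2 \<le> b\<^sup>2" using that by (intro power2_le_iff_abs_le[THEN iffD2]) auto
    moreover have "0 \<le> (y - x) * (z - y)" using that by simp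
    then have "(x - y)\<^sup>2 + (y - z)\<^sup>2 \<le> (x - z)\<^sup>2"
      by (simp add: power2_eq_square algebra_simps)
    ultimately show ?thesis by linarith
  qed
  consider "x \<le> y \<and> y \<le> z" | "x \<le> z \<and> z \<le> y" | "y \<le> x \<and> x \<le> z" | "y \<le> z \<and> z \<le> x" | "z \<le> x \<and> x \<le> y" | "z \<le> y \<and> y \<le> x"
    by linarith
  then show ?thesis
    using assms *[of x y z] *[of x z y] *[of y x z] *[of y z x] *[of z x y] *[of z y x]
    by cases (simp_all add: power2_commute algebra_simps)
qed

lemma block_var_le:
  assumes J: "card J = 2 \<or> card J = 3" and z: "\<And>i. i \<in> J \<Longrightarrow> 0 \<le> z i \<and> z i \<le> b"
  shows "block_var J z \<le> b\<^sup>2 / 2"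
  using J
proof
  assume "card J = 2"
  then obtain i j where ij: "J = {i, j}" "i \<noteq> j" by (auto simp: card_2_iff)
  have "(z i - z j)\<^sup>2 \<le> b\<^sup>2"
    using z[of i] z[of j] ij by (intro power2_le_iff_abs_le[THEN iffD2]) auto
  then show ?thesis
    using ij by (simp add: block_var_def power2_commute[of "z j"])
next
  assume "card J = 3"
  then obtain i j k where ij: "J = {i, j, k}" "i \<noteq> j" "j \<noteq> k" "i \<noteq> k" by (auto simp: card_3_iff)
  have "(z i - z j)\<^sup>2 + (z j - z k)\<^sup>2 + (z i - z k)\<^sup>2 \<le> 2 * b\<^sup>2"
    using z ij by (intro three_points_sq) auto
  then show ?thesis
    using ij by (simp add: block_var_def power2_commute[of "z j" "z i"] power2_commute[of "z k"])
qed

text \<open>Turns a deviation of a standard deviation into a linear one of the variance, to which an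
  exponential moment can be applied.\<close>

lemma sqrt_diff_square_le:
  fixes v x s :: real
  assumes "0 \<le> x" "0 \<le> s" "sqrt x < sqrt v - s"
  shows "s \<le> sqrt v" "x \<le> v - s * sqrt v"
proof -
  have "0 \<le> sqrt x" using assms by simp
  then show s: "s \<le> sqrt v" using assms(3) by linarith
  have v: "0 \<le> v" using s assms(2) by (metis order_trans real_sqrt_ge_0_iff)
  have "x = (sqrt x)\<^sup>2" using assms by simp
  also have "\<dots> \<le> (sqrt v - s)\<^sup>2" using assms by (intro power_mono) auto
  also have "\<dots> = v - s * sqrt v - s * (sqrt v - s)"
    using v by (simp add: power2_diff) (simp add: power2_eq_square algebra_simps)
  also have "\<dots> \<le> v - s * sqrt v"
    using s assms(2) by simp
  finally show "x \<le> v - s * sqrt v" .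
qed

section \<open>Sample variance and the empirical Bernstein inequality\<close>

locale bounded_indep = prob_space M for M :: "'w measure" +
  fixes Z :: "nat \<Rightarrow> 'w \<Rightarrow> real" and m :: nat and b :: real
  assumes indepZ: "indep_vars (\<lambda>_. borel) Z {1..m}"
    and Z_bounds: "i \<in> {1..m} \<Longrightarrow> \<omega> \<in> space M \<Longrightarrow> 0 \<le> Z i \<omega> \<and> Z i \<omega> \<le> b"
    and b_pos: "0 < b" and m2: "2 \<le> m"
begin

abbreviation "EZ i \<equiv> expectation (Z i)"

definition var_Z where "var_Z i = expectation (\<lambda>\<omega>. (Z i \<omega> - EZ i)\<^sup>2)"

lemma measZ: "i \<in> {1..m} \<Longrightarrow> Z i \<in> borel_measurable M"
  using indepZ by (auto simp: indep_vars_def)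

lemma intZ: "i \<in> {1..m} \<Longrightarrow> integrable M (Z i)"
  by (rule integrable_bdd[OF measZ, of _ b]) (use Z_bounds in force)+

lemma EZ_bounds: "i \<in> {1..m} \<Longrightarrow> 0 \<le> EZ i \<and> EZ i \<le> b"
proof
  assume i: "i \<in> {1..m}"
  show "0 \<le> EZ i" using Z_bounds[OF i] by (intro integral_nonneg_AE AE_I2) auto
  have "EZ i \<le> expectation (\<lambda>_. b)"
    using Z_bounds[OF i] by (intro expectation_mono_bdd intZ i) auto
  then show "EZ i \<le> b" by (simp add: prob_space)
qed

lemma dev_bound: "i \<in> {1..m} \<Longrightarrow> \<omega> \<in> space M \<Longrightarrow> \<bar>EZ i - Z i \<omega>\<bar> \<le> b"
  using Z_bounds[of i \<omega>] EZ_bounds[of i] by (auto simp: abs_le_iff)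

lemma int_dev_sq: "i \<in> {1..m} \<Longrightarrow> integrable M (\<lambda>\<omega>. (EZ i - Z i \<omega>)\<^sup>2)"
proof (rule integrable_bdd)
  assume i: "i \<in> {1..m}"
  show "(\<lambda>\<omega>. (EZ i - Z i \<omega>)\<^sup>2) \<in> borel_measurable M"
    by (intro borel_measurable_power borel_measurable_diff borel_measurable_const measZ i)
  fix \<omega> assume "\<omega> \<in> space M"
  from dev_bound[OF i this] show "norm ((EZ i - Z i \<omega>)\<^sup>2) \<le> b\<^sup>2"
    by (simp add: power2_le_iff_abs_le[OF less_imp_le[OF b_pos]])
qed

lemma var_Z_nonneg: "0 \<le> var_Z i"
  unfolding var_Z_def by (intro integral_nonneg_AE AE_I2) auto

lemma mgf_dev:
  assumes i: "i \<in> {1..m}" and \<theta>: "0 < \<theta>"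
  shows "expectation (\<lambda>\<omega>. exp (\<theta> * (EZ i - Z i \<omega>))) \<le> exp (bennett_g (\<theta> * b) * \<theta>\<^sup>2 * var_Z i)"
    and "integrable M (\<lambda>\<omega>. exp (\<theta> * (EZ i - Z i \<omega>)))"
proof -
  show int: "integrable M (\<lambda>\<omega>. exp (\<theta> * (EZ i - Z i \<omega>)))"
  proof (rule integrable_bdd)
    show "(\<lambda>\<omega>. exp (\<theta> * (EZ i - Z i \<omega>))) \<in> borel_measurable M"
      by (intro measurable_compose[OF _ borel_measurable_exp] borel_measurable_times borel_measurable_diff borel_measurable_const measZ i)
    fix \<omega> assume "\<omega> \<in> space M"
    from dev_bound[OF i this] show "norm (exp (\<theta> * (EZ i - Z i \<omega>))) \<le> exp (\<theta> * b)"
      using \<theta> by (simp add: abs_le_iff)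
  qed
  have intd: "integrable M (\<lambda>\<omega>. EZ i - Z i \<omega>)" using intZ[OF i] by simp
  have "expectation (\<lambda>\<omega>. exp (\<theta> * (EZ i - Z i \<omega>))) \<le>
      expectation (\<lambda>\<omega>. 1 + \<theta> * (EZ i - Z i \<omega>) + bennett_g (\<theta> * b) * \<theta>\<^sup>2 * (EZ i - Z i \<omega>)\<^sup>2)"
  proof (rule expectation_mono_bdd[OF int])
    show "integrable M (\<lambda>\<omega>. 1 + \<theta> * (EZ i - Z i \<omega>) + bennett_g (\<theta> * b) * \<theta>\<^sup>2 * (EZ i - Z i \<omega>)\<^sup>2)"
      using intd int_dev_sq[OF i] by (intro Bochner_Integration.integrable_add integrable_mult_right) auto
    fix \<omega> assume \<omega>: "\<omega> \<in> space M"
    have "\<bar>\<theta> * (EZ i - Z i \<omega>)\<bar> \<le> \<theta> * b"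
      using dev_bound[OF i \<omega>] \<theta> by (simp add: abs_mult)
    from exp_le_quadratic[OF this] show "exp (\<theta> * (EZ i - Z i \<omega>)) \<le> 1 + \<theta> * (EZ i - Z i \<omega>) + bennett_g (\<theta> * b) * \<theta>\<^sup>2 * (EZ i - Z i \<omega>)\<^sup>2"
      using \<theta> b_pos by (simp add: power_mult_distrib mult.assoc)
  qed
  also have "\<dots> = 1 + bennett_g (\<theta> * b) * \<theta>\<^sup>2 * var_Z i"
    using intd int_dev_sq[OF i] intZ[OF i] by (simp add: var_Z_def prob_space power2_commute[of "Z i _"])
  also have "\<dots> \<le> exp (bennett_g (\<theta> * b) * \<theta>\<^sup>2 * var_Z i)"
    by (rule exp_ge_add_one_self)
  finally show "expectation (\<lambda>\<omega>. exp (\<theta> * (EZ i - Z i \<omega>))) \<le> exp (bennett_g (\<theta> * b) * \<theta>\<^sup>2 * var_Z i)" .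
qed

lemma markov_exp:
  assumes int: "integrable M (\<lambda>\<omega>. exp (f \<omega>))"
    and f: "f \<in> borel_measurable M"
  shows "prob {\<omega> \<in> space M. t \<le> f \<omega>} \<le> expectation (\<lambda>\<omega>. exp (f \<omega>)) * exp (- t)"
proof -
  have "{\<omega> \<in> space M. t \<le> f \<omega>} = {\<omega> \<in> space M. exp t \<le> exp (f \<omega>)}" by simp
  also have "prob \<dots> \<le> expectation (\<lambda>\<omega>. exp (f \<omega>)) / exp t"
    by (rule integral_Markov_inequality_measure[OF int, of "{}"]) auto
  finally show ?thesis by (simp add: exp_minus field_simps)
qed

text \<open>The one-sided Bernstein bound: exponential moments multiply by independence,
  \<open>bennett_g_le\<close> brings the exponent into sub-gamma form with scale
  \<open>b / 3\<close>, and \<open>subgamma_tail\<close> inverts it.\<close>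

lemma bernstein_lower:
  assumes L: "0 < L"
  shows "prob {\<omega> \<in> space M. sqrt (2 * (\<Sum>i=1..m. var_Z i) * L) + b / 3 * L \<le> (\<Sum>i=1..m. EZ i - Z i \<omega>)} \<le> exp (- L)"
proof -
  let ?S = "\<Sum>i=1..m. var_Z i"
  let ?t = "sqrt (2 * ?S * L) + b / 3 * L"
  have "prob {\<omega> \<in> space M. ?t \<le> (\<Sum>i=1..m. EZ i - Z i \<omega>)} \<le> 1 * exp (- L)"
  proof (rule subgamma_tail[where S = ?S and c = "b / 3"])
    fix \<theta> :: real assume \<theta>: "0 < \<theta>" "\<theta> * (b / 3) < 1"
    have ind: "indep_vars (\<lambda>_. borel) (\<lambda>i \<omega>. exp (\<theta> * (EZ i - Z i \<omega>))) {1..m}"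
      by (rule indep_vars_compose2[OF indepZ]) measurable
    have eqp: "exp (\<theta> * (\<Sum>i=1..m. EZ i - Z i \<omega>)) = (\<Prod>i=1..m. exp (\<theta> * (EZ i - Z i \<omega>)))" for \<omega>
      by (simp add: sum_distrib_left exp_sum)
    have "integrable M (\<lambda>\<omega>. \<Prod>i=1..m. exp (\<theta> * (EZ i - Z i \<omega>)))"
      by (rule indep_vars_integrable[OF _ ind]) (auto intro: mgf_dev(2) \<theta>)
    then have int: "integrable M (\<lambda>\<omega>. exp (\<theta> * (\<Sum>i=1..m. EZ i - Z i \<omega>)))"
      by (simp only: eqp)
    have "{\<omega> \<in> space M. ?t \<le> (\<Sum>i=1..m. EZ i - Z i \<omega>)} = {\<omega> \<in> space M. \<theta> * ?t \<le> \<theta> * (\<Sum>i=1..m. EZ i - Z i \<omega>)}"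
      using \<theta> by simp
    also have "prob \<dots> \<le> expectation (\<lambda>\<omega>. exp (\<theta> * (\<Sum>i=1..m. EZ i - Z i \<omega>))) * exp (- (\<theta> * ?t))"
      by (rule markov_exp[OF int])
        (intro borel_measurable_times borel_measurable_sum borel_measurable_diff borel_measurable_const measZ; simp)
    finally have p1: "prob {\<omega> \<in> space M. ?t \<le> (\<Sum>i=1..m. EZ i - Z i \<omega>)} \<le>
      expectation (\<lambda>\<omega>. exp (\<theta> * (\<Sum>i=1..m. EZ i - Z i \<omega>))) * exp (- (\<theta> * ?t))" .
    have "expectation (\<lambda>\<omega>. exp (\<theta> * (\<Sum>i=1..m. EZ i - Z i \<omega>))) = (\<Prod>i=1..m. expectation (\<lambda>\<omega>. exp (\<theta> * (EZ i - Z i \<omega>))))"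
      unfolding eqp by (rule indep_vars_lebesgue_integral[OF _ ind]) (auto intro: mgf_dev(2) \<theta>)
    also have "\<dots> \<le> (\<Prod>i=1..m. exp (bennett_g (\<theta> * b) * \<theta>\<^sup>2 * var_Z i))"
      by (intro prod_mono conjI mgf_dev(1) \<theta> integral_nonneg_AE) auto
    also have "\<dots> = exp (bennett_g (\<theta> * b) * \<theta>\<^sup>2 * ?S)"
      by (simp add: exp_sum sum_distrib_left)
    also have "\<dots> \<le> exp (?S * \<theta>\<^sup>2 / (2 * (1 - \<theta> * (b / 3))))"
    proof -
      have "bennett_g (\<theta> * b) \<le> 1 / (2 * (1 - \<theta> * b / 3))"
        using \<theta> b_pos by (intro bennett_g_le) auto
      then have "bennett_g (\<theta> * b) * (\<theta>\<^sup>2 * ?S) \<le> 1 / (2 * (1 - \<theta> * b / 3)) * (\<theta>\<^sup>2 * ?S)"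
        by (intro mult_right_mono mult_nonneg_nonneg sum_nonneg var_Z_nonneg) auto
      moreover have "1 / (2 * (1 - \<theta> * b / 3)) * (\<theta>\<^sup>2 * ?S) = ?S * \<theta>\<^sup>2 / (2 * (1 - \<theta> * (b / 3)))"
        by (simp only: times_divide_eq_right times_divide_eq_left mult_1 mult.commute[of ?S])
      ultimately show ?thesis by (simp only: exp_le_cancel_iff mult.assoc)
    qed
    finally have "expectation (\<lambda>\<omega>. exp (\<theta> * (\<Sum>i=1..m. EZ i - Z i \<omega>))) * exp (- (\<theta> * ?t))
        \<le> exp (?S * \<theta>\<^sup>2 / (2 * (1 - \<theta> * (b / 3)))) * exp (- (\<theta> * ?t))"
      by (rule mult_right_mono) simp
    with p1 show "prob {\<omega> \<in> space M. ?t \<le> (\<Sum>i=1..m. EZ i - Z i \<omega>)} \<le>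
        1 * exp (?S * \<theta>\<^sup>2 / (2 * (1 - \<theta> * (b / 3))) - \<theta> * ?t)"
      by (simp only: mult_1 exp_add[symmetric] diff_conv_add_uminus)
  next
    show "0 \<le> ?S" by (intro sum_nonneg var_Z_nonneg)
  qed (use L b_pos in simp_all)
  then show ?thesis by simp
qed

text \<open>Independence removes the mixed term. The variables may have different means, whose
  squared difference only adds to the right side.\<close>

lemma pair_var:
  assumes "i \<in> {1..m}" "j \<in> {1..m}" "i \<noteq> j"
  shows "var_Z i + var_Z j \<le> expectation (\<lambda>\<omega>. (Z i \<omega> - Z j \<omega>)\<^sup>2)"
proof -
  let ?U = "\<lambda>i \<omega>. Z i \<omega> - EZ i"
  have ind: "indep_var borel (?U i) borel (?U j)"
  proof -
    have m: "(\<lambda>x. x k - EZ k) \<in> borel_measurable (PiM {k} (\<lambda>_. borel))" for k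
      by (intro borel_measurable_diff measurable_component_singleton borel_measurable_const) simp
    have "indep_var borel ((\<lambda>x. x i - EZ i) \<circ> (\<lambda>\<omega>. \<lambda>k\<in>{i}. Z k \<omega>)) borel ((\<lambda>x. x j - EZ j) \<circ> (\<lambda>\<omega>. \<lambda>k\<in>{j}. Z k \<omega>))"
      using assms by (intro indep_var_compose[OF _ m m] indep_var_restrict[OF indepZ]) auto
    then show ?thesis by (simp add: comp_def)
  qed
  have bd: "norm (?U k \<omega>) \<le> b" if "k \<in> {1..m}" "\<omega> \<in> space M" for k \<omega>
    using dev_bound[OF that] by (simp add: abs_minus_commute)
  have z: "expectation (?U k) = 0" if "k \<in> {1..m}" for k
    using intZ[OF that] by (simp add: prob_space)
  have cross: "expectation (\<lambda>\<omega>. ?U i \<omega> * ?U j \<omega>) = 0"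
    using indep_var_inner[OF ind bd bd] assms z by simp
  have mU: "?U k \<in> borel_measurable M" if "k \<in> {1..m}" for k
    using that by (intro borel_measurable_diff measZ borel_measurable_const)
  have bd2: "\<bar>?U k \<omega> * ?U l \<omega>\<bar> \<le> b * b" if "k \<in> {1..m}" "l \<in> {1..m}" "\<omega> \<in> space M" for k l \<omega>
    using bd[OF that(1,3)] bd[OF that(2,3)] unfolding abs_mult by (intro mult_mono) auto
  have iUU: "integrable M (\<lambda>\<omega>. ?U k \<omega> * ?U l \<omega>)" if "k \<in> {1..m}" "l \<in> {1..m}" for k l
    by (rule integrable_bdd[OF borel_measurable_times[OF mU mU]]) (use bd2 that in auto)
  have iU: "integrable M (?U k)" if "k \<in> {1..m}" for k
    using intZ[OF that] by simp
  have "expectation (\<lambda>\<omega>. (Z i \<omega> - Z j \<omega>)\<^sup>2) =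
      expectation (\<lambda>\<omega>. ?U i \<omega> * ?U i \<omega> + ?U j \<omega> * ?U j \<omega> - 2 * (?U i \<omega> * ?U j \<omega>)
        + 2 * (EZ i - EZ j) * ?U i \<omega> - 2 * (EZ i - EZ j) * ?U j \<omega> + (EZ i - EZ j)\<^sup>2)"
    by (intro Bochner_Integration.integral_cong refl) (simp add: power2_eq_square algebra_simps)
  also have "\<dots> = var_Z i + var_Z j - 2 * expectation (\<lambda>\<omega>. ?U i \<omega> * ?U j \<omega>)
        + 2 * (EZ i - EZ j) * expectation (?U i) - 2 * (EZ i - EZ j) * expectation (?U j) + (EZ i - EZ j)\<^sup>2"
    unfolding var_Z_def power2_eq_square[of "Z _ _ - _"]
    using iUU[OF assms(1,1)] iUU[OF assms(2,2)] iUU[OF assms(1,2)] iU[OF assms(1)] iU[OF assms(2)]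
    by (simp add: prob_space)
  also have "\<dots> = var_Z i + var_Z j + (EZ i - EZ j)\<^sup>2"
    unfolding cross z[OF assms(1)] z[OF assms(2)] by simp
  finally show ?thesis by simp
qed

lemma int_sq_diff: "i \<in> {1..m} \<Longrightarrow> j \<in> {1..m} \<Longrightarrow> integrable M (\<lambda>\<omega>. (Z i \<omega> - Z j \<omega>)\<^sup>2)"
proof (rule integrable_bdd)
  assume i: "i \<in> {1..m}" and j: "j \<in> {1..m}"
  show "(\<lambda>\<omega>. (Z i \<omega> - Z j \<omega>)\<^sup>2) \<in> borel_measurable M"
    by (intro borel_measurable_power borel_measurable_diff measZ i j)
  fix \<omega> assume "\<omega> \<in> space M"
  then have "\<bar>Z i \<omega> - Z j \<omega>\<bar> \<le> b"
    using Z_bounds[OF i] Z_bounds[OF j] by (fastforce simp: abs_le_iff)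
  then show "norm ((Z i \<omega> - Z j \<omega>)\<^sup>2) \<le> b\<^sup>2"
    by (simp add: power2_le_iff_abs_le[OF less_imp_le[OF b_pos]])
qed

context
  fixes J :: "nat set"
  assumes J: "J \<subseteq> {1..m}" and cJ: "card J = 2 \<or> card J = 3"
begin

lemma finJ: "finite J"
  using J finite_subset by blast

lemma int_block: "integrable M (\<lambda>\<omega>. block_var J (\<lambda>i. Z i \<omega>))"
  unfolding block_var_def using J
  by (intro integrable_divide Bochner_Integration.integrable_sum int_sq_diff) auto

text \<open>Summed over ordered pairs of distinct indices, \<open>pair_var\<close> counts every
  variance \<open>2 * (card J - 1)\<close> times; the denominator of \<open>block_var\<close> turns
  this into one half.\<close>

lemma expectation_block: "(\<Sum>i\<in>J. var_Z i) / 2 \<le> expectation (\<lambda>\<omega>. block_var J (\<lambda>i. Z i \<omega>))"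
proof -
  have k: "0 < 4 * (real (card J) - 1)" using cJ by auto
  have "2 * (real (card J) - 1) * (\<Sum>i\<in>J. var_Z i) = (\<Sum>i\<in>J. (\<Sum>j\<in>J. var_Z i + var_Z j) - 2 * var_Z i)"
    by (simp add: sum_subtractf sum.distrib sum_distrib_left[symmetric] algebra_simps)
  also have "\<dots> = (\<Sum>i\<in>J. \<Sum>j\<in>J - {i}. var_Z i + var_Z j)"
    by (rule sum.cong[OF refl]) (simp add: sum.remove[OF finJ])
  also have "\<dots> \<le> (\<Sum>i\<in>J. \<Sum>j\<in>J - {i}. expectation (\<lambda>\<omega>. (Z i \<omega> - Z j \<omega>)\<^sup>2))"
    using J by (intro sum_mono pair_var) auto
  also have "\<dots> = (\<Sum>i\<in>J. \<Sum>j\<in>J. expectation (\<lambda>\<omega>. (Z i \<omega> - Z j \<omega>)\<^sup>2))"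
  proof (rule sum.cong[OF refl])
    fix i assume "i \<in> J"
    from sum.remove[OF finJ this, of "\<lambda>j. expectation (\<lambda>\<omega>. (Z i \<omega> - Z j \<omega>)\<^sup>2)"]
    show "(\<Sum>j\<in>J - {i}. expectation (\<lambda>\<omega>. (Z i \<omega> - Z j \<omega>)\<^sup>2)) = (\<Sum>j\<in>J. expectation (\<lambda>\<omega>. (Z i \<omega> - Z j \<omega>)\<^sup>2))"
      by simp
  qed
  also have "\<dots> = expectation (\<lambda>\<omega>. \<Sum>i\<in>J. \<Sum>j\<in>J. (Z i \<omega> - Z j \<omega>)\<^sup>2)"
  proof -
    have "(\<Sum>i\<in>J. \<Sum>j\<in>J. expectation (\<lambda>\<omega>. (Z i \<omega> - Z j \<omega>)\<^sup>2)) = (\<Sum>i\<in>J. expectation (\<lambda>\<omega>. \<Sum>j\<in>J. (Z i \<omega> - Z j \<omega>)\<^sup>2))"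
      using J by (intro sum.cong[OF refl] Bochner_Integration.integral_sum[symmetric] int_sq_diff) auto
    also have "\<dots> = expectation (\<lambda>\<omega>. \<Sum>i\<in>J. \<Sum>j\<in>J. (Z i \<omega> - Z j \<omega>)\<^sup>2)"
      using J by (intro Bochner_Integration.integral_sum[symmetric] Bochner_Integration.integrable_sum int_sq_diff) auto
    finally show ?thesis .
  qed
  finally have "(\<Sum>i\<in>J. var_Z i) / 2 * (4 * (real (card J) - 1)) \<le> expectation (\<lambda>\<omega>. \<Sum>i\<in>J. \<Sum>j\<in>J. (Z i \<omega> - Z j \<omega>)\<^sup>2)"
    by (simp add: algebra_simps)
  then show ?thesis
    unfolding block_var_def integral_divide_zero pos_le_divide_eq[OF k] .
qed

lemma meas_block: "(\<lambda>x. block_var J x) \<in> borel_measurable (PiM J (\<lambda>_. borel))"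
  unfolding block_var_def
  by (intro borel_measurable_divide borel_measurable_sum borel_measurable_power borel_measurable_diff
      measurable_component_singleton borel_measurable_const)

text \<open>The block variance \<open>q\<close> is self-bounding:
  \<open>0 \<le> q \<le> b^2 / 2\<close> gives \<open>q^2 \<le> (b^2 / 2) q\<close>, so the
  second-order term of \<open>exp (- l q)\<close> is again linear in \<open>q\<close>.\<close>

lemma mgf_block:
  assumes l: "0 \<le> l"
  shows "expectation (\<lambda>\<omega>. exp (- l * block_var J (\<lambda>i. Z i \<omega>)))
           \<le> exp (- (l - l\<^sup>2 * b\<^sup>2 / 4) * expectation (\<lambda>\<omega>. block_var J (\<lambda>i. Z i \<omega>)))"
    and "integrable M (\<lambda>\<omega>. exp (- l * block_var J (\<lambda>i. Z i \<omega>)))"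
proof -
  let ?q = "\<lambda>\<omega>. block_var J (\<lambda>i. Z i \<omega>)"
  have q0: "0 \<le> ?q \<omega>" for \<omega> by (rule block_var_nonneg[OF cJ])
  show int: "integrable M (\<lambda>\<omega>. exp (- l * ?q \<omega>))"
  proof (rule integrable_bdd)
    show "(\<lambda>\<omega>. exp (- l * ?q \<omega>)) \<in> borel_measurable M"
      by (intro measurable_compose[OF _ borel_measurable_exp] borel_measurable_times borel_measurable_const
          borel_measurable_integrable[OF int_block])
    show "norm (exp (- l * ?q \<omega>)) \<le> 1" for \<omega> using q0 l by simp
  qed
  have "expectation (\<lambda>\<omega>. exp (- l * ?q \<omega>)) \<le> expectation (\<lambda>\<omega>. 1 - (l - l\<^sup>2 * b\<^sup>2 / 4) * ?q \<omega>)"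
  proof (rule expectation_mono_bdd[OF int])
    show "integrable M (\<lambda>\<omega>. 1 - (l - l\<^sup>2 * b\<^sup>2 / 4) * ?q \<omega>)"
      using int_block by (intro Bochner_Integration.integrable_diff integrable_mult_right) auto
    fix \<omega> assume \<omega>: "\<omega> \<in> space M"
    have qb: "?q \<omega> \<le> b\<^sup>2 / 2"
      using J Z_bounds \<omega> by (intro block_var_le[OF cJ]) auto
    define x where "x = l * ?q \<omega>"
    have x0: "0 \<le> x" using q0 l by (simp add: x_def)
    \<comment> \<open>Invert the quadratic lower bound for \<open>exp x\<close>: the product of the
      two quadratic polynomials is \<open>1 + x^4 / 4\<close>.\<close>
    have "exp (- x) \<le> 1 - x + x\<^sup>2 / 2"
    proof -
      have "1 + x + x\<^sup>2 / 2 \<le> exp x" using x0 by (rule exp_lower_Taylor_quadratic)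
      then have "exp (- x) \<le> inverse (1 + x + x\<^sup>2 / 2)"
        unfolding exp_minus using x0 by (intro le_imp_inverse_le) (auto intro: add_pos_nonneg)
      also have "\<dots> \<le> 1 - x + x\<^sup>2 / 2"
      proof -
        have "(1 - x + x\<^sup>2 / 2) * (1 + x + x\<^sup>2 / 2) = 1 + (x\<^sup>2)\<^sup>2 / 4"
          by (simp add: power2_eq_square field_simps)
        then have "1 \<le> (1 - x + x\<^sup>2 / 2) * (1 + x + x\<^sup>2 / 2)"
          by simp
        moreover have "0 < 1 + x + x\<^sup>2 / 2" using x0 by (auto intro: add_pos_nonneg)
        ultimately show ?thesis by (simp add: inverse_eq_divide divide_le_eq)
      qed
      finally show ?thesis .
    qed
    moreover have "x\<^sup>2 / 2 \<le> l\<^sup>2 * b\<^sup>2 / 4 * ?q \<omega>"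
    proof -
      have "?q \<omega> * ?q \<omega> \<le> b\<^sup>2 / 2 * ?q \<omega>"
        using qb q0 by (intro mult_right_mono)
      then have "l\<^sup>2 / 2 * (?q \<omega> * ?q \<omega>) \<le> l\<^sup>2 / 2 * (b\<^sup>2 / 2 * ?q \<omega>)"
        by (intro mult_left_mono) auto
      then show ?thesis by (simp add: x_def power2_eq_square mult_ac)
    qed
    ultimately show "exp (- l * ?q \<omega>) \<le> 1 - (l - l\<^sup>2 * b\<^sup>2 / 4) * ?q \<omega>"
      by (simp add: x_def left_diff_distrib)
  qed
  also have "\<dots> = 1 + (- (l - l\<^sup>2 * b\<^sup>2 / 4) * expectation ?q)"
    using int_block by (simp add: prob_space left_diff_distrib)
  also have "\<dots> \<le> exp (- (l - l\<^sup>2 * b\<^sup>2 / 4) * expectation ?q)"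
    by (rule exp_ge_add_one_self)
  finally show "expectation (\<lambda>\<omega>. exp (- l * ?q \<omega>)) \<le> exp (- (l - l\<^sup>2 * b\<^sup>2 / 4) * expectation ?q)" .
qed

end

lemma mgf_partition:
  assumes l: "0 \<le> l" "l * b\<^sup>2 \<le> 4"
    and P: "finite P" "\<Union>P = {1..m}" "disjoint P" "\<forall>J\<in>P. card J = 2 \<or> card J = 3"
  shows "expectation (\<lambda>\<omega>. exp (- l * (\<Sum>J\<in>P. block_var J (\<lambda>i. Z i \<omega>))))
           \<le> exp (- (l - l\<^sup>2 * b\<^sup>2 / 4) / 2 * (\<Sum>i=1..m. var_Z i))"
    and "integrable M (\<lambda>\<omega>. exp (- l * (\<Sum>J\<in>P. block_var J (\<lambda>i. Z i \<omega>))))"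
proof -
  let ?q = "\<lambda>J \<omega>. block_var J (\<lambda>i. Z i \<omega>)"
  have sub: "J \<subseteq> {1..m}" if "J \<in> P" for J using P(2) that by blast
  have c: "card J = 2 \<or> card J = 3" if "J \<in> P" for J using P(4) that by blast
  have "indep_vars (\<lambda>J. PiM J (\<lambda>_. borel)) (\<lambda>J \<omega>. \<lambda>i\<in>J. Z i \<omega>) P"
    using sub P(3) by (intro indep_vars_restrict[OF indepZ, where K = id, unfolded id_apply])
      (auto simp: disjoint_family_on_def disjoint_def)
  then have "indep_vars (\<lambda>_. borel) (\<lambda>J \<omega>. exp (- l * block_var J (\<lambda>i\<in>J. Z i \<omega>))) P"
    by (rule indep_vars_compose2)
      (intro measurable_compose[OF _ borel_measurable_exp] borel_measurable_times borel_measurable_const meas_block sub c)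
  moreover have "block_var J (\<lambda>i\<in>J. z i) = block_var J z" for J z
    by (simp add: block_var_def)
  ultimately have ind: "indep_vars (\<lambda>_. borel) (\<lambda>J \<omega>. exp (- l * ?q J \<omega>)) P" by simp
  have eqp: "exp (- l * (\<Sum>J\<in>P. ?q J \<omega>)) = (\<Prod>J\<in>P. exp (- l * ?q J \<omega>))" for \<omega>
    using P(1) by (simp add: sum_distrib_left exp_sum sum_negf[symmetric])
  have intJ: "integrable M (\<lambda>\<omega>. exp (- l * ?q J \<omega>))" if "J \<in> P" for J
    by (rule mgf_block(2)[OF sub[OF that] c[OF that] l(1)])
  show "integrable M (\<lambda>\<omega>. exp (- l * (\<Sum>J\<in>P. ?q J \<omega>)))"
    unfolding eqp by (rule indep_vars_integrable[OF P(1) ind intJ])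
  \<comment> \<open>With a nonnegative coefficient the lower bound for the expected block variance
    may be inserted into the exponent; this is where \<open>l * b^2 \<le> 4\<close> enters.\<close>
  have k: "0 \<le> l - l\<^sup>2 * b\<^sup>2 / 4"
    using mult_left_mono[OF l(2,1)] by (simp add: power2_eq_square mult_ac)
  have "expectation (\<lambda>\<omega>. exp (- l * (\<Sum>J\<in>P. ?q J \<omega>))) = (\<Prod>J\<in>P. expectation (\<lambda>\<omega>. exp (- l * ?q J \<omega>)))"
    unfolding eqp by (rule indep_vars_lebesgue_integral[OF P(1) ind intJ])
  also have "\<dots> \<le> (\<Prod>J\<in>P. exp (- (l - l\<^sup>2 * b\<^sup>2 / 4) / 2 * (\<Sum>i\<in>J. var_Z i)))"
  proof (rule prod_mono, rule conjI)
    fix J assume J: "J \<in> P"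
    show "0 \<le> expectation (\<lambda>\<omega>. exp (- l * ?q J \<omega>))" by (intro integral_nonneg_AE) auto
    have "(l - l\<^sup>2 * b\<^sup>2 / 4) * ((\<Sum>i\<in>J. var_Z i) / 2) \<le> (l - l\<^sup>2 * b\<^sup>2 / 4) * expectation (?q J)"
      by (intro mult_left_mono expectation_block sub c J k)
    then have "exp (- (l - l\<^sup>2 * b\<^sup>2 / 4) * expectation (?q J)) \<le> exp (- (l - l\<^sup>2 * b\<^sup>2 / 4) / 2 * (\<Sum>i\<in>J. var_Z i))"
      by (simp only: exp_le_cancel_iff)
    with mgf_block(1)[OF sub[OF J] c[OF J] l(1)]
    show "expectation (\<lambda>\<omega>. exp (- l * ?q J \<omega>)) \<le> exp (- (l - l\<^sup>2 * b\<^sup>2 / 4) / 2 * (\<Sum>i\<in>J. var_Z i))"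
      by linarith
  qed
  also have "\<dots> = exp (- (l - l\<^sup>2 * b\<^sup>2 / 4) / 2 * (\<Sum>J\<in>P. \<Sum>i\<in>J. var_Z i))"
    using P(1) by (simp only: sum_distrib_left exp_sum)
  also have "(\<Sum>J\<in>P. \<Sum>i\<in>J. var_Z i) = (\<Sum>i=1..m. var_Z i)"
  proof -
    have "\<forall>J\<in>P. finite J" using sub finite_subset[OF _ finite_atLeastAtMost] by blast
    then show ?thesis
      unfolding P(2)[symmetric] using P(3) by (subst sum.Union_disjoint) (auto simp: disjoint_def)
  qed
  finally show "expectation (\<lambda>\<omega>. exp (- l * (\<Sum>J\<in>P. ?q J \<omega>))) \<le> exp (- (l - l\<^sup>2 * b\<^sup>2 / 4) / 2 * (\<Sum>i=1..m. var_Z i))" .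
qed

text \<open>The expression \<open>block_var {1..m}\<close>, that is, \<open>m / 2\<close> times the
  sample variance.\<close>

definition scaled_variance :: "'w \<Rightarrow> real" where
  "scaled_variance \<omega> = (\<Sum>i=1..m. \<Sum>j=1..m. (Z i \<omega> - Z j \<omega>)\<^sup>2) / (4 * (real m - 1))"

text \<open>Hoeffding's device for U-statistics: the sample variance is the average over all permutations
  of a sum of independent block variances.\<close>

lemma scaled_variance_average:
  assumes P: "finite P" "\<Union>P = {1..m}" "disjoint P" "\<forall>J\<in>P. card J = 2 \<or> card J = 3"
  shows "(\<Sum>\<pi> | \<pi> permutes {1..m}. \<Sum>J\<in>(\<lambda>J. \<pi> ` J) ` P. block_var J (\<lambda>i. Z i \<omega>))
           = real (card {\<pi>. \<pi> permutes {1..m}}) * scaled_variance \<omega>"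
proof -
  let ?f = "\<lambda>i j. (Z i \<omega> - Z j \<omega>)\<^sup>2"
  let ?N = "real (card {\<pi>. \<pi> permutes {1..m}})"
  let ?D = "\<Sum>i=1..m. \<Sum>j=1..m. ?f i j"
  have sub: "J \<subseteq> {1..m}" if "J \<in> P" for J using P(2) that by blast
  have finJ: "finite J" if "J \<in> P" for J using sub[OF that] finite_subset by blast
  have c: "card J = 2 \<or> card J = 3" if "J \<in> P" for J using P(4) that by blast
  have m0: "0 < real m * (real m - 1)" using m2 by simp
  have blk: "(\<Sum>J\<in>(\<lambda>J. \<pi> ` J) ` P. block_var J (\<lambda>i. Z i \<omega>)) =
     (\<Sum>J\<in>P. (\<Sum>i\<in>J. \<Sum>j\<in>J. ?f (\<pi> i) (\<pi> j)) / (4 * (real (card J) - 1)))" if "\<pi> permutes {1..m}" for \<pi>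
  proof -
    have inj: "inj \<pi>" using that by (rule permutes_inj)
    have "inj_on (\<lambda>J. \<pi> ` J) P" by (rule inj_onI) (simp add: inj_image_eq_iff[OF inj])
    then show ?thesis
      unfolding block_var_def
      by (simp add: sum.reindex inj_on_subset[OF inj] card_image)
  qed
  have pair: "(\<Sum>\<pi> | \<pi> permutes {1..m}. ?f (\<pi> i) (\<pi> j)) = (if i = j then 0 else ?N * ?D / (real m * (real m - 1)))"
    if "i \<in> {1..m}" "j \<in> {1..m}" for i j
    using sum_over_permutations_pairs[of ?f "{1..m}" i j] that m0 by (auto simp: field_simps)
  have blockJ: "(\<Sum>\<pi> | \<pi> permutes {1..m}. (\<Sum>i\<in>J. \<Sum>j\<in>J. ?f (\<pi> i) (\<pi> j)) / (4 * (real (card J) - 1)))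
      = real (card J) * (?N * ?D / (real m * (real m - 1)) / 4)" if J: "J \<in> P" for J
  proof -
    let ?t = "?N * ?D / (real m * (real m - 1))"
    have "(\<Sum>\<pi> | \<pi> permutes {1..m}. \<Sum>i\<in>J. \<Sum>j\<in>J. ?f (\<pi> i) (\<pi> j)) =
        (\<Sum>i\<in>J. \<Sum>j\<in>J. \<Sum>\<pi> | \<pi> permutes {1..m}. ?f (\<pi> i) (\<pi> j))"
      by (subst sum.swap, rule sum.cong[OF refl], rule sum.swap)
    also have "\<dots> = (\<Sum>i\<in>J. \<Sum>j\<in>J. if i = j then 0 else ?t)"
      by (rule sum.cong[OF refl], rule sum.cong[OF refl], rule pair) (use sub[OF J] in blast)+
    also have "\<dots> = (\<Sum>i\<in>J. \<Sum>j\<in>J - {i}. ?t)"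
      by (rule sum.cong[OF refl], rule sum.mono_neutral_cong_right) (use finJ[OF J] in auto)
    also have "\<dots> = (\<Sum>i\<in>J. (real (card J) - 1) * ?t)"
      by (rule sum.cong[OF refl]) (use finJ[OF J] c[OF J] in \<open>auto simp: of_nat_diff\<close>)
    also have "\<dots> = real (card J) * ((real (card J) - 1) * ?t)" by simp
    finally have "(\<Sum>\<pi> | \<pi> permutes {1..m}. \<Sum>i\<in>J. \<Sum>j\<in>J. ?f (\<pi> i) (\<pi> j)) = real (card J) * ((real (card J) - 1) * ?t)" .
    then show ?thesis
      unfolding sum_divide_distrib[symmetric] using c[OF J] by auto
  qed
  have "(\<Sum>\<pi> | \<pi> permutes {1..m}. \<Sum>J\<in>(\<lambda>J. \<pi> ` J) ` P. block_var J (\<lambda>i. Z i \<omega>)) =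
      (\<Sum>\<pi> | \<pi> permutes {1..m}. \<Sum>J\<in>P. (\<Sum>i\<in>J. \<Sum>j\<in>J. ?f (\<pi> i) (\<pi> j)) / (4 * (real (card J) - 1)))"
    by (rule sum.cong[OF refl], rule blk) simp
  also have "\<dots> = (\<Sum>J\<in>P. real (card J) * (?N * ?D / (real m * (real m - 1)) / 4))"
    by (subst sum.swap, rule sum.cong[OF refl], rule blockJ)
  also have "\<dots> = real (\<Sum>J\<in>P. card J) * (?N * ?D / (real m * (real m - 1)) / 4)"
    by (simp only: of_nat_sum sum_distrib_right)
  also have "(\<Sum>J\<in>P. card J) = m"
    using card_Union_disjoint[of P] P(2,3) finJ by (simp add: disjoint_def pairwise_def disjnt_def)
  finally have "(\<Sum>\<pi> | \<pi> permutes {1..m}. \<Sum>J\<in>(\<lambda>J. \<pi> ` J) ` P. block_var J (\<lambda>i. Z i \<omega>))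
      = real m * (?N * ?D / (real m * (real m - 1)) / 4)" .
  moreover have "a * (x * y / (a * k) / 4) = x * (y / (4 * k))" if "a \<noteq> 0" for a x y k :: real
    using that by (simp add: divide_simps)
  ultimately show ?thesis
    using m2 by (simp only: scaled_variance_def)
qed

text \<open>The block sums of different permutations depend on each other, but convexity of the
  exponential bounds the exponential of their average by the average of their exponentials, and each
  of these obeys the same bound.\<close>

lemma mgf_scaled_variance:
  assumes l: "0 \<le> l" "l * b\<^sup>2 \<le> 4"
  shows "expectation (\<lambda>\<omega>. exp (- l * scaled_variance \<omega>)) \<le> exp (- (l - l\<^sup>2 * b\<^sup>2 / 4) / 2 * (\<Sum>i=1..m. var_Z i))"
    and "integrable M (\<lambda>\<omega>. exp (- l * scaled_variance \<omega>))" and "scaled_variance \<in> borel_measurable M"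
proof -
  show ms: "scaled_variance \<in> borel_measurable M"
    unfolding scaled_variance_def[abs_def]
    by (intro borel_measurable_divide borel_measurable_sum borel_measurable_power borel_measurable_diff measZ borel_measurable_const)
  have sq0: "0 \<le> scaled_variance \<omega>" for \<omega>
    unfolding scaled_variance_def using m2 by (intro divide_nonneg_nonneg sum_nonneg) auto
  show int: "integrable M (\<lambda>\<omega>. exp (- l * scaled_variance \<omega>))"
  proof (rule integrable_bdd)
    show "(\<lambda>\<omega>. exp (- l * scaled_variance \<omega>)) \<in> borel_measurable M"
      by (intro measurable_compose[OF _ borel_measurable_exp] borel_measurable_times borel_measurable_const ms)
    show "norm (exp (- l * scaled_variance \<omega>)) \<le> 1" for \<omega> using sq0 l(1) by simp
  qed
  obtain P where P: "finite P" "\<Union>P = {1..m}" "disjoint P" "\<forall>J\<in>P. finite J \<and> (card J = 2 \<or> card J = 3)"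
    using partition_2_3[OF m2] by blast
  let ?Per = "{\<pi>. \<pi> permutes {1..m}}"
  let ?N = "real (card ?Per)"
  let ?W = "\<lambda>\<pi> \<omega>. \<Sum>J\<in>(\<lambda>J. \<pi> ` J) ` P. block_var J (\<lambda>i. Z i \<omega>)"
  let ?e = "exp (- (l - l\<^sup>2 * b\<^sup>2 / 4) / 2 * (\<Sum>i=1..m. var_Z i))"
  have fin: "finite ?Per" by (rule finite_permutations) simp
  have ne: "?Per \<noteq> {}" using permutes_id by blast
  have N: "0 < ?N" using fin ne by (simp add: card_gt_0_iff)
  have P': "finite ((\<lambda>J. \<pi> ` J) ` P)" "\<Union>((\<lambda>J. \<pi> ` J) ` P) = {1..m}" "disjoint ((\<lambda>J. \<pi> ` J) ` P)"
      "\<forall>J\<in>(\<lambda>J. \<pi> ` J) ` P. card J = 2 \<or> card J = 3" if \<pi>: "\<pi> permutes {1..m}" for \<pi>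
  proof -
    have inj: "inj \<pi>" using \<pi> by (rule permutes_inj)
    show "finite ((\<lambda>J. \<pi> ` J) ` P)" using P(1) by simp
    show "\<Union>((\<lambda>J. \<pi> ` J) ` P) = {1..m}"
      using P(2) permutes_image[OF \<pi>] by (simp add: image_Union[symmetric])
    show "disjoint ((\<lambda>J. \<pi> ` J) ` P)"
      using P(3) unfolding disjoint_def by (auto simp: image_Int[OF inj, symmetric])
    show "\<forall>J\<in>(\<lambda>J. \<pi> ` J) ` P. card J = 2 \<or> card J = 3"
      using P(4) by (simp add: card_image[OF inj_on_subset[OF inj]])
  qed
  have mg: "expectation (\<lambda>\<omega>. exp (- l * ?W \<pi> \<omega>)) \<le> ?e" "integrable M (\<lambda>\<omega>. exp (- l * ?W \<pi> \<omega>))"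
    if "\<pi> \<in> ?Per" for \<pi>
    using mgf_partition[OF l P'] that by auto
  have "expectation (\<lambda>\<omega>. exp (- l * scaled_variance \<omega>)) \<le> expectation (\<lambda>\<omega>. \<Sum>\<pi>\<in>?Per. 1 / ?N * exp (- l * ?W \<pi> \<omega>))"
  proof (rule expectation_mono_bdd[OF int])
    show "integrable M (\<lambda>\<omega>. \<Sum>\<pi>\<in>?Per. 1 / ?N * exp (- l * ?W \<pi> \<omega>))"
      by (intro Bochner_Integration.integrable_sum integrable_mult_right mg(2))
    fix \<omega>
    have "(\<Sum>\<pi>\<in>?Per. ?W \<pi> \<omega>) = ?N * scaled_variance \<omega>"
      using P by (intro scaled_variance_average) auto
    then have "scaled_variance \<omega> = 1 / ?N * (\<Sum>\<pi>\<in>?Per. ?W \<pi> \<omega>)" using N by simp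
    then have "- l * scaled_variance \<omega> = (\<Sum>\<pi>\<in>?Per. (1 / ?N) *\<^sub>R (- l * ?W \<pi> \<omega>))"
      by (simp only: sum_distrib_left real_scaleR_def mult_ac)
    then show "exp (- l * scaled_variance \<omega>) \<le> (\<Sum>\<pi>\<in>?Per. 1 / ?N * exp (- l * ?W \<pi> \<omega>))"
      using N by (simp only:) (rule convex_on_sum[OF fin ne exp_convex], auto)
  qed
  also have "\<dots> = (\<Sum>\<pi>\<in>?Per. 1 / ?N * expectation (\<lambda>\<omega>. exp (- l * ?W \<pi> \<omega>)))"
  proof (subst Bochner_Integration.integral_sum)
    show "integrable M (\<lambda>\<omega>. 1 / ?N * exp (- l * ?W \<pi> \<omega>))" if "\<pi> \<in> ?Per" for \<pi>
      by (intro integrable_mult_right mg(2) that)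
  qed simp
  also have "\<dots> \<le> (\<Sum>\<pi>\<in>?Per. 1 / ?N * ?e)"
    by (intro sum_mono mult_left_mono mg(1)) auto
  also have "\<dots> = ?e" using N by simp
  finally show "expectation (\<lambda>\<omega>. exp (- l * scaled_variance \<omega>)) \<le> ?e" .
qed

lemma sample_variance_eq: "sample_variance m (\<lambda>i. Z i \<omega>) = 2 / real m * scaled_variance \<omega>"
proof -
  have "(\<Sum>i=1..m. \<Sum>j=1..m. (Z i \<omega> - Z j \<omega>)\<^sup>2) = 2 * (\<Sum>j=1..m. \<Sum>i\<in>{1..<j}. (Z i \<omega> - Z j \<omega>)\<^sup>2)"
    by (rule sum_pairs_ordered) (auto simp: power2_commute)
  moreover have "1 / (a * k) * x = 2 / a * (2 * x / (4 * k))" for a k x :: real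
    by (simp add: divide_simps)
  ultimately show ?thesis
    unfolding sample_variance_def scaled_variance_def by (simp only:)
qed

abbreviation "mean_var \<equiv> (\<Sum>i=1..m. var_Z i) / real m"

text \<open>An exponential Markov bound for the negative scaled variance. Unless the event is empty,
  \<open>b * s\<close> is at most the true standard deviation \<open>w\<close>, and this puts the
  optimal \<open>l\<close> into the admissible range of \<open>mgf_scaled_variance\<close>.\<close>

lemma sample_variance_lower:
  assumes L: "0 < L"
  shows "prob {\<omega> \<in> space M. sqrt (sample_variance m (\<lambda>i. Z i \<omega>)) < sqrt mean_var - b * sqrt (2 * L / real m)} \<le> exp (- L)"
proof -
  define s where "s = sqrt (2 * L / real m)"
  define v where "v = mean_var"
  have m0: "0 < real m" using m2 by simp
  have s0: "0 < s" using L m0 by (simp add: s_def)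
  have s2: "real m * s\<^sup>2 = 2 * L" using L m0 by (simp add: s_def)
  have v0: "0 \<le> v" unfolding v_def by (intro divide_nonneg_nonneg sum_nonneg var_Z_nonneg) auto
  have V0: "0 \<le> sample_variance m (\<lambda>i. Z i \<omega>)" for \<omega>
    unfolding sample_variance_def using m2 by (intro mult_nonneg_nonneg sum_nonneg) auto
  let ?A = "{\<omega> \<in> space M. sqrt (sample_variance m (\<lambda>i. Z i \<omega>)) < sqrt v - b * s}"
  have "prob ?A \<le> exp (- L)"
  proof (cases "?A = {}")
    case True
    show ?thesis unfolding True by simp
  next
    case False
    then obtain \<omega>0 where \<omega>0: "sqrt (sample_variance m (\<lambda>i. Z i \<omega>0)) < sqrt v - b * s" by blast
    have bs: "b * s \<le> sqrt v"
      by (rule sqrt_diff_square_le(1)[OF V0 _ \<omega>0]) (use b_pos s0 in simp)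
    have w0: "0 < sqrt v" using bs b_pos s0 by (metis less_le_trans mult_pos_pos)
    define w where "w = sqrt v"
    have w: "0 < w" "v = w\<^sup>2" "b * s \<le> w" using w0 v0 bs by (auto simp: w_def)
    \<comment> \<open>Minimizes \<open>l^2 * b^2 * w^2 / 4 - l * b * s * w\<close>; the minimum is
      \<open>- s^2\<close>, which yields exactly \<open>- L\<close>.\<close>
    define l where "l = 2 * s / (b * w)"
    have l0: "0 \<le> l" using s0 b_pos w by (simp add: l_def)
    have "l * b\<^sup>2 = 2 * (b * s) / w" using b_pos w by (simp add: l_def power2_eq_square)
    also have "\<dots> \<le> 4" using w by (simp add: divide_le_eq)
    finally have lb: "l * b\<^sup>2 \<le> 4" .
    let ?x = "real m / 2 * (v - b * s * w)"
    have ms: "scaled_variance \<in> borel_measurable M" by (rule mgf_scaled_variance(3)[OF l0 lb])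
    have mset: "{\<omega> \<in> space M. - l * ?x \<le> - l * scaled_variance \<omega>} \<in> sets M"
      by (intro borel_measurable_le borel_measurable_times borel_measurable_const ms)
    have sub: "?A \<subseteq> {\<omega> \<in> space M. - l * ?x \<le> - l * scaled_variance \<omega>}"
    proof clarify
      fix \<omega> assume "sqrt (sample_variance m (\<lambda>i. Z i \<omega>)) < sqrt v - b * s"
      then have "sample_variance m (\<lambda>i. Z i \<omega>) \<le> v - b * s * w"
        unfolding w_def by (rule sqrt_diff_square_le(2)[OF V0, rotated]) (use b_pos s0 in simp)
      then have "scaled_variance \<omega> \<le> ?x"
        unfolding sample_variance_eq using m0 by (simp add: field_simps)
      then show "- l * ?x \<le> - l * scaled_variance \<omega>"
        using mult_left_mono[OF _ l0, of "scaled_variance \<omega>" ?x] by (simp only: mult_minus_left neg_le_iff_le)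
    qed
    have "prob ?A \<le> prob {\<omega> \<in> space M. - l * ?x \<le> - l * scaled_variance \<omega>}"
      using sub mset by (rule finite_measure_mono)
    also have "\<dots> \<le> expectation (\<lambda>\<omega>. exp (- l * scaled_variance \<omega>)) * exp (- (- l * ?x))"
      by (intro markov_exp mgf_scaled_variance(2)[OF l0 lb] borel_measurable_times borel_measurable_const ms)
    also have "\<dots> \<le> exp (- (l - l\<^sup>2 * b\<^sup>2 / 4) / 2 * (\<Sum>i=1..m. var_Z i)) * exp (- (- l * ?x))"
      by (intro mult_right_mono mgf_scaled_variance(1)[OF l0 lb]) simp
    also have "\<dots> = exp (- L)"
    proof -
      have "(\<Sum>i=1..m. var_Z i) = real m * w\<^sup>2" using m0 w(2) by (simp add: v_def field_simps)
      then have "- (l - l\<^sup>2 * b\<^sup>2 / 4) / 2 * (\<Sum>i=1..m. var_Z i) + - (- l * ?x) = real m / 2 * (l\<^sup>2 * b\<^sup>2 * w\<^sup>2 / 4 - l * b * s * w)"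
        by (simp add: w(2) field_simps)
      also have "l\<^sup>2 * b\<^sup>2 * w\<^sup>2 / 4 = s\<^sup>2"
        using b_pos w by (simp add: l_def power_divide power_mult_distrib)
      also have "l * b * s * w = 2 * s\<^sup>2"
        using b_pos w by (simp add: l_def power2_eq_square)
      also have "real m / 2 * (s\<^sup>2 - 2 * s\<^sup>2) = - L" using s2 by simp
      finally show ?thesis by (simp only: exp_add[symmetric])
    qed
    finally show ?thesis .
  qed
  then show ?thesis by (simp only: v_def s_def)
qed

text \<open>Half of \<open>\<delta>\<close> is spent on Bernstein's inequality with the true
  variance, half on replacing that variance by the sample variance. The replacement costs
  \<open>b * s * s = 2 * b * L / m\<close>; together with \<open>b * L / (3 * m)\<close> this makes
  the constant \<open>7 / 3\<close>, and passing from \<open>m\<close> to \<open>m - 1\<close> only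
  enlarges the term.\<close>

theorem empirical_bernstein:
  assumes \<delta>: "0 < \<delta>" "\<delta> < 1"
  shows "prob {\<omega> \<in> space M. (\<Sum>i=1..m. Z i \<omega>) / real m
            + sqrt (sample_variance m (\<lambda>i. Z i \<omega>)) * sqrt (2 * ln (2 / \<delta>) / real m)
            + 7 * b * ln (2 / \<delta>) / (3 * (real m - 1)) < (\<Sum>i=1..m. EZ i) / real m} \<le> \<delta>"
    (is "prob ?E \<le> \<delta>")
proof -
  define L where "L = ln (2 / \<delta>)"
  have L: "0 < L" "exp (- L) = \<delta> / 2" using \<delta> by (simp_all add: L_def exp_minus)
  have m0: "0 < real m" "0 < real m - 1" using m2 by auto
  define s where "s = sqrt (2 * L / real m)"
  have s0: "0 \<le> s" using L m0 by (simp add: s_def)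
  have s2: "s * s = 2 * L / real m" using L m0 by (simp add: s_def)
  let ?S = "\<Sum>i=1..m. var_Z i"
  let ?A = "{\<omega> \<in> space M. sqrt (2 * ?S * L) + b / 3 * L \<le> (\<Sum>i=1..m. EZ i - Z i \<omega>)}"
  let ?B = "{\<omega> \<in> space M. sqrt (sample_variance m (\<lambda>i. Z i \<omega>)) < sqrt mean_var - b * s}"
  have mA: "?A \<in> sets M"
    by (intro borel_measurable_le borel_measurable_sum borel_measurable_diff borel_measurable_const measZ)
  have mB: "?B \<in> sets M"
  proof -
    have "(\<lambda>\<omega>. sqrt (2 / real m * scaled_variance \<omega>)) \<in> borel_measurable M"
      by (intro borel_measurable_sqrt[THEN measurable_compose[rotated]] borel_measurable_times borel_measurable_const mgf_scaled_variance(3)[of 0]) simp_all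
    then show ?thesis
      unfolding sample_variance_eq by (intro borel_measurable_less borel_measurable_const)
  qed
  have "?E \<subseteq> ?A \<union> ?B"
  proof (rule subsetI, rule ccontr)
    fix \<omega> assume E: "\<omega> \<in> ?E" and n: "\<omega> \<notin> ?A \<union> ?B"
    let ?V = "sample_variance m (\<lambda>i. Z i \<omega>)"
    from E n have 1: "(\<Sum>i=1..m. EZ i - Z i \<omega>) < sqrt (2 * ?S * L) + b / 3 * L"
      and 2: "sqrt mean_var \<le> sqrt ?V + b * s" by auto
    have e: "sqrt (2 * ?S * L) = real m * (s * sqrt mean_var)"
    proof (rule real_sqrt_unique)
      have "0 \<le> mean_var" by (intro divide_nonneg_nonneg sum_nonneg var_Z_nonneg) auto
      have "(real m * (s * sqrt mean_var))\<^sup>2 = (real m)\<^sup>2 * (s * s) * (sqrt mean_var)\<^sup>2"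
        by (simp add: power2_eq_square mult_ac)
      also have "\<dots> = 2 * ?S * L"
        unfolding s2 real_sqrt_pow2[OF \<open>0 \<le> mean_var\<close>] using m0 by (simp add: power2_eq_square)
      finally show "(real m * (s * sqrt mean_var))\<^sup>2 = 2 * ?S * L" .
      show "0 \<le> real m * (s * sqrt mean_var)" using s0 \<open>0 \<le> mean_var\<close> by simp
    qed
    have "(\<Sum>i=1..m. EZ i) / real m - (\<Sum>i=1..m. Z i \<omega>) / real m < s * sqrt mean_var + b * L / (3 * real m)"
    proof -
      have "((\<Sum>i=1..m. EZ i) - (\<Sum>i=1..m. Z i \<omega>)) / real m < (real m * (s * sqrt mean_var) + b / 3 * L) / real m"
        using 1 unfolding e sum_subtractf by (rule divide_strict_right_mono[OF _ m0(1)])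
      then show ?thesis
        using m0 by (simp add: add_divide_distrib diff_divide_distrib)
    qed
    also have "\<dots> \<le> s * (sqrt ?V + b * s) + b * L / (3 * real m)"
      using 2 s0 by (intro add_right_mono mult_left_mono)
    also have "\<dots> = sqrt ?V * s + 7 * b * L / (3 * real m)"
    proof -
      have "s * (sqrt ?V + b * s) = sqrt ?V * s + b * (s * s)" by (simp add: algebra_simps)
      then show ?thesis unfolding s2 using m0 by (simp add: field_simps)
    qed
    also have "7 * b * L / (3 * real m) \<le> 7 * b * L / (3 * (real m - 1))"
      using m0 b_pos L by (intro divide_left_mono) auto
    finally show False
      using E by (simp add: L_def[symmetric] s_def[symmetric])
  qed
  then have "prob ?E \<le> prob (?A \<union> ?B)"
    using mA mB by (intro finite_measure_mono) auto
  also have "\<dots> \<le> prob ?A + prob ?B"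
    using mA mB by (intro measure_Un_le)
  also have "\<dots> \<le> exp (- L) + exp (- L)"
    unfolding s_def by (intro add_mono bernstein_lower sample_variance_lower L)
  also have "\<dots> = \<delta>" using L by simp
  finally show ?thesis .
qed

end

section \<open>Orthonormal bases and traces\<close>

lemma nonneg_summable_onI:
  fixes f :: "'i \<Rightarrow> real"
  assumes "\<And>x. x \<in> A \<Longrightarrow> 0 \<le> f x" "\<And>F. finite F \<Longrightarrow> F \<subseteq> A \<Longrightarrow> sum f F \<le> L"
  shows "f summable_on A" "infsum f A \<le> L"
proof -
  show s: "f summable_on A"
    using assms by (intro nonneg_bdd_above_summable_on) (auto intro!: bdd_aboveI)
  show "infsum f A \<le> L"
    using assms by (intro infsum_le_finite_sums s) auto
qed

lemma has_sum_sumI: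
  fixes f :: "'i \<Rightarrow> 'j \<Rightarrow> 'b::topological_comm_monoid_add"
  assumes "\<And>i. i \<in> I \<Longrightarrow> (f i has_sum t i) A"
  shows "((\<lambda>x. \<Sum>i\<in>I. f i x) has_sum (\<Sum>i\<in>I. t i)) A"
  using assms by (induction I rule: infinite_finite_induct) (auto intro!: has_sum_add)

context hilbert_space
begin

definition orthonormal where
  "orthonormal S \<longleftrightarrow> (\<forall>e\<in>S. \<forall>f\<in>S. ip e f = (if e = f then 1 else 0))"

lemma orthonormalD: "orthonormal S \<Longrightarrow> e \<in> S \<Longrightarrow> f \<in> S \<Longrightarrow> ip e f = (if e = f then 1 else 0)"
  unfolding orthonormal_def by (drule (1) bspec) (erule (1) bspec)

lemma onb_iff: "onb ip E \<longleftrightarrow> orthonormal E \<and> (\<forall>x. (\<forall>e\<in>E. ip x e = 0) \<longrightarrow> x = 0)"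
  unfolding onb_def orthonormal_def ..

lemma orthonormal_subset: "orthonormal E \<Longrightarrow> F \<subseteq> E \<Longrightarrow> orthonormal F"
  unfolding orthonormal_def[of F] by (intro ballI orthonormalD[of E]) (simp_all add: subset_iff)

lemma onb_orthonormal: "onb ip E \<Longrightarrow> F \<subseteq> E \<Longrightarrow> orthonormal F"
  unfolding onb_iff by (erule conjE) (rule orthonormal_subset)

lemma finite_onset_axI: "finite F \<Longrightarrow> orthonormal F \<Longrightarrow> finite_onset K scale ip F"
  by (intro finite_onset.intro hilbert_space_axioms finite_onset_axioms.intro orthonormalD)

text \<open>A maximal orthonormal set is complete by Zorn's lemma. Existence matters for the notion
  of trace: over an empty family of bases every number would satisfy
  \<open>has_trace\<close>.\<close>

lemma ex_onb: "\<exists>E. onb ip E"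
proof -
  have "\<exists>E\<in>{S. orthonormal S}. \<forall>X\<in>{S. orthonormal S}. E \<subseteq> X \<longrightarrow> X = E"
  proof (rule subset_Zorn')
    fix \<C> assume c: "subset.chain {S. orthonormal S} \<C>"
    show "\<Union>\<C> \<in> {S. orthonormal S}"
      unfolding mem_Collect_eq orthonormal_def
    proof (intro ballI)
      fix e f assume "e \<in> \<Union>\<C>" "f \<in> \<Union>\<C>"
      then obtain S T where ST: "S \<in> \<C>" "T \<in> \<C>" "e \<in> S" "f \<in> T" by blast
      then have "S \<subseteq> T \<or> T \<subseteq> S" using c unfolding subset_chain_def by blast
      then obtain U where "U \<in> \<C>" "e \<in> U" "f \<in> U" using ST by blast
      moreover from this have "orthonormal U" using c unfolding subset_chain_def by blast
      ultimately show "ip e f = (if e = f then 1 else 0)"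
        by (intro orthonormalD)
    qed
  qed
  then obtain E where E: "orthonormal E" and max: "\<And>X. orthonormal X \<Longrightarrow> E \<subseteq> X \<Longrightarrow> X = E" by blast
  have "x = 0" if x: "\<forall>e\<in>E. ip x e = 0" for x
  proof (rule ccontr)
    assume nz: "x \<noteq> 0"
    define u where "u = (1 / norm x) *\<^sub>R x"
    have uE: "ip u e = 0" "ip e u = 0" if "e \<in> E" for e
    proof -
      show 1: "ip u e = 0" using x that by (simp add: u_def ip_scaleR_left)
      show "ip e u = 0" by (subst ip_cnj) (simp add: 1)
    qed
    have uu: "ip u u = 1" using nz by (simp add: ip_self u_def)
    have "orthonormal (insert u E)"
      unfolding orthonormal_def
    proof (intro ballI)
      fix e f assume "e \<in> insert u E" "f \<in> insert u E"
      then show "ip e f = (if e = f then 1 else 0)"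
      proof (elim insertE)
        assume "e = u" "f \<in> E"
        then show ?thesis using uE(1)[of f] uE(1)[of u] uu by (cases "e = f") simp_all
      next
        assume "e \<in> E" "f = u"
        then show ?thesis using uE(2)[of e] uE(2)[of u] uu by (cases "e = f") simp_all
      next
        assume "e \<in> E" "f \<in> E"
        then show ?thesis by (rule orthonormalD[OF E])
      qed (simp add: uu)
    qed
    then have "u \<in> E" using max by blast
    then show False using uE(1)[of u] uu by simp
  qed
  then show ?thesis unfolding onb_iff using E by (intro exI[of _ E] conjI allI impI)
qed

text \<open>Distinct basis vectors are at distance \<open>sqrt 2\<close>, so the balls of radius one
  half around them are disjoint, and a separable space has only countably many disjoint nonempty
  open sets.\<close>

lemma countable_onb: assumes "onb ip E" shows "countable E"
proof -
  have d: "1 < dist e f" if "e \<in> E" "f \<in> E" "e \<noteq> f" for e f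
  proof -
    have ip: "ip e e = 1" "ip f f = 1" "ip e f = 0"
      using orthonormalD[OF onb_orthonormal[OF assms order_refl]] that by simp_all
    have "(dist e f)\<^sup>2 = (e - f) \<bullet> (e - f)" by (simp add: dist_norm power2_norm_eq_inner)
    also have "\<dots> = Re (ip (e - f) (e - f))" by (simp add: ip_Re)
    also have "\<dots> = 2" using ip ip_cnj[of e f] by (simp add: ip_diff_left ip_diff_right)
    finally have "1\<^sup>2 < (dist e f)\<^sup>2" by simp
    then show ?thesis by (rule power2_less_imp_less) simp
  qed
  have "countable ((\<lambda>e. ball e (1/2)) ` E)"
  proof (rule countable_disjoint_open_subsets)
    show "disjoint ((\<lambda>e. ball e (1/2)) ` E)"
    proof (rule disjointI)
      fix a b assume "a \<in> (\<lambda>e. ball e (1/2)) ` E" "b \<in> (\<lambda>e. ball e (1/2)) ` E" "a \<noteq> b"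
      then obtain e f where ef: "e \<in> E" "f \<in> E" "a = ball e (1/2)" "b = ball f (1/2)" "e \<noteq> f" by auto
      show "a \<inter> b = {}"
      proof (rule ccontr)
        assume "a \<inter> b \<noteq> {}"
        then obtain z where "dist e z < 1/2" "dist f z < 1/2" using ef by auto
        then show False using dist_triangle2[of e f z] d[OF ef(1,2,5)] by simp
      qed
    qed
  qed auto
  moreover have "inj_on (\<lambda>e. ball e (1/2)) E"
  proof (rule inj_onI, rule ccontr)
    fix e f assume ef: "e \<in> E" "f \<in> E" "ball e (1/2) = ball f (1/2)" "e \<noteq> f"
    have "e \<in> ball e (1/2)" by simp
    then have "e \<in> ball f (1/2)" using ef(3) by blast
    then show False using d[OF ef(2,1)] ef(4) by (simp add: dist_commute)
  qed
  ultimately show ?thesis by (rule countable_image_inj_on)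
qed

text \<open>Initial segments of a fixed enumeration; they turn unordered sums into limits of
  sequences, which preserve measurability.\<close>

definition fin_part :: "'a set \<Rightarrow> nat \<Rightarrow> 'a set" where
  "fin_part E k = {e \<in> E. to_nat_on E e < k}"

lemma fin_part_subset: "fin_part E k \<subseteq> E" and fin_part_mono: "k \<le> l \<Longrightarrow> fin_part E k \<subseteq> fin_part E l"
  by (auto simp: fin_part_def)

lemma finite_fin_part: assumes "countable E" shows "finite (fin_part E k)"
proof (rule finite_imageD)
  show "finite (to_nat_on E ` fin_part E k)"
    by (rule finite_subset[of _ "{..<k}"]) (auto simp: fin_part_def)
  show "inj_on (to_nat_on E) (fin_part E k)"
    using inj_on_to_nat_on[OF assms] fin_part_subset by (rule inj_on_subset)
qed

lemma eventually_fin_part: assumes "finite F" "F \<subseteq> E" shows "\<forall>\<^sub>F k in sequentially. F \<subseteq> fin_part E k"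
proof (rule eventually_sequentiallyI)
  fix k assume "Suc (\<Sum>e\<in>F. to_nat_on E e) \<le> k"
  then show "F \<subseteq> fin_part E k"
    using assms member_le_sum[of _ F "to_nat_on E"] by (fastforce simp: fin_part_def)
qed

lemma has_sum_fin_part:
  assumes "countable E" "(f has_sum t) E"
  shows "(\<lambda>k. sum f (fin_part E k)) \<longlonglongrightarrow> t"
proof -
  have "filterlim (fin_part E) (finite_subsets_at_top E) sequentially"
    unfolding filterlim_finite_subsets_at_top
    using eventually_fin_part finite_fin_part[OF assms(1)] fin_part_subset
    by (auto elim!: eventually_mono)
  then show ?thesis
    using assms(2) unfolding has_sum_def by (rule filterlim_compose[rotated])
qed

abbreviation pr where "pr \<equiv> finite_onset.prj scale ip"

context
  fixes E :: "'a set"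
  assumes E: "onb ip E"
begin

lemma finite_onset_subset: "finite F \<Longrightarrow> F \<subseteq> E \<Longrightarrow> finite_onset K scale ip F"
  by (intro finite_onset_axI onb_orthonormal[OF E])

lemma finite_onset_subset_part: "finite_onset K scale ip (fin_part E k)"
  by (intro finite_onset_subset finite_fin_part countable_onb E fin_part_subset)

lemma bessel: "finite F \<Longrightarrow> F \<subseteq> E \<Longrightarrow> (\<Sum>e\<in>F. (cmod (ip x e))\<^sup>2) \<le> (norm x)\<^sup>2"
  using finite_onset.norm_prj_sq[OF finite_onset_subset] finite_onset.norm_prj_le[OF finite_onset_subset] by (metis power_mono norm_ge_zero)

text \<open>By Pythagoras the projections are as Cauchy as their squared norms, which converge by
  Bessel's inequality. The defect of the limit is orthogonal to the whole basis, hence zero.\<close>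

lemma pr_tendsto: "(\<lambda>k. pr (fin_part E k) x) \<longlonglongrightarrow> x"
proof -
  let ?p = "\<lambda>k. pr (fin_part E k) x"
  have sm: "(\<lambda>e. (cmod (ip x e))\<^sup>2) summable_on E"
    by (rule nonneg_summable_onI(1)[of _ _ "(norm x)\<^sup>2"]) (auto intro: bessel)
  have "(\<lambda>k. \<Sum>e\<in>fin_part E k. (cmod (ip x e))\<^sup>2) \<longlonglongrightarrow> infsum (\<lambda>e. (cmod (ip x e))\<^sup>2) E"
    by (intro has_sum_fin_part countable_onb E has_sum_infsum sm)
  then have cn: "Cauchy (\<lambda>k. (norm (?p k))\<^sup>2)"
    unfolding finite_onset.norm_prj_sq[OF finite_onset_subset_part] by (rule LIMSEQ_imp_Cauchy)
  have diff: "(norm (?p l - ?p k))\<^sup>2 = (norm (?p l))\<^sup>2 - (norm (?p k))\<^sup>2" if "k \<le> l" for k l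
  proof -
    interpret k: finite_onset K scale ip "fin_part E k" by (rule finite_onset_subset_part)
    interpret l: finite_onset K scale ip "fin_part E l" by (rule finite_onset_subset_part)
    have "l.prj (k.prj x) = (\<Sum>e\<in>fin_part E k. l.prj (scale (ip x e) e))"
      unfolding k.prj_def by (rule l.prj_sum)
    also have "\<dots> = k.prj x"
      unfolding k.prj_def by (rule sum.cong[OF refl]) (simp add: l.prj_scale l.prj_basis subsetD[OF fin_part_mono[OF that]])
    finally have "l.prj x \<bullet> k.prj x = x \<bullet> k.prj x" by (simp add: l.inner_prj)
    moreover have "x \<bullet> k.prj x = k.prj x \<bullet> k.prj x" by (simp add: k.inner_prj)
    ultimately show ?thesis
      by (simp add: power2_norm_eq_inner inner_diff_left inner_diff_right inner_commute[of "k.prj x" "l.prj x"])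
  qed
  have "Cauchy ?p"
  proof (rule metric_CauchyI)
    fix \<epsilon> :: real assume \<epsilon>: "0 < \<epsilon>"
    then have "0 < \<epsilon>\<^sup>2" by simp
    from metric_CauchyD[OF cn this] obtain N where
      N: "\<And>a b. a \<ge> N \<Longrightarrow> b \<ge> N \<Longrightarrow> dist ((norm (?p a))\<^sup>2) ((norm (?p b))\<^sup>2) < \<epsilon>\<^sup>2" by blast
    have *: "dist (?p l) (?p k) < \<epsilon>" if "N \<le> k" "k \<le> l" for k l
    proof (rule power2_less_imp_less)
      have "(dist (?p l) (?p k))\<^sup>2 = (norm (?p l))\<^sup>2 - (norm (?p k))\<^sup>2"
        using diff[OF that(2)] by (simp add: dist_norm)
      also have "\<dots> < \<epsilon>\<^sup>2" using N[of l k] that by (simp add: dist_real_def)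
      finally show "(dist (?p l) (?p k))\<^sup>2 < \<epsilon>\<^sup>2" .
    qed (use \<epsilon> in simp)
    show "\<exists>N. \<forall>a\<ge>N. \<forall>b\<ge>N. dist (?p a) (?p b) < \<epsilon>"
      using * by (metis dist_commute nle_le)
  qed
  then obtain y where y: "?p \<longlonglongrightarrow> y" using Cauchy_convergent convergent_def by blast
  have "ip (x - y) e = 0" if e: "e \<in> E" for e
  proof -
    have "(\<lambda>k. ip x e - ip (?p k) e) \<longlonglongrightarrow> 0"
    proof (rule Lim_transform_eventually)
      show "(\<lambda>k. 0 :: complex) \<longlonglongrightarrow> 0" by simp
      have "\<forall>\<^sub>F k in sequentially. {e} \<subseteq> fin_part E k" using e by (intro eventually_fin_part) auto
      then show "\<forall>\<^sub>F k in sequentially. 0 = ip x e - ip (?p k) e"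
        by (rule eventually_mono) (simp add: finite_onset.ip_prj_basis[OF finite_onset_subset_part])
    qed
    moreover have "(\<lambda>k. ip x e - ip (?p k) e) \<longlonglongrightarrow> ip (x - y) e"
    proof (rule LIM_zero_cancel, rule Lim_null_comparison)
      have "norm (ip x e - ip (?p k) e - ip (x - y) e) \<le> norm (y - ?p k) * norm e" for k
        using cmod_ip_le[of "y - ?p k" e] by (simp add: ip_diff_left)
      then show "\<forall>\<^sub>F k in sequentially. norm (ip x e - ip (?p k) e - ip (x - y) e) \<le> norm (y - ?p k) * norm e"
        by simp
      have "(\<lambda>k. norm (y - ?p k) * norm e) \<longlonglongrightarrow> norm (y - y) * norm e"
        by (intro tendsto_intros y)
      then show "(\<lambda>k. norm (y - ?p k) * norm e) \<longlonglongrightarrow> 0" by simp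
    qed
    ultimately show ?thesis by (rule LIMSEQ_unique[symmetric])
  qed
  then have "x - y = 0" using E unfolding onb_def by blast
  then show ?thesis using y by simp
qed

lemma parseval: "((\<lambda>e. (cmod (ip x e))\<^sup>2) has_sum (norm x)\<^sup>2) E"
proof -
  have sm: "(\<lambda>e. (cmod (ip x e))\<^sup>2) summable_on E"
    by (rule nonneg_summable_onI(1)[of _ _ "(norm x)\<^sup>2"]) (auto intro: bessel)
  then have "(\<lambda>k. \<Sum>e\<in>fin_part E k. (cmod (ip x e))\<^sup>2) \<longlonglongrightarrow> infsum (\<lambda>e. (cmod (ip x e))\<^sup>2) E"
    by (intro has_sum_fin_part countable_onb E has_sum_infsum)
  moreover have "(\<lambda>k. \<Sum>e\<in>fin_part E k. (cmod (ip x e))\<^sup>2) \<longlonglongrightarrow> (norm x)\<^sup>2"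
    unfolding finite_onset.norm_prj_sq[OF finite_onset_subset_part, symmetric] by (intro tendsto_intros pr_tendsto)
  ultimately show ?thesis using has_sum_infsum[OF sm] LIMSEQ_unique by metis
qed

end

lemma HS_le:
  assumes E: "onb ip E" "onb ip E'" and D: "\<And>x y. ip (D x) y = ip x (D' y)"
    and t: "((\<lambda>e. (norm (D e))\<^sup>2) has_sum t) E" and F: "finite F" "F \<subseteq> E'"
  shows "(\<Sum>f\<in>F. (norm (D' f))\<^sup>2) \<le> t"
proof -
  have "((\<lambda>e. \<Sum>f\<in>F. (cmod (ip (D' f) e))\<^sup>2) has_sum (\<Sum>f\<in>F. (norm (D' f))\<^sup>2)) E"
    by (intro has_sum_sumI parseval E)
  then show ?thesis
  proof (rule has_sum_mono[OF _ t])
    fix e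
    have "cmod (ip (D' f) e) = cmod (ip (D e) f)" for f
      by (metis D complex_mod_cnj ip_cnj)
    then show "(\<Sum>f\<in>F. (cmod (ip (D' f) e))\<^sup>2) \<le> (norm (D e))\<^sup>2"
      using bessel[OF E(2) F] by simp
  qed
qed

text \<open>Parseval makes either side a double sum of \<open>cmod (ip (D e) f)\<close> squared.
  Allowing two bases gives in one stroke the invariance under adjoints and, for self-adjoint maps,
  under a change of basis.\<close>

lemma HS_adjoint:
  assumes E: "onb ip E" "onb ip E'" and D: "\<And>x y. ip (D x) y = ip x (D' y)"
    and t: "((\<lambda>e. (norm (D e))\<^sup>2) has_sum t) E"
  shows "((\<lambda>e. (norm (D' e))\<^sup>2) has_sum t) E'"
proof -
  note S = nonneg_summable_onI[of E' "\<lambda>f. (norm (D' f))\<^sup>2" t, OF _ HS_le[OF E D t]]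
  have s: "(\<lambda>f. (norm (D' f))\<^sup>2) summable_on E'" by (rule S(1)) auto
  have le: "infsum (\<lambda>f. (norm (D' f))\<^sup>2) E' \<le> t" by (rule S(2)) auto
  have D': "ip (D' x) y = ip x (D y)" for x y by (metis D complex_cnj_cnj ip_cnj)
  have "infsum (\<lambda>e. (norm (D e))\<^sup>2) E \<le> infsum (\<lambda>f. (norm (D' f))\<^sup>2) E'"
    by (rule nonneg_summable_onI(2)[OF _ HS_le[OF E(2,1) D' has_sum_infsum[OF s]]]) auto
  then have "t \<le> infsum (\<lambda>f. (norm (D' f))\<^sup>2) E'" using infsumI[OF t] by simp
  with le show ?thesis using has_sum_infsum[OF s] by simp
qed

text \<open>Polarization of \<open>HS_adjoint\<close>. It expresses the cyclic property of the real
  part of the trace for a product of two Hilbert-Schmidt operators.\<close>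

lemma HS_pairing:
  assumes E: "onb ip E" and A: "\<And>x y. ip (A x) y = ip x (A' y)" and B: "\<And>x y. ip (B x) y = ip x (B' y)"
    and sA: "(\<lambda>e. (norm (A e))\<^sup>2) summable_on E" and sB: "(\<lambda>e. (norm (B e))\<^sup>2) summable_on E"
  shows "\<exists>t. ((\<lambda>e. A e \<bullet> B e) has_sum t) E \<and> ((\<lambda>e. A' e \<bullet> B' e) has_sum t) E"
proof -
  have bnd: "(norm (A e + s *\<^sub>R B e))\<^sup>2 \<le> 2 * (norm (A e))\<^sup>2 + 2 * (norm (B e))\<^sup>2" if "\<bar>s\<bar> = 1" for s e
  proof -
    have "0 \<le> (norm (A e - s *\<^sub>R B e))\<^sup>2" by simp
    moreover have "(norm (A e + s *\<^sub>R B e))\<^sup>2 + (norm (A e - s *\<^sub>R B e))\<^sup>2 = 2 * (norm (A e))\<^sup>2 + 2 * (s * s) * (norm (B e))\<^sup>2"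
      by (simp add: power2_norm_eq_inner inner_add_left inner_add_right inner_diff_left inner_diff_right inner_commute)
    moreover have "s * s = 1" using that by (metis abs_mult_self_eq mult_1)
    then have "2 * (s * s) * (norm (B e))\<^sup>2 = 2 * (norm (B e))\<^sup>2" by simp
    ultimately show ?thesis by linarith
  qed
  have sm: "(\<lambda>e. (norm (A e + s *\<^sub>R B e))\<^sup>2) summable_on E" if "\<bar>s\<bar> = 1" for s
    by (rule summable_on_comparison_test[where f = "\<lambda>e. 2 * (norm (A e))\<^sup>2 + 2 * (norm (B e))\<^sup>2"])
      (intro summable_on_add summable_on_cmult_right sA sB bnd[OF that] zero_le_power2)+
  define p where "p = infsum (\<lambda>e. (norm (A e + 1 *\<^sub>R B e))\<^sup>2) E"
  define q where "q = infsum (\<lambda>e. (norm (A e + (-1) *\<^sub>R B e))\<^sup>2) E"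
  have P: "((\<lambda>e. (norm (A e + 1 *\<^sub>R B e))\<^sup>2) has_sum p) E" unfolding p_def by (intro has_sum_infsum sm) simp
  have Q: "((\<lambda>e. (norm (A e + (-1) *\<^sub>R B e))\<^sup>2) has_sum q) E" unfolding q_def by (intro has_sum_infsum sm) simp
  have ad: "ip (A x + s *\<^sub>R B x) y = ip x (A' y + s *\<^sub>R B' y)" for s x y
    using A B by (simp add: ip_add_left ip_add_right ip_scaleR_left ip_scaleR_right)
  note P' = HS_adjoint[OF E E ad P] and Q' = HS_adjoint[OF E E ad Q]
  have pol: "u \<bullet> v = ((norm (u + 1 *\<^sub>R v))\<^sup>2 + (-1) * (norm (u + (-1) *\<^sub>R v))\<^sup>2) * (1/4)" for u v :: 'a
    by (simp add: power2_norm_eq_inner inner_add_left inner_add_right inner_diff_left inner_diff_right inner_commute)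
  show ?thesis
    unfolding pol by (intro exI[of _ "(p + (-1) * q) * (1/4)"] conjI has_sum_cmult_left has_sum_add has_sum_cmult_right P Q P' Q')
qed

lemma has_trace_unique: "has_trace ip A t \<Longrightarrow> op_trace ip A = t"
proof -
  assume t: "has_trace ip A t"
  obtain E where E: "onb ip E" using ex_onb by blast
  show ?thesis
    unfolding op_trace_def
  proof (rule the_equality)
    show "has_trace ip A t" by (rule t)
    fix s assume "has_trace ip A s"
    then have "((\<lambda>e. ip (blinfun_apply A e) e) has_sum complex_of_real s) E" using E by (simp add: has_trace_def)
    moreover have "((\<lambda>e. ip (blinfun_apply A e) e) has_sum complex_of_real t) E" using t E by (simp add: has_trace_def)
    ultimately show "s = t" using has_sum_unique of_real_eq_iff by blast
  qed
qed

lemma ip_op_sq: "self_adjoint ip D \<Longrightarrow> ip (blinfun_apply (op_sq D) e) e = complex_of_real ((norm (blinfun_apply D e))\<^sup>2)"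
  unfolding op_sq_def self_adjoint_def ip_self[symmetric] by simp

lemma has_trace_op_sq:
  assumes D: "self_adjoint ip D" and E: "onb ip E" and t: "((\<lambda>e. (norm (blinfun_apply D e))\<^sup>2) has_sum t) E"
  shows "has_trace ip (r *\<^sub>R op_sq D) (r * t)"
  unfolding has_trace_def
proof (intro allI impI)
  fix E' assume E': "onb ip E'"
  have "((\<lambda>e. (norm (blinfun_apply D e))\<^sup>2) has_sum t) E'"
    using D by (intro HS_adjoint[OF E E' _ t]) (auto simp: self_adjoint_def)
  then have "((\<lambda>e. r * (norm (blinfun_apply D e))\<^sup>2) has_sum r * t) E'" by (rule has_sum_cmult_right)
  then have "((\<lambda>e. complex_of_real (r * (norm (blinfun_apply D e))\<^sup>2)) has_sum complex_of_real (r * t)) E'"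
    by (simp only: has_sum_of_real_iff)
  moreover have "ip (blinfun_apply (r *\<^sub>R op_sq D) e) e = complex_of_real (r * (norm (blinfun_apply D e))\<^sup>2)" for e
    by (simp add: blinfun.scaleR_left ip_scaleR_left ip_op_sq[OF D])
  ultimately show "((\<lambda>e. ip (blinfun_apply (r *\<^sub>R op_sq D) e) e) has_sum complex_of_real (r * t)) E'"
    by simp
qed

lemma trace_class_op_sq:
  assumes D: "self_adjoint ip D" and E: "onb ip E" and t: "trace_class ip (op_sq D)"
  shows "((\<lambda>e. (norm (blinfun_apply D e))\<^sup>2) has_sum op_trace ip (op_sq D)) E"
proof -
  obtain t where t: "has_trace ip (op_sq D) t" using t by (auto simp: trace_class_def)
  then have "((\<lambda>e. complex_of_real ((norm (blinfun_apply D e))\<^sup>2)) has_sum complex_of_real t) E"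
    using E by (simp add: has_trace_def ip_op_sq[OF D])
  then show ?thesis
    unfolding has_trace_unique[OF t] by (simp only: has_sum_of_real_iff)
qed

lemma has_trace_scaled_sum:
  assumes "\<And>i. i \<in> I \<Longrightarrow> has_trace ip (A i) (t i)"
  shows "has_trace ip (r *\<^sub>R (\<Sum>i\<in>I. A i)) (r * (\<Sum>i\<in>I. t i))"
  unfolding has_trace_def
proof (intro allI impI)
  fix E assume E: "onb ip E"
  have "((\<lambda>e. \<Sum>i\<in>I. ip (blinfun_apply (A i) e) e) has_sum (\<Sum>i\<in>I. complex_of_real (t i))) E"
    using assms E by (intro has_sum_sumI) (auto simp: has_trace_def)
  then have "((\<lambda>e. complex_of_real r * (\<Sum>i\<in>I. ip (blinfun_apply (A i) e) e)) has_sum complex_of_real r * (\<Sum>i\<in>I. complex_of_real (t i))) E"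
    by (rule has_sum_cmult_right)
  then show "((\<lambda>e. ip (blinfun_apply (r *\<^sub>R (\<Sum>i\<in>I. A i)) e) e) has_sum complex_of_real (r * (\<Sum>i\<in>I. t i))) E"
    by (simp add: blinfun.scaleR_left blinfun.sum_left ip_scaleR_left ip_sum_left)
qed

section \<open>Traces of paired operators\<close>

lemma self_adjoint_diff: "self_adjoint ip A \<Longrightarrow> self_adjoint ip B \<Longrightarrow> self_adjoint ip (A - B)"
  by (simp add: self_adjoint_def blinfun.diff_left ip_diff_left ip_diff_right)

lemma self_adjoint_sq: "self_adjoint ip A \<Longrightarrow> self_adjoint ip (r *\<^sub>R op_sq A)"
  by (simp add: self_adjoint_def op_sq_def blinfun.scaleR_left ip_scaleR_left ip_scaleR_right)

text \<open>The parallelogram inequality doubles the two Hilbert-Schmidt sums and the factor one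
  half undoes this. With both sums at most \<open>B\<close> the trace is at most
  \<open>2 * B\<close>, the range that appears in \<open>tau_u\<close>.\<close>

lemma has_trace_paired:
  assumes E: "onb ip E"
    and A: "self_adjoint ip A" and B: "self_adjoint ip B"
    and a: "((\<lambda>e. (norm (blinfun_apply A e))\<^sup>2) has_sum a) E" and b: "((\<lambda>e. (norm (blinfun_apply B e))\<^sup>2) has_sum b) E"
  shows "\<exists>t. ((\<lambda>e. (norm (blinfun_apply (A - B) e))\<^sup>2) has_sum 2 * t) E
           \<and> has_trace ip ((1/2) *\<^sub>R op_sq (A - B)) t \<and> 0 \<le> t \<and> t \<le> a + b"
proof -
  let ?f = "\<lambda>e. (norm (blinfun_apply (A - B) e))\<^sup>2"
  have le: "?f e \<le> 2 * (norm (blinfun_apply A e))\<^sup>2 + 2 * (norm (blinfun_apply B e))\<^sup>2" for e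
  proof -
    have "0 \<le> (norm (blinfun_apply A e + blinfun_apply B e))\<^sup>2" by simp
    then show ?thesis
      by (simp add: blinfun.diff_left power2_norm_eq_inner inner_add_left inner_add_right inner_diff_left inner_diff_right inner_commute)
  qed
  have ab: "((\<lambda>e. 2 * (norm (blinfun_apply A e))\<^sup>2 + 2 * (norm (blinfun_apply B e))\<^sup>2) has_sum 2 * a + 2 * b) E"
    by (intro has_sum_add has_sum_cmult_right a b)
  have s: "?f summable_on E"
    by (rule summable_on_comparison_test[OF has_sum_imp_summable[OF ab]]) (auto intro: le)
  define t where "t = infsum ?f E / 2"
  have t: "(?f has_sum 2 * t) E" using has_sum_infsum[OF s] by (simp add: t_def)
  have "2 * t \<le> 2 * a + 2 * b" by (rule has_sum_mono[OF t ab le])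
  moreover have "0 \<le> t" unfolding t_def by (intro divide_nonneg_nonneg infsum_nonneg) auto
  moreover have "has_trace ip ((1/2) *\<^sub>R op_sq (A - B)) (1/2 * (2 * t))"
    by (rule has_trace_op_sq[OF self_adjoint_diff[OF A B] E t])
  ultimately show ?thesis using t by (intro exI[of _ t]) simp
qed

text \<open>The mixed term is nonnegative because both operators are squares; without this the bound
  would be twice as large.\<close>

lemma has_trace_paired_sq:
  assumes E: "onb ip E"
    and D1: "self_adjoint ip D1" "norm D1 \<le> 2 * c" "((\<lambda>e. (norm (blinfun_apply D1 e))\<^sup>2) has_sum 2 * t1) E"
    and D2: "self_adjoint ip D2" "norm D2 \<le> 2 * c" "((\<lambda>e. (norm (blinfun_apply D2 e))\<^sup>2) has_sum 2 * t2) E"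
  defines "A1 \<equiv> (1/2) *\<^sub>R op_sq D1" and "A2 \<equiv> (1/2) *\<^sub>R op_sq D2"
  shows "\<exists>t. ((\<lambda>e. (norm (blinfun_apply (A1 - A2) e))\<^sup>2) has_sum 2 * t) E
           \<and> has_trace ip ((1/2) *\<^sub>R op_sq (A1 - A2)) t \<and> 0 \<le> t \<and> t \<le> c\<^sup>2 * (t1 + t2)"
proof -
  have sa: "self_adjoint ip A1" "self_adjoint ip A2"
    unfolding A1_def A2_def by (intro self_adjoint_sq D1 D2)+
  have A_le: "(norm (blinfun_apply ((1/2) *\<^sub>R op_sq D) e))\<^sup>2 \<le> c\<^sup>2 * (norm (blinfun_apply D e))\<^sup>2"
    if "norm D \<le> 2 * c" for D e
  proof -
    have "norm (blinfun_apply ((1/2) *\<^sub>R op_sq D) e) = norm (blinfun_apply D (blinfun_apply D e)) / 2"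
      by (simp add: op_sq_def blinfun.scaleR_left)
    also have "\<dots> \<le> c * norm (blinfun_apply D e)"
      using norm_blinfun[of D "blinfun_apply D e"] mult_right_mono[OF that, of "norm (blinfun_apply D e)"] by simp
    finally have "(norm (blinfun_apply ((1/2) *\<^sub>R op_sq D) e))\<^sup>2 \<le> (c * norm (blinfun_apply D e))\<^sup>2"
      by (rule power_mono) simp
    then show ?thesis by (simp only: power_mult_distrib)
  qed
  have S: "((\<lambda>e. c\<^sup>2 * (norm (blinfun_apply D1 e))\<^sup>2) has_sum c\<^sup>2 * (2 * t1)) E"
          "((\<lambda>e. c\<^sup>2 * (norm (blinfun_apply D2 e))\<^sup>2) has_sum c\<^sup>2 * (2 * t2)) E"
    by (intro has_sum_cmult_right D1(3) D2(3))+
  have s1: "(\<lambda>e. (norm (blinfun_apply A1 e))\<^sup>2) summable_on E"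
    unfolding A1_def by (rule summable_on_comparison_test[OF has_sum_imp_summable[OF S(1)]]) (auto intro: A_le D1)
  have s2: "(\<lambda>e. (norm (blinfun_apply A2 e))\<^sup>2) summable_on E"
    unfolding A2_def by (rule summable_on_comparison_test[OF has_sum_imp_summable[OF S(2)]]) (auto intro: A_le D2)
  obtain t where t: "((\<lambda>e. (norm (blinfun_apply (A1 - A2) e))\<^sup>2) has_sum 2 * t) E"
      "has_trace ip ((1/2) *\<^sub>R op_sq (A1 - A2)) t" "0 \<le> t"
    using has_trace_paired[OF E sa has_sum_infsum[OF s1] has_sum_infsum[OF s2]] by blast
  let ?D1 = "blinfun_apply D1" and ?D2 = "blinfun_apply D2" and ?A1 = "blinfun_apply A1"
  have b2: "(norm (?D2 (?A1 e)))\<^sup>2 \<le> (norm D2)\<^sup>2 * (norm (?A1 e))\<^sup>2" for e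
    using power_mono[OF norm_blinfun norm_ge_zero, of D2 "?A1 e" 2] by (simp add: power_mult_distrib)
  have s3: "(\<lambda>e. (norm (?D2 (?A1 e)))\<^sup>2) summable_on E"
    by (rule summable_on_comparison_test[OF summable_on_cmult_right[OF s1, of "(norm D2)\<^sup>2"]]) (auto intro: b2)
  have adA: "ip (?A1 x) y = ip x (?A1 y)" for x y
    using sa(1) unfolding self_adjoint_def by blast
  have adD: "ip (?D2 x) y = ip x (?D2 y)" for x y
    using D2(1) unfolding self_adjoint_def by blast
  have adDA: "ip (?D2 (?A1 x)) y = ip x (?A1 (?D2 y))" for x y
    by (simp only: adA adD)
  \<comment> \<open>\<open>u\<close> is twice the trace of \<open>A1\<close> times
    \<open>A2\<close>. The two expressions for it serve different ends: the first is the mixed term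
    of the square, the second is visibly nonnegative.\<close>
  obtain u where u: "((\<lambda>e. ?D2 (?A1 e) \<bullet> ?D2 e) has_sum u) E" "((\<lambda>e. ?A1 (?D2 e) \<bullet> ?D2 e) has_sum u) E"
    using HS_pairing[OF E adDA adD s3 has_sum_imp_summable[OF D2(3)]] by blast
  have "0 \<le> u"
  proof (rule has_sum_nonneg[OF u(2)])
    fix e
    have "?A1 (?D2 e) \<bullet> ?D2 e = (norm (?D1 (?D2 e)))\<^sup>2 / 2"
      using D1(1) by (simp add: A1_def op_sq_def blinfun.scaleR_left self_adjoint_inner power2_norm_eq_inner)
    then show "0 \<le> ?A1 (?D2 e) \<bullet> ?D2 e"
      using zero_le_power2[of "norm (?D1 (?D2 e))"] by linarith
  qed
  have eq: "(norm (blinfun_apply (A1 - A2) e))\<^sup>2 + ?D2 (?A1 e) \<bullet> ?D2 e = (norm (?A1 e))\<^sup>2 + (norm (blinfun_apply A2 e))\<^sup>2" for e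
  proof -
    have "?A1 e \<bullet> blinfun_apply A2 e = (?D2 (?A1 e) \<bullet> ?D2 e) / 2"
      using D2(1) by (simp add: A2_def op_sq_def blinfun.scaleR_left self_adjoint_inner)
    then show ?thesis
      by (simp add: blinfun.diff_left power2_norm_eq_inner inner_diff_left inner_diff_right inner_commute[of "blinfun_apply A2 e" "?A1 e"])
  qed
  have "2 * t + u \<le> c\<^sup>2 * (2 * t1) + c\<^sup>2 * (2 * t2)"
  proof (rule has_sum_mono[OF has_sum_add[OF t(1) u(1)] has_sum_add[OF S]])
    fix e
    show "(norm (blinfun_apply (A1 - A2) e))\<^sup>2 + ?D2 (?A1 e) \<bullet> ?D2 e \<le> c\<^sup>2 * (norm (?D1 e))\<^sup>2 + c\<^sup>2 * (norm (?D2 e))\<^sup>2"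
      unfolding eq unfolding A1_def A2_def by (intro add_mono A_le D1 D2)
  qed
  then have "t \<le> c\<^sup>2 * (t1 + t2)" using \<open>0 \<le> u\<close> by (simp add: distrib_left)
  then show ?thesis using t by blast
qed

end

section \<open>Bennett and Bernstein tails\<close>

text \<open>The claim is trivial unless \<open>2 * exp (a - r) < 1\<close>, and in that range passing from the
  hyperbolic cosine to the exponential costs nothing.\<close>

lemma cosh_ratio:
  fixes p \<kappa> a r :: real
  assumes "p \<le> 1" "1 \<le> \<kappa>" "0 < r" and p: "p * (exp r + exp (- r) - 2) \<le> 2 * \<kappa> * (exp a - 1)"
  shows "p \<le> 2 * \<kappa> * exp (a - r)"
proof (cases "1 \<le> 2 * \<kappa> * exp (a - r)")
  case False
  define x where "x = exp r"
  have x1: "1 < x" using assms(3) by (simp add: x_def)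
  have "exp (a - r) \<le> \<kappa> * exp (a - r)" using assms(2) by simp
  then have "2 * exp (a - r) < 1" using False by linarith
  then have ea: "2 * exp a \<le> x"
    by (simp add: exp_diff x_def divide_less_eq)
  have den: "0 < x + 1 / x - 2"
  proof -
    have "x * (x + 1 / x - 2) = (x - 1) * (x - 1)" using x1 by (simp add: algebra_simps)
    moreover have "0 < (x - 1) * (x - 1)" using x1 by simp
    ultimately show ?thesis using x1 by (metis less_trans zero_less_mult_pos zero_less_one)
  qed
  have "exp a * (2 - 1 / x) \<le> exp a * 2" using x1 by (intro mult_left_mono) auto
  then have "exp a * (2 - 1 / x) \<le> x" using ea by linarith
  then have "(exp a - 1) * x \<le> exp a * (x + 1 / x - 2)" using x1 by (simp add: algebra_simps)
  then have "exp a - 1 \<le> exp a / x * (x + 1 / x - 2)" using x1 by (simp add: field_simps)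
  then have "2 * \<kappa> * (exp a - 1) \<le> 2 * \<kappa> * (exp a / x * (x + 1 / x - 2))"
    using assms(2) by (intro mult_left_mono) auto
  then have "p * (x + 1 / x - 2) \<le> 2 * \<kappa> * exp (a - r) * (x + 1 / x - 2)"
    using p by (simp add: x_def exp_minus exp_diff inverse_eq_divide)
  then show ?thesis using den by (simp add: mult_le_cancel_right)
qed (use assms(1) in linarith)

context operator_bennett
begin

text \<open>The Chernoff parameter enters by rescaling the summands, so \<open>tail_bound\<close>
  itself is stated without one.\<close>

lemma scaled: assumes \<theta>: "0 < \<theta>"
  shows "operator_bennett K scale ip F M N \<Xi> (\<lambda>i x. \<theta> *\<^sub>R y i x) n (\<theta> * C) \<kappa> (\<lambda>i. \<theta>\<^sup>2 * s i)"
proof (intro operator_bennett.intro finite_onset_axioms prob_space_axioms operator_bennett_axioms.intro indep)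
  fix i v \<omega> assume i: "i \<in> {1..n}"
  show "strong_meas (N i) (\<lambda>x. \<theta> *\<^sub>R y i x)" by (intro strong_meas_scaleR strong_meas_y i)
  show "expectation (\<lambda>\<omega>. ap (\<theta> *\<^sub>R Y i \<omega>) v) = 0" using mean_y[OF i] by simp
  show "expectation (\<lambda>\<omega>. (norm (ap (\<theta> *\<^sub>R Y i \<omega>) v))\<^sup>2) \<le> \<theta>\<^sup>2 * s i * (norm v)\<^sup>2"
    using mult_left_mono[OF var_y[OF i, of v], of "\<theta>\<^sup>2"] by (simp add: power_mult_distrib mult.assoc)
  show "expectation (\<lambda>\<omega>. \<Sum>e\<in>F. (norm (ap (\<theta> *\<^sub>R Y i \<omega>) e))\<^sup>2) \<le> \<kappa> * (\<theta>\<^sup>2 * s i)"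
    using mult_left_mono[OF HS_y[OF i], of "\<theta>\<^sup>2"]
    by (simp add: power_mult_distrib sum_distrib_left[symmetric] mult_ac)
  show "0 \<le> \<theta>\<^sup>2 * s i" using s_nonneg[OF i] by simp
  assume \<omega>: "\<omega> \<in> space M"
  show "\<theta> *\<^sub>R Y i \<omega> \<in> G" by (intro G_intros yG i \<omega>)
  show "adj (\<theta> *\<^sub>R Y i \<omega>) (\<theta> *\<^sub>R Y i \<omega>)" by (intro adj_intros y_adj i \<omega>)
  show "ap (\<theta> *\<^sub>R Y i \<omega>) (prj v) = ap (\<theta> *\<^sub>R Y i \<omega>) v" using y_prj[OF i \<omega>] by simp
  show "norm (\<theta> *\<^sub>R Y i \<omega>) \<le> \<theta> * C" using norm_y[OF i \<omega>] \<theta> by simp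
qed (use \<theta> C_pos \<kappa>_nonneg in auto)

lemma chernoff:
  assumes \<theta>: "0 < \<theta>" and r: "0 < r" and \<kappa>: "1 \<le> \<kappa>" and S: "(\<Sum>i=1..n. s i) \<le> S"
  shows "prob {\<omega> \<in> space M. \<exists>i\<in>{1..n}. r \<le> norm (\<Sum>l=1..i. Y l \<omega>)}
           \<le> 2 * \<kappa> * exp (bennett_g (\<theta> * C) * \<theta>\<^sup>2 * S - \<theta> * r)"
proof -
  interpret sc: operator_bennett K scale ip F M N \<Xi> "\<lambda>i x. \<theta> *\<^sub>R y i x" n "\<theta> * C" \<kappa> "\<lambda>i. \<theta>\<^sup>2 * s i"
    by (rule scaled[OF \<theta>])
  have g: "0 \<le> bennett_g (\<theta> * C)" using \<theta> C_pos by (intro bennett_g_nonneg) simp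
  have eq: "\<theta> * r \<le> norm (\<Sum>l=1..i. \<theta> *\<^sub>R Y l \<omega>) \<longleftrightarrow> r \<le> norm (\<Sum>l=1..i. Y l \<omega>)" for i \<omega>
    using \<theta> by (simp add: scaleR_sum_right[symmetric])
  let ?p = "prob {\<omega> \<in> space M. \<exists>i\<in>{1..n}. r \<le> norm (\<Sum>l=1..i. Y l \<omega>)}"
  have "?p * (exp (\<theta> * r) + exp (- (\<theta> * r)) - 2) \<le> 2 * \<kappa> * (exp (bennett_g (\<theta> * C) * (\<Sum>k=1..n. \<theta>\<^sup>2 * s k)) - 1)"
    using sc.tail_bound[of "\<theta> * r"] \<theta> r unfolding eq by simp
  also have "\<dots> \<le> 2 * \<kappa> * (exp (bennett_g (\<theta> * C) * \<theta>\<^sup>2 * S) - 1)"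
  proof -
    have "bennett_g (\<theta> * C) * (\<Sum>k=1..n. \<theta>\<^sup>2 * s k) = bennett_g (\<theta> * C) * \<theta>\<^sup>2 * (\<Sum>k=1..n. s k)"
      by (simp add: sum_distrib_left mult.assoc)
    also have "\<dots> \<le> bennett_g (\<theta> * C) * \<theta>\<^sup>2 * S" using g S by (intro mult_left_mono) auto
    finally show ?thesis using \<kappa> by (intro mult_left_mono) auto
  qed
  finally show ?thesis
    using \<theta> r \<kappa> by (intro cosh_ratio) auto
qed

lemma bennett_tail:
  assumes s: "\<And>i. i \<in> {1..n} \<Longrightarrow> s i = s0" and s0: "0 < s0" and n: "0 < n" and r: "0 < r" and \<kappa>: "1 \<le> \<kappa>"
  shows "prob {\<omega> \<in> space M. \<exists>i\<in>{1..n}. r \<le> norm (\<Sum>l=1..i. Y l \<omega>)}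
           \<le> 2 * \<kappa> * exp (- (real n * s0 / C\<^sup>2 * bennett_h (C * r / (real n * s0))))"
proof -
  define S where "S = real n * s0"
  have S0: "0 < S" using s0 n by (simp add: S_def)
  define u where "u = C * r / S"
  have u0: "0 < u" using C_pos r S0 by (simp add: u_def)
  \<comment> \<open>Minimizes the Chernoff exponent: there \<open>exp (\<theta> * C)\<close> equals
    \<open>1 + u\<close>, and the exponent becomes the Bennett function.\<close>
  define \<theta> where "\<theta> = ln (1 + u) / C"
  have th: "0 < \<theta>" using u0 C_pos by (simp add: \<theta>_def)
  have thC: "\<theta> * C = ln (1 + u)" using C_pos by (simp add: \<theta>_def)
  have "(\<Sum>i=1..n. s i) = S" using s by (simp add: S_def)
  then have "prob {\<omega> \<in> space M. \<exists>i\<in>{1..n}. r \<le> norm (\<Sum>l=1..i. Y l \<omega>)} \<le> 2 * \<kappa> * exp (bennett_g (\<theta> * C) * \<theta>\<^sup>2 * S - \<theta> * r)"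
    by (intro chernoff th r \<kappa>) simp
  also have "bennett_g (\<theta> * C) * \<theta>\<^sup>2 * S - \<theta> * r = - (S / C\<^sup>2 * bennett_h u)"
  proof -
    have e1: "bennett_g (\<theta> * C) * \<theta>\<^sup>2 = (u - \<theta> * C) / C\<^sup>2"
    proof -
      have "bennett_g (\<theta> * C) = (u - \<theta> * C) / (\<theta>\<^sup>2 * C\<^sup>2)"
        using u0 unfolding bennett_g_def power_mult_distrib by (simp add: thC)
      then show ?thesis using th by simp
    qed
    have "r = S / C\<^sup>2 * (C * u)" using S0 C_pos by (simp add: u_def power2_eq_square)
    then have e2: "\<theta> * r = S / C\<^sup>2 * (u * ln (1 + u))" unfolding thC[symmetric] by (simp add: mult_ac)
    have *: "(u - l) / x * S - S / x * (u * l) = - (S / x * ((1 + u) * l - u))" for x l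
      by (simp add: algebra_simps diff_divide_distrib add_divide_distrib)
    show ?thesis
      unfolding e1 e2 unfolding thC bennett_h_def by (rule *)
  qed
  finally show ?thesis by (simp only: S_def u_def)
qed

lemma bernstein_tail:
  assumes S: "(\<Sum>i=1..n. s i) \<le> S" and S0: "0 \<le> S" and L: "0 < L" and \<kappa>: "\<kappa> = 1"
  shows "prob {\<omega> \<in> space M. \<exists>i\<in>{1..n}. sqrt (2 * S * L) + C / 3 * L \<le> norm (\<Sum>l=1..i. Y l \<omega>)} \<le> 2 * exp (- L)"
proof (rule subgamma_tail[OF S0 _ L])
  fix \<theta> :: real assume \<theta>: "0 < \<theta>" "\<theta> * (C / 3) < 1"
  let ?r = "sqrt (2 * S * L) + C / 3 * L"
  have r: "0 < ?r" using S0 L C_pos by (simp add: add_nonneg_pos)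
  have "prob {\<omega> \<in> space M. \<exists>i\<in>{1..n}. ?r \<le> norm (\<Sum>l=1..i. Y l \<omega>)} \<le> 2 * \<kappa> * exp (bennett_g (\<theta> * C) * \<theta>\<^sup>2 * S - \<theta> * ?r)"
    by (rule chernoff[OF \<theta>(1) r _ S]) (simp add: \<kappa>)
  also have "\<dots> \<le> 2 * exp (S * \<theta>\<^sup>2 / (2 * (1 - \<theta> * (C / 3))) - \<theta> * ?r)"
  proof -
    have "bennett_g (\<theta> * C) \<le> 1 / (2 * (1 - \<theta> * C / 3))"
      using \<theta> C_pos by (intro bennett_g_le) auto
    then have "bennett_g (\<theta> * C) * (\<theta>\<^sup>2 * S) \<le> 1 / (2 * (1 - \<theta> * C / 3)) * (\<theta>\<^sup>2 * S)"
      using S0 by (intro mult_right_mono) auto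
    also have "\<dots> = S * \<theta>\<^sup>2 / (2 * (1 - \<theta> * (C / 3)))"
      by (simp only: times_divide_eq_right times_divide_eq_left mult_1 mult.commute[of S])
    finally show ?thesis unfolding \<kappa> by (simp add: mult.assoc)
  qed
  finally show "prob {\<omega> \<in> space M. \<exists>i\<in>{1..n}. ?r \<le> norm (\<Sum>l=1..i. Y l \<omega>)} \<le>
     2 * exp (S * \<theta>\<^sup>2 / (2 * (1 - \<theta> * (C / 3))) - \<theta> * ?r)" .
qed (use C_pos in auto)

end

section \<open>The Bennett bound as a function of its level, and its inverse\<close>

lemma bennett_h_strict_mono: assumes "0 \<le> u" "u < v" shows "bennett_h u < bennett_h v"
proof (rule DERIV_pos_imp_increasing_open[OF assms(2)])
  fix x assume "u < x" "x < v"
  then have x: "0 < x" using assms by simp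
  have "(bennett_h has_real_derivative ln (1 + x)) (at x)"
    unfolding bennett_h_def[abs_def] using x by (auto intro!: derivative_eq_intros)
  then show "\<exists>y. (bennett_h has_real_derivative y) (at x) \<and> 0 < y" using x by (intro exI[of _ "ln (1 + x)"]) simp
next
  show "continuous_on {u..v} bennett_h"
    unfolding bennett_h_def[abs_def] using assms by (intro continuous_intros) auto
qed

lemma bennett_h_0 [simp]: "bennett_h 0 = 0" by (simp add: bennett_h_def)

text \<open>From \<open>exp 2\<close> on the logarithm is at least two, which gives linear growth.
  It makes the Bennett bound fall below every positive level.\<close>

lemma bennett_h_ge: assumes "exp 2 \<le> u" shows "u \<le> bennett_h u"
proof -
  have u: "0 < u" using assms exp_gt_zero[of "2::real"] by linarith
  have "2 \<le> ln (1 + u)" using assms u by (simp add: ln_ge_iff)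
  then have *: "(1 + u) * 2 \<le> (1 + u) * ln (1 + u)" using u by (intro mult_left_mono) auto
  have "u \<le> (1 + u) * 2 - u" by simp
  also have "\<dots> \<le> bennett_h u" unfolding bennett_h_def by (rule diff_right_mono[OF *])
  finally show ?thesis .
qed

text \<open>The right side of \<open>Pi_bound\<close> with the trace bound \<open>t\<close> and the
  variance bound \<open>s\<close> as free parameters, to be evaluated at deterministic and at
  empirical values.\<close>

definition bennett_bound :: "real \<Rightarrow> real \<Rightarrow> real \<Rightarrow> real \<Rightarrow> real \<Rightarrow> real" where
  "bennett_bound nn C t s r = 2 * max (t / s) 1 * exp (- (nn * s / C\<^sup>2 * bennett_h (C * r / (nn * s))))"

lemma bennett_bound_continuous:
  assumes "0 < nn" "0 < C" "0 < s"
  shows "continuous_on {0..} (bennett_bound nn C t s)"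
proof -
  have *: "0 \<le> C * r / (nn * s)" if "0 \<le> r" for r using assms that by simp
  have "1 + C * r / (nn * s) \<noteq> 0" if "r \<in> {0..}" for r using *[of r] that by auto
  then show ?thesis
    unfolding bennett_bound_def[abs_def] bennett_h_def using assms by (intro continuous_intros) auto
qed

text \<open>\<open>the_inv_into\<close> returns a preimage only for an injective function and an
  attained value. The bound decreases strictly from at least two and tends to zero, so every
  \<open>\<delta>\<close> below one is attained, at a positive point.\<close>

lemma bennett_bound_inverse:
  fixes t :: real
  assumes p: "0 < nn" "0 < C" "0 < s" and \<delta>: "0 < \<delta>" "\<delta> < 1"
  defines "r \<equiv> the_inv_into {0..} (bennett_bound nn C t s) \<delta>"
  shows "0 < r" "bennett_bound nn C t s r = \<delta>"
proof -
  let ?g = "bennett_bound nn C t s"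
  let ?m = "max (t / s) 1"
  define a where "a = nn * s / C\<^sup>2"
  have a: "0 < a" using p by (simp add: a_def)
  have g: "?g x = 2 * ?m * exp (- (a * bennett_h (C * x / (nn * s))))" for x
    by (simp add: bennett_bound_def a_def)
  have anti: "?g y < ?g x" if "0 \<le> x" "x < y" for x y
  proof -
    have "bennett_h (C * x / (nn * s)) < bennett_h (C * y / (nn * s))"
      using that p by (intro bennett_h_strict_mono) (auto intro: divide_strict_right_mono)
    moreover have "0 < 2 * ?m" by (simp add: less_max_iff_disj)
    ultimately show ?thesis unfolding g using a by (intro mult_strict_left_mono) auto
  qed
  have inj: "inj_on ?g {0..}"
  proof (rule inj_onI, rule ccontr)
    fix x y assume "x \<in> {0..}" "y \<in> {0..}" "?g x = ?g y" "x \<noteq> y"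
    then show False using anti[of x y] anti[of y x] by (cases x y rule: linorder_cases) auto
  qed
  \<comment> \<open>Large enough that \<open>bennett_h u \<ge> u\<close> and that
    \<open>a * u\<close> already outweighs the logarithm of the prefactor over
    \<open>\<delta>\<close>.\<close>
  define u where "u = max (exp 2) (ln (2 * ?m / \<delta>) / a)"
  define y where "y = u * (nn * s) / C"
  have u0: "0 < u" unfolding u_def by (simp add: less_max_iff_disj)
  have y0: "0 \<le> y" using u0 p by (simp add: y_def)
  have "ln (2 * ?m / \<delta>) / a \<le> u" by (simp add: u_def)
  then have "ln (2 * ?m / \<delta>) \<le> a * u" using a by (simp only: pos_divide_le_eq mult.commute)
  also have "\<dots> \<le> a * bennett_h u" using a by (intro mult_left_mono bennett_h_ge) (auto simp: u_def)
  also have "u = C * y / (nn * s)" using p by (simp add: y_def)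
  finally have "exp (- (a * bennett_h (C * y / (nn * s)))) \<le> exp (- ln (2 * ?m / \<delta>))" by simp
  also have "\<dots> = \<delta> / (2 * ?m)" using \<delta> by (subst exp_minus, subst exp_ln) (auto simp: max_def)
  finally have gy: "?g y \<le> \<delta>" unfolding g by (simp add: max_def field_simps split: if_splits)
  have g0: "\<delta> \<le> ?g 0" using \<delta> unfolding g by (simp add: max_def)
  have "\<exists>x. 0 \<le> x \<and> x \<le> y \<and> ?g x = \<delta>"
    by (rule IVT2'[OF gy g0 y0 continuous_on_subset[OF bennett_bound_continuous[OF p]]]) auto
  then obtain x where x: "0 \<le> x" "?g x = \<delta>" by blast
  then have "r = x" unfolding r_def x(2)[symmetric] by (intro the_inv_into_f_f[OF inj]) simp
  moreover have "x \<noteq> 0" using x(2) \<delta> unfolding g by (auto simp: max_def split: if_splits)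
  ultimately show "0 < r" "?g r = \<delta>" using x by auto
qed

lemma Pi_bound_eq:
  "Pi_bound ip c B n X \<delta>\<^sub>2 \<delta>\<^sub>3 = bennett_bound (real n) (2 * c) (tau_u ip B n X \<delta>\<^sub>2) (sigma2_u ip c B n X \<delta>\<^sub>3)"
  by (rule ext) (simp only: Pi_bound_def bennett_bound_def Let_def)

lemma bennett_bound_mono: "0 < s \<Longrightarrow> t \<le> t' \<Longrightarrow> bennett_bound nn C t s r \<le> bennett_bound nn C t' s r"
  unfolding bennett_bound_def by (intro mult_right_mono mult_left_mono max.mono divide_right_mono) auto

section \<open>Limits of events and random levels\<close>

context prob_space
begin

text \<open>Fatou's lemma for events: the lower limit of the \<open>A k\<close> inherits their
  common probability bound.\<close>

lemma prob_le_eventually: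
  assumes A: "\<And>k::nat. A k \<in> events" "\<And>k. prob (A k) \<le> b"
    and S: "\<And>\<omega>. \<omega> \<in> S \<Longrightarrow> \<forall>\<^sub>F k in sequentially. \<omega> \<in> A k"
    and mS: "S \<in> events"
  shows "prob S \<le> b"
proof -
  define D where "D m = (\<Inter>k\<in>{m..}. A k)" for m
  have D: "D m \<in> events" for m unfolding D_def using A(1) by (intro sets.countable_INT') auto
  have inc: "incseq D" unfolding D_def by (intro incseq_SucI INF_superset_mono) auto
  have "(\<lambda>m. prob (D m)) \<longlonglongrightarrow> prob (\<Union>m. D m)"
    using D inc by (intro finite_Lim_measure_incseq) auto
  moreover have "prob (D m) \<le> b" for m
    by (rule order_trans[OF finite_measure_mono A(2)[of m]]) (auto simp: D_def A)
  ultimately have "prob (\<Union>m. D m) \<le> b" by (intro LIMSEQ_le_const2) auto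
  moreover have "S \<subseteq> (\<Union>m. D m)"
    using S by (fastforce simp: D_def eventually_sequentially)
  then have "prob S \<le> prob (\<Union>m. D m)" using D by (intro finite_measure_mono) auto
  ultimately show ?thesis by simp
qed

text \<open>The level of the event may depend on the outcome, as long as it is a level that works
  deterministically.\<close>

lemma prob_exists_level:
  fixes Z :: "'a \<Rightarrow> real"
  assumes Z: "Z \<in> borel_measurable M" and R: "\<And>r. r \<in> R \<Longrightarrow> prob {\<omega> \<in> space M. r \<le> Z \<omega>} \<le> \<delta>"
    and bdd: "bdd_below R" and \<delta>: "0 \<le> \<delta>"
  shows "\<exists>A\<in>events. prob A \<le> \<delta> \<and> {\<omega> \<in> space M. \<exists>r\<in>R. r \<le> Z \<omega>} \<subseteq> A"
proof (cases "R = {}")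
  case True
  then show ?thesis using \<delta> by (intro bexI[of _ "{}"]) auto
next
  case False
  have mZ: "{\<omega> \<in> space M. r \<le> Z \<omega>} \<in> events" for r
    by (intro borel_measurable_le borel_measurable_const Z)
  \<comment> \<open>The union over all levels is a half-line event at the infimum of
    \<open>R\<close>: closed if the infimum is attained, open otherwise. In the open case a sequence
    of levels decreases to it from within \<open>R\<close>.\<close>
  show ?thesis
  proof (cases "Inf R \<in> R")
    case True
    have "{\<omega> \<in> space M. \<exists>r\<in>R. r \<le> Z \<omega>} \<subseteq> {\<omega> \<in> space M. Inf R \<le> Z \<omega>}"
      using cInf_lower[OF _ bdd] by (auto intro: order_trans)
    then show ?thesis using R[OF True] mZ by blast
  next
    case nin: False
    let ?A = "{\<omega> \<in> space M. Inf R < Z \<omega>}"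
    have mA: "?A \<in> events" by (intro borel_measurable_less borel_measurable_const Z)
    have "\<exists>r\<in>R. r < Inf R + 1 / real (Suc k)" for k
      by (rule cInf_lessD[OF False]) simp
    then obtain \<rho> where \<rho>: "\<And>k. \<rho> k \<in> R" "\<And>k. \<rho> k < Inf R + 1 / real (Suc k)" by metis
    have "prob ?A \<le> \<delta>"
    proof (rule prob_le_eventually[where A = "\<lambda>k. {\<omega> \<in> space M. \<rho> k \<le> Z \<omega>}"])
      fix \<omega> assume \<omega>: "\<omega> \<in> ?A"
      have "(\<lambda>k. Inf R + 1 / real (Suc k)) \<longlonglongrightarrow> Inf R + 0"
        by (intro tendsto_add tendsto_const LIMSEQ_Suc[OF lim_1_over_n])
      then have "\<forall>\<^sub>F k in sequentially. Inf R + 1 / real (Suc k) < Z \<omega>"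
        using \<omega> by (intro order_tendstoD) auto
      then show "\<forall>\<^sub>F k in sequentially. \<omega> \<in> {\<omega> \<in> space M. \<rho> k \<le> Z \<omega>}"
        using \<omega> \<rho>(2) by (auto elim!: eventually_mono intro: less_imp_le less_trans)
    qed (use mZ R \<rho> mA in auto)
    moreover have "{\<omega> \<in> space M. \<exists>r\<in>R. r \<le> Z \<omega>} \<subseteq> ?A"
    proof clarify
      fix \<omega> r assume r: "r \<in> R" "r \<le> Z \<omega>"
      have "Inf R \<le> r" by (rule cInf_lower[OF r(1) bdd])
      then show "Inf R < Z \<omega>" using r nin by (cases "Inf R = r") auto
    qed
    ultimately show ?thesis using mA by blast
  qed
qed

end

text \<open>Polarization: with \<open>y\<close> the image of \<open>x\<close> rescaled to the norm
  of \<open>x\<close>, the inner product of \<open>T x\<close> and \<open>y\<close> is a difference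
  of two values of the quadratic form.\<close>

lemma norm_self_adjoint_le:
  fixes T :: "'a::real_inner bop"
  assumes sa: "adj T T" and q: "\<And>v. \<bar>ap T v \<bullet> v\<bar> \<le> a * (norm v)\<^sup>2" and a: "0 \<le> a"
  shows "norm T \<le> a"
proof (rule norm_bop_bound[OF a])
  fix x :: 'a
  show "norm (ap T x) \<le> a * norm x"
  proof (cases "ap T x = 0 \<or> x = 0")
    case False
    then have nz: "0 < norm (ap T x)" "0 < norm x" by auto
    define y where "y = (norm x / norm (ap T x)) *\<^sub>R ap T x"
    have ny: "norm y = norm x" using nz by (simp add: y_def)
    have "4 * (ap T x \<bullet> y) = ap T (x + y) \<bullet> (x + y) - ap T (x - y) \<bullet> (x - y)"
    proof -
      have "ap T y \<bullet> x = ap T x \<bullet> y" using sa by (simp add: adj_def inner_commute)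
      then show ?thesis
        by (simp add: inner_add_left inner_add_right inner_diff_left inner_diff_right)
    qed
    also have "\<dots> \<le> a * (norm (x + y))\<^sup>2 + a * (norm (x - y))\<^sup>2"
      using q[of "x + y"] q[of "x - y"] by linarith
    also have "\<dots> = a * (2 * (norm x)\<^sup>2 + 2 * (norm y)\<^sup>2)"
      by (simp add: power2_norm_eq_inner inner_add_left inner_add_right inner_diff_left inner_diff_right inner_commute algebra_simps)
    finally have "ap T x \<bullet> y \<le> a * (norm x)\<^sup>2" by (simp add: ny)
    moreover have "ap T x \<bullet> y = norm x * norm (ap T x)"
      using nz by (simp add: y_def power2_norm_eq_inner[symmetric] power2_eq_square)
    ultimately have "norm x * norm (ap T x) \<le> norm x * (a * norm x)"
      by (simp add: power2_eq_square mult_ac)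
    then show ?thesis using nz by simp
  qed (use a in auto)
qed

section \<open>Sums of random self-adjoint operators\<close>

text \<open>The norm bound on the sample holds only almost surely; cutting off large operators makes
  it hold everywhere, so that all expectations below are of bounded quantities.\<close>

definition truncate :: "real \<Rightarrow> ('a::real_normed_vector \<Rightarrow>\<^sub>L 'a) \<Rightarrow> 'a bop" where
  "truncate c x = (if norm x \<le> c then to_bop x else 0)"

lemma strong_meas_truncate: "strong_meas borel (truncate c)"
  unfolding strong_meas_def
proof
  fix v :: 'a
  have "(\<lambda>x :: 'a \<Rightarrow>\<^sub>L 'a. if norm x \<le> c then blinfun_apply x v else 0) \<in> borel_measurable borel"
  proof (rule measurable_If)
    show "(\<lambda>x :: 'a \<Rightarrow>\<^sub>L 'a. blinfun_apply x v) \<in> borel_measurable borel"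
      by (intro borel_measurable_continuous_onI continuous_intros)
    have "closed {x :: 'a \<Rightarrow>\<^sub>L 'a. norm x \<le> c}" by (intro closed_Collect_le continuous_intros)
    then show "{x \<in> space borel. norm (x :: 'a \<Rightarrow>\<^sub>L 'a) \<le> c} \<in> sets borel"
      by (simp add: borel_closed)
  qed (rule borel_measurable_const)
  then show "(\<lambda>x. ap (truncate c x) v) \<in> borel_measurable borel"
    unfolding truncate_def if_distrib[of "\<lambda>x. ap x v"] by (simp only: ap_simps bop_inverse)
qed

lemma norm_truncate_le: "0 \<le> c \<Longrightarrow> norm (truncate c x) \<le> c"
  by (simp add: truncate_def norm_bop_def zero_bop_def)

context hilbert_space
begin

definition K_lin :: "'a bop \<Rightarrow> bool" where
  "K_lin T \<longleftrightarrow> (\<forall>a\<in>K. \<forall>v. ap T (scale a v) = scale a (ap T v))"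

lemma K_linD: "K_lin T \<Longrightarrow> a \<in> K \<Longrightarrow> ap T (scale a v) = scale a (ap T v)"
  by (simp add: K_lin_def)

lemma K_lin_intros:
  "K_lin 0" "K_lin S \<Longrightarrow> K_lin T \<Longrightarrow> K_lin (S - T)" "K_lin T \<Longrightarrow> K_lin (r *\<^sub>R T)" "K_lin T \<Longrightarrow> K_lin (T\<^sup>2)"
  by (simp_all add: K_lin_def scale_diff_right scale_scaleR power2_eq_square)

lemma K_lin_adj_truncate:
  assumes "self_adjoint ip x" shows "K_lin (truncate c x)" "adj (truncate c x) (truncate c x)"
proof -
  show "K_lin (truncate c x)"
    using self_adjoint_K_linear[OF assms] K_lin_intros(1) by (auto simp: truncate_def K_lin_def)
  show "adj (truncate c x) (truncate c x)"
    using self_adjoint_inner[OF assms] adj_intros(1) by (auto simp: truncate_def adj_def)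
qed

lemma bounded_linear_scale: "a \<in> K \<Longrightarrow> bounded_linear (scale a)"
  by (rule bounded_linear_intro[where K = "cmod a"]) (auto simp: scale_add_right scale_scaleR norm_scale mult.commute)

end

lemma norm_ap_bound: "norm x \<le> b \<Longrightarrow> norm (ap x v) \<le> b * norm v"
  by (rule order_trans[OF norm_ap_le mult_right_mono[OF _ norm_ge_zero]])

context prob_space
begin

lemma integrable_ap:
  fixes R :: "'a \<Rightarrow> 'b::{real_inner, banach, second_countable_topology} bop"
  assumes "strong_meas M R" "\<And>\<omega>. \<omega> \<in> space M \<Longrightarrow> norm (R \<omega>) \<le> b"
  shows "integrable M (\<lambda>\<omega>. ap (R \<omega>) v)"
  by (rule integrable_bdd[OF strong_measD[OF assms(1)], of _ "b * norm v"]) (rule norm_ap_bound[OF assms(2)])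

lemma norm_expectation_ap:
  fixes R :: "'a \<Rightarrow> 'b::{real_inner, banach, second_countable_topology} bop"
  assumes "strong_meas M R" "\<And>\<omega>. \<omega> \<in> space M \<Longrightarrow> norm (R \<omega>) \<le> b"
  shows "norm (expectation (\<lambda>\<omega>. ap (R \<omega>) v)) \<le> b * norm v"
proof -
  have "norm (expectation (\<lambda>\<omega>. ap (R \<omega>) v)) \<le> expectation (\<lambda>\<omega>. norm (ap (R \<omega>) v))"
    by (rule integral_norm_bound)
  also have "\<dots> \<le> expectation (\<lambda>\<omega>. b * norm v)"
    by (intro expectation_mono_bdd integrable_norm integrable_ap[OF assms] integrable_const norm_ap_bound[OF assms(2)])
  finally show ?thesis by (simp add: prob_space)
qed

text \<open>\<open>Blinfun\<close> has its intended value only on bounded linear maps, and the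
  uniformly bounded version \<open>R\<close> of the random operator shows that the pointwise
  expectation is one.\<close>

lemma op_expectation_apply:
  fixes Y :: "'a \<Rightarrow> ('b::{real_inner, banach, second_countable_topology} \<Rightarrow>\<^sub>L 'b)"
  assumes R: "strong_meas M R" "\<And>\<omega>. \<omega> \<in> space M \<Longrightarrow> norm (R \<omega>) \<le> b"
    and Y: "\<And>v. (\<lambda>\<omega>. blinfun_apply (Y \<omega>) v) \<in> borel_measurable M"
    and eq: "AE \<omega> in M. to_bop (Y \<omega>) = R \<omega>"
  shows "blinfun_apply (op_expectation M Y) v = expectation (\<lambda>\<omega>. ap (R \<omega>) v)"
proof -
  have e: "(\<lambda>v. expectation (\<lambda>\<omega>. blinfun_apply (Y \<omega>) v)) = (\<lambda>v. expectation (\<lambda>\<omega>. ap (R \<omega>) v))"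
  proof
    fix v
    have "AE \<omega> in M. blinfun_apply (Y \<omega>) v = ap (R \<omega>) v"
      using eq by eventually_elim (metis bop_inverse(1))
    then show "expectation (\<lambda>\<omega>. blinfun_apply (Y \<omega>) v) = expectation (\<lambda>\<omega>. ap (R \<omega>) v)"
      by (intro integral_cong_AE Y strong_measD R)
  qed
  have "bounded_linear (\<lambda>v. expectation (\<lambda>\<omega>. ap (R \<omega>) v))"
  proof (rule bounded_linear_intro[where K = b])
    show "expectation (\<lambda>\<omega>. ap (R \<omega>) (v + w)) = expectation (\<lambda>\<omega>. ap (R \<omega>) v) + expectation (\<lambda>\<omega>. ap (R \<omega>) w)" for v w
      using integrable_ap[OF R] by simp
    show "norm (expectation (\<lambda>\<omega>. ap (R \<omega>) v)) \<le> norm v * b" for v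
      using norm_expectation_ap[OF R, of v] by (simp add: mult.commute)
  qed simp
  then show ?thesis
    unfolding op_expectation_def e by (simp add: bounded_linear_Blinfun_apply)
qed

end

section \<open>The sample, its truncation and its paired differences\<close>

locale setting = hilbert_space K scale ip + prob_space M
  for K scale and ip :: "'a \<Rightarrow> 'a::{real_inner, banach, second_countable_topology} \<Rightarrow> complex"
    and M :: "'w measure" +
  fixes X :: "nat \<Rightarrow> 'w \<Rightarrow> ('a \<Rightarrow>\<^sub>L 'a)" and \<mu> \<Sigma> :: "'a \<Rightarrow>\<^sub>L 'a" and n :: nat and c B :: real
  assumes n8: "n \<ge> 8" and n4: "4 dvd n" and c0: "0 < c" and B0: "0 < B"
    and indepX: "indep_vars (\<lambda>_. borel) X {1..n}"
    and saX: "i \<in> {1..n} \<Longrightarrow> \<omega> \<in> space M \<Longrightarrow> self_adjoint ip (X i \<omega>)"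
    and normX: "i \<in> {1..n} \<Longrightarrow> AE \<omega> in M. norm (X i \<omega>) \<le> c"
    and traceX: "i \<in> {1..n} \<Longrightarrow>
           AE \<omega> in M. trace_class ip (op_sq (X i \<omega>)) \<and> op_trace ip (op_sq (X i \<omega>)) \<le> B"
    and meanX: "i \<in> {1..n} \<Longrightarrow> op_expectation M (X i) = \<mu>"
    and varX: "i \<in> {1..n} \<Longrightarrow> op_variance M (X i) = \<Sigma>"
begin

definition "m0 = to_bop \<mu>"
definition "Sg = to_bop \<Sigma>"

abbreviation "w i \<omega> \<equiv> truncate c (X i \<omega>)"
abbreviation "U i \<omega> \<equiv> w i \<omega> - m0"

text \<open>A function of the whole family, so that it can also be evaluated at families restricted
  to a block of indices; the independence statements are obtained in this way.\<close>

definition Dx :: "(nat \<Rightarrow> ('a \<Rightarrow>\<^sub>L 'a)) \<Rightarrow> nat \<Rightarrow> 'a bop" where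
  "Dx x i = truncate c (x (2 * i - 1)) - truncate c (x (2 * i))"

definition Qx :: "(nat \<Rightarrow> ('a \<Rightarrow>\<^sub>L 'a)) \<Rightarrow> nat \<Rightarrow> 'a bop" where
  "Qx x i = (1 / 2) *\<^sub>R (Dx x i)\<^sup>2"

abbreviation "DD i \<omega> \<equiv> Dx (\<lambda>j. X j \<omega>) i"
abbreviation "QQ i \<omega> \<equiv> Qx (\<lambda>j. X j \<omega>) i"

lemma mX: "i \<in> {1..n} \<Longrightarrow> X i \<in> measurable M borel"
  using indepX by (simp add: indep_vars_def)

lemma strong_meas_w: "i \<in> {1..n} \<Longrightarrow> strong_meas M (w i)"
  by (rule strong_meas_compose[OF strong_meas_truncate mX])

lemma norm_w: "norm (w i \<omega>) \<le> c"
  using c0 by (intro norm_truncate_le) simp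

lemma AE_w: "i \<in> {1..n} \<Longrightarrow> AE \<omega> in M. to_bop (X i \<omega>) = w i \<omega>"
  by (drule normX) (erule eventually_mono, simp add: truncate_def)

lemma adj_w: "i \<in> {1..n} \<Longrightarrow> \<omega> \<in> space M \<Longrightarrow> adj (w i \<omega>) (w i \<omega>)"
  and K_lin_w: "i \<in> {1..n} \<Longrightarrow> \<omega> \<in> space M \<Longrightarrow> K_lin (w i \<omega>)"
  using K_lin_adj_truncate[OF saX] by auto

lemma expected_op:
  assumes R: "strong_meas M R" "\<And>\<omega>. \<omega> \<in> space M \<Longrightarrow> norm (R \<omega>) \<le> b"
    and T: "\<And>v. ap T v = expectation (\<lambda>\<omega>. ap (R \<omega>) v)"
    and aR: "\<And>\<omega>. \<omega> \<in> space M \<Longrightarrow> adj (R \<omega>) (R \<omega>)" and kR: "\<And>\<omega>. \<omega> \<in> space M \<Longrightarrow> K_lin (R \<omega>)"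
  shows "adj T T" "K_lin T"
proof -
  note int = integrable_ap[OF R]
  show "adj T T"
    unfolding adj_def
  proof (intro allI)
    fix v u
    have "ap T v \<bullet> u = expectation (\<lambda>\<omega>. ap (R \<omega>) v \<bullet> u)" unfolding T by (rule integral_inner_left[symmetric]) (rule int)
    also have "\<dots> = expectation (\<lambda>\<omega>. v \<bullet> ap (R \<omega>) u)"
      by (rule Bochner_Integration.integral_cong[OF refl]) (use aR in \<open>simp add: adj_def\<close>)
    also have "\<dots> = v \<bullet> ap T u" unfolding T by (rule integral_inner_right) (rule int)
    finally show "ap T v \<bullet> u = v \<bullet> ap T u" .
  qed
  show "K_lin T"
    unfolding K_lin_def
  proof (intro ballI allI)
    fix a v assume a: "a \<in> K"
    have "ap T (scale a v) = expectation (\<lambda>\<omega>. scale a (ap (R \<omega>) v))"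
      unfolding T by (rule Bochner_Integration.integral_cong[OF refl]) (rule K_linD[OF kR a])
    also have "\<dots> = scale a (ap T v)"
      unfolding T by (rule integral_bounded_linear[OF bounded_linear_scale[OF a] int])
    finally show "ap T (scale a v) = scale a (ap T v)" .
  qed
qed

lemma ap_m0: assumes i: "i \<in> {1..n}" shows "ap m0 v = expectation (\<lambda>\<omega>. ap (w i \<omega>) v)"
proof -
  have "(\<lambda>\<omega>. blinfun_apply (X i \<omega>) v) \<in> borel_measurable M" for v
    by (rule measurable_compose[OF mX[OF i]]) (intro borel_measurable_continuous_onI continuous_intros)
  from op_expectation_apply[OF strong_meas_w[OF i] norm_w this AE_w[OF i]] show ?thesis
    by (simp add: m0_def meanX[OF i])
qed

lemma one_n: "1 \<in> {1..n}" using n8 by simp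

lemma adj_m0: "adj m0 m0" and K_lin_m0: "K_lin m0"
  by (rule expected_op[OF strong_meas_w[OF one_n] norm_w ap_m0[OF one_n] adj_w[OF one_n] K_lin_w[OF one_n]], assumption+)+

lemma norm_m0: "norm m0 \<le> c"
  by (rule norm_bop_bound) (use c0 norm_expectation_ap[OF strong_meas_w[OF one_n] norm_w] ap_m0[OF one_n] in auto)

lemma strong_meas_U: "i \<in> {1..n} \<Longrightarrow> strong_meas M (U i)"
  by (intro strong_meas_diff strong_meas_w strong_meas_const)

lemma norm_U: "norm (U i \<omega>) \<le> 2 * c"
  using norm_triangle_ineq4[of "w i \<omega>" m0] norm_w[of i \<omega>] norm_m0 by linarith

lemma adj_U: "i \<in> {1..n} \<Longrightarrow> \<omega> \<in> space M \<Longrightarrow> adj (U i \<omega>) (U i \<omega>)"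
  and K_lin_U: "i \<in> {1..n} \<Longrightarrow> \<omega> \<in> space M \<Longrightarrow> K_lin (U i \<omega>)"
  by (intro adj_intros adj_w adj_m0 K_lin_intros K_lin_w K_lin_m0; assumption)+

lemma mean_U: "i \<in> {1..n} \<Longrightarrow> expectation (\<lambda>\<omega>. ap (U i \<omega>) v) = 0"
  using integrable_ap[OF strong_meas_w norm_w, of i v] ap_m0[of i v] by (simp add: prob_space)

lemma norm_U_sq: "norm ((U i \<omega>)\<^sup>2) \<le> (2 * c)\<^sup>2"
  using norm_power_bop_le[of "U i \<omega>" 2] power_mono[OF norm_U norm_ge_zero, of i \<omega> 2] by linarith

lemma ap_Sg: assumes i: "i \<in> {1..n}" shows "ap Sg v = expectation (\<lambda>\<omega>. ap ((U i \<omega>)\<^sup>2) v)"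
proof -
  have m: "(\<lambda>\<omega>. blinfun_apply (op_sq (X i \<omega> - \<mu>)) v) \<in> borel_measurable M" for v
    unfolding op_sq_def blinfun_apply_blinfun_compose
    by (rule measurable_compose[OF mX[OF i]]) (intro borel_measurable_continuous_onI continuous_intros)
  have "to_bop (op_sq (x - \<mu>)) = (to_bop x - m0)\<^sup>2" for x
    by (rule bop_eqI) (simp add: op_sq_def m0_def power2_eq_square blinfun.bilinear_simps)
  then have "AE \<omega> in M. to_bop (op_sq (X i \<omega> - \<mu>)) = (U i \<omega>)\<^sup>2"
    using AE_w[OF i] by (auto elim!: eventually_mono)
  from op_expectation_apply[OF strong_meas_power[OF strong_meas_U[OF i]] norm_U_sq m this] show ?thesis
    using varX[OF i] meanX[OF i] by (simp add: Sg_def op_variance_def)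
qed

lemma adj_Sg: "adj Sg Sg" and K_lin_Sg: "K_lin Sg"
  by (rule expected_op[OF strong_meas_power[OF strong_meas_U[OF one_n]] norm_U_sq ap_Sg[OF one_n]
        adj_power[OF adj_U[OF one_n]] K_lin_intros(4)[OF K_lin_U[OF one_n]]], assumption+)+

lemma integrable_inner_ap:
  assumes "strong_meas M R" "\<And>\<omega>. \<omega> \<in> space M \<Longrightarrow> norm (R \<omega>) \<le> b"
    and "strong_meas M S" "\<And>\<omega>. \<omega> \<in> space M \<Longrightarrow> norm (S \<omega>) \<le> d"
  shows "integrable M (\<lambda>\<omega>. ap (R \<omega>) v \<bullet> ap (S \<omega>) (u :: 'a))"
proof (rule integrable_bdd)
  show "(\<lambda>\<omega>. ap (R \<omega>) v \<bullet> ap (S \<omega>) u) \<in> borel_measurable M"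
    by (intro borel_measurable_inner strong_measD assms)
  fix \<omega> assume \<omega>: "\<omega> \<in> space M"
  have "\<bar>ap (R \<omega>) v \<bullet> ap (S \<omega>) u\<bar> \<le> norm (ap (R \<omega>) v) * norm (ap (S \<omega>) u)" by (rule Cauchy_Schwarz_ineq2)
  also have "\<dots> \<le> (b * norm v) * (d * norm u)"
    using assms(2)[OF \<omega>] assms(4)[OF \<omega>] order_trans[OF norm_ge_zero assms(2)[OF \<omega>]]
    by (intro mult_mono order_trans[OF norm_ap_le] mult_right_mono) auto
  finally show "norm (ap (R \<omega>) v \<bullet> ap (S \<omega>) u) \<le> (b * norm v) * (d * norm u)" by simp
qed

lemma integrable_norm_sq_ap:
  assumes "strong_meas M R" "\<And>\<omega>. \<omega> \<in> space M \<Longrightarrow> norm (R \<omega>) \<le> b"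
  shows "integrable M (\<lambda>\<omega>. (norm (ap (R \<omega>) (v :: 'a)))\<^sup>2)"
  unfolding power2_norm_eq_inner by (rule integrable_inner_ap[OF assms assms])

lemma Sg_inner: assumes i: "i \<in> {1..n}" shows "ap Sg v \<bullet> u = expectation (\<lambda>\<omega>. ap (U i \<omega>) v \<bullet> ap (U i \<omega>) u)"
proof -
  have "ap Sg v \<bullet> u = expectation (\<lambda>\<omega>. ap ((U i \<omega>)\<^sup>2) v \<bullet> u)"
    unfolding ap_Sg[OF i] by (rule integral_inner_left[symmetric]) (rule integrable_ap[OF strong_meas_power[OF strong_meas_U[OF i]] norm_U_sq])
  also have "\<dots> = expectation (\<lambda>\<omega>. ap (U i \<omega>) v \<bullet> ap (U i \<omega>) u)"
    by (rule Bochner_Integration.integral_cong[OF refl]) (use adj_U[OF i] in \<open>simp add: power2_eq_square adj_def del: ap_simps(4)\<close>)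
  finally show ?thesis .
qed

lemma Sg_quadratic: "i \<in> {1..n} \<Longrightarrow> ap Sg v \<bullet> v = expectation (\<lambda>\<omega>. (norm (ap (U i \<omega>) v))\<^sup>2)"
  using Sg_inner[of i v v] by (simp only: power2_norm_eq_inner)

lemma Sg_quadratic_le: "ap Sg v \<bullet> v \<le> norm Sg * (norm v)\<^sup>2"
proof -
  have "ap Sg v \<bullet> v \<le> norm (ap Sg v) * norm v" by (rule norm_cauchy_schwarz)
  also have "\<dots> \<le> (norm Sg * norm v) * norm v" by (intro mult_right_mono norm_ap_le) simp
  finally show ?thesis by (simp add: power2_eq_square mult.assoc)
qed

lemma indep_blocks:
  assumes "A \<inter> A' = {}" "A \<subseteq> {1..n}" "A' \<subseteq> {1..n}"
    and R: "strong_meas (PiM A (\<lambda>_. borel)) R" "strong_meas (PiM A' (\<lambda>_. borel)) R'"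
  shows "indep_var borel (\<lambda>\<omega>. ap (R (\<lambda>j\<in>A. X j \<omega>)) v) borel (\<lambda>\<omega>. ap (R' (\<lambda>j\<in>A'. X j \<omega>)) v')"
  using indep_var_compose[OF indep_var_restrict[OF indepX assms(1-3)] strong_measD[OF R(1)] strong_measD[OF R(2)]]
  by (simp add: comp_def)

lemma strong_meas_coord: "i \<in> A \<Longrightarrow> strong_meas (PiM A (\<lambda>_. borel)) (\<lambda>x. truncate c (x i))"
  by (rule strong_meas_compose[OF strong_meas_truncate]) (rule measurable_component_singleton)

lemma strong_meas_Dx: "2 * i - 1 \<in> A \<Longrightarrow> 2 * i \<in> A \<Longrightarrow> strong_meas (PiM A (\<lambda>_. borel)) (\<lambda>x. Dx x i)"
  and strong_meas_Qx: "2 * i - 1 \<in> A \<Longrightarrow> 2 * i \<in> A \<Longrightarrow> strong_meas (PiM A (\<lambda>_. borel)) (\<lambda>x. Qx x i)"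
  unfolding Qx_def Dx_def by (intro strong_meas_scaleR strong_meas_power strong_meas_diff strong_meas_coord; assumption)+

lemma Dx_cong: "x (2 * i - 1) = x' (2 * i - 1) \<Longrightarrow> x (2 * i) = x' (2 * i) \<Longrightarrow> Dx x i = Dx x' i"
  and Qx_cong: "x (2 * i - 1) = x' (2 * i - 1) \<Longrightarrow> x (2 * i) = x' (2 * i) \<Longrightarrow> Qx x i = Qx x' i"
  unfolding Qx_def Dx_def by simp_all

lemma strong_meas_DD: "2 * i - 1 \<in> {1..n} \<Longrightarrow> 2 * i \<in> {1..n} \<Longrightarrow> strong_meas M (DD i)"
  and strong_meas_QQ: "2 * i - 1 \<in> {1..n} \<Longrightarrow> 2 * i \<in> {1..n} \<Longrightarrow> strong_meas M (QQ i)"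
  unfolding Qx_def Dx_def by (intro strong_meas_scaleR strong_meas_power strong_meas_diff strong_meas_w; assumption)+

lemma norm_Dx: "norm (Dx x i) \<le> 2 * c"
  unfolding Dx_def using norm_triangle_ineq4[of "truncate c (x (2 * i - 1))" "truncate c (x (2 * i))"]
    norm_truncate_le[of c "x (2 * i - 1)"] norm_truncate_le[of c "x (2 * i)"] c0 by linarith

lemma norm_Qx: "norm (Qx x i) \<le> 2 * c\<^sup>2"
  using norm_power_bop_le[of "Dx x i" 2] power_mono[OF norm_Dx norm_ge_zero, of x i 2]
  by (simp add: Qx_def power_mult_distrib)

context fixes i assumes i: "i \<in> {1..n div 2}"
begin

lemma pair_idx: "2 * i - 1 \<in> {1..n}" "2 * i \<in> {1..n}" "2 * i - 1 \<noteq> 2 * i"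
  using i by auto

lemma adj_DD: "\<omega> \<in> space M \<Longrightarrow> adj (DD i \<omega>) (DD i \<omega>)" and K_lin_DD: "\<omega> \<in> space M \<Longrightarrow> K_lin (DD i \<omega>)"
  unfolding Dx_def by (intro adj_intros adj_w K_lin_intros K_lin_w pair_idx; assumption)+

lemma adj_QQ: "\<omega> \<in> space M \<Longrightarrow> adj (QQ i \<omega>) (QQ i \<omega>)" and K_lin_QQ: "\<omega> \<in> space M \<Longrightarrow> K_lin (QQ i \<omega>)"
  unfolding Qx_def by (intro adj_intros(6) adj_power adj_DD K_lin_intros(3) K_lin_intros(4) K_lin_DD; assumption)+

text \<open>The unknown mean cancels in the difference, and independence removes the mixed terms,
  leaving two copies of the variance. Hence \<open>QQ i\<close> is an unbiased estimator of
  \<open>Sg\<close>.\<close>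

lemma expectation_DD: "expectation (\<lambda>\<omega>. ap (DD i \<omega>) v \<bullet> ap (DD i \<omega>) u) = 2 * (ap Sg v \<bullet> u)"
proof -
  let ?p = "2 * i - 1" and ?q = "2 * i"
  have cross: "expectation (\<lambda>\<omega>. ap (U j \<omega>) v \<bullet> ap (U k \<omega>) u) = 0"
    if "j \<in> {1..n}" "k \<in> {1..n}" "j \<noteq> k" for j k v u
  proof -
    have "indep_var borel (\<lambda>\<omega>. ap (U j \<omega>) v) borel (\<lambda>\<omega>. ap (U k \<omega>) u)"
      using indep_blocks[of "{j}" "{k}" "\<lambda>x. truncate c (x j) - m0" "\<lambda>x. truncate c (x k) - m0" v u] that
      by (simp add: strong_meas_diff strong_meas_coord strong_meas_const)
    then have "expectation (\<lambda>\<omega>. ap (U j \<omega>) v \<bullet> ap (U k \<omega>) u) = expectation (\<lambda>\<omega>. ap (U j \<omega>) v) \<bullet> expectation (\<lambda>\<omega>. ap (U k \<omega>) u)"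
      by (rule indep_var_inner[where a = "2 * c * norm v" and b = "2 * c * norm u"])
        (rule order_trans[OF norm_ap_le mult_right_mono[OF norm_U norm_ge_zero]])+
    then show ?thesis by (simp only: mean_U[OF that(1)] inner_zero_left)
  qed
  have int: "integrable M (\<lambda>\<omega>. ap (U j \<omega>) v \<bullet> ap (U k \<omega>) u)" if "j \<in> {1..n}" "k \<in> {1..n}" for j k v u
    by (rule integrable_inner_ap[OF strong_meas_U norm_U strong_meas_U norm_U]; rule that)
  have "expectation (\<lambda>\<omega>. ap (DD i \<omega>) v \<bullet> ap (DD i \<omega>) u) =
     expectation (\<lambda>\<omega>. (ap (U ?p \<omega>) v \<bullet> ap (U ?p \<omega>) u + ap (U ?q \<omega>) v \<bullet> ap (U ?q \<omega>) u)
        - (ap (U ?p \<omega>) v \<bullet> ap (U ?q \<omega>) u + ap (U ?q \<omega>) v \<bullet> ap (U ?p \<omega>) u))"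
    unfolding Dx_def by (rule Bochner_Integration.integral_cong[OF refl]) (simp add: inner_diff_left inner_diff_right)
  also have "\<dots> = (ap Sg v \<bullet> u + ap Sg v \<bullet> u) - (0 + 0)"
    unfolding Bochner_Integration.integral_diff[OF Bochner_Integration.integrable_add[OF int[OF pair_idx(1,1)] int[OF pair_idx(2,2)]] Bochner_Integration.integrable_add[OF int[OF pair_idx(1,2)] int[OF pair_idx(2,1)]]]
      Bochner_Integration.integral_add[OF int[OF pair_idx(1,1)] int[OF pair_idx(2,2)]]
      Bochner_Integration.integral_add[OF int[OF pair_idx(1,2)] int[OF pair_idx(2,1)]]
      Sg_inner[OF pair_idx(1), symmetric] Sg_inner[OF pair_idx(2), symmetric]
      cross[OF pair_idx(1,2,3)] cross[OF pair_idx(2,1) pair_idx(3)[symmetric]] ..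
  finally show ?thesis by simp
qed

lemma mean_QQ: "expectation (\<lambda>\<omega>. ap (QQ i \<omega>) v) = ap Sg v"
proof -
  have "expectation (\<lambda>\<omega>. ap (QQ i \<omega>) v) \<bullet> u = ap Sg v \<bullet> u" for u
  proof -
    have "expectation (\<lambda>\<omega>. ap (QQ i \<omega>) v) \<bullet> u = expectation (\<lambda>\<omega>. ap (QQ i \<omega>) v \<bullet> u)"
      by (rule integral_inner_left[symmetric]) (rule integrable_ap[OF strong_meas_QQ[OF pair_idx(1,2)] norm_Qx])
    also have "\<dots> = expectation (\<lambda>\<omega>. (ap (DD i \<omega>) v \<bullet> ap (DD i \<omega>) u) / 2)"
      by (rule Bochner_Integration.integral_cong[OF refl]) (use adj_DD in \<open>simp add: Qx_def power2_eq_square adj_def\<close>)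
    also have "\<dots> = ap Sg v \<bullet> u" by (simp add: expectation_DD)
    finally show ?thesis .
  qed
  then show ?thesis using vector_eq_rdot by blast
qed

lemma QQ_quadratic: "\<omega> \<in> space M \<Longrightarrow> ap (QQ i \<omega>) v \<bullet> v = (norm (ap (DD i \<omega>) v))\<^sup>2 / 2"
  using adj_DD[of \<omega>] by (simp add: Qx_def power2_eq_square adj_def power2_norm_eq_inner)
     (simp add: power2_norm_eq_inner flip: power2_eq_square)

text \<open>Both quadratic forms lie between zero and \<open>2 * c^2\<close>, so their difference is
  bounded by \<open>2 * c^2\<close> as well; the triangle inequality would give twice as much. This
  is the range behind the linear term of \<open>Gamma_dev\<close>.\<close>

lemma norm_QQ_Sg: assumes \<omega>: "\<omega> \<in> space M" shows "norm (QQ i \<omega> - Sg) \<le> 2 * c\<^sup>2"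
proof (rule norm_self_adjoint_le)
  show "adj (QQ i \<omega> - Sg) (QQ i \<omega> - Sg)" by (intro adj_intros adj_QQ adj_Sg \<omega>)
  have q: "0 \<le> ap (QQ i \<omega>) v \<bullet> v \<and> ap (QQ i \<omega>) v \<bullet> v \<le> 2 * c\<^sup>2 * (norm v)\<^sup>2" if "\<omega> \<in> space M" for \<omega> v
  proof
    show "0 \<le> ap (QQ i \<omega>) v \<bullet> v" unfolding QQ_quadratic[OF that] by simp
    have "ap (QQ i \<omega>) v \<bullet> v \<le> norm (ap (QQ i \<omega>) v) * norm v" by (rule norm_cauchy_schwarz)
    also have "\<dots> \<le> (2 * c\<^sup>2 * norm v) * norm v"
      by (intro mult_right_mono order_trans[OF norm_ap_le] norm_Qx) auto
    finally show "ap (QQ i \<omega>) v \<bullet> v \<le> 2 * c\<^sup>2 * (norm v)\<^sup>2" by (simp add: power2_eq_square mult.assoc)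
  qed
  fix v
  have int: "integrable M (\<lambda>\<omega>. ap (QQ i \<omega>) v \<bullet> v)"
    by (rule integrable_inner_left) (rule integrable_ap[OF strong_meas_QQ[OF pair_idx(1,2)] norm_Qx])
  have Sv: "ap Sg v \<bullet> v = expectation (\<lambda>\<omega>. ap (QQ i \<omega>) v \<bullet> v)"
    unfolding mean_QQ[symmetric] by (rule integral_inner_left[symmetric]) (rule integrable_ap[OF strong_meas_QQ[OF pair_idx(1,2)] norm_Qx])
  have "0 \<le> ap Sg v \<bullet> v" unfolding Sv by (rule integral_nonneg_AE) (use q in auto)
  moreover have "ap Sg v \<bullet> v \<le> expectation (\<lambda>_. 2 * c\<^sup>2 * (norm v)\<^sup>2)"
    unfolding Sv by (rule expectation_mono_bdd[OF int]) (use q in auto)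
  then have "ap Sg v \<bullet> v \<le> 2 * c\<^sup>2 * (norm v)\<^sup>2" by (simp add: prob_space)
  ultimately show "\<bar>ap (QQ i \<omega> - Sg) v \<bullet> v\<bar> \<le> 2 * c\<^sup>2 * (norm v)\<^sup>2"
    using q[OF \<omega>, of v] by (simp add: inner_diff_left abs_le_iff)
qed (use c0 in simp)

end

end

section \<open>Compression to a finite-dimensional subspace\<close>

context finite_onset
begin

definition compress :: "'a bop \<Rightarrow> 'a bop" where "compress T = prjop * T * prjop"

lemma ap_compress: "ap (compress T) v = prj (ap T (prj v))" by (simp add: compress_def)

lemma compress_G: "K_lin T \<Longrightarrow> compress T \<in> G"
  unfolding compress_def by (rule G_compress) (rule K_linD)

lemma adj_compress: "adj T T \<Longrightarrow> adj (compress T) (compress T)"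
  by (simp add: adj_def ap_compress inner_prj)

lemma ap_compress_prj: "ap (compress T) (prj v) = ap (compress T) v" by (simp add: ap_compress)

lemma norm_ap_compress: "norm (ap (compress T) v) \<le> norm (ap T (prj v))"
  unfolding ap_compress by (rule norm_prj_le)

lemma norm_compress: "norm T \<le> b \<Longrightarrow> norm (compress T) \<le> b"
proof (rule norm_bop_bound)
  assume b: "norm T \<le> b"
  then show b0: "0 \<le> b" using norm_ge_zero[of T] by linarith
  fix v
  have "norm (ap (compress T) v) \<le> b * norm (prj v)" by (rule order_trans[OF norm_ap_compress norm_ap_bound[OF b]])
  also have "\<dots> \<le> b * norm v" by (intro mult_left_mono norm_prj_le b0)
  finally show "norm (ap (compress T) v) \<le> b * norm v" .
qed

lemma compress_sum: "compress (\<Sum>i\<in>I. T i) = (\<Sum>i\<in>I. compress (T i))"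
  by (simp add: compress_def sum_distrib_left sum_distrib_right)

lemma strong_meas_compress: "strong_meas N T \<Longrightarrow> strong_meas N (\<lambda>x. compress (T x))"
  unfolding compress_def by (intro strong_meas_mult strong_meas_const)

end

lemma sum_pairs: "(\<Sum>i=1..2 * q. f i) = (\<Sum>i=1..q. f (2 * i - 1) + f (2 * i))" for f :: "nat \<Rightarrow> real"
  by (induction q) (simp_all add: add.assoc)

section \<open>Concentration of compressed sums and passage to the full space\<close>

context setting
begin

definition "E0 = (SOME E. onb ip E)"

lemma onb_E0: "onb ip E0"
  unfolding E0_def using ex_onb by (rule someI_ex)

abbreviation "Fk \<equiv> fin_part E0"

lemma finite_onset_Fk: "finite_onset K scale ip (Fk k)" by (rule finite_onset_subset_part[OF onb_E0])

abbreviation "compress_k k \<equiv> finite_onset.compress scale ip (Fk k)"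

text \<open>The error splits into the projection error at \<open>v\<close>, passed through
  \<open>T\<close>, and the projection error at \<open>T v\<close>.\<close>

lemma compress_k_tendsto: "(\<lambda>k. ap (compress_k k T) v) \<longlonglongrightarrow> ap T v"
proof -
  let ?p = "\<lambda>k. pr (Fk k)"
  have 1: "(\<lambda>k. norm (ap T (?p k v) - ap T v) + norm (?p k (ap T v) - ap T v)) \<longlonglongrightarrow> norm (ap T v - ap T v) + norm (ap T v - ap T v)"
    by (intro tendsto_intros pr_tendsto[OF onb_E0] blinfun.tendsto[OF tendsto_const])
  have "(\<lambda>k. ap (compress_k k T) v - ap T v) \<longlonglongrightarrow> 0"
  proof (rule Lim_null_comparison)
    show "\<forall>\<^sub>F k in sequentially. norm (ap (compress_k k T) v - ap T v) \<le> norm (ap T (?p k v) - ap T v) + norm (?p k (ap T v) - ap T v)"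
    proof (rule always_eventually, rule allI)
      fix k
      interpret k: finite_onset K scale ip "Fk k" by (rule finite_onset_Fk)
      have "ap (k.compress T) v - ap T v = k.prj (ap T (k.prj v) - ap T v) + (k.prj (ap T v) - ap T v)"
        by (simp add: k.ap_compress k.prj_diff)
      then show "norm (ap (k.compress T) v - ap T v) \<le> norm (ap T (k.prj v) - ap T v) + norm (k.prj (ap T v) - ap T v)"
        by (metis norm_triangle_mono k.norm_prj_le order_refl)
    qed
    show "(\<lambda>k. norm (ap T (?p k v) - ap T v) + norm (?p k (ap T v) - ap T v)) \<longlonglongrightarrow> 0"
      using 1 by simp
  qed
  then show ?thesis by (rule LIM_zero_cancel)
qed

text \<open>Compressions converge only strongly, and the norm is merely lower semicontinuous in that
  mode: a single vector on which \<open>T\<close> exceeds the factor \<open>r\<close> survives in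
  the limit. This explains the strict inequality.\<close>

lemma eventually_norm_compress_k: assumes r: "0 \<le> r" "r < norm T" shows "\<forall>\<^sub>F k in sequentially. r \<le> norm (compress_k k T)"
proof -
  have "\<exists>v. r * norm v < norm (ap T v)"
  proof (rule ccontr)
    assume "\<not> (\<exists>v. r * norm v < norm (ap T v))"
    then have "norm T \<le> r" by (intro norm_bop_bound r(1)) (simp add: not_less)
    then show False using r(2) by simp
  qed
  then obtain v where v: "r * norm v < norm (ap T v)" by blast
  have "(\<lambda>k. norm (ap (compress_k k T) v)) \<longlonglongrightarrow> norm (ap T v)" by (intro tendsto_intros compress_k_tendsto)
  then have "\<forall>\<^sub>F k in sequentially. r * norm v < norm (ap (compress_k k T) v)" using v by (rule order_tendstoD)
  then show ?thesis
  proof (rule eventually_mono)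
    fix k assume "r * norm v < norm (ap (compress_k k T) v)"
    then have "r * norm v < norm (compress_k k T) * norm v" using norm_ap_le[of "compress_k k T" v] by linarith
    then have "r < norm (compress_k k T)" by (rule mult_right_less_imp_less) simp
    then show "r \<le> norm (compress_k k T)" by simp
  qed
qed

lemma meas_sum_ge:
  fixes m :: nat
  assumes "\<And>i. i \<in> {1..m} \<Longrightarrow> strong_meas M (T i)"
  shows "{\<omega> \<in> space M. \<exists>i\<in>{1..m}. r \<le> norm (\<Sum>l=1..i. T l \<omega> :: 'a bop)} \<in> events"
proof (rule sets.sets_Collect_finite_Ex)
  fix i assume i: "i \<in> {1..m}"
  have "(\<lambda>\<omega>. norm (\<Sum>l=1..i. T l \<omega>)) \<in> borel_measurable M"
    using i by (intro strong_meas_norm strong_meas_sum assms) auto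
  then show "{\<omega> \<in> space M. r \<le> norm (\<Sum>l=1..i. T l \<omega>)} \<in> events"
    by (rule borel_measurable_le[rotated]) (rule borel_measurable_const)
qed simp

lemma compressed_bennett:
  assumes s0: "0 < s0" "norm Sg \<le> s0" and t: "(\<Sum>e\<in>Fk k. ap Sg e \<bullet> e) \<le> t" and r: "0 < r"
  shows "prob {\<omega> \<in> space M. \<exists>i\<in>{1..n}. r \<le> norm (\<Sum>l=1..i. compress_k k (U l \<omega>))} \<le> bennett_bound (real n) (2 * c) t s0 r"
proof -
  interpret k: finite_onset K scale ip "Fk k" by (rule finite_onset_Fk)
  \<comment> \<open>The ratio of trace and variance bound is the intrinsic dimension; it is raised
    to at least one because \<open>cosh_ratio\<close> asks for that.\<close>
  interpret ob: operator_bennett K scale ip "Fk k" M "\<lambda>_. borel" X "\<lambda>i x. k.compress (truncate c x - m0)" n "2 * c" "max (t / s0) 1" "\<lambda>_. s0"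
  proof (intro operator_bennett.intro k.finite_onset_axioms prob_space_axioms operator_bennett_axioms.intro indepX)
    fix i v \<omega> assume i: "i \<in> {1..n}"
    have sm: "strong_meas M (\<lambda>\<omega>. k.compress (U i \<omega>))" by (intro k.strong_meas_compress strong_meas_U i)
    have nc: "norm (k.compress (U i \<omega>)) \<le> 2 * c" for \<omega> by (intro k.norm_compress norm_U)
    have int: "integrable M (\<lambda>\<omega>. (norm (ap (U i \<omega>) v))\<^sup>2)" for v
      by (rule integrable_norm_sq_ap[OF strong_meas_U[OF i] norm_U])
    have intc: "integrable M (\<lambda>\<omega>. (norm (ap (k.compress (U i \<omega>)) v))\<^sup>2)" for v
      by (rule integrable_norm_sq_ap[OF sm nc])
    have le: "expectation (\<lambda>\<omega>. (norm (ap (k.compress (U i \<omega>)) v))\<^sup>2) \<le> ap Sg (k.prj v) \<bullet> k.prj v" for v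
      unfolding Sg_quadratic[OF i] by (intro expectation_mono_bdd int intc power_mono k.norm_ap_compress norm_ge_zero)
    show "strong_meas borel (\<lambda>x. k.compress (truncate c x - m0))" by (intro k.strong_meas_compress strong_meas_diff strong_meas_truncate strong_meas_const)
    have "expectation (\<lambda>\<omega>. ap (k.compress (U i \<omega>)) v) = ap k.prjop (expectation (\<lambda>\<omega>. ap (U i \<omega>) (k.prj v)))"
      unfolding k.ap_compress k.ap_prjop[symmetric]
      by (rule integral_bounded_linear[OF blinfun.bounded_linear_right integrable_ap[OF strong_meas_U[OF i] norm_U]])
    then show "expectation (\<lambda>\<omega>. ap (k.compress (U i \<omega>)) v) = 0" by (simp only: mean_U[OF i] ap_linear)
    have "expectation (\<lambda>\<omega>. (norm (ap (k.compress (U i \<omega>)) v))\<^sup>2) \<le> norm Sg * (norm (k.prj v))\<^sup>2"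
      by (rule order_trans[OF le Sg_quadratic_le])
    also have "\<dots> \<le> s0 * (norm v)\<^sup>2"
      using s0 by (intro mult_mono power_mono k.norm_prj_le) auto
    finally show "expectation (\<lambda>\<omega>. (norm (ap (k.compress (U i \<omega>)) v))\<^sup>2) \<le> s0 * (norm v)\<^sup>2" .
    have "expectation (\<lambda>\<omega>. \<Sum>e\<in>Fk k. (norm (ap (k.compress (U i \<omega>)) e))\<^sup>2) = (\<Sum>e\<in>Fk k. expectation (\<lambda>\<omega>. (norm (ap (k.compress (U i \<omega>)) e))\<^sup>2))"
      by (rule Bochner_Integration.integral_sum) (rule intc)
    also have "\<dots> \<le> (\<Sum>e\<in>Fk k. ap Sg e \<bullet> e)"
    proof (rule sum_mono)
      fix e assume "e \<in> Fk k"
      then show "expectation (\<lambda>\<omega>. (norm (ap (k.compress (U i \<omega>)) e))\<^sup>2) \<le> ap Sg e \<bullet> e"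
        using le[of e] by (simp only: k.prj_basis)
    qed
    also have "\<dots> \<le> max (t / s0) 1 * s0"
    proof -
      have "t = t / s0 * s0" using s0 by simp
      also have "\<dots> \<le> max (t / s0) 1 * s0" using s0 by (intro mult_right_mono) auto
      finally show ?thesis using t by linarith
    qed
    finally show "expectation (\<lambda>\<omega>. \<Sum>e\<in>Fk k. (norm (ap (k.compress (U i \<omega>)) e))\<^sup>2) \<le> max (t / s0) 1 * s0" .
    show "norm (k.compress (U i \<omega>)) \<le> 2 * c" by (rule nc)
    assume \<omega>: "\<omega> \<in> space M"
    show "k.compress (U i \<omega>) \<in> k.G" by (intro k.compress_G K_lin_U i \<omega>)
    show "adj (k.compress (U i \<omega>)) (k.compress (U i \<omega>))" by (intro k.adj_compress adj_U i \<omega>)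
    show "ap (k.compress (U i \<omega>)) (k.prj v) = ap (k.compress (U i \<omega>)) v" by (rule k.ap_compress_prj)
  qed (use c0 s0 in auto)
  show ?thesis
    unfolding bennett_bound_def using n8 by (intro ob.bennett_tail s0 r) auto
qed

text \<open>Lower semicontinuity of the norm reaches every level \<open>\<rho>\<close> strictly
  below \<open>r\<close>, and left continuity of the bound recovers the level \<open>r\<close>
  itself.\<close>

theorem uncompressed_bennett:
  assumes s0: "0 < s0" "norm Sg \<le> s0" and t: "\<And>k. (\<Sum>e\<in>Fk k. ap Sg e \<bullet> e) \<le> t" and r: "0 < r"
  shows "prob {\<omega> \<in> space M. \<exists>i\<in>{1..n}. r \<le> norm (\<Sum>l=1..i. U l \<omega>)} \<le> bennett_bound (real n) (2 * c) t s0 r"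
proof -
  let ?S = "{\<omega> \<in> space M. \<exists>i\<in>{1..n}. r \<le> norm (\<Sum>l=1..i. U l \<omega>)}"
  have mS: "?S \<in> events" by (rule meas_sum_ge) (rule strong_meas_U)
  have le: "prob ?S \<le> bennett_bound (real n) (2 * c) t s0 \<rho>" if \<rho>: "0 < \<rho>" "\<rho> < r" for \<rho>
  proof (rule prob_le_eventually[OF _ compressed_bennett[OF s0 t \<rho>(1)] _ mS])
    fix k
    show "{\<omega> \<in> space M. \<exists>i\<in>{1..n}. \<rho> \<le> norm (\<Sum>l=1..i. compress_k k (U l \<omega>))} \<in> events"
      by (rule meas_sum_ge) (rule finite_onset.strong_meas_compress[OF finite_onset_Fk strong_meas_U])
  next
    fix \<omega> assume "\<omega> \<in> ?S"
    then obtain i where i: "\<omega> \<in> space M" "i \<in> {1..n}" "r \<le> norm (\<Sum>l=1..i. U l \<omega>)" by blast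
    have "\<forall>\<^sub>F k in sequentially. \<rho> \<le> norm (compress_k k (\<Sum>l=1..i. U l \<omega>))"
      by (rule eventually_norm_compress_k) (use \<rho> i in auto)
    then show "\<forall>\<^sub>F k in sequentially. \<omega> \<in> {\<omega> \<in> space M. \<exists>i\<in>{1..n}. \<rho> \<le> norm (\<Sum>l=1..i. compress_k k (U l \<omega>))}"
    proof (rule eventually_mono)
      fix k assume "\<rho> \<le> norm (compress_k k (\<Sum>l=1..i. U l \<omega>))"
      then show "\<omega> \<in> {\<omega> \<in> space M. \<exists>i\<in>{1..n}. \<rho> \<le> norm (\<Sum>l=1..i. compress_k k (U l \<omega>))}"
        unfolding finite_onset.compress_sum[OF finite_onset_Fk] using i by blast
    qed
  qed
  have "continuous_on {0..} (bennett_bound (real n) (2 * c) t s0)"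
    using n8 c0 s0 by (intro bennett_bound_continuous) auto
  then have "continuous (at r within {0..}) (bennett_bound (real n) (2 * c) t s0)"
    using r by (simp add: continuous_on_eq_continuous_within)
  then have "continuous (at r within {0..r}) (bennett_bound (real n) (2 * c) t s0)"
    by (rule continuous_within_subset) auto
  then have "((bennett_bound (real n) (2 * c) t s0) \<longlongrightarrow> bennett_bound (real n) (2 * c) t s0 r) (at_left r)"
    using r by (simp add: continuous_within at_within_Icc_at_left)
  moreover have "\<forall>\<^sub>F \<rho> in at_left r. prob ?S \<le> bennett_bound (real n) (2 * c) t s0 \<rho>"
    using eventually_at_left_real[OF r] by (rule eventually_mono) (rule le, simp_all)
  ultimately show ?thesis
    by (rule tendsto_lowerbound) (rule trivial_limit_at_left_real)
qed

abbreviation "N2 \<equiv> n div 2"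

text \<open>The trace of the variance of the compressed deviation. It serves as the variance bound
  in the Bernstein inequality for the \<open>QQ i\<close>, with \<open>\<kappa> = 1\<close>; the
  prefactor is then \<open>2\<close>, whence the \<open>ln (2 / \<delta>)\<close> in
  \<open>Gamma_dev\<close>.\<close>

definition "HSk k i = expectation (\<lambda>\<omega>. \<Sum>e\<in>Fk k. (norm (ap (compress_k k (QQ i \<omega> - Sg)) e))\<^sup>2)"

lemma strong_meas_QQ_Sg: "i \<in> {1..N2} \<Longrightarrow> strong_meas M (\<lambda>\<omega>. QQ i \<omega> - Sg)"
  by (intro strong_meas_diff strong_meas_QQ pair_idx strong_meas_const)

lemma compressed_bernstein:
  assumes L: "0 < L" and S: "(\<Sum>i=1..N2. HSk k i) \<le> S" "0 \<le> S"
  shows "prob {\<omega> \<in> space M. \<exists>i\<in>{1..N2}. sqrt (2 * S * L) + 2 * c\<^sup>2 / 3 * L \<le> norm (\<Sum>l=1..i. compress_k k (QQ l \<omega> - Sg))} \<le> 2 * exp (- L)"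
proof -
  interpret k: finite_onset K scale ip "Fk k" by (rule finite_onset_Fk)
  let ?A = "\<lambda>i. {2 * i - 1, 2 * i}"
  have sub: "?A i \<subseteq> {1..n}" if "i \<in> {1..N2}" for i using pair_idx[OF that] by auto
  have indA: "indep_vars (\<lambda>i. PiM (?A i) (\<lambda>_. borel)) (\<lambda>i \<omega>. \<lambda>j\<in>?A i. X j \<omega>) {1..N2}"
    using sub by (intro indep_vars_restrict[OF indepX]) (auto simp: disjoint_family_on_def)
  have QA: "Qx (\<lambda>j\<in>?A i. X j \<omega>) i = QQ i \<omega>" for i \<omega> by (rule Qx_cong) auto
  interpret ob: operator_bennett K scale ip "Fk k" M "\<lambda>i. PiM (?A i) (\<lambda>_. borel)" "\<lambda>i \<omega>. \<lambda>j\<in>?A i. X j \<omega>"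
    "\<lambda>i x. k.compress (Qx x i - Sg)" N2 "2 * c\<^sup>2" 1 "HSk k"
  proof (intro operator_bennett.intro k.finite_onset_axioms prob_space_axioms operator_bennett_axioms.intro indA, unfold QA)
    fix i v \<omega> assume i: "i \<in> {1..N2}"
    show "strong_meas (PiM (?A i) (\<lambda>_. borel)) (\<lambda>x. k.compress (Qx x i - Sg))"
      by (intro k.strong_meas_compress strong_meas_diff strong_meas_Qx strong_meas_const) auto
    have sm: "strong_meas M (\<lambda>\<omega>. k.compress (QQ i \<omega> - Sg))" by (intro k.strong_meas_compress strong_meas_QQ_Sg i)
    have nc: "norm (k.compress (QQ i \<omega> - Sg)) \<le> 2 * c\<^sup>2" if "\<omega> \<in> space M" for \<omega> by (intro k.norm_compress norm_QQ_Sg i that)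
    have intc: "integrable M (\<lambda>\<omega>. (norm (ap (k.compress (QQ i \<omega> - Sg)) v))\<^sup>2)" for v
      by (rule integrable_norm_sq_ap[OF sm nc])
    have iq: "integrable M (\<lambda>\<omega>. ap (QQ i \<omega> - Sg) v)" for v
      by (rule integrable_ap[OF strong_meas_QQ_Sg[OF i] norm_QQ_Sg[OF i]])
    have iQ: "integrable M (\<lambda>\<omega>. ap (QQ i \<omega>) v)" for v
      by (rule integrable_ap[OF strong_meas_QQ[OF pair_idx(1,2)[OF i]] norm_Qx])
    have mq: "expectation (\<lambda>\<omega>. ap (QQ i \<omega> - Sg) v) = 0" for v
      using iQ mean_QQ[OF i, of v] by (simp add: prob_space)
    have "expectation (\<lambda>\<omega>. ap (k.compress (QQ i \<omega> - Sg)) v) = ap k.prjop (expectation (\<lambda>\<omega>. ap (QQ i \<omega> - Sg) (k.prj v)))"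
      unfolding k.ap_compress k.ap_prjop[symmetric] by (rule integral_bounded_linear[OF blinfun.bounded_linear_right iq])
    then show "expectation (\<lambda>\<omega>. ap (k.compress (QQ i \<omega> - Sg)) v) = 0" by (simp only: mq ap_linear)
    have iHS: "integrable M (\<lambda>\<omega>. \<Sum>e\<in>Fk k. (norm (ap (k.compress (QQ i \<omega> - Sg)) e))\<^sup>2)"
      by (intro Bochner_Integration.integrable_sum intc)
    have "expectation (\<lambda>\<omega>. (norm (ap (k.compress (QQ i \<omega> - Sg)) v))\<^sup>2) \<le> expectation (\<lambda>\<omega>. (\<Sum>e\<in>Fk k. (norm (ap (k.compress (QQ i \<omega> - Sg)) e))\<^sup>2) * (norm v)\<^sup>2)"
    proof (rule expectation_mono_bdd[OF intc])
      show "integrable M (\<lambda>\<omega>. (\<Sum>e\<in>Fk k. (norm (ap (k.compress (QQ i \<omega> - Sg)) e))\<^sup>2) * (norm v)\<^sup>2)"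
        by (intro integrable_mult_left iHS)
      fix \<omega> assume \<omega>: "\<omega> \<in> space M"
      have "k.compress (QQ i \<omega> - Sg) \<in> k.G" by (intro k.compress_G K_lin_intros K_lin_QQ K_lin_Sg i \<omega>)
      from k.norm_ap_HS[OF this, of v]
      show "(norm (ap (k.compress (QQ i \<omega> - Sg)) v))\<^sup>2 \<le> (\<Sum>e\<in>Fk k. (norm (ap (k.compress (QQ i \<omega> - Sg)) e))\<^sup>2) * (norm v)\<^sup>2"
        unfolding k.ap_compress_prj .
    qed
    also have "\<dots> = HSk k i * (norm v)\<^sup>2" unfolding HSk_def by (rule integral_mult_left_zero)
    finally show "expectation (\<lambda>\<omega>. (norm (ap (k.compress (QQ i \<omega> - Sg)) v))\<^sup>2) \<le> HSk k i * (norm v)\<^sup>2" .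
    show "expectation (\<lambda>\<omega>. \<Sum>e\<in>Fk k. (norm (ap (k.compress (QQ i \<omega> - Sg)) e))\<^sup>2) \<le> 1 * HSk k i" by (simp add: HSk_def)
    show "0 \<le> HSk k i" unfolding HSk_def by (intro integral_nonneg_AE AE_I2 sum_nonneg zero_le_power2)
    assume \<omega>: "\<omega> \<in> space M"
    show "norm (k.compress (QQ i \<omega> - Sg)) \<le> 2 * c\<^sup>2" by (rule nc[OF \<omega>])
    show "k.compress (QQ i \<omega> - Sg) \<in> k.G" by (intro k.compress_G K_lin_intros K_lin_QQ K_lin_Sg i \<omega>)
    show "adj (k.compress (QQ i \<omega> - Sg)) (k.compress (QQ i \<omega> - Sg))" by (intro k.adj_compress adj_intros adj_QQ adj_Sg i \<omega>)
    show "ap (k.compress (QQ i \<omega> - Sg)) (k.prj v) = ap (k.compress (QQ i \<omega> - Sg)) v" by (rule k.ap_compress_prj)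
  qed (use c0 in auto)
  show ?thesis
    using ob.bernstein_tail[OF S L refl] unfolding QA .
qed

text \<open>The event is stated with a strict inequality, so
  \<open>eventually_norm_compress_k\<close> applies at the level \<open>?r\<close> directly.\<close>

theorem uncompressed_bernstein:
  assumes L: "0 < L" and S: "\<And>k. (\<Sum>i=1..N2. HSk k i) \<le> S" "0 \<le> S"
  shows "prob {\<omega> \<in> space M. sqrt (2 * S * L) + 2 * c\<^sup>2 / 3 * L < norm (\<Sum>l=1..N2. QQ l \<omega> - Sg)} \<le> 2 * exp (- L)"
    and "{\<omega> \<in> space M. sqrt (2 * S * L) + 2 * c\<^sup>2 / 3 * L < norm (\<Sum>l=1..N2. QQ l \<omega> - Sg)} \<in> events"
proof -
  let ?r = "sqrt (2 * S * L) + 2 * c\<^sup>2 / 3 * L"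
  let ?S = "{\<omega> \<in> space M. ?r < norm (\<Sum>l=1..N2. QQ l \<omega> - Sg)}"
  have r: "0 \<le> ?r" using L S(2) by simp
  have "(\<lambda>\<omega>. norm (\<Sum>l=1..N2. QQ l \<omega> - Sg)) \<in> borel_measurable M"
    by (intro strong_meas_norm strong_meas_sum strong_meas_QQ_Sg)
  then show mS: "?S \<in> events"
    by (rule borel_measurable_less[rotated]) (rule borel_measurable_const)
  have N: "N2 \<in> {1..N2}" using n8 by simp
  show "prob ?S \<le> 2 * exp (- L)"
  proof (rule prob_le_eventually[OF _ compressed_bernstein[OF L S] _ mS])
    fix k
    show "{\<omega> \<in> space M. \<exists>i\<in>{1..N2}. ?r \<le> norm (\<Sum>l=1..i. compress_k k (QQ l \<omega> - Sg))} \<in> events"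
      by (rule meas_sum_ge) (rule finite_onset.strong_meas_compress[OF finite_onset_Fk strong_meas_QQ_Sg])
  next
    fix \<omega> assume \<omega>: "\<omega> \<in> ?S"
    then have "\<forall>\<^sub>F k in sequentially. ?r \<le> norm (compress_k k (\<Sum>l=1..N2. QQ l \<omega> - Sg))"
      by (intro eventually_norm_compress_k r) blast
    then show "\<forall>\<^sub>F k in sequentially. \<omega> \<in> {\<omega> \<in> space M. \<exists>i\<in>{1..N2}. ?r \<le> norm (\<Sum>l=1..i. compress_k k (QQ l \<omega> - Sg))}"
    proof (rule eventually_mono)
      fix k assume "?r \<le> norm (compress_k k (\<Sum>l=1..N2. QQ l \<omega> - Sg))"
      then show "\<omega> \<in> {\<omega> \<in> space M. \<exists>i\<in>{1..N2}. ?r \<le> norm (\<Sum>l=1..i. compress_k k (QQ l \<omega> - Sg))}"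
        unfolding finite_onset.compress_sum[OF finite_onset_Fk] using \<omega> N by blast
    qed
  qed
qed

end

section \<open>Empirical quantities\<close>

lemma sample_variance_cong:
  assumes "\<And>i. i \<in> {1..m} \<Longrightarrow> Z i = Z' i" shows "sample_variance m Z = sample_variance m Z'"
proof -
  have "(\<Sum>j=1..m. \<Sum>i\<in>{1..<j}. (Z i - Z j)\<^sup>2) = (\<Sum>j=1..m. \<Sum>i\<in>{1..<j}. (Z' i - Z' j)\<^sup>2)"
    by (intro sum.cong refl) (use assms in auto)
  then show ?thesis by (simp only: sample_variance_def)
qed

context setting
begin

text \<open>Half the squared Hilbert--Schmidt norm, capped at \<open>b\<close> so that it is a bounded measurable
  function of the operator everywhere; on trace class realizations it is the trace.\<close>

definition capped_HS :: "real \<Rightarrow> 'a bop \<Rightarrow> real" where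
  "capped_HS b T = (SUP k. min b ((\<Sum>e\<in>Fk k. (norm (ap T e))\<^sup>2) / 2))"

lemma capped_HS_bdd: "bdd_above (range (\<lambda>k. min b ((\<Sum>e\<in>Fk k. (norm (ap T e))\<^sup>2) / 2)))"
  by (rule bdd_aboveI[of _ b]) auto

lemma capped_HS_le: "capped_HS b T \<le> b"
  unfolding capped_HS_def by (rule cSUP_least) auto

lemma capped_HS_nonneg: assumes "0 \<le> b" shows "0 \<le> capped_HS b T"
proof -
  have "0 \<le> min b ((\<Sum>e\<in>Fk 0. (norm (ap T e))\<^sup>2) / 2)" using assms by (simp add: sum_nonneg)
  also have "\<dots> \<le> capped_HS b T" unfolding capped_HS_def by (rule cSUP_upper[OF UNIV_I capped_HS_bdd])
  finally show ?thesis .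
qed

lemma capped_HS_measurable: assumes "strong_meas N T" shows "(\<lambda>x. capped_HS b (T x)) \<in> borel_measurable N"
  unfolding capped_HS_def
proof (rule borel_measurable_cSUP)
  fix k
  show "(\<lambda>x. min b ((\<Sum>e\<in>Fk k. (norm (ap (T x) e))\<^sup>2) / 2)) \<in> borel_measurable N"
    by (intro borel_measurable_min borel_measurable_const borel_measurable_divide borel_measurable_sum
        borel_measurable_power measurable_compose[OF strong_measD[OF assms] borel_measurable_norm])
qed (auto intro: capped_HS_bdd)

lemma capped_HS_eq:
  assumes h: "((\<lambda>e. (norm (ap T e))\<^sup>2) has_sum 2 * t) E0" and t: "t \<le> b"
  shows "capped_HS b T = t" "(\<Sum>e\<in>Fk k. (norm (ap T e))\<^sup>2) \<le> 2 * t"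
proof -
  have fin: "finite (Fk k)" for k using finite_onset.finF[OF finite_onset_Fk] .
  show le: "(\<Sum>e\<in>Fk k. (norm (ap T e))\<^sup>2) \<le> 2 * t" for k
    by (rule finite_sum_le_has_sum[OF h fin fin_part_subset]) simp
  have eq: "min b ((\<Sum>e\<in>Fk k. (norm (ap T e))\<^sup>2) / 2) = (\<Sum>e\<in>Fk k. (norm (ap T e))\<^sup>2) / 2" for k
    using le[of k] t by simp
  have "(\<lambda>k. (\<Sum>e\<in>Fk k. (norm (ap T e))\<^sup>2) / 2) \<longlonglongrightarrow> 2 * t / 2"
    by (intro tendsto_divide has_sum_fin_part[OF countable_onb[OF onb_E0] h] tendsto_const) simp
  then have lim: "(\<lambda>k. (\<Sum>e\<in>Fk k. (norm (ap T e))\<^sup>2) / 2) \<longlonglongrightarrow> t" by simp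
  have bdd: "bdd_above (range (\<lambda>k. (\<Sum>e\<in>Fk k. (norm (ap T e))\<^sup>2) / 2))"
  proof (rule bdd_aboveI)
    fix x assume "x \<in> range (\<lambda>k. (\<Sum>e\<in>Fk k. (norm (ap T e))\<^sup>2) / 2)"
    then obtain k where "x = (\<Sum>e\<in>Fk k. (norm (ap T e))\<^sup>2) / 2" by blast
    then show "x \<le> t" using le[of k] by simp
  qed
  show "capped_HS b T = t"
    unfolding capped_HS_def eq
  proof (rule antisym)
    show "(SUP k. (\<Sum>e\<in>Fk k. (norm (ap T e))\<^sup>2) / 2) \<le> t"
    proof (rule cSUP_least)
      fix k
      show "(\<Sum>e\<in>Fk k. (norm (ap T e))\<^sup>2) / 2 \<le> t" using le[of k] by simp
    qed simp
    show "t \<le> (SUP k. (\<Sum>e\<in>Fk k. (norm (ap T e))\<^sup>2) / 2)"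
      by (rule LIMSEQ_le_const2[OF lim], intro exI allI impI, rule cSUP_upper[OF UNIV_I bdd])
  qed
qed

text \<open>Realizations on which truncation and capping change nothing, so that the measurable
  surrogates agree with the empirical quantities of the statement.\<close>

definition "good \<omega> \<longleftrightarrow> \<omega> \<in> space M \<and> (\<forall>i\<in>{1..n}. norm (X i \<omega>) \<le> c \<and>
   trace_class ip (op_sq (X i \<omega>)) \<and> op_trace ip (op_sq (X i \<omega>)) \<le> B)"

lemma AE_good: "AE \<omega> in M. good \<omega>"
proof -
  have "AE \<omega> in M. \<forall>i\<in>{1..n}. norm (X i \<omega>) \<le> c \<and> trace_class ip (op_sq (X i \<omega>)) \<and> op_trace ip (op_sq (X i \<omega>)) \<le> B"
    by (rule AE_finite_allI) (use normX traceX in \<open>auto simp: AE_conj_iff\<close>)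
  then show ?thesis using AE_space by eventually_elim (simp add: good_def)
qed

abbreviation "Xr \<omega> \<equiv> (\<lambda>i. X i \<omega>)"
abbreviation "N4 \<equiv> n div 4"

lemma n_eq: "n = 4 * N4" "N2 = 2 * N4" "2 \<le> N4" "real N2 = real n / 2" "real N4 = real n / 4"
  using n4 n8 by auto

context fixes \<omega> assumes g: "good \<omega>"
begin

lemma good_space: "\<omega> \<in> space M" using g by (simp add: good_def)

lemma good_truncate: "i \<in> {1..n} \<Longrightarrow> truncate c (X i \<omega>) = to_bop (X i \<omega>)"
  using g by (simp add: good_def truncate_def)

lemma ap_DD: assumes i: "i \<in> {1..N2}" shows "ap (DD i \<omega>) = blinfun_apply (X (2 * i - 1) \<omega> - X (2 * i) \<omega>)"
  unfolding Dx_def good_truncate[OF pair_idx(1)[OF i]] good_truncate[OF pair_idx(2)[OF i]] minus_bop_def by simp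

lemma of_QQ: assumes i: "i \<in> {1..N2}" shows "of_bop (QQ i \<omega>) = paired (Xr \<omega>) i"
proof (rule blinfun_eqI)
  fix v
  show "ap (QQ i \<omega>) v = blinfun_apply (paired (Xr \<omega>) i) v"
    unfolding Qx_def paired_def op_sq_def power2_eq_square ap_simps ap_DD[OF i] blinfun.scaleR_left blinfun_apply_blinfun_compose ..
qed

lemma pair_trace:
  assumes i: "i \<in> {1..N2}"
  shows "\<exists>t. ((\<lambda>e. (norm (ap (DD i \<omega>) e))\<^sup>2) has_sum 2 * t) E0 \<and> has_trace ip (paired (Xr \<omega>) i) t \<and> t \<le> 2 * B"
proof -
  have h: "((\<lambda>e. (norm (blinfun_apply (X j \<omega>) e))\<^sup>2) has_sum op_trace ip (op_sq (X j \<omega>))) E0"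
    "op_trace ip (op_sq (X j \<omega>)) \<le> B" if "j \<in> {1..n}" for j
  proof -
    show "((\<lambda>e. (norm (blinfun_apply (X j \<omega>) e))\<^sup>2) has_sum op_trace ip (op_sq (X j \<omega>))) E0"
      using g that by (intro trace_class_op_sq saX good_space onb_E0) (auto simp: good_def)
    show "op_trace ip (op_sq (X j \<omega>)) \<le> B" using g that by (auto simp: good_def)
  qed
  from has_trace_paired[OF onb_E0 saX[OF pair_idx(1)[OF i] good_space] saX[OF pair_idx(2)[OF i] good_space] h(1)[OF pair_idx(1)[OF i]] h(1)[OF pair_idx(2)[OF i]]]
  obtain t where t: "((\<lambda>e. (norm (blinfun_apply (X (2 * i - 1) \<omega> - X (2 * i) \<omega>) e))\<^sup>2) has_sum 2 * t) E0"
    "has_trace ip ((1 / 2) *\<^sub>R op_sq (X (2 * i - 1) \<omega> - X (2 * i) \<omega>)) t"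
    "t \<le> op_trace ip (op_sq (X (2 * i - 1) \<omega>)) + op_trace ip (op_sq (X (2 * i) \<omega>))" by blast
  then have "t \<le> 2 * B" using h(2)[OF pair_idx(1)[OF i]] h(2)[OF pair_idx(2)[OF i]] by linarith
  then show ?thesis using t(1,2) unfolding ap_DD[OF i] paired_def by blast
qed

lemma pair_trace_capped_HS:
  assumes i: "i \<in> {1..N2}"
  shows "has_trace ip (paired (Xr \<omega>) i) (capped_HS (2 * B) (DD i \<omega>))"
    and "(\<Sum>e\<in>Fk k. (norm (ap (DD i \<omega>) e))\<^sup>2) \<le> 2 * capped_HS (2 * B) (DD i \<omega>)"
  using pair_trace[OF i] capped_HS_eq by auto

text \<open>The differences have norm at most \<open>2 * c\<close> and their half-squares trace at
  most \<open>2 * B\<close>, so \<open>has_trace_paired_sq\<close> gives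
  \<open>c^2 * (2 * B + 2 * B)\<close>, the range that appears in \<open>tau_u'\<close>.\<close>

lemma pair_pair_trace_capped_HS:
  assumes i: "i \<in> {1..N4}"
  shows "has_trace ip (paired (paired (Xr \<omega>)) i) (capped_HS (4 * B * c\<^sup>2) (QQ (2 * i - 1) \<omega> - QQ (2 * i) \<omega>))"
    and "(\<Sum>e\<in>Fk k. (norm (ap (QQ (2 * i - 1) \<omega> - QQ (2 * i) \<omega>) e))\<^sup>2) \<le> 2 * capped_HS (4 * B * c\<^sup>2) (QQ (2 * i - 1) \<omega> - QQ (2 * i) \<omega>)"
proof -
  let ?D = "\<lambda>j. X (2 * j - 1) \<omega> - X (2 * j) \<omega>"
  have ij: "2 * i - 1 \<in> {1..N2}" "2 * i \<in> {1..N2}" using i n_eq(2) by auto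
  have sa: "self_adjoint ip (?D j)" if "j \<in> {1..N2}" for j
    by (intro self_adjoint_diff saX pair_idx[OF that] good_space)
  have nd: "norm (?D j) \<le> 2 * c" if "j \<in> {1..N2}" for j
  proof -
    have "norm (X (2 * j - 1) \<omega>) \<le> c" "norm (X (2 * j) \<omega>) \<le> c"
      using g pair_idx[OF that] by (auto simp: good_def)
    then show ?thesis using norm_triangle_ineq4[of "X (2 * j - 1) \<omega>" "X (2 * j) \<omega>"] by linarith
  qed
  obtain t1 where t1: "((\<lambda>e. (norm (blinfun_apply (?D (2 * i - 1)) e))\<^sup>2) has_sum 2 * t1) E0" "t1 \<le> 2 * B"
    using pair_trace[OF ij(1)] unfolding ap_DD[OF ij(1)] by blast
  obtain t2 where t2: "((\<lambda>e. (norm (blinfun_apply (?D (2 * i)) e))\<^sup>2) has_sum 2 * t2) E0" "t2 \<le> 2 * B"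
    using pair_trace[OF ij(2)] unfolding ap_DD[OF ij(2)] by blast
  from has_trace_paired_sq[OF onb_E0 sa[OF ij(1)] nd[OF ij(1)] t1(1) sa[OF ij(2)] nd[OF ij(2)] t2(1)]
  obtain t where t: "((\<lambda>e. (norm (blinfun_apply (paired (Xr \<omega>) (2 * i - 1) - paired (Xr \<omega>) (2 * i)) e))\<^sup>2) has_sum 2 * t) E0"
    "has_trace ip ((1 / 2) *\<^sub>R op_sq (paired (Xr \<omega>) (2 * i - 1) - paired (Xr \<omega>) (2 * i))) t" "t \<le> c\<^sup>2 * (t1 + t2)"
    unfolding paired_def by blast
  have "c\<^sup>2 * (t1 + t2) \<le> c\<^sup>2 * (4 * B)" using t1(2) t2(2) by (intro mult_left_mono) auto
  then have tb: "t \<le> 4 * B * c\<^sup>2" using t(3) by (simp add: mult.commute)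
  have e: "blinfun_apply (paired (Xr \<omega>) (2 * i - 1) - paired (Xr \<omega>) (2 * i)) = ap (QQ (2 * i - 1) \<omega> - QQ (2 * i) \<omega>)"
    unfolding of_QQ[OF ij(1), symmetric] of_QQ[OF ij(2), symmetric] minus_bop_def by simp
  note capped_HS = capped_HS_eq[OF t(1)[unfolded e] tb]
  show "has_trace ip (paired (paired (Xr \<omega>)) i) (capped_HS (4 * B * c\<^sup>2) (QQ (2 * i - 1) \<omega> - QQ (2 * i) \<omega>))"
    using t(2) unfolding capped_HS(1) paired_def[of "paired (Xr \<omega>)"] .
  show "(\<Sum>e\<in>Fk k. (norm (ap (QQ (2 * i - 1) \<omega> - QQ (2 * i) \<omega>) e))\<^sup>2) \<le> 2 * capped_HS (4 * B * c\<^sup>2) (QQ (2 * i - 1) \<omega> - QQ (2 * i) \<omega>)"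
    using capped_HS(2) unfolding capped_HS(1) .
qed

end

definition "Z1 i \<omega> = capped_HS (2 * B) (DD i \<omega>)"
definition "Z2 i \<omega> = capped_HS (4 * B * c\<^sup>2) (QQ (2 * i - 1) \<omega> - QQ (2 * i) \<omega>)"

lemma bounded_indep1: "bounded_indep M Z1 N2 (2 * B)"
proof (intro bounded_indep.intro prob_space_axioms bounded_indep_axioms.intro)
  let ?A = "\<lambda>i. {2 * i - 1, 2 * i}"
  have "indep_vars (\<lambda>i. PiM (?A i) (\<lambda>_. borel)) (\<lambda>i \<omega>. \<lambda>j\<in>?A i. X j \<omega>) {1..N2}"
    by (intro indep_vars_restrict[OF indepX]) (auto simp: disjoint_family_on_def)
  then have "indep_vars (\<lambda>_. borel) (\<lambda>i \<omega>. capped_HS (2 * B) (Dx (\<lambda>j\<in>?A i. X j \<omega>) i)) {1..N2}"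
    by (rule indep_vars_compose2) (intro capped_HS_measurable strong_meas_Dx, auto)
  moreover have "Dx (\<lambda>j\<in>?A i. X j \<omega>) i = DD i \<omega>" for i \<omega> by (rule Dx_cong) auto
  ultimately show "indep_vars (\<lambda>_. borel) Z1 {1..N2}" by (simp add: Z1_def[abs_def])
  show "0 \<le> Z1 i \<omega> \<and> Z1 i \<omega> \<le> 2 * B" for i \<omega>
    using capped_HS_nonneg capped_HS_le B0 by (simp add: Z1_def)
qed (use B0 n8 in auto)

text \<open>Each \<open>Z2 i\<close> reads four consecutive operators, and these blocks of four are
  disjoint.\<close>

lemma bounded_indep2: "bounded_indep M Z2 N4 (4 * B * c\<^sup>2)"
proof (intro bounded_indep.intro prob_space_axioms bounded_indep_axioms.intro)
  let ?A = "\<lambda>i. {4 * i - 3, 4 * i - 2, 4 * i - 1, 4 * i}"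
  have idx: "2 * (2 * i - 1) - 1 \<in> ?A i" "2 * (2 * i - 1) \<in> ?A i" "2 * (2 * i) - 1 \<in> ?A i" "2 * (2 * i) \<in> ?A i" for i :: nat
    by auto
  have "indep_vars (\<lambda>i. PiM (?A i) (\<lambda>_. borel)) (\<lambda>i \<omega>. \<lambda>j\<in>?A i. X j \<omega>) {1..N4}"
  proof (rule indep_vars_restrict[OF indepX])
    show "?A i \<subseteq> {1..n}" if "i \<in> {1..N4}" for i using that by auto
    show "disjoint_family_on ?A {1..N4}"
      unfolding disjoint_family_on_def
    proof (intro ballI impI)
      fix i j assume ij: "i \<in> {1..N4}" "j \<in> {1..N4}" "i \<noteq> j"
      have "a \<noteq> b" if "a \<in> ?A i" "b \<in> ?A j" for a b
      proof -
        have "4 * i - 3 \<le> a \<and> a \<le> 4 * i" "4 * j - 3 \<le> b \<and> b \<le> 4 * j" using that ij by auto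
        then show ?thesis using ij by auto
      qed
      then show "?A i \<inter> ?A j = {}" by blast
    qed
  qed
  then have "indep_vars (\<lambda>_. borel) (\<lambda>i \<omega>. capped_HS (4 * B * c\<^sup>2) (Qx (\<lambda>j\<in>?A i. X j \<omega>) (2 * i - 1) - Qx (\<lambda>j\<in>?A i. X j \<omega>) (2 * i))) {1..N4}"
    by (rule indep_vars_compose2) (intro capped_HS_measurable strong_meas_diff strong_meas_Qx idx)
  moreover have "Qx (\<lambda>j\<in>?A i. X j \<omega>) (2 * i - 1) = QQ (2 * i - 1) \<omega>" "Qx (\<lambda>j\<in>?A i. X j \<omega>) (2 * i) = QQ (2 * i) \<omega>" for i \<omega>
    by (rule Qx_cong; rule restrict_apply'; rule idx)+
  ultimately show "indep_vars (\<lambda>_. borel) Z2 {1..N4}" by (simp only: Z2_def[abs_def])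
  show "0 \<le> Z2 i \<omega> \<and> Z2 i \<omega> \<le> 4 * B * c\<^sup>2" for i \<omega>
    using capped_HS_nonneg capped_HS_le B0 by (simp add: Z2_def)
qed (use B0 c0 n_eq(3) in auto)

text \<open>The deterministic quantities that \<open>tau_u\<close> and \<open>tau_u'\<close>
  estimate from above. They dominate the trace of \<open>Sg\<close> and the averaged trace of the
  variance of the \<open>QQ i\<close>.\<close>

definition "\<tau>0 = (\<Sum>i=1..N2. expectation (Z1 i)) / real N2"
definition "\<tau>0' = (\<Sum>i=1..N4. expectation (Z2 i)) / real N4"

text \<open>By \<open>expectation_DD\<close> the sum over a finite part of the basis is half an
  expected partial Hilbert-Schmidt sum, and on good realizations \<open>Z1 i\<close> dominates half
  of that partial sum.\<close>

lemma trace_Sg_le: "(\<Sum>e\<in>Fk k. ap Sg e \<bullet> e) \<le> \<tau>0"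
proof -
  have "(\<Sum>e\<in>Fk k. ap Sg e \<bullet> e) \<le> expectation (Z1 i)" if i: "i \<in> {1..N2}" for i
  proof -
    have int: "integrable M (\<lambda>\<omega>. (norm (ap (DD i \<omega>) e))\<^sup>2)" for e
      by (rule integrable_norm_sq_ap[OF strong_meas_DD[OF pair_idx(1,2)[OF i]] norm_Dx])
    have "(\<Sum>e\<in>Fk k. ap Sg e \<bullet> e) = (\<Sum>e\<in>Fk k. expectation (\<lambda>\<omega>. (norm (ap (DD i \<omega>) e))\<^sup>2)) / 2"
      unfolding power2_norm_eq_inner expectation_DD[OF i] by (simp add: sum_distrib_left[symmetric])
    also have "\<dots> = expectation (\<lambda>\<omega>. (\<Sum>e\<in>Fk k. (norm (ap (DD i \<omega>) e))\<^sup>2) / 2)"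
      using int by simp
    also have "\<dots> \<le> expectation (Z1 i)"
    proof (rule integral_mono_AE)
      show "integrable M (\<lambda>\<omega>. (\<Sum>e\<in>Fk k. (norm (ap (DD i \<omega>) e))\<^sup>2) / 2)"
        by (intro integrable_divide Bochner_Integration.integrable_sum int)
      show "integrable M (Z1 i)" by (rule bounded_indep.intZ[OF bounded_indep1 i])
      show "AE \<omega> in M. (\<Sum>e\<in>Fk k. (norm (ap (DD i \<omega>) e))\<^sup>2) / 2 \<le> Z1 i \<omega>"
        using AE_good
      proof eventually_elim
        case (elim \<omega>)
        from pair_trace_capped_HS(2)[OF this i, of k] show ?case by (simp add: Z1_def)
      qed
    qed
    finally show ?thesis .
  qed
  then have "(\<Sum>i=1..N2. \<Sum>e\<in>Fk k. ap Sg e \<bullet> e) \<le> (\<Sum>i=1..N2. expectation (Z1 i))" by (rule sum_mono)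
  then show ?thesis
    unfolding \<tau>0_def using n8 by (simp add: le_divide_eq mult.commute)
qed

text \<open>The pairing device once more, one level up: two independent copies with common mean
  \<open>Sg\<close> satisfy that the expected squared norm of their difference is the sum of both
  variances. Compression only decreases Hilbert-Schmidt sums, and the two members of each of the
  \<open>N4\<close> pairs account for \<open>N2 = 2 * N4\<close>.\<close>

lemma HSk_sum_le: "(\<Sum>i=1..N2. HSk k i) \<le> real N2 * \<tau>0'"
proof -
  define V where "V i = expectation (\<lambda>\<omega>. \<Sum>e\<in>Fk k. (norm (ap (QQ i \<omega> - Sg) e))\<^sup>2)" for i
  have int: "integrable M (\<lambda>\<omega>. (norm (ap (QQ i \<omega> - Sg) e))\<^sup>2)" if "i \<in> {1..N2}" for i e
    by (rule integrable_norm_sq_ap[OF strong_meas_QQ_Sg[OF that] norm_QQ_Sg[OF that]])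
  have HV: "HSk k i \<le> V i" if i: "i \<in> {1..N2}" for i
    unfolding HSk_def V_def
  proof (rule expectation_mono_bdd)
    have "norm (compress_k k (QQ i \<omega> - Sg)) \<le> 2 * c\<^sup>2" if "\<omega> \<in> space M" for \<omega>
      by (rule finite_onset.norm_compress[OF finite_onset_Fk norm_QQ_Sg[OF i that]])
    then show "integrable M (\<lambda>\<omega>. \<Sum>e\<in>Fk k. (norm (ap (compress_k k (QQ i \<omega> - Sg)) e))\<^sup>2)"
      by (intro Bochner_Integration.integrable_sum integrable_norm_sq_ap[OF finite_onset.strong_meas_compress[OF finite_onset_Fk strong_meas_QQ_Sg[OF i]]])
    show "integrable M (\<lambda>\<omega>. \<Sum>e\<in>Fk k. (norm (ap (QQ i \<omega> - Sg) e))\<^sup>2)"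
      by (intro Bochner_Integration.integrable_sum int i)
    fix \<omega>
    show "(\<Sum>e\<in>Fk k. (norm (ap (compress_k k (QQ i \<omega> - Sg)) e))\<^sup>2) \<le> (\<Sum>e\<in>Fk k. (norm (ap (QQ i \<omega> - Sg) e))\<^sup>2)"
    proof (intro sum_mono power_mono norm_ge_zero)
      fix e assume "e \<in> Fk k"
      then show "norm (ap (compress_k k (QQ i \<omega> - Sg)) e) \<le> norm (ap (QQ i \<omega> - Sg) e)"
        using finite_onset.norm_ap_compress[OF finite_onset_Fk, of k "QQ i \<omega> - Sg" e] by (simp only: finite_onset.prj_basis[OF finite_onset_Fk])
    qed
  qed
  have VV: "V (2 * i - 1) + V (2 * i) \<le> 2 * expectation (Z2 i)" if i: "i \<in> {1..N4}" for i
  proof -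
    let ?p = "2 * i - 1" and ?q = "2 * i"
    have pq: "?p \<in> {1..N2}" "?q \<in> {1..N2}" using i n_eq(2) by auto
    let ?P = "\<lambda>\<omega>. QQ ?p \<omega> - Sg" and ?Q = "\<lambda>\<omega>. QQ ?q \<omega> - Sg"
    have cross: "expectation (\<lambda>\<omega>. ap (?P \<omega>) e \<bullet> ap (?Q \<omega>) e) = 0" for e
    proof -
      let ?A = "{2 * ?p - 1, 2 * ?p}" and ?A' = "{2 * ?q - 1, 2 * ?q}"
      have QA: "Qx (\<lambda>j\<in>?A. X j \<omega>) ?p = QQ ?p \<omega>" "Qx (\<lambda>j\<in>?A'. X j \<omega>) ?q = QQ ?q \<omega>" for \<omega>
        by (rule Qx_cong; rule restrict_apply'; blast)+
      have "indep_var borel (\<lambda>\<omega>. ap (Qx (\<lambda>j\<in>?A. X j \<omega>) ?p - Sg) e) borel (\<lambda>\<omega>. ap (Qx (\<lambda>j\<in>?A'. X j \<omega>) ?q - Sg) e)"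
      proof (rule indep_blocks)
        show "?A \<inter> ?A' = {}" using i by auto
        show "?A \<subseteq> {1..n}" using pair_idx[OF pq(1)] by blast
        show "?A' \<subseteq> {1..n}" using pair_idx[OF pq(2)] by blast
        show "strong_meas (PiM ?A (\<lambda>_. borel)) (\<lambda>x. Qx x ?p - Sg)" by (intro strong_meas_diff strong_meas_Qx strong_meas_const) blast+
        show "strong_meas (PiM ?A' (\<lambda>_. borel)) (\<lambda>x. Qx x ?q - Sg)" by (intro strong_meas_diff strong_meas_Qx strong_meas_const) blast+
      qed
      then have "indep_var borel (\<lambda>\<omega>. ap (?P \<omega>) e) borel (\<lambda>\<omega>. ap (?Q \<omega>) e)" unfolding QA .
      then have "expectation (\<lambda>\<omega>. ap (?P \<omega>) e \<bullet> ap (?Q \<omega>) e) = expectation (\<lambda>\<omega>. ap (?P \<omega>) e) \<bullet> expectation (\<lambda>\<omega>. ap (?Q \<omega>) e)"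
        by (rule indep_var_inner[where a = "2 * c\<^sup>2 * norm e" and b = "2 * c\<^sup>2 * norm e"])
          (rule norm_ap_bound[OF norm_QQ_Sg[OF pq(1)]] norm_ap_bound[OF norm_QQ_Sg[OF pq(2)]]; assumption)+
      moreover have "expectation (\<lambda>\<omega>. ap (?P \<omega>) e) = 0"
        using integrable_ap[OF strong_meas_QQ[OF pair_idx(1,2)[OF pq(1)]] norm_Qx, of e] mean_QQ[OF pq(1), of e] by (simp add: prob_space)
      ultimately show ?thesis by (simp only: inner_zero_left)
    qed
    have intc: "integrable M (\<lambda>\<omega>. ap (?P \<omega>) e \<bullet> ap (?Q \<omega>) e)" for e
      by (rule integrable_inner_ap[OF strong_meas_QQ_Sg[OF pq(1)] norm_QQ_Sg[OF pq(1)] strong_meas_QQ_Sg[OF pq(2)] norm_QQ_Sg[OF pq(2)]])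
    have e2: "(norm (ap (QQ ?p \<omega> - QQ ?q \<omega>) e))\<^sup>2 = (norm (ap (?P \<omega>) e))\<^sup>2 + (norm (ap (?Q \<omega>) e))\<^sup>2 - 2 * (ap (?P \<omega>) e \<bullet> ap (?Q \<omega>) e)" for \<omega> e
    proof -
      have "(norm (x - y))\<^sup>2 = (norm x)\<^sup>2 + (norm y)\<^sup>2 - 2 * (x \<bullet> y)" for x y :: 'a
        by (simp add: power2_norm_eq_inner inner_diff_left inner_diff_right inner_commute)
      moreover have "ap (QQ ?p \<omega> - QQ ?q \<omega>) e = ap (?P \<omega>) e - ap (?Q \<omega>) e" by simp
      ultimately show ?thesis by (simp only:)
    qed
    have intd: "integrable M (\<lambda>\<omega>. (norm (ap (QQ ?p \<omega> - QQ ?q \<omega>) e))\<^sup>2)" for e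
      unfolding e2 using int[OF pq(1)] int[OF pq(2)] intc by simp
    have "expectation (\<lambda>\<omega>. (norm (ap (QQ ?p \<omega> - QQ ?q \<omega>) e))\<^sup>2) = expectation (\<lambda>\<omega>. (norm (ap (?P \<omega>) e))\<^sup>2) + expectation (\<lambda>\<omega>. (norm (ap (?Q \<omega>) e))\<^sup>2)" for e
      unfolding e2 using int[OF pq(1)] int[OF pq(2)] intc cross[of e] by (simp del: ap_simps)
    then have "V ?p + V ?q = expectation (\<lambda>\<omega>. \<Sum>e\<in>Fk k. (norm (ap (QQ ?p \<omega> - QQ ?q \<omega>) e))\<^sup>2)"
      unfolding V_def Bochner_Integration.integral_sum[OF int[OF pq(1)]] Bochner_Integration.integral_sum[OF int[OF pq(2)]] Bochner_Integration.integral_sum[OF intd]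
      by (simp only: sum.distrib)
    also have "\<dots> \<le> expectation (\<lambda>\<omega>. 2 * Z2 i \<omega>)"
    proof (rule integral_mono_AE)
      show "integrable M (\<lambda>\<omega>. \<Sum>e\<in>Fk k. (norm (ap (QQ ?p \<omega> - QQ ?q \<omega>) e))\<^sup>2)"
        by (intro Bochner_Integration.integrable_sum intd)
      show "integrable M (\<lambda>\<omega>. 2 * Z2 i \<omega>)" by (intro integrable_mult_right bounded_indep.intZ[OF bounded_indep2 i])
      show "AE \<omega> in M. (\<Sum>e\<in>Fk k. (norm (ap (QQ ?p \<omega> - QQ ?q \<omega>) e))\<^sup>2) \<le> 2 * Z2 i \<omega>"
        using AE_good
      proof eventually_elim
        case (elim \<omega>)
        from pair_pair_trace_capped_HS(2)[OF this i, of k] show ?case by (simp only: Z2_def)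
      qed
    qed
    finally show ?thesis by simp
  qed
  have "(\<Sum>i=1..N2. HSk k i) \<le> (\<Sum>i=1..N2. V i)" by (intro sum_mono HV)
  also have "\<dots> = (\<Sum>i=1..N4. V (2 * i - 1) + V (2 * i))" unfolding n_eq(2) by (rule sum_pairs)
  also have "\<dots> \<le> (\<Sum>i=1..N4. 2 * expectation (Z2 i))" by (intro sum_mono VV)
  also have "\<dots> = real N2 * \<tau>0'"
    unfolding \<tau>0'_def n_eq(2) sum_distrib_left[symmetric] using n_eq(3) by simp
  finally show ?thesis .
qed

lemma \<tau>0'_nonneg: "0 \<le> \<tau>0'"
  unfolding \<tau>0'_def Z2_def using B0 by (intro divide_nonneg_nonneg sum_nonneg integral_nonneg_AE AE_I2 capped_HS_nonneg) auto

end

lemma of_bop_sum: "of_bop (\<Sum>i\<in>I. T i) = (\<Sum>i\<in>I. of_bop (T i))"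
  by (rule blinfun_eqI) (simp add: ap_sum blinfun.sum_left)

lemma (in bounded_indep) empirical_bernstein_measurable:
  "{\<omega> \<in> space M. (\<Sum>i=1..m. Z i \<omega>) / real m + sqrt (sample_variance m (\<lambda>i. Z i \<omega>)) * x + y < z} \<in> events"
proof -
  have "(\<lambda>\<omega>. sqrt (2 / real m * scaled_variance \<omega>)) \<in> borel_measurable M"
    by (intro borel_measurable_sqrt[THEN measurable_compose[rotated]] borel_measurable_times borel_measurable_const mgf_scaled_variance(3)[of 0]) simp_all
  then show ?thesis
    unfolding sample_variance_eq
    by (intro borel_measurable_less borel_measurable_add borel_measurable_divide borel_measurable_sum borel_measurable_times
        borel_measurable_const measZ)
qed

section \<open>Exceptional events and their union\<close>

context setting
begin

definition "bad1 \<delta> = {\<omega> \<in> space M. (\<Sum>i=1..N2. Z1 i \<omega>) / real N2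
    + sqrt (sample_variance N2 (\<lambda>i. Z1 i \<omega>)) * sqrt (2 * ln (2 / \<delta>) / real N2)
    + 7 * (2 * B) * ln (2 / \<delta>) / (3 * (real N2 - 1)) < (\<Sum>i=1..N2. expectation (Z1 i)) / real N2}"

definition "bad2 \<delta> = {\<omega> \<in> space M. (\<Sum>i=1..N4. Z2 i \<omega>) / real N4
    + sqrt (sample_variance N4 (\<lambda>i. Z2 i \<omega>)) * sqrt (2 * ln (2 / \<delta>) / real N4)
    + 7 * (4 * B * c\<^sup>2) * ln (2 / \<delta>) / (3 * (real N4 - 1)) < (\<Sum>i=1..N4. expectation (Z2 i)) / real N4}"

definition "bad3 \<delta> = {\<omega> \<in> space M. sqrt (2 * (real N2 * \<tau>0') * ln (2 / \<delta>)) + 2 * c\<^sup>2 / 3 * ln (2 / \<delta>)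
    < norm (\<Sum>l=1..N2. QQ l \<omega> - Sg)}"

lemma bad_events:
  assumes "0 < \<delta>" "\<delta> < 1"
  shows "bad1 \<delta> \<in> events" "prob (bad1 \<delta>) \<le> \<delta>" "bad2 \<delta> \<in> events" "prob (bad2 \<delta>) \<le> \<delta>"
    "bad3 \<delta> \<in> events" "prob (bad3 \<delta>) \<le> \<delta>"
proof -
  show "bad1 \<delta> \<in> events"
    unfolding bad1_def by (rule bounded_indep.empirical_bernstein_measurable[OF bounded_indep1])
  show "prob (bad1 \<delta>) \<le> \<delta>"
    unfolding bad1_def by (rule bounded_indep.empirical_bernstein[OF bounded_indep1 assms])
  show "bad2 \<delta> \<in> events"
    unfolding bad2_def by (rule bounded_indep.empirical_bernstein_measurable[OF bounded_indep2])
  show "prob (bad2 \<delta>) \<le> \<delta>"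
    unfolding bad2_def by (rule bounded_indep.empirical_bernstein[OF bounded_indep2 assms])
  have L: "0 < ln (2 / \<delta>)" "2 * exp (- ln (2 / \<delta>)) = \<delta>" using assms by (simp_all add: exp_minus)
  have S: "0 \<le> real N2 * \<tau>0'" using \<tau>0'_nonneg by simp
  show "bad3 \<delta> \<in> events"
    unfolding bad3_def by (rule uncompressed_bernstein(2)[OF L(1) HSk_sum_le S])
  show "prob (bad3 \<delta>) \<le> \<delta>"
    using uncompressed_bernstein(1)[OF L(1) HSk_sum_le S] unfolding L(2) bad3_def .
qed

context fixes \<omega> assumes g: "good \<omega>"
begin

lemma norm_partial_sum:
  assumes "i \<in> {1..n}"
  shows "norm ((\<Sum>j=1..i. X j \<omega>) - real i *\<^sub>R \<mu>) = norm (\<Sum>l=1..i. U l \<omega>)"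
proof -
  have "of_bop (\<Sum>l=1..i. U l \<omega>) = (\<Sum>l=1..i. X l \<omega> - \<mu>)"
    unfolding of_bop_sum
  proof (rule sum.cong[OF refl])
    fix l assume "l \<in> {1..i}"
    then have "l \<in> {1..n}" using assms by auto
    then show "of_bop (U l \<omega>) = X l \<omega> - \<mu>" by (simp add: good_truncate[OF g] m0_def minus_bop_def)
  qed
  also have "\<dots> = (\<Sum>j=1..i. X j \<omega>) - real i *\<^sub>R \<mu>"
    by (simp add: sum_subtractf sum_constant_scaleR)
  finally show ?thesis by (simp add: norm_bop_def)
qed

lemma tau_u_ge:
  assumes "\<omega> \<notin> bad1 \<delta>" shows "\<tau>0 \<le> tau_u ip B n (Xr \<omega>) \<delta>"
proof -
  have tr: "op_trace ip (paired (Xr \<omega>) i) = Z1 i \<omega>" if "i \<in> {1..N2}" for i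
    unfolding Z1_def by (rule has_trace_unique[OF pair_trace_capped_HS(1)[OF g that]])
  have "op_trace ip (Sigma_n n (Xr \<omega>)) = 2 / real n * (\<Sum>i=1..N2. Z1 i \<omega>)"
    unfolding Sigma_n_def Z1_def by (intro has_trace_unique has_trace_scaled_sum pair_trace_capped_HS(1)[OF g])
  also have "\<dots> = (\<Sum>i=1..N2. Z1 i \<omega>) / real N2" by (simp add: n_eq(4))
  finally have 1: "op_trace ip (Sigma_n n (Xr \<omega>)) = (\<Sum>i=1..N2. Z1 i \<omega>) / real N2" .
  have 2: "sample_variance N2 (\<lambda>i. op_trace ip (paired (Xr \<omega>) i)) = sample_variance N2 (\<lambda>i. Z1 i \<omega>)"
    by (rule sample_variance_cong) (rule tr)
  show ?thesis
    using assms good_space[OF g] unfolding tau_u_def 1 2 n_eq(4)[symmetric] bad1_def \<tau>0_def by (simp add: not_less)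
qed

lemma tau_u'_ge:
  assumes "\<omega> \<notin> bad2 \<delta>" shows "\<tau>0' \<le> tau_u' ip c B n (Xr \<omega>) \<delta>"
proof -
  have tr: "op_trace ip (paired (paired (Xr \<omega>)) i) = Z2 i \<omega>" if "i \<in> {1..N4}" for i
    unfolding Z2_def by (rule has_trace_unique[OF pair_pair_trace_capped_HS(1)[OF g that]])
  have "op_trace ip (Sigma_n' n (Xr \<omega>)) = 4 / real n * (\<Sum>i=1..N4. Z2 i \<omega>)"
    unfolding Sigma_n'_def Z2_def by (intro has_trace_unique has_trace_scaled_sum pair_pair_trace_capped_HS(1)[OF g])
  also have "\<dots> = (\<Sum>i=1..N4. Z2 i \<omega>) / real N4" by (simp add: n_eq(5))
  finally have 1: "op_trace ip (Sigma_n' n (Xr \<omega>)) = (\<Sum>i=1..N4. Z2 i \<omega>) / real N4" .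
  have 2: "sample_variance N4 (\<lambda>i. op_trace ip (paired (paired (Xr \<omega>)) i)) = sample_variance N4 (\<lambda>i. Z2 i \<omega>)"
    by (rule sample_variance_cong) (rule tr)
  show ?thesis
    using assms good_space[OF g] unfolding tau_u'_def 1 2 n_eq(5)[symmetric] bad2_def \<tau>0'_def by (simp add: not_less)
qed

text \<open>The triangle inequality for the average of the \<open>QQ i\<close>, whose deviation from
  \<open>Sg\<close> is controlled outside \<open>bad3\<close> in terms of \<open>\<tau>0'\<close>;
  outside \<open>bad2\<close> the empirical \<open>tau_u'\<close> may replace
  \<open>\<tau>0'\<close>. Positivity comes from the linear term of \<open>Gamma_dev\<close>, even
  if the sample is degenerate.\<close>

lemma sigma2_u_ge:
  assumes nb: "\<omega> \<notin> bad2 (\<delta> / 2)" "\<omega> \<notin> bad3 (\<delta> / 2)" and \<delta>: "0 < \<delta>" "\<delta> < 1"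
  shows "norm Sg \<le> sigma2_u ip c B n (Xr \<omega>) \<delta>" "0 < sigma2_u ip c B n (Xr \<omega>) \<delta>"
proof -
  define l where "l = ln (2 / (\<delta> / 2))"
  define t where "t = tau_u' ip c B n (Xr \<omega>) (\<delta> / 2)"
  have l0: "0 < l" using \<delta> by (simp add: l_def)
  have t: "\<tau>0' \<le> t" unfolding t_def by (rule tau_u'_ge[OF nb(1)])
  have N: "0 < real N2" using n8 by simp
  have sq: "sqrt (2 * \<tau>0' / real N2 * l) \<le> sqrt (2 * t / real N2 * l)"
    using t l0 N by (intro real_sqrt_le_mono mult_right_mono divide_right_mono) auto
  have s2: "sigma2_u ip c B n (Xr \<omega>) \<delta> = norm (Sigma_n n (Xr \<omega>)) + (sqrt (2 * t / real N2 * l) + 2 * c\<^sup>2 / (3 * real N2) * l)"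
    unfolding sigma2_u_def sigma2_u_of_def Gamma_dev_def l_def[symmetric] t_def[symmetric] n_eq(4)[symmetric] ..
  have p: "0 < 2 * c\<^sup>2 / (3 * real N2) * l" using c0 N l0 by simp
  have "0 \<le> sqrt (2 * \<tau>0' / real N2 * l)" using \<tau>0'_nonneg l0 by simp
  then show "0 < sigma2_u ip c B n (Xr \<omega>) \<delta>"
    unfolding s2 using p sq norm_ge_zero[of "Sigma_n n (Xr \<omega>)"] by linarith
  have nS: "norm (Sigma_n n (Xr \<omega>)) = norm (\<Sum>i=1..N2. QQ i \<omega>) / real N2"
  proof -
    have "(\<Sum>i=1..N2. paired (Xr \<omega>) i) = of_bop (\<Sum>i=1..N2. QQ i \<omega>)"
      unfolding of_bop_sum by (rule sum.cong[OF refl]) (rule of_QQ[OF g, symmetric])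
    then show ?thesis
      unfolding Sigma_n_def n_eq(4) by (simp add: norm_bop_def)
  qed
  have "real N2 * norm Sg = norm (real N2 *\<^sub>R Sg)" by simp
  also have "real N2 *\<^sub>R Sg = (\<Sum>i=1..N2. QQ i \<omega>) - (\<Sum>i=1..N2. QQ i \<omega> - Sg)"
    by (simp add: sum_subtractf sum_constant_scaleR)
  also have "norm \<dots> \<le> norm (\<Sum>i=1..N2. QQ i \<omega>) + norm (\<Sum>i=1..N2. QQ i \<omega> - Sg)"
    by (rule norm_triangle_ineq4)
  also have "norm (\<Sum>i=1..N2. QQ i \<omega> - Sg) \<le> sqrt (2 * (real N2 * \<tau>0') * l) + 2 * c\<^sup>2 / 3 * l"
    using nb(2) good_space[OF g] unfolding bad3_def l_def by (simp add: not_less)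
  also have "sqrt (2 * (real N2 * \<tau>0') * l) = real N2 * sqrt (2 * \<tau>0' / real N2 * l)"
  proof (rule real_sqrt_unique)
    have "0 \<le> 2 * \<tau>0' / real N2 * l" using \<tau>0'_nonneg l0 by simp
    then have "(real N2 * sqrt (2 * \<tau>0' / real N2 * l))\<^sup>2 = (real N2)\<^sup>2 * (2 * \<tau>0' / real N2 * l)"
      unfolding power_mult_distrib by (simp only: real_sqrt_pow2)
    then show "(real N2 * sqrt (2 * \<tau>0' / real N2 * l))\<^sup>2 = 2 * (real N2 * \<tau>0') * l"
      using N by (simp add: power2_eq_square)
    show "0 \<le> real N2 * sqrt (2 * \<tau>0' / real N2 * l)" using \<open>0 \<le> 2 * \<tau>0' / real N2 * l\<close> by simp
  qed
  finally have "real N2 * norm Sg \<le> norm (\<Sum>i=1..N2. QQ i \<omega>) + (real N2 * sqrt (2 * \<tau>0' / real N2 * l) + 2 * c\<^sup>2 / 3 * l)" by simp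
  then have "norm Sg \<le> (norm (\<Sum>i=1..N2. QQ i \<omega>) + (real N2 * sqrt (2 * \<tau>0' / real N2 * l) + 2 * c\<^sup>2 / 3 * l)) / real N2"
    unfolding pos_le_divide_eq[OF N] by (simp only: mult.commute)
  also have "\<dots> = norm (Sigma_n n (Xr \<omega>)) + (sqrt (2 * \<tau>0' / real N2 * l) + 2 * c\<^sup>2 / (3 * real N2) * l)"
    unfolding nS add_divide_distrib using N by simp
  also have "\<dots> \<le> sigma2_u ip c B n (Xr \<omega>) \<delta>" unfolding s2 using sq by simp
  finally show "norm Sg \<le> sigma2_u ip c B n (Xr \<omega>) \<delta>" .
qed

end

text \<open>Built from the truncated operators and therefore measurable; on good realizations it is
  the supremum of the statement.\<close>

definition "max_deviation \<omega> = Max ((\<lambda>i. norm (\<Sum>l=1..i. U l \<omega>)) ` {1..n})"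

lemma max_deviation_ge: "r \<le> max_deviation \<omega> \<longleftrightarrow> (\<exists>i\<in>{1..n}. r \<le> norm (\<Sum>l=1..i. U l \<omega>))"
  unfolding max_deviation_def using n8 by (subst Max_ge_iff) auto

theorem deviation_bound:
  assumes \<delta>: "0 < \<delta>\<^sub>1" "\<delta>\<^sub>1 < 1" "0 < \<delta>\<^sub>2" "\<delta>\<^sub>2 < 1" "0 < \<delta>\<^sub>3" "\<delta>\<^sub>3 < 1"
  shows "measure M {\<omega> \<in> space M.
           (SUP i\<in>{1..n}. norm ((\<Sum>j=1..i. X j \<omega>) - real i *\<^sub>R \<mu>))
             \<ge> Pi_bound_inv ip c B n (\<lambda>i. X i \<omega>) \<delta>\<^sub>2 \<delta>\<^sub>3 \<delta>\<^sub>1}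
         \<le> \<delta>\<^sub>1 + \<delta>\<^sub>2 + \<delta>\<^sub>3" (is "measure M ?E \<le> _")
proof -
  \<comment> \<open>The levels that work deterministically. The random level belongs to
    \<open>R\<close> with witness \<open>s\<close> equal to the realized \<open>sigma2_u\<close>:
    outside the exceptional events this value is at least \<open>norm Sg\<close>, and lowering the
    realized \<open>tau_u\<close> to \<open>\<tau>0\<close> only lowers the bound.\<close>
  define R where "R = {r. 0 < r \<and> (\<exists>s>0. norm Sg \<le> s \<and> bennett_bound (real n) (2 * c) \<tau>0 s r \<le> \<delta>\<^sub>1)}"
  have mm: "max_deviation \<in> borel_measurable M"
    unfolding borel_measurable_iff_ge max_deviation_ge by (intro allI meas_sum_ge strong_meas_U)
  have R: "prob {\<omega> \<in> space M. r \<le> max_deviation \<omega>} \<le> \<delta>\<^sub>1" if rR: "r \<in> R" for r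
  proof -
    obtain s where s: "0 < r" "0 < s" "norm Sg \<le> s" "bennett_bound (real n) (2 * c) \<tau>0 s r \<le> \<delta>\<^sub>1"
      using rR unfolding R_def by blast
    show ?thesis
      unfolding max_deviation_ge by (rule order_trans[OF uncompressed_bennett[OF s(2,3) trace_Sg_le s(1)] s(4)])
  qed
  have "bdd_below R" by (rule bdd_belowI[of _ 0]) (auto simp: R_def)
  from prob_exists_level[OF mm R this less_imp_le[OF \<delta>(1)]]
  obtain A where A: "A \<in> events" "prob A \<le> \<delta>\<^sub>1" "{\<omega> \<in> space M. \<exists>r\<in>R. r \<le> max_deviation \<omega>} \<subseteq> A" by blast
  have h: "0 < \<delta>\<^sub>3 / 2" "\<delta>\<^sub>3 / 2 < 1" using \<delta> by auto
  note b1 = bad_events[OF \<delta>(3,4)] and b3 = bad_events[OF h]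
  let ?B = "A \<union> (bad1 \<delta>\<^sub>2 \<union> (bad2 (\<delta>\<^sub>3 / 2) \<union> bad3 (\<delta>\<^sub>3 / 2)))"
  have mB: "?B \<in> events" by (intro sets.Un A(1) b1(1) b3(3) b3(5))
  have pB: "prob ?B \<le> \<delta>\<^sub>1 + \<delta>\<^sub>2 + \<delta>\<^sub>3"
  proof -
    have "prob (bad2 (\<delta>\<^sub>3 / 2) \<union> bad3 (\<delta>\<^sub>3 / 2)) \<le> \<delta>\<^sub>3 / 2 + \<delta>\<^sub>3 / 2"
      by (rule order_trans[OF measure_Un_le[OF b3(3,5)] add_mono[OF b3(4,6)]])
    then have "prob (bad1 \<delta>\<^sub>2 \<union> (bad2 (\<delta>\<^sub>3 / 2) \<union> bad3 (\<delta>\<^sub>3 / 2))) \<le> \<delta>\<^sub>2 + (\<delta>\<^sub>3 / 2 + \<delta>\<^sub>3 / 2)"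
      by (rule order_trans[OF measure_Un_le[OF b1(1) sets.Un[OF b3(3,5)]] add_mono[OF b1(2)]])
    then have "prob ?B \<le> \<delta>\<^sub>1 + (\<delta>\<^sub>2 + (\<delta>\<^sub>3 / 2 + \<delta>\<^sub>3 / 2))"
      by (rule order_trans[OF measure_Un_le[OF A(1) sets.Un[OF b1(1) sets.Un[OF b3(3,5)]]] add_mono[OF A(2)]])
    then show ?thesis by simp
  qed
  \<comment> \<open>\<open>?E\<close> involves traces and an inverse function of the raw data, so it
    is bounded through the measurable event \<open>?B\<close>, which contains it up to a null
    set.\<close>
  have "AE \<omega> in M. \<omega> \<in> ?E \<longrightarrow> \<omega> \<in> ?B"
    using AE_good
  proof eventually_elim
    case (elim \<omega>)
    show "\<omega> \<in> ?E \<longrightarrow> \<omega> \<in> ?B"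
    proof (rule impI, rule ccontr)
      assume E: "\<omega> \<in> ?E" and nB: "\<omega> \<notin> ?B"
      let ?t = "tau_u ip B n (Xr \<omega>) \<delta>\<^sub>2" and ?s = "sigma2_u ip c B n (Xr \<omega>) \<delta>\<^sub>3"
      define r where "r = Pi_bound_inv ip c B n (Xr \<omega>) \<delta>\<^sub>2 \<delta>\<^sub>3 \<delta>\<^sub>1"
      have t: "\<tau>0 \<le> ?t" by (rule tau_u_ge[OF elim]) (use nB in blast)
      have s: "norm Sg \<le> ?s" "0 < ?s"
        by (rule sigma2_u_ge[OF elim _ _ \<delta>(5,6)]; use nB in blast)+
      have n0: "0 < real n" "0 < 2 * c" using n8 c0 by auto
      have r: "0 < r" "bennett_bound (real n) (2 * c) ?t ?s r = \<delta>\<^sub>1"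
        unfolding r_def Pi_bound_inv_def Pi_bound_eq
        by (rule bennett_bound_inverse[OF n0 s(2) \<delta>(1,2)])+
      have "bennett_bound (real n) (2 * c) \<tau>0 ?s r \<le> \<delta>\<^sub>1"
        using bennett_bound_mono[OF s(2) t, of "real n" "2 * c" r] r(2) by simp
      then have "r \<in> R" unfolding R_def using r(1) s by blast
      have "(SUP i\<in>{1..n}. norm ((\<Sum>j=1..i. X j \<omega>) - real i *\<^sub>R \<mu>)) = max_deviation \<omega>"
      proof -
        have "(\<lambda>i. norm ((\<Sum>j=1..i. X j \<omega>) - real i *\<^sub>R \<mu>)) ` {1..n} = (\<lambda>i. norm (\<Sum>l=1..i. U l \<omega>)) ` {1..n}"
          by (rule image_cong[OF refl]) (rule norm_partial_sum[OF elim])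
        then show ?thesis
          unfolding max_deviation_def using n8 by (simp only:) (rule cSup_eq_Max, auto)
      qed
      then have "r \<le> max_deviation \<omega>" using E unfolding r_def by simp
      then show False using A(3) \<open>r \<in> R\<close> good_space[OF elim] nB by blast
    qed
  qed
  then have "prob ?E \<le> prob ?B" using mB by (rule finite_measure_mono_AE)
  then show ?thesis using pB by simp
qed

end

theorem theorem5p4:
  fixes K :: "complex set"
    and scale :: "complex \<Rightarrow> 'a \<Rightarrow> 'a::{real_inner, banach, second_countable_topology}"
    and ip :: "'a \<Rightarrow> 'a \<Rightarrow> complex"
    and M :: "'w measure"
    and X :: "nat \<Rightarrow> 'w \<Rightarrow> ('a \<Rightarrow>\<^sub>L 'a)"
    and \<mu> \<Sigma> \<Sigma>' :: "'a \<Rightarrow>\<^sub>L 'a"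
    and n :: nat
    and c B \<delta>\<^sub>1 \<delta>\<^sub>2 \<delta>\<^sub>3 :: real
  assumes "hilbert_space K scale ip"
    and "prob_space M"
    and "n \<ge> 8" and "4 dvd n"
    and "c > 0" and "B > 0"
    and "prob_space.indep_vars M (\<lambda>_. borel) X {1..n}"
    and "\<And>i \<omega>. i \<in> {1..n} \<Longrightarrow> \<omega> \<in> space M \<Longrightarrow> compact_operator (X i \<omega>) \<and> self_adjoint ip (X i \<omega>)"
    and "\<And>i. i \<in> {1..n} \<Longrightarrow> AE \<omega> in M. norm (X i \<omega>) \<le> c"
    and "\<And>i. i \<in> {1..n} \<Longrightarrow>
           AE \<omega> in M. trace_class ip (op_sq (X i \<omega>)) \<and> op_trace ip (op_sq (X i \<omega>)) \<le> B"
    and "\<And>i. i \<in> {1..n} \<Longrightarrow> op_expectation M (X i) = \<mu>"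
    and "\<And>i. i \<in> {1..n} \<Longrightarrow> op_variance M (X i) = \<Sigma>"
    and "\<And>i. i \<in> {1..n} \<Longrightarrow> op_variance M (\<lambda>\<omega>. op_sq (X i \<omega> - \<mu>) - \<Sigma>) = \<Sigma>'"
    and "0 < \<delta>\<^sub>1" and "\<delta>\<^sub>1 < 1"
    and "0 < \<delta>\<^sub>2" and "\<delta>\<^sub>2 < 1"
    and "0 < \<delta>\<^sub>3" and "\<delta>\<^sub>3 < 1"
  shows "measure M {\<omega> \<in> space M.
           (SUP i\<in>{1..n}. norm ((\<Sum>j=1..i. X j \<omega>) - real i *\<^sub>R \<mu>))
             \<ge> Pi_bound_inv ip c B n (\<lambda>i. X i \<omega>) \<delta>\<^sub>2 \<delta>\<^sub>3 \<delta>\<^sub>1}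
         \<le> \<delta>\<^sub>1 + \<delta>\<^sub>2 + \<delta>\<^sub>3"
proof -
  interpret setting K scale ip M X \<mu> \<Sigma> n c B
    by (intro setting.intro setting_axioms.intro assms conjunct2[OF assms(8)])
  show ?thesis by (rule deviation_bound; fact)
qed

end
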